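(* Let $s\in(0,s_0)$, $d>sp$, and let $f\in L^q_{\mathrm{loc}}(\Omega)$ with $q>\frac{d}{sp}$. Let $u$ be a weak solution of $(-\Delta_p)^{s+\log}u=f$ in $\Omega$. Then $u$ is locally Hölder continuous in $\Omega$. More precisely, there exist $\alpha=\alpha(d,s,p,q)\in\Big(0,\frac{sp-\frac dq}{p-1}\Big)$ and a constant $C=C(d,s,p,q)>0$ such that, whenever $B_R(x_0)\subset\Omega$ with $\operatorname{diam}(B_R(x_0))\le1$, $$\operatorname*{osc}_{B_r(x_0)}u\le C\Big(\frac rR\Big)^\alpha\Bigg(\Big(1+\log\tfrac1R\Big)^{-\frac1{p-1}}\mathrm{Tail}_{\mathrm{mod}}\big(u;x_0,\tfrac R2\big)+\Big(\fint_{B_R(x_0)}|u|^{p\sigma}dx\Big)^{\frac1{p\sigma}}+\Big(1+\log\tfrac1R\Big)^{-\frac{\sigma}{p\sigma-1}}R^{(sp-\frac dq)\frac1{p-1}}\|f\|_{L^q(B_R(x_0))}^{\frac1{p-1}}\Bigg)$$ for every $r\in(0,\frac R2]$, where $\sigma=\frac{(dp-d+sp)q-d}{(dp-d+sp)q-dp}$ (which satisfies $p\sigma<p_s^*=\frac{dp}{d-sp}$).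
   Context: $d\ge 1$, $1<p<\infty$, $\Omega\subset\mathbb{R}^d$ is a bounded open set; $B_r(x_0)$ is the ball of radius $r$ centered at $x_0$; $a_+=\max\{a,0\}$, $a_-=\max\{-a,0\}$; $\fint_A$ denotes the average over $A$; $\operatorname{osc}_Au=\sup_Au-\inf_Au$ (essential supremum and infimum). Constants. For $s\in(0,1)$, $C_{d,s,p}>0$ is the normalization constant of the fractional $p$-Laplacian $(-\Delta_p)^su(x)=C_{d,s,p}\,\mathrm{P.V.}\int_{\mathbb{R}^d}\frac{|u(x)-u(y)|^{p-2}(u(x)-u(y))}{|x-y|^{d+sp}}dy$ (a positive constant depending only on $d,s,p$), and $B_{d,s,p}=\frac{d}{dt}\log C_{d,t,p}\big|_{t=s}=2\log2+\frac1s+\frac p2\psi\big(\frac{d+sp}{2}\big)+\psi(1-s)$ with $\psi=\Gamma'/\Gamma$. A threshold $0<s_0<\min\{2(p-1)/p,1\}$ is fixed such that $B_{d,s,p}\ge0$ for all $s\in(0,s_0)$. Kernels, for $r>0$: $\mathcal K^{s+\log}(r)=C_{d,s,p}\frac{B_{d,s,p}-p\log r}{r^{d+sp}}$, $\mathcal K^{s+\log}_\pm(r)=C_{d,s,p}\frac{(-\log r)_\pm}{r^{d+sp}}$, $\mathcal K^{s+\log}_{\mathrm{mod}}=p\mathcal K^{s+\log}_++p\mathcal K^{s+\log}_-$. Function spaces. $W^{s+\log,p}(\mathbb{R}^d)$ is the set of $u\in L^p(\mathbb{R}^d)$ with $\iint_{\mathbb{R}^d\times\mathbb{R}^d}\mathcal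 K^{s+\log}_+(|x-y|)|u(x)-u(y)|^p\,dx\,dy<\infty$; $W_0^{s+\log,p}(U)$ is the set of $u\in W^{s+\log,p}(\mathbb{R}^d)$ with $u=0$ a.e. in $\mathbb{R}^d\setminus U$; $W^{s+\log,p}_{\mathrm{loc}}(\Omega)$ is the set of $u$ with $u\in L^p(K)$ and $\iint_{K\times K}\mathcal K^{s+\log}_+(|x-y|)|u(x)-u(y)|^p\,dx\,dy<\infty$ for every compact $K\subset\Omega$; $L_{\log,p}(\mathbb{R}^d)$ is the set of $u\in L^{p-1}_{\mathrm{loc}}(\mathbb{R}^d)$ with $\int_{\mathbb{R}^d}\frac{1+\log(1+|y|)}{(1+|y|)^{d+sp}}|u(y)|^{p-1}dy<\infty$. Weak solutions. A function $u\in W^{s+\log,p}_{\mathrm{loc}}(\Omega)\cap L_{\log,p}(\mathbb{R}^d)$ is a (local) weak solution to $(-\Delta_p)^{s+\log}u=f$ in $\Omega$ if for every compact $K\subset\Omega$ and every nonnegative $v\in W_0^{s+\log,p}(K)$, $$\iint_{\mathbb{R}^d\times\mathbb{R}^d}\mathcal K^{s+\log}(|x-y|)|u(x)-u(y)|^{p-2}(u(x)-u(y))(v(x)-v(y))\,dx\,dy=\int_\Omega fv\,dx.$$ Tail: $\mathrm{Tail}_{\mathrm{mod}}(u;x_0,R)=\Big[R^{sp}\int_{\mathbb{R}^d\setminus B_R(x_0)}\Big(\frac1{|x_0-y|^{d+sp}}+\mathcal K^{s+\log}_{\mathrm{mod}}(|x_0-y|)\Big)|u(y)|^{p-1}dy\Big]^{\frac1{p-1}}$.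 *)

theory Defs
  imports "HOL-Analysis.Analysis" "HOL-Probability.Essential_Supremum"
begin

section \<open>Normalization constant and kernels\<close>

definition log_const :: "nat \<Rightarrow> real \<Rightarrow> real \<Rightarrow> real" where
  "log_const d s p =
     2 * ln 2 + 1 / s + p / 2 * Digamma ((real d + s * p) / 2) + Digamma (1 - s)"

text \<open>The normalization constant of the fractional \<open>p\<close>-Laplacian enters only as a positive function
  of \<open>d\<close>, \<open>s\<close>, \<open>p\<close> whose logarithmic derivative in \<open>s\<close> is \<^const>\<open>log_const\<close>. Conventions in
  the literature differ by factors depending on \<open>d\<close> and \<open>p\<close> only, and these two properties fix
  the constant exactly up to such a factor. The lemma \<open>frac_p_const_normalization\<close> below shows that
  the usual explicit constant has them.\<close>

definition is_normalization_const :: "(nat \<Rightarrow> real \<Rightarrow> real \<Rightarrow> real) \<Rightarrow> bool" where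
  "is_normalization_const C \<longleftrightarrow>
     (\<forall>d s p. 1 \<le> d \<longrightarrow> 0 < s \<longrightarrow> s < 1 \<longrightarrow> 1 < p \<longrightarrow>
        0 < C d s p \<and> ((\<lambda>t. ln (C d t p)) has_real_derivative log_const d s p) (at s))"

definition frac_p_const :: "nat \<Rightarrow> real \<Rightarrow> real \<Rightarrow> real" where
  "frac_p_const d s p =
     s * p * 2 powr (2 * s - 2) * Gamma ((real d + s * p) / 2) /
       (pi powr ((real d - 1) / 2) * Gamma ((p + 1) / 2) * Gamma (1 - s))"

lemma frac_p_const_normalization: "is_normalization_const frac_p_const"
  unfolding is_normalization_const_def
proof (intro allI impI conjI)
  fix d :: nat and s p :: real
  assume d: "1 \<le> d" and s: "0 < s" "s < 1" and p: "1 < p"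
  show "0 < frac_p_const d s p"
    using d s p unfolding frac_p_const_def
    by (intro divide_pos_pos mult_pos_pos Gamma_real_pos) (auto intro!: add_pos_pos)
  define g where "g t = ln t + ln p + (2 * t - 2) * ln 2 + ln_Gamma ((real d + t * p) / 2)
      - ((real d - 1) / 2 * ln pi + ln (Gamma ((p + 1) / 2)) + ln_Gamma (1 - t))" for t
  have pos: "0 < (real d + t * p) / 2" if "0 < t" for t
    using that d p by (intro divide_pos_pos add_pos_pos) auto
  have eq: "g t = ln (frac_p_const d t p)" if "t \<in> {0<..<1}" for t
  proof -
    have "Gamma ((real d + t * p) / 2) \<noteq> 0" "Gamma ((p + 1) / 2) \<noteq> 0" "Gamma (1 - t) \<noteq> 0"
      using Gamma_real_pos[OF pos[of t]] Gamma_real_pos[of "(p + 1) / 2"]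
        Gamma_real_pos[of "1 - t"] that p by fastforce+
    moreover have "ln_Gamma ((real d + t * p) / 2) = ln (Gamma ((real d + t * p) / 2))"
      "ln_Gamma (1 - t) = ln (Gamma (1 - t))"
      using pos[of t] that by (auto intro!: ln_Gamma_real_pos)
    ultimately show ?thesis
      using that p unfolding g_def frac_p_const_def
      by (simp add: ln_div ln_mult ln_powr)
  qed
  have "(g has_real_derivative log_const d s p) (at s)"
    unfolding g_def log_const_def using s p d pos[of s]
    by (auto intro!: derivative_eq_intros simp: field_simps)
  then show "((\<lambda>t. ln (frac_p_const d t p)) has_real_derivative log_const d s p) (at s)"
    by (rule has_field_derivative_transform_within_open[where S = "{0<..<1}"]) (use s eq in auto)
qed

text \<open>The argument \<open>C\<close> of the following notions is the normalization constant.\<close>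

definition kernel :: "(nat \<Rightarrow> real \<Rightarrow> real \<Rightarrow> real) \<Rightarrow> nat \<Rightarrow> real \<Rightarrow> real \<Rightarrow> real \<Rightarrow> real" where
  "kernel C d s p r = C d s p * (log_const d s p - p * ln r) / r powr (real d + s * p)"

definition kernel_plus :: "(nat \<Rightarrow> real \<Rightarrow> real \<Rightarrow> real) \<Rightarrow> nat \<Rightarrow> real \<Rightarrow> real \<Rightarrow> real \<Rightarrow> real" where
  "kernel_plus C d s p r = C d s p * max (- ln r) 0 / r powr (real d + s * p)"

definition kernel_minus :: "(nat \<Rightarrow> real \<Rightarrow> real \<Rightarrow> real) \<Rightarrow> nat \<Rightarrow> real \<Rightarrow> real \<Rightarrow> real \<Rightarrow> real" where
  "kernel_minus C d s p r = C d s p * max (- (- ln r)) 0 / r powr (real d + s * p)"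

definition kernel_mod :: "(nat \<Rightarrow> real \<Rightarrow> real \<Rightarrow> real) \<Rightarrow> nat \<Rightarrow> real \<Rightarrow> real \<Rightarrow> real \<Rightarrow> real" where
  "kernel_mod C d s p r = p * kernel_plus C d s p r + p * kernel_minus C d s p r"


section \<open>Function spaces\<close>

definition Lp_on :: "real \<Rightarrow> 'a::euclidean_space set \<Rightarrow> ('a \<Rightarrow> real) \<Rightarrow> bool" where
  "Lp_on p A u \<longleftrightarrow> set_borel_measurable lebesgue A u \<and>
     (\<integral>\<^sup>+x\<in>A. ennreal (\<bar>u x\<bar> powr p) \<partial>lebesgue) < \<infinity>"

definition Lp_loc :: "real \<Rightarrow> 'a::euclidean_space set \<Rightarrow> ('a \<Rightarrow> real) \<Rightarrow> bool" where
  "Lp_loc p U u \<longleftrightarrow> (\<forall>K. compact K \<and> K \<subseteq> U \<longrightarrow> Lp_on p K u)"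

definition log_seminorm_finite_on ::
    "(nat \<Rightarrow> real \<Rightarrow> real \<Rightarrow> real) \<Rightarrow> real \<Rightarrow> real \<Rightarrow> 'a::euclidean_space set \<Rightarrow> ('a \<Rightarrow> real) \<Rightarrow> bool" where
  "log_seminorm_finite_on C s p A u \<longleftrightarrow>
     (\<integral>\<^sup>+z\<in>A \<times> A. ennreal (case z of (x, y) \<Rightarrow>
         kernel_plus C DIM('a) s p (dist x y) * \<bar>u x - u y\<bar> powr p) \<partial>lebesgue) < \<infinity>"

definition W_log ::
    "(nat \<Rightarrow> real \<Rightarrow> real \<Rightarrow> real) \<Rightarrow> real \<Rightarrow> real \<Rightarrow> ('a::euclidean_space \<Rightarrow> real) set" where
  "W_log C s p = {u. Lp_on p UNIV u \<and> log_seminorm_finite_on C s p UNIV u}"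

definition W0_log ::
    "(nat \<Rightarrow> real \<Rightarrow> real \<Rightarrow> real) \<Rightarrow> real \<Rightarrow> real \<Rightarrow> 'a::euclidean_space set \<Rightarrow> ('a \<Rightarrow> real) set" where
  "W0_log C s p U = {u \<in> W_log C s p. AE x in lebesgue. x \<notin> U \<longrightarrow> u x = 0}"

definition W_log_loc ::
    "(nat \<Rightarrow> real \<Rightarrow> real \<Rightarrow> real) \<Rightarrow> real \<Rightarrow> real \<Rightarrow> 'a::euclidean_space set \<Rightarrow> ('a \<Rightarrow> real) set" where
  "W_log_loc C s p U =
     {u. \<forall>K. compact K \<and> K \<subseteq> U \<longrightarrow> Lp_on p K u \<and> log_seminorm_finite_on C s p K u}"

definition L_log :: "real \<Rightarrow> real \<Rightarrow> ('a::euclidean_space \<Rightarrow> real) set" where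
  "L_log s p = {u. Lp_loc (p - 1) UNIV u \<and>
     (\<integral>\<^sup>+y. ennreal ((1 + ln (1 + norm y)) / (1 + norm y) powr (real DIM('a) + s * p)
        * \<bar>u y\<bar> powr (p - 1)) \<partial>lebesgue) < \<infinity>}"


section \<open>Weak solutions\<close>

text \<open>\<open>f\<close> matters only on \<open>U\<close>. Both Bochner integrals below converge absolutely when
  \<open>u\<close>, \<open>v\<close> are as required, \<open>s p < d\<close> and \<open>f \<in> L\<^sup>q\<^sub>l\<^sub>o\<^sub>c\<close> with \<open>q > d / (s p)\<close>. On the
  diagonal the integrand vanishes since \<open>0 powr a = 0\<close>.\<close>

definition weak_solution ::
    "(nat \<Rightarrow> real \<Rightarrow> real \<Rightarrow> real) \<Rightarrow> real \<Rightarrow> real \<Rightarrow> 'a::euclidean_space set \<Rightarrow>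
       ('a \<Rightarrow> real) \<Rightarrow> ('a \<Rightarrow> real) \<Rightarrow> bool" where
  "weak_solution C s p U f u \<longleftrightarrow>
     u \<in> W_log_loc C s p U \<inter> L_log s p \<and>
     (\<forall>K v. compact K \<and> K \<subseteq> U \<and> v \<in> W0_log C s p K \<and> (AE x in lebesgue. 0 \<le> v x) \<longrightarrow>
        (\<integral>(x, y). kernel C DIM('a) s p (dist x y) * \<bar>u x - u y\<bar> powr (p - 2) * (u x - u y)
            * (v x - v y) \<partial>lebesgue)
        = (LINT x:U|lebesgue. f x * v x))"


section \<open>Quantities in the oscillation estimate\<close>

text \<open>Norms, averages and tails are kept in \<open>[0, \<infinity>]\<close>: for an open ball that touches the boundary of
  the domain, local integrability does not make them finite. The following power is meant for
  exponents \<open>a > 0\<close>.\<close>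

definition ennreal_powr :: "ennreal \<Rightarrow> real \<Rightarrow> ennreal" where
  "ennreal_powr x a = (if x = \<infinity> then \<infinity> else ennreal (enn2real x powr a))"

definition Lp_norm_on :: "real \<Rightarrow> 'a::euclidean_space set \<Rightarrow> ('a \<Rightarrow> real) \<Rightarrow> ennreal" where
  "Lp_norm_on q A u =
     ennreal_powr (\<integral>\<^sup>+x\<in>A. ennreal (\<bar>u x\<bar> powr q) \<partial>lebesgue) (1 / q)"

definition Lp_mean_on :: "real \<Rightarrow> 'a::euclidean_space set \<Rightarrow> ('a \<Rightarrow> real) \<Rightarrow> ennreal" where
  "Lp_mean_on q A u =
     ennreal_powr ((\<integral>\<^sup>+x\<in>A. ennreal (\<bar>u x\<bar> powr q) \<partial>lebesgue) / emeasure lebesgue A) (1 / q)"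

definition Tail_mod ::
    "(nat \<Rightarrow> real \<Rightarrow> real \<Rightarrow> real) \<Rightarrow> real \<Rightarrow> real \<Rightarrow> ('a::euclidean_space \<Rightarrow> real) \<Rightarrow> 'a \<Rightarrow> real \<Rightarrow> ennreal" where
  "Tail_mod C s p u x0 R =
     ennreal_powr (ennreal (R powr (s * p)) *
       (\<integral>\<^sup>+y\<in>- ball x0 R. ennreal ((1 / dist x0 y powr (real DIM('a) + s * p)
            + kernel_mod C DIM('a) s p (dist x0 y)) * \<bar>u y\<bar> powr (p - 1)) \<partial>lebesgue))
       (1 / (p - 1))"

definition ess_osc :: "'a::euclidean_space set \<Rightarrow> ('a \<Rightarrow> real) \<Rightarrow> ereal" where
  "ess_osc A u =
     esssup (restrict_space lebesgue A) (\<lambda>x. ereal (u x))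
     - (- esssup (restrict_space lebesgue A) (\<lambda>x. - ereal (u x)))"

text \<open>Functions are identified when equal almost everywhere, so Hoelder continuity is that of a
  suitable representative.\<close>

definition locally_holder :: "'a::euclidean_space set \<Rightarrow> ('a \<Rightarrow> real) \<Rightarrow> bool" where
  "locally_holder U u \<longleftrightarrow>
     (\<exists>w. (AE x in lebesgue. x \<in> U \<longrightarrow> u x = w x) \<and>
        (\<exists>\<gamma>. 0 < \<gamma> \<and> \<gamma> \<le> 1 \<and>
          (\<forall>K. compact K \<and> K \<subseteq> U \<longrightarrow>
            (\<exists>L. \<forall>x\<in>K. \<forall>y\<in>K. \<bar>w x - w y\<bar> \<le> L * dist x y powr \<gamma>))))"

definition sigma_exp :: "nat \<Rightarrow> real \<Rightarrow> real \<Rightarrow> real \<Rightarrow> real" where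
  "sigma_exp d s p q =
     ((real d * p - real d + s * p) * q - real d) / ((real d * p - real d + s * p) * q - real d * p)"

end

theory Submission
  imports Defs
begin

text \<open>De Giorgi's method, uniformly in the scale \<open>\<rho>\<close>. Rescale \<open>B\<^sub>\<rho>\<close> to \<open>B\<^sub>1\<close> and divide the kernel by its
  logarithmic size \<open>1 + ln (1 / \<rho>)\<close> at that scale. On bounded sets the result dominates a multiple of the
  fractional kernel \<open>r powr (- d - s p)\<close>, and everywhere its modulus is at most a multiple of
  \<open>(1 + \<bar>ln r\<bar>) / r powr (d + s p)\<close>, with constants that do not depend on \<open>\<rho>\<close>. Its negative part, which
  lives at distances larger than \<open>1 / \<rho>\<close>, only enters the tail. A Faber--Krahn inequality gives a
  subcritical Sobolev inequality, and testing with \<open>\<eta>\<^sup>p u\<^sub>+\<close> gives a Caccioppoli inequality that also controls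
  the cross term of \<open>u\<^sub>+\<close> and \<open>u\<^sub>-\<close>. The two yield local boundedness; the cross term makes the set
  where \<open>u\<close> is close to its infimum small, so that the oscillation drops by a fixed factor between two scales.
  Iterating over geometrically shrinking balls gives the oscillation decay.\<close>

subsection \<open>Pointwise inequalities\<close>

text \<open>Two features of the kernel shape the proof. It is negative at distances beyond
  \<open>exp (B / p)\<close>; since \<open>0 \<le> B\<close> it is nonnegative up to distance 1, and
  beyond that only its modulus is used. The usual logarithmic estimate for positive solutions is
  therefore replaced by the cross term, which comes at no cost with the Caccioppoli inequality.
  Moreover the kernel is not homogeneous: its logarithmic size grows as the scale shrinks. After
  division by \<open>lg \<rho>\<close> all that remains when data on a ball of radius
  \<open>R\<close> are passed to a scale \<open>\<rho> \<le> R\<close> is the factor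
  \<open>lg R / lg \<rho> \<le> 1\<close>. The price is a lower bound on bounded sets only, hence
  the truncated energy \<open>gagliardo\<close> and Sobolev inequalities derived from scratch for
  it. The iteration itself works with the p-th power mean of \<open>u\<close> and the factor
  \<open>lg R powr (- 1 / (p - 1))\<close> for tail and right-hand side; the quantities of the
  statement dominate these because \<open>1 < \<sigma>\<close>. A possible circle has to be avoided:
  the level set must be small in terms of the De Giorgi threshold, which depends on a tail bound, so
  that tail bound has to be fixed before the level.\<close>

definition signed_powr :: "real \<Rightarrow> real \<Rightarrow> real" where
  "signed_powr p t = \<bar>t\<bar> powr (p - 2) * t"

lemma signed_powr_nonneg: "0 \<le> t \<Longrightarrow> signed_powr p t = t powr (p - 1)"
proof (cases "t = 0")
  case False
  assume "0 \<le> t"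
  then show ?thesis
    using False powr_mult_base[of t "p - 2"] unfolding signed_powr_def by (simp add: mult.commute)
qed (simp add: signed_powr_def)

lemma signed_powr_minus: "signed_powr p (- t) = - signed_powr p t"
  by (simp add: signed_powr_def)

lemma abs_signed_powr: "\<bar>signed_powr p t\<bar> = \<bar>t\<bar> powr (p - 1)"
proof (cases "0 \<le> t")
  case True then show ?thesis by (simp add: signed_powr_nonneg)
next
  case False
  then have "signed_powr p t = - signed_powr p \<bar>t\<bar>" by (simp add: signed_powr_minus[symmetric])
  then show ?thesis by (simp add: signed_powr_nonneg)
qed

lemma signed_powr_measurable [measurable]:
  "f \<in> borel_measurable M \<Longrightarrow> (\<lambda>x. signed_powr p (f x)) \<in> borel_measurable M"
  unfolding signed_powr_def by measurable

lemma powr_add_le: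
  fixes a b r :: real
  assumes "0 \<le> a" "0 \<le> b" "0 \<le> r"
  shows "(a + b) powr r \<le> 2 powr r * (a powr r + b powr r)"
proof -
  have "(a + b) powr r \<le> (2 * max a b) powr r"
    using assms by (intro powr_mono2) auto
  also have "\<dots> = 2 powr r * max a b powr r" using assms by (simp add: powr_mult)
  also have "max a b powr r \<le> a powr r + b powr r" by (cases "a \<le> b") (auto simp: max_def)
  finally show ?thesis by simp
qed

lemma powr_split: "0 \<le> a \<Longrightarrow> 1 < p \<Longrightarrow> a powr p = a powr (p - 1) * a" for a p :: real
  by (cases "a = 0") (use powr_mult_base[of a "p - 1"] in \<open>auto simp: mult.commute\<close>)

lemma powr_mult_le_sum:
  fixes a b p :: real
  assumes "0 \<le> a" "0 \<le> b" "1 < p"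
  shows "a powr (p - 1) * b \<le> a powr p + b powr p"
proof (cases "a \<le> b")
  case True
  then have "a powr (p - 1) * b \<le> b powr (p - 1) * b"
    using assms by (intro mult_right_mono powr_mono2) auto
  then show ?thesis using assms powr_split[of b p] by (smt (verit) powr_ge_zero)
next
  case False
  then have "a powr (p - 1) * b \<le> a powr (p - 1) * a"
    using assms by (intro mult_left_mono) auto
  then show ?thesis using assms powr_split[of a p] by (smt (verit) powr_ge_zero)
qed

text \<open>This is the tangent line inequality for the convex function \<open>x powr p\<close> at
  \<open>a\<close>. Young's inequality for \<open>a powr (p - 1) * b\<close> gives it without
  derivatives, so \<open>a = 0\<close> is no exception.\<close>

lemma powr_diff_le:
  fixes a b p :: real
  assumes "0 \<le> b" "0 \<le> a" "1 < p"
  shows "a powr p - b powr p \<le> p * a powr (p - 1) * (a - b)"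
proof -
  have 1: "1 < p / (p - 1)" "1 / (p / (p - 1)) + 1 / p = 1" using assms by (auto simp: field_simps)
  have "a powr (p - 1) * b \<le> (a powr (p - 1)) powr (p / (p - 1)) / (p / (p - 1)) + b powr p / p"
    using assms 1 by (intro Youngs_inequality) auto
  also have "(a powr (p - 1)) powr (p / (p - 1)) = a powr p" using assms by (simp add: powr_powr)
  finally have "p * (a powr (p - 1) * b) \<le> (p - 1) * a powr p + b powr p"
    using assms by (simp add: field_simps)
  then show ?thesis using powr_split[of a p] assms by (simp add: algebra_simps)
qed

text \<open>The two cases meet at \<open>X = 2 * p * Z\<close>, where the left side equals
  \<open>X powr p / 2\<close>. The coefficient \<open>1 / 2\<close> is what later lets the term be
  absorbed into \<open>X powr p\<close>.\<close>

lemma young_absorb: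
  fixes X Z p :: real
  assumes "0 \<le> X" "0 \<le> Z" "1 < p"
  shows "p * X powr (p - 1) * Z \<le> X powr p / 2 + p * (2 * p) powr (p - 1) * Z powr p"
proof (cases "2 * p * Z \<le> X")
  case True
  have "p * X powr (p - 1) * Z = X powr (p - 1) * (2 * p * Z) / 2" by simp
  also have "\<dots> \<le> X powr (p - 1) * X / 2" using True by (intro divide_right_mono mult_left_mono) auto
  also have "\<dots> = X powr p / 2" using powr_split[of X p] assms by simp
  finally have "p * X powr (p - 1) * Z \<le> X powr p / 2" .
  moreover have "0 \<le> p * (2 * p) powr (p - 1) * Z powr p" using assms by simp
  ultimately show ?thesis by linarith
next
  case False
  have "p * X powr (p - 1) * Z \<le> p * (2 * p * Z) powr (p - 1) * Z"
    using False assms by (intro mult_right_mono mult_left_mono powr_mono2) auto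
  also have "\<dots> = p * (2 * p) powr (p - 1) * Z powr p"
    using powr_split[of Z p] assms by (simp add: powr_mult)
  finally show ?thesis using powr_ge_zero[of X p] by linarith
qed

text \<open>The factor \<open>2 powr (- p)\<close> undoes the constant of \<open>powr_add_le\<close>
  for \<open>(X + Z) powr p\<close>, and \<open>1 / 2\<close> is the share of
  \<open>X powr p\<close> that \<open>young_absorb\<close> leaves. \<open>cac_err\<close> collects
  the coefficients of \<open>Z powr p\<close>: \<open>1 / 2\<close> from the first estimate, the
  rest from the second.\<close>

definition cac_low :: "real \<Rightarrow> real" where "cac_low p = 2 powr (- p - 1)"
definition cac_err :: "real \<Rightarrow> real" where "cac_err p = 1 / 2 + p * (2 * p) powr (p - 1)"

lemma cac_low: "0 < cac_low p" "1 < p \<Longrightarrow> cac_low p \<le> 1 / 2"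
  unfolding cac_low_def using powr_mono[of "- p - 1" "-1" 2] by (auto simp: powr_minus_divide)

lemma cac_err: "1 < p \<Longrightarrow> 0 < cac_err p"
  unfolding cac_err_def by (auto intro!: add_pos_pos mult_pos_pos)

text \<open>Both cross terms are carried so that the case \<open>a < b\<close> follows by exchanging
  the two points. Under \<open>b \<le> a\<close> the second one vanishes, since \<open>0 < b\<close>
  forces \<open>0 < a\<close>.\<close>

lemma caccioppoli_pointwise_aux:
  fixes a b e h p :: real
  assumes p: "1 < p" and "0 \<le> e" "0 \<le> h" and ab: "b \<le> a"
  shows "cac_low p * \<bar>e * max a 0 - h * max b 0\<bar> powr p
      + 1 / 2 * (max (- b) 0 powr (p - 1) * (e powr p * max a 0))
      + 1 / 2 * (max (- a) 0 powr (p - 1) * (h powr p * max b 0))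
    \<le> signed_powr p (a - b) * (e powr p * max a 0 - h powr p * max b 0)
      + cac_err p * ((max a 0 powr p + max b 0 powr p) * \<bar>e - h\<bar> powr p)"
    (is "?L \<le> ?R")
proof -
  have J: "signed_powr p (a - b) = (a - b) powr (p - 1)"
    using ab by (simp add: signed_powr_nonneg)
  have err0: "0 \<le> cac_err p * ((max a 0 powr p + max b 0 powr p) * \<bar>e - h\<bar> powr p)"
    using cac_err[OF p] by (intro mult_nonneg_nonneg) auto
  consider "a \<le> 0" | "0 < a" "b \<le> 0" | "0 < b" by linarith
  then show ?thesis
  proof cases
    case 1
    then show ?thesis using ab err0 p by simp
  next
    case 2
    define g where "g = - b"
    have g: "0 \<le> g" "max (- b) 0 = g" "a - b = a + g" using 2 by (auto simp: g_def)
    \<comment> \<open>Where the sign changes, half of \<open>(a + g) powr (p - 1)\<close> is spent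
      on the energy and the other half on the cross term.\<close>
    have "a powr (p - 1) \<le> (a + g) powr (p - 1)" "g powr (p - 1) \<le> (a + g) powr (p - 1)"
      using 2 g p by (auto intro!: powr_mono2)
    then have "1 / 2 * a powr (p - 1) + 1 / 2 * g powr (p - 1) \<le> (a + g) powr (p - 1)" by simp
    then have "(1 / 2 * a powr (p - 1) + 1 / 2 * g powr (p - 1)) * (e powr p * a)
        \<le> (a + g) powr (p - 1) * (e powr p * a)"
      using 2 by (intro mult_right_mono) auto
    moreover have "a powr (p - 1) * (e powr p * a) = (e * a) powr p"
      using powr_split[of a p] 2 p assms by (simp add: powr_mult)
    ultimately have "1 / 2 * (e * a) powr p + 1 / 2 * (g powr (p - 1) * (e powr p * a))
        \<le> (a + g) powr (p - 1) * (e powr p * a)"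
      by (simp add: algebra_simps)
    moreover have "cac_low p * (e * a) powr p \<le> 1 / 2 * (e * a) powr p"
      using cac_low(2)[OF p] by (intro mult_right_mono) auto
    moreover have "\<bar>e * a\<bar> = e * a" using 2 assms by auto
    ultimately have "cac_low p * (e * a) powr p + 1 / 2 * (g powr (p - 1) * (e powr p * a))
        \<le> (a + g) powr (p - 1) * (e powr p * a)" "\<bar>e * a\<bar> = e * a"
      by linarith+
    moreover have "max a 0 = a" "max b 0 = 0" "max (- a) 0 = 0" using 2 by auto
    ultimately show ?thesis
      using err0 p J[unfolded g(3)] by (simp add: g)
  next
    case 3
    define t where "t = a - b"
    define X where "X = h * t"
    define Z where "Z = a * \<bar>e - h\<bar>"
    note defs = t_def X_def Z_def
    have "0 \<le> t" "0 < a" using 3 ab by (auto simp: t_def)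
    then have pos: "0 \<le> t" "0 \<le> X" "0 \<le> Z" "0 < a"
      using \<open>0 \<le> h\<close> unfolding X_def Z_def by (auto intro!: mult_nonneg_nonneg)
    have 4: "X powr p - (X powr p / 2 + p * (2 * p) powr (p - 1) * Z powr p)
       \<le> t powr (p - 1) * (e powr p * a - h powr p * b)"
    proof -
      \<comment> \<open>The increment is expanded around \<open>h\<close>, the cutoff at the smaller
        value. The error then carries \<open>h powr (p - 1)\<close>, which combines with
        \<open>t powr (p - 1)\<close> into a power of \<open>X = h * t\<close>.\<close>
      have "t powr (p - 1) * (e powr p * a - h powr p * b)
         = h powr p * (t powr (p - 1) * t) - t powr (p - 1) * a * (h powr p - e powr p)"
        by (simp add: defs algebra_simps)
      also have "h powr p * (t powr (p - 1) * t) = X powr p"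
        using powr_split[of t p] pos p assms by (simp add: defs powr_mult)
      finally have eq: "t powr (p - 1) * (e powr p * a - h powr p * b)
         = X powr p - t powr (p - 1) * a * (h powr p - e powr p)" .
      have "h powr p - e powr p \<le> p * h powr (p - 1) * \<bar>e - h\<bar>"
        using powr_diff_le[of e h p] assms
        by (smt (verit) mult_left_mono mult_nonneg_nonneg powr_ge_zero)
      then have "t powr (p - 1) * a * (h powr p - e powr p)
          \<le> t powr (p - 1) * a * (p * h powr (p - 1) * \<bar>e - h\<bar>)"
        using pos by (intro mult_left_mono) auto
      also have "\<dots> = p * X powr (p - 1) * Z"
        using pos assms by (simp add: defs powr_mult)
      also have "\<dots> \<le> X powr p / 2 + p * (2 * p) powr (p - 1) * Z powr p"
        using young_absorb[of X Z p] pos p by simp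
      finally show ?thesis using eq by linarith
    qed
    have "\<bar>e * a - h * b\<bar> \<le> X + Z"
    proof -
      have "e * a - h * b = h * t + a * (e - h)" by (simp add: defs algebra_simps)
      also have "\<bar>\<dots>\<bar> \<le> \<bar>h * t\<bar> + \<bar>a * (e - h)\<bar>" by (rule abs_triangle_ineq)
      also have "\<dots> = X + Z" using pos \<open>0 \<le> h\<close> by (simp add: X_def Z_def abs_mult)
      finally show ?thesis .
    qed
    then have "\<bar>e * a - h * b\<bar> powr p \<le> (X + Z) powr p" using p by (intro powr_mono2) auto
    also have "\<dots> \<le> 2 powr p * (X powr p + Z powr p)" using powr_add_le[of X Z p] pos p by simp
    finally have "cac_low p * \<bar>e * a - h * b\<bar> powr p
        \<le> cac_low p * (2 powr p * (X powr p + Z powr p))"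
      using cac_low(1)[of p] by (intro mult_left_mono) auto
    also have "cac_low p * (2 powr p * (X powr p + Z powr p)) = 1 / 2 * (X powr p + Z powr p)"
      by (simp add: cac_low_def powr_diff powr_minus field_simps)
    finally have 5: "cac_low p * \<bar>e * a - h * b\<bar> powr p \<le> 1 / 2 * (X powr p + Z powr p)" .
    have "Z powr p = a powr p * \<bar>e - h\<bar> powr p" using pos by (simp add: defs powr_mult)
    also have "\<dots> \<le> (a powr p + b powr p) * \<bar>e - h\<bar> powr p" by (intro mult_right_mono) auto
    finally have "cac_err p * Z powr p \<le> cac_err p * ((a powr p + b powr p) * \<bar>e - h\<bar> powr p)"
      using cac_err[OF p] by (intro mult_left_mono) auto
    with 4 5 have "cac_low p * \<bar>e * a - h * b\<bar> powr p
       \<le> t powr (p - 1) * (e powr p * a - h powr p * b)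
         + cac_err p * ((a powr p + b powr p) * \<bar>e - h\<bar> powr p)"
      unfolding cac_err_def by (simp add: algebra_simps)
    then show ?thesis using 3 pos J p by (simp add: defs max_def)
  qed
qed

text \<open>The last term on the left is usually discarded as nonnegative. It is kept because its
  integral later bounds the measure of the set where \<open>u\<close> is close to its
  infimum.\<close>

lemma caccioppoli_pointwise:
  fixes a b e h p :: real
  assumes p: "1 < p" and "0 \<le> e" "0 \<le> h"
  shows "cac_low p * \<bar>e * max a 0 - h * max b 0\<bar> powr p
      + 1 / 2 * (max (- b) 0 powr (p - 1) * (e powr p * max a 0))
    \<le> signed_powr p (a - b) * (e powr p * max a 0 - h powr p * max b 0)
      + cac_err p * ((max a 0 powr p + max b 0 powr p) * \<bar>e - h\<bar> powr p)"
proof -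
  have nn: "0 \<le> max (- a) 0 powr (p - 1) * (h powr p * max b 0)"
    "0 \<le> max (- b) 0 powr (p - 1) * (e powr p * max a 0)" by simp_all
  show ?thesis
  proof (cases "b \<le> a")
    case True
    then show ?thesis
      using caccioppoli_pointwise_aux[OF p assms(2,3) True] nn by linarith
  next
    case False
    have "signed_powr p (b - a) = - signed_powr p (a - b)" using signed_powr_minus[of p "a - b"] by simp
    then have eq: "signed_powr p (b - a) * (h powr p * max b 0 - e powr p * max a 0)
        = signed_powr p (a - b) * (e powr p * max a 0 - h powr p * max b 0)"
      by (simp add: algebra_simps)
    have "a \<le> b" using False by simp
    note aux = caccioppoli_pointwise_aux[OF p assms(3,2) this, unfolded eq]
    have "\<bar>h * max b 0 - e * max a 0\<bar> = \<bar>e * max a 0 - h * max b 0\<bar>" "\<bar>h - e\<bar> = \<bar>e - h\<bar>"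
      by simp_all
    note aux = aux[unfolded this add.commute[of "max b 0 powr p"]]
    then show ?thesis using nn by linarith
  qed
qed

subsection \<open>Integrals of radial functions\<close>

lemma ennreal_le_suminf: "f n \<le> (\<Sum>i. f i)" for f :: "nat \<Rightarrow> ennreal"
  using sum_le_suminf[of f "{n}"] by simp

lemma ball_measurable [measurable]: "ball a r \<in> sets borel" "cball a r \<in> sets borel"
  for a :: "'a::metric_space"
  by auto

lemma exists_dyadic_down:
  fixes R x :: real
  assumes "0 < x" "x < R"
  obtains n :: nat where "R / 2 ^ Suc n \<le> x" "x < R / 2 ^ n"
proof -
  have "\<exists>n. R / 2 ^ Suc n \<le> x"
  proof -
    obtain n where "R / x < 2 ^ n" using real_arch_pow[of 2 "R / x"] by auto
    then have "R < x * 2 ^ n" using assms by (simp add: field_simps)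
    also have "\<dots> \<le> x * 2 ^ Suc n" using assms by simp
    finally show ?thesis using assms by (auto simp: field_simps intro!: exI[of _ n])
  qed
  then have 1: "R / 2 ^ Suc (LEAST n. R / 2 ^ Suc n \<le> x) \<le> x" by (rule LeastI_ex)
  moreover have "x < R / 2 ^ (LEAST n. R / 2 ^ Suc n \<le> x)"
  proof (cases "LEAST n. R / 2 ^ Suc n \<le> x")
    case 0
    then show ?thesis using assms by (simp only: power_0)
  next
    case (Suc m)
    then have "\<not> R / 2 ^ Suc m \<le> x" using not_less_Least[of m] by (metis lessI)
    then show ?thesis unfolding Suc by simp
  qed
  ultimately show ?thesis using that by blast
qed

lemma exists_dyadic_up:
  fixes R x :: real
  assumes "0 < R" "R \<le> x"
  obtains n :: nat where "R * 2 ^ n \<le> x" "x < R * 2 ^ Suc n"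
proof -
  have "\<exists>n. x < R * 2 ^ Suc n"
  proof -
    obtain n where "x / R < 2 ^ n" using real_arch_pow[of 2 "x / R"] by auto
    then have "x < R * 2 ^ n" using assms by (simp add: field_simps)
    also have "\<dots> \<le> R * 2 ^ Suc n" using assms by simp
    finally show ?thesis by blast
  qed
  then have 1: "x < R * 2 ^ Suc (LEAST n. x < R * 2 ^ Suc n)" by (rule LeastI_ex)
  moreover have "R * 2 ^ (LEAST n. x < R * 2 ^ Suc n) \<le> x"
  proof (cases "LEAST n. x < R * 2 ^ Suc n")
    case 0
    then show ?thesis using assms by (simp only: power_0)
  next
    case (Suc m)
    then have "\<not> x < R * 2 ^ Suc m" using not_less_Least[of m] by (metis lessI)
    then show ?thesis unfolding Suc by simp
  qed
  ultimately show ?thesis using that by blast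
qed

lemma emeasure_lborel_ball:
  "0 \<le> r \<Longrightarrow> emeasure lborel (ball (c::'a::euclidean_space) r)
     = ennreal (unit_ball_vol DIM('a) * r powr DIM('a))"
  by (cases "r = 0") (simp_all add: emeasure_ball powr_realpow)

text \<open>In place of polar coordinates, the integrand is bounded by a constant on each dyadic
  shell and the shell is enlarged to a ball, which leaves a geometric series of ratio
  \<open>2 powr - \<beta>\<close>. The factor \<open>2 powr \<bar>\<gamma>\<bar>\<close> covers both
  signs of the exponent \<gamma>.\<close>

lemma nn_integral_radial_inside:
  fixes \<beta> R :: real
  assumes "0 < \<beta>"
  shows "(\<integral>\<^sup>+z::'a::euclidean_space\<in>ball 0 R. ennreal (norm z powr (\<beta> - DIM('a))) \<partial>lborel) < \<infinity>"
proof (cases "0 < R")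
  case False
  then show ?thesis by (simp add: ball_empty)
next
  case True
  define \<gamma> where "\<gamma> = \<beta> - real DIM('a)"
  define r where "r n = R / 2 ^ n" for n :: nat
  define c where "c n = 2 powr \<bar>\<gamma>\<bar> * r n powr \<gamma>" for n
  have r: "0 < r n" for n using True by (simp add: r_def)
  have "ennreal (norm z powr \<gamma>) * indicator (ball 0 R) z
      \<le> (\<Sum>n. ennreal (c n) * indicator (ball 0 (r n)) z)" for z :: 'a
  \<comment> \<open>At the origin the integrand is 0, since \<open>0 powr \<gamma> = 0\<close> also
    for negative \<gamma>.\<close>
  proof (cases "z = 0 \<or> R \<le> norm z")
    case True
    then show ?thesis by auto
  next
    case False
    then obtain n where n: "R / 2 ^ Suc n \<le> norm z" "norm z < R / 2 ^ n"
      using exists_dyadic_down[of "norm z" R] by auto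
    have "norm z powr \<gamma> \<le> c n"
    proof (cases "0 \<le> \<gamma>")
      case True
      have "norm z powr \<gamma> \<le> r n powr \<gamma>" using n True by (intro powr_mono2) (auto simp: r_def)
      also have "\<dots> \<le> c n" using ge_one_powr_ge_zero[of 2 "\<bar>\<gamma>\<bar>"] mult_right_mono[of 1 "2 powr \<bar>\<gamma>\<bar>" "r n powr \<gamma>"]
        by (simp add: c_def)
      finally show ?thesis .
    next
      case False
      have "norm z powr \<gamma> \<le> (r n / 2) powr \<gamma>"
        using n False r[of n] by (intro powr_mono2') (auto simp: r_def field_simps)
      also have "\<dots> = c n" using False r[of n] by (simp add: c_def powr_divide powr_minus field_simps)
      finally show ?thesis .
    qed
    then have "ennreal (norm z powr \<gamma>) * indicator (ball 0 R) z \<le> ennreal (c n) * indicator (ball 0 (r n)) z"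
      using n False by (auto simp: r_def indicator_def intro: ennreal_leI)
    also have "\<dots> \<le> (\<Sum>n. ennreal (c n) * indicator (ball 0 (r n)) z)"
      by (rule ennreal_le_suminf)
    finally show ?thesis .
  qed
  then have "(\<integral>\<^sup>+z::'a\<in>ball 0 R. ennreal (norm z powr \<gamma>) \<partial>lborel)
      \<le> (\<integral>\<^sup>+z. (\<Sum>n. ennreal (c n) * indicator (ball (0::'a) (r n)) z) \<partial>lborel)"
    by (intro nn_integral_mono) auto
  also have "\<dots> = (\<Sum>n. ennreal (c n) * emeasure lborel (ball (0::'a) (r n)))"
    by (subst nn_integral_suminf) (measurable, simp add: nn_integral_cmult_indicator)
  also have "\<dots> = (\<Sum>n. ennreal (2 powr \<bar>\<gamma>\<bar> * unit_ball_vol DIM('a) * R powr \<beta> * (2 powr - \<beta>) ^ n))"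
  proof (intro suminf_cong)
    fix n
    have "r n powr \<gamma> * r n powr DIM('a) = r n powr \<beta>" by (simp add: powr_add[symmetric] \<gamma>_def)
    also have "r n powr \<beta> = R powr \<beta> * (2 powr - \<beta>) ^ n"
      using True by (simp add: r_def powr_divide powr_minus powr_realpow[symmetric] powr_powr
          field_simps power_divide powr_power mult.commute)
    finally have "c n * (unit_ball_vol DIM('a) * r n powr DIM('a))
       = 2 powr \<bar>\<gamma>\<bar> * unit_ball_vol DIM('a) * R powr \<beta> * (2 powr - \<beta>) ^ n"
      by (simp add: c_def mult_ac)
    then show "ennreal (c n) * emeasure lborel (ball (0::'a) (r n))
        = ennreal (2 powr \<bar>\<gamma>\<bar> * unit_ball_vol DIM('a) * R powr \<beta> * (2 powr - \<beta>) ^ n)"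
      using r[of n] by (simp add: emeasure_lborel_ball ennreal_mult[symmetric] c_def)
  qed
  also have "\<dots> < \<infinity>"
  proof -
    have "2 powr - \<beta> < 1" using assms powr_less_mono[of "-\<beta>" 0 2] by simp
    then have "summable (\<lambda>n. 2 powr \<bar>\<gamma>\<bar> * unit_ball_vol DIM('a) * R powr \<beta> * (2 powr - \<beta>) ^ n)"
      by (intro summable_mult summable_geometric) simp
    then show ?thesis
      using ennreal_suminf_neq_top by (fastforce simp: top.not_eq_extremum)
  qed
  finally show ?thesis by (simp add: \<gamma>_def)
qed

text \<open>The same series, growing outwards. Shell \<open>n\<close> is enclosed in
  \<open>ball 0 (r (Suc n))\<close>, hence the factor \<open>2 powr DIM('a)\<close>.\<close>

lemma nn_integral_radial_outside:
  fixes \<beta> R :: real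
  assumes "0 < \<beta>" "0 < R"
  shows "(\<integral>\<^sup>+z::'a::euclidean_space\<in>- ball 0 R. ennreal (norm z powr (- real DIM('a) - \<beta>)) \<partial>lborel) < \<infinity>"
proof -
  define \<gamma> where "\<gamma> = - real DIM('a) - \<beta>"
  define r where "r n = R * 2 ^ n" for n :: nat
  define c where "c n = r n powr \<gamma>" for n
  have r: "0 < r n" for n using assms by (simp add: r_def)
  have "\<gamma> < 0" using assms by (simp add: \<gamma>_def)
  have "ennreal (norm z powr \<gamma>) * indicator (- ball 0 R) z
      \<le> (\<Sum>n. ennreal (c n) * indicator (ball 0 (r (Suc n))) z)" for z :: 'a
  proof (cases "norm z < R")
    case True
    then show ?thesis by auto
  next
    case False
    then obtain n where n: "R * 2 ^ n \<le> norm z" "norm z < R * 2 ^ Suc n"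
      using exists_dyadic_up[of R "norm z"] assms by auto
    have "norm z powr \<gamma> \<le> c n"
      using n \<open>\<gamma> < 0\<close> r[of n] unfolding c_def by (intro powr_mono2') (auto simp: r_def)
    then have "ennreal (norm z powr \<gamma>) * indicator (- ball 0 R) z
        \<le> ennreal (c n) * indicator (ball 0 (r (Suc n))) z"
      using n False by (auto simp: r_def indicator_def intro: ennreal_leI)
    also have "\<dots> \<le> (\<Sum>n. ennreal (c n) * indicator (ball 0 (r (Suc n))) z)"
      by (rule ennreal_le_suminf)
    finally show ?thesis .
  qed
  then have "(\<integral>\<^sup>+z::'a\<in>- ball 0 R. ennreal (norm z powr \<gamma>) \<partial>lborel)
      \<le> (\<integral>\<^sup>+z. (\<Sum>n. ennreal (c n) * indicator (ball (0::'a) (r (Suc n))) z) \<partial>lborel)"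
    by (intro nn_integral_mono) auto
  also have "\<dots> = (\<Sum>n. ennreal (c n) * emeasure lborel (ball (0::'a) (r (Suc n))))"
    by (subst nn_integral_suminf) (measurable, simp add: nn_integral_cmult_indicator)
  also have "\<dots> = (\<Sum>n. ennreal (2 powr DIM('a) * unit_ball_vol DIM('a) * R powr - \<beta> * (2 powr - \<beta>) ^ n))"
  proof (intro suminf_cong)
    fix n
    have "r (Suc n) = 2 * r n" by (simp add: r_def)
    then have "r (Suc n) powr DIM('a) = 2 powr DIM('a) * r n powr DIM('a)"
      using r[of n] by (simp add: powr_mult)
    moreover have "r n powr \<gamma> * r n powr DIM('a) = r n powr - \<beta>"
      by (simp add: powr_add[symmetric] \<gamma>_def)
    moreover have "r n powr - \<beta> = R powr - \<beta> * (2 powr - \<beta>) ^ n"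
      using assms by (simp add: r_def powr_mult powr_realpow[symmetric] powr_powr mult.commute)
    ultimately have "c n * (unit_ball_vol DIM('a) * r (Suc n) powr DIM('a))
       = 2 powr DIM('a) * unit_ball_vol DIM('a) * R powr - \<beta> * (2 powr - \<beta>) ^ n"
      by (simp add: c_def mult_ac)
    then show "ennreal (c n) * emeasure lborel (ball (0::'a) (r (Suc n)))
        = ennreal (2 powr DIM('a) * unit_ball_vol DIM('a) * R powr - \<beta> * (2 powr - \<beta>) ^ n)"
      using r[of "Suc n"] by (simp add: emeasure_lborel_ball ennreal_mult[symmetric] c_def)
  qed
  also have "\<dots> < \<infinity>"
  proof -
    have "2 powr - \<beta> < 1" using assms powr_less_mono[of "-\<beta>" 0 2] by simp
    then have "summable (\<lambda>n. 2 powr DIM('a) * unit_ball_vol DIM('a) * R powr - \<beta> * (2 powr - \<beta>) ^ n)"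
      by (intro summable_mult summable_geometric) simp
    then show ?thesis
      using ennreal_suminf_neq_top by (fastforce simp: top.not_eq_extremum)
  qed
  finally show ?thesis by (simp add: \<gamma>_def)
qed

text \<open>Trades the logarithm for arbitrarily small powers at 0 and at infinity, so that the two
  radial lemmas apply to kernels with a logarithm. It comes from \<open>ln x \<le> x\<close> at
  \<open>r powr e\<close> and at \<open>r powr - e\<close>.\<close>

lemma one_plus_abs_ln_le:
  fixes e r :: real
  assumes "0 < e" "0 < r"
  shows "1 + \<bar>ln r\<bar> \<le> (1 + 1 / e) * (r powr e + r powr - e)"
proof -
  have "ln (r powr e) \<le> r powr e" "ln (r powr - e) \<le> r powr - e"
    using assms by (intro ln_bound; simp)+
  then have "e * ln r \<le> r powr e" "- (e * ln r) \<le> r powr - e" using assms by (simp_all add: ln_powr)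
  moreover have "e * \<bar>ln r\<bar> = \<bar>e * ln r\<bar>" using assms by (simp add: abs_mult)
  ultimately have "e * \<bar>ln r\<bar> \<le> r powr e + r powr - e"
    using powr_ge_zero[of r e] powr_ge_zero[of r "- e"] by linarith
  then have 1: "\<bar>ln r\<bar> \<le> (r powr e + r powr - e) / e" using assms by (simp add: field_simps)
  have "1 \<le> r powr e + r powr - e"
  proof (cases "1 \<le> r")
    case True
    then show ?thesis using ge_one_powr_ge_zero[of r e] assms powr_ge_zero[of r "-e"] by linarith
  next
    case False
    then have "1 powr - e \<le> r powr - e" using assms by (intro powr_mono2') auto
    then show ?thesis using powr_ge_zero[of r e] unfolding powr_one_eq_one by linarith
  qed
  moreover have "(1 + 1 / e) * (r powr e + r powr - e)
      = (r powr e + r powr - e) + (r powr e + r powr - e) / e"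
    by (simp add: distrib_right)
  ultimately show ?thesis using 1 by linarith
qed

lemma two_power_powr: "(2 ^ n :: real) powr x = (2 powr x) ^ n"
proof -
  have "(2 ^ n :: real) powr x = (2 powr real n) powr x" by (simp add: powr_realpow)
  also have "\<dots> = (2 powr x) powr real n" by (simp add: powr_powr mult.commute)
  also have "\<dots> = (2 powr x) ^ n" by (rule powr_realpow) simp
  finally show ?thesis .
qed

subsection \<open>Faber--Krahn and Sobolev inequalities\<close>

locale frac_exponents =
  fixes ty :: "'a::euclidean_space itself" and s p :: real
  assumes p: "1 < p" and s: "0 < s" "s < 1" and sp: "s * p < DIM('a)"
begin

text \<open>\<open>\<theta>\<close> is the power of the measure gained by one use of the
  Faber--Krahn inequality and \<open>pstar\<close> is the critical Sobolev exponent;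
  \<open>pstar * (1 - \<theta>) = p\<close> is the relation that turns the one into the
  other.\<close>

definition "\<theta> = s * p / DIM('a)"
definition "pstar = DIM('a) * p / (DIM('a) - s * p)"
definition "vol = unit_ball_vol (DIM('a))"
text \<open>For the radius with \<open>r powr DIM('a) = 2 * a / vol\<close>, the quotient
  \<open>r powr (DIM('a) + s * p) / a\<close> equals
  \<open>fk_const * a powr \<theta>\<close>.\<close>

definition "fk_const = (2 / vol) powr (1 + \<theta>)"

lemma dim_pos: "1 \<le> real DIM('a)" using DIM_positive[where 'a='a] by (simp add: Suc_leI)
lemma sp_pos: "0 < s * p" using s p by simp
lemma theta: "0 < \<theta>" "\<theta> < 1" using sp_pos sp dim_pos by (auto simp: \<theta>_def)
lemma vol_pos: "0 < vol" by (simp add: vol_def)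
lemma fk_const_pos: "0 < fk_const" using vol_pos by (simp add: fk_const_def)
lemma pstar_theta: "pstar * (1 - \<theta>) = p"
  using sp dim_pos by (simp add: pstar_def \<theta>_def field_simps)
lemma pstar_diff: "pstar - p = pstar * \<theta>" using pstar_theta by (simp add: algebra_simps)
lemma pstar_gt: "p < pstar"
proof -
  have "0 < pstar" using p sp sp_pos by (simp add: pstar_def)
  then show ?thesis using pstar_diff theta by (smt (verit) mult_pos_pos)
qed

text \<open>The fractional energy is truncated at distance 2, because the rescaled kernel dominates
  the fractional one on bounded sets only, and the Faber--Krahn argument never looks
  farther.\<close>

definition gagliardo :: "('a \<Rightarrow> real) \<Rightarrow> ennreal" where
  "gagliardo v = (\<integral>\<^sup>+x. (\<integral>\<^sup>+y. ennreal (\<bar>v x - v y\<bar> powr p / dist x y powr (DIM('a) + s * p))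
      * indicator (ball x 2) y \<partial>lborel) \<partial>lborel)"

lemma gagliardo_mono:
  assumes "\<And>x y. \<bar>v x - v y\<bar> \<le> \<bar>w x - w y\<bar>"
  shows "gagliardo v \<le> gagliardo w"
  unfolding gagliardo_def using assms p
  by (intro nn_integral_mono mult_right_mono ennreal_leI divide_right_mono powr_mono2) auto

text \<open>Where \<open>v x > 0\<close>, at least half of a ball around \<open>x\<close> of twice the volume of \<open>{v > 0}\<close>
  lies in \<open>{v = 0}\<close>.\<close>

lemma faber_krahn:
  fixes v :: "'a \<Rightarrow> real"
  assumes [measurable]: "v \<in> borel_measurable borel" and v0: "\<And>x. 0 \<le> v x"
    and a: "emeasure lborel {x. 0 < v x} \<le> ennreal a" "0 < a" "a \<le> vol"
  shows "(\<integral>\<^sup>+x. ennreal (v x powr p) \<partial>lborel) \<le> ennreal (fk_const * a powr \<theta>) * gagliardo v"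
proof -
  define A where "A = {x. 0 < v x}"
  define r where "r = (2 * a / vol) powr (1 / DIM('a))"
  define K where "K = a / r powr (DIM('a) + s * p)"
  have [measurable]: "A \<in> sets borel" unfolding A_def by measurable
  have rpos: "0 < r" using a vol_pos by (simp add: r_def)
  have rd: "r powr DIM('a) = 2 * a / vol" using a vol_pos by (simp add: r_def powr_powr)
  \<comment> \<open>Here \<open>a \<le> vol\<close> enters: the ball of twice the volume stays
    within the truncation radius of \<open>gagliardo\<close>.\<close>
  have "r \<le> 2 powr (1 / DIM('a))"
    unfolding r_def using a vol_pos by (intro powr_mono2) (auto simp: field_simps)
  also have "\<dots> \<le> 2 powr 1" using dim_pos by (intro powr_mono) auto
  finally have r2: "r \<le> 2" by simp
  have K: "0 < K" using a rpos by (simp add: K_def)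
  have inner: "ennreal (K * v x powr p)
      \<le> (\<integral>\<^sup>+y. ennreal (\<bar>v x - v y\<bar> powr p / dist x y powr (DIM('a) + s * p))
          * indicator (ball x 2) y \<partial>lborel)" for x
  proof (cases "v x = 0")
    case True
    then show ?thesis by simp
  next
    case False
    define e where "e = emeasure lborel (ball x r - A)"
    define c where "c = v x powr p / r powr (DIM('a) + s * p)"
    have "emeasure lborel (ball x r) \<le> emeasure lborel ((ball x r - A) \<union> A)"
      by (intro emeasure_mono) auto
    also have "\<dots> \<le> e + emeasure lborel A"
      unfolding e_def by (intro emeasure_subadditive) auto
    also have "\<dots> \<le> e + ennreal a" using a by (auto simp: A_def intro: add_left_mono)
    finally have "ennreal (2 * a) \<le> e + ennreal a"
      using rpos vol_pos rd a by (simp add: emeasure_lborel_ball vol_def[symmetric])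
    then have ea: "ennreal a \<le> e"
      using a by (cases e) (auto simp: ennreal_plus[symmetric] simp del: ennreal_plus)
    have "ennreal (K * v x powr p) = ennreal c * ennreal a"
      using a by (subst ennreal_mult[symmetric]) (auto simp: c_def K_def)
    also have "\<dots> \<le> ennreal c * e" using ea by (rule mult_left_mono) simp
    also have "\<dots> = (\<integral>\<^sup>+y. ennreal c * indicator (ball x r - A) y \<partial>lborel)"
      unfolding e_def by (subst nn_integral_cmult_indicator) auto
    also have "\<dots> \<le> (\<integral>\<^sup>+y. ennreal (\<bar>v x - v y\<bar> powr p / dist x y powr (DIM('a) + s * p))
          * indicator (ball x 2) y \<partial>lborel)"
    proof (intro nn_integral_mono)
      fix y
      show "ennreal c * indicator (ball x r - A) y
         \<le> ennreal (\<bar>v x - v y\<bar> powr p / dist x y powr (DIM('a) + s * p)) * indicator (ball x 2) y"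
      proof (cases "y \<in> ball x r - A")
        case True
        then have "v y = 0" using v0[of y] by (auto simp: A_def)
        then have "x \<noteq> y" using False by auto
        have "c \<le> \<bar>v x - v y\<bar> powr p / dist x y powr (DIM('a) + s * p)"
          unfolding c_def using True \<open>v y = 0\<close> v0[of x] \<open>x \<noteq> y\<close> sp_pos p
          by (intro frac_le powr_mono2) auto
        then show ?thesis using True r2 by (auto simp: indicator_def intro: ennreal_leI)
      qed auto
    qed
    finally show ?thesis .
  qed
  have "ennreal K * (\<integral>\<^sup>+x. ennreal (v x powr p) \<partial>lborel) = (\<integral>\<^sup>+x. ennreal (K * v x powr p) \<partial>lborel)"
    using K by (subst nn_integral_cmult[symmetric]) (auto simp: ennreal_mult)
  also have "\<dots> \<le> gagliardo v" unfolding gagliardo_def by (intro nn_integral_mono inner)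
  finally have "ennreal (1 / K) * (ennreal K * (\<integral>\<^sup>+x. ennreal (v x powr p) \<partial>lborel)) \<le> ennreal (1 / K) * gagliardo v"
    by (rule mult_left_mono) simp
  moreover have "ennreal (1 / K) * (ennreal K * z) = z" for z
    using K by (simp add: mult.assoc[symmetric] ennreal_mult[symmetric])
  moreover have "1 / K = fk_const * a powr \<theta>"
  proof -
    have "r powr (DIM('a) + s * p) = (r powr DIM('a)) powr (1 + \<theta>)"
    proof -
      have "DIM('a) * (1 + \<theta>) = DIM('a) + s * p" using dim_pos by (simp add: \<theta>_def field_simps)
      then show ?thesis by (simp only: powr_powr)
    qed
    also have "\<dots> = (2 / vol) powr (1 + \<theta>) * a powr (1 + \<theta>)"
      unfolding rd using a vol_pos by (simp add: powr_mult[symmetric])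
    also have "a powr (1 + \<theta>) = a * a powr \<theta>" using a by (simp add: powr_add)
    finally show ?thesis using a by (simp add: K_def fk_const_def)
  qed
  ultimately show ?thesis by simp
qed

definition "sob_base e = (2 powr pstar * fk_const * e)"

text \<open>Faber--Krahn is applied to the truncation \<open>min (max (v - l) 0) l\<close>, which
  lives on \<open>{l < v}\<close> and equals \<open>l\<close> on \<open>{2 * l \<le> v}\<close>. For
  \<open>X l = N l * l powr pstar\<close> this reads
  \<open>X (2 * l) \<le> sob_base e * X l powr \<theta>\<close>, a map with fixed point
  \<open>S\<close>. If \<open>X l\<close> exceeded \<open>S\<close>, so would
  \<open>X (l / 2 ^ n)\<close> for every \<open>n\<close>; but \<open>N \<le> a\<close> forces these
  values to 0.\<close>

lemma weak_sobolev:
  fixes v :: "'a \<Rightarrow> real"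
  assumes [measurable]: "v \<in> borel_measurable borel" and v0: "\<And>x. 0 \<le> v x"
    and a: "emeasure lborel {x. 0 < v x} \<le> ennreal a" "0 < a" "a \<le> vol"
    and e: "gagliardo v \<le> ennreal e" "0 < e" and l: "0 < l"
  shows "emeasure lborel {x. l < v x} \<le> ennreal (sob_base e powr (1 / (1 - \<theta>)) * l powr - pstar)"
proof -
  define N where "N l = measure lborel {x. l < v x}" for l
  define X where "X l = N l * l powr pstar" for l
  define S where "S = sob_base e powr (1 / (1 - \<theta>))"
  have sets[measurable]: "{x. l < v x} \<in> sets lborel" for l by measurable
  have sb: "0 < sob_base e" using e fk_const_pos by (simp add: sob_base_def)
  have S: "0 < S" "S = sob_base e * S powr \<theta>"
  proof -
    show "0 < S" using sb by (simp add: S_def)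
    have "S powr (1 - \<theta>) = sob_base e" using sb theta by (simp add: S_def powr_powr)
    then show "S = sob_base e * S powr \<theta>" using \<open>0 < S\<close> by (simp add: powr_diff field_simps)
  qed
  have em_le: "emeasure lborel {x. l < v x} \<le> ennreal a" if "0 \<le> l" for l
    by (rule order_trans[OF emeasure_mono a(1)]) (use that in auto)
  have emN: "emeasure lborel {x. l < v x} = ennreal (N l)" if "0 \<le> l" for l
    unfolding N_def using em_le[OF that] by (intro emeasure_eq_ennreal_measure) (auto simp: top_unique)
  have N_le: "N l \<le> a" if "0 \<le> l" for l
    using em_le[OF that] emN[OF that] a by (simp add: N_def)
  have N0: "0 \<le> N l" for l by (simp add: N_def)
  have step: "X (2 * l) \<le> sob_base e * X l powr \<theta>" if l: "0 < l" for l
  proof (cases "N l = 0")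
    case True
    have "ennreal (N (2 * l)) \<le> ennreal (N l)"
      using l by (subst (1 2) emN[symmetric]) (auto intro!: emeasure_mono)
    then have "N (2 * l) = 0" using True N0[of "2 * l"] by simp
    then show ?thesis using True by (simp add: X_def)
  next
    case False
    then have Np: "0 < N l" using N0[of l] by simp
    define w where "w x = min (max (v x - l) 0) l" for x
    have [measurable]: "w \<in> borel_measurable borel" unfolding w_def by measurable
    have "{x. 0 < w x} = {x. l < v x}" using l by (auto simp: w_def)
    then have "(\<integral>\<^sup>+x. ennreal (w x powr p) \<partial>lborel) \<le> ennreal (fk_const * N l powr \<theta>) * gagliardo w"
      using emN[of l] l Np N_le[of l] a by (intro faber_krahn) (auto simp: w_def)
    also have "gagliardo w \<le> gagliardo v" by (intro gagliardo_mono) (auto simp: w_def)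
    also have "gagliardo v \<le> ennreal e" by fact
    finally have "(\<integral>\<^sup>+x. ennreal (w x powr p) \<partial>lborel) \<le> ennreal (fk_const * N l powr \<theta> * e)"
      using fk_const_pos e by (simp add: ennreal_mult mult_left_mono)
    moreover have "ennreal (l powr p) * emeasure lborel {x. 2 * l < v x}
       \<le> (\<integral>\<^sup>+x. ennreal (w x powr p) \<partial>lborel)"
    proof -
      have "ennreal (l powr p) * emeasure lborel {x. 2 * l < v x}
        = (\<integral>\<^sup>+x. ennreal (l powr p) * indicator {x. 2 * l < v x} x \<partial>lborel)"
        by (subst nn_integral_cmult_indicator) auto
      also have "\<dots> \<le> (\<integral>\<^sup>+x. ennreal (w x powr p) \<partial>lborel)"
        by (intro nn_integral_mono) (auto simp: w_def indicator_def)
      finally show ?thesis .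
    qed
    ultimately have "ennreal (l powr p * N (2 * l)) \<le> ennreal (fk_const * N l powr \<theta> * e)"
      using emN[of "2 * l"] l N0 by (simp add: ennreal_mult)
    then have 1: "l powr p * N (2 * l) \<le> fk_const * N l powr \<theta> * e"
      using fk_const_pos e by (subst (asm) ennreal_le_iff) auto
    have "X (2 * l) = 2 powr pstar * l powr (pstar - p) * (l powr p * N (2 * l))"
      using l by (simp add: X_def powr_mult powr_diff)
    also have "\<dots> \<le> 2 powr pstar * l powr (pstar - p) * (fk_const * N l powr \<theta> * e)"
      by (intro mult_left_mono 1) simp
    also have "\<dots> = sob_base e * X l powr \<theta>"
      using l N0 by (simp add: X_def sob_base_def pstar_diff powr_mult powr_powr)
    finally show ?thesis .
  qed
  have "X l \<le> S"
  proof (rule ccontr)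
    assume "\<not> X l \<le> S"
    have gt: "S < X (l / 2 ^ n)" for n
    proof (induction n)
      case 0
      then show ?case using \<open>\<not> X l \<le> S\<close> by simp
    next
      case (Suc n)
      have "S < X (2 * (l / 2 ^ Suc n))" using Suc by simp
      also have "\<dots> \<le> sob_base e * X (l / 2 ^ Suc n) powr \<theta>" using l by (intro step) simp
      finally have "sob_base e * S powr \<theta> < sob_base e * X (l / 2 ^ Suc n) powr \<theta>"
        using S(2) by linarith
      then have less: "S powr \<theta> < X (l / 2 ^ Suc n) powr \<theta>" using sb by simp
      show ?case
      proof (rule ccontr)
        assume "\<not> S < X (l / 2 ^ Suc n)"
        then have "X (l / 2 ^ Suc n) powr \<theta> \<le> S powr \<theta>"
          using theta N0 by (intro powr_mono2) (auto simp: X_def)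
        then show False using less by simp
      qed
    qed
    have "X (l / 2 ^ n) \<le> a * l powr pstar * (1 / 2 powr pstar) ^ n" for n
    proof -
      have "X (l / 2 ^ n) \<le> a * (l / 2 ^ n) powr pstar"
        unfolding X_def using l by (intro mult_right_mono N_le) auto
      also have "(l / 2 ^ n) powr pstar = l powr pstar * (1 / 2 powr pstar) ^ n"
        using l by (simp add: powr_divide two_power_powr power_divide)
      finally show ?thesis by simp
    qed
    then have le: "S \<le> a * l powr pstar * (1 / 2 powr pstar) ^ n" for n
      using gt[of n] by (meson less_le_trans less_imp_le)
    have "1 / 2 powr pstar < (1::real)" using pstar_gt p by simp
    then have "(\<lambda>n. a * l powr pstar * (1 / 2 powr pstar) ^ n) \<longlonglongrightarrow> a * l powr pstar * 0"
      by (intro tendsto_intros LIMSEQ_realpow_zero) auto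
    then have "S \<le> a * l powr pstar * 0"
      by (rule LIMSEQ_le_const) (use le in auto)
    then show False using S by simp
  qed
  then have "N l \<le> S * l powr - pstar" using l by (simp add: X_def powr_minus field_simps)
  then show ?thesis using emN[of l] l by (auto simp: S_def intro: ennreal_leI)
qed

definition "sob_const \<kappa> = (2 powr pstar * fk_const) powr (\<kappa> / p) *
  (1 + 2 powr \<kappa> * (\<Sum>n. (2 powr (\<kappa> - pstar)) ^ n))"

lemma sob_series: "\<kappa> < pstar \<Longrightarrow> summable (\<lambda>n. (2 powr (\<kappa> - pstar)) ^ n)"
  by (intro summable_geometric) (use powr_less_mono[of "\<kappa> - pstar" 0 2] in auto)

lemma sob_const_pos: "\<kappa> < pstar \<Longrightarrow> 0 < sob_const \<kappa>"
  unfolding sob_const_def using fk_const_pos sob_series[of \<kappa>]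
  by (intro mult_pos_pos add_pos_nonneg mult_nonneg_nonneg suminf_nonneg) auto

text \<open>The integral is split at the level \<open>T\<close> where the weak bound
  \<open>S * T powr - pstar\<close> equals \<open>a\<close>. Below \<open>T\<close> the measure of
  the support suffices; above it the dyadic level sets are summed, and the series converges because
  \<open>\<kappa> < pstar\<close>.\<close>

lemma subcritical_sobolev:
  fixes v :: "'a \<Rightarrow> real"
  assumes [measurable]: "v \<in> borel_measurable borel" and v0: "\<And>x. 0 \<le> v x"
    and a: "emeasure lborel {x. 0 < v x} \<le> ennreal a" "0 < a" "a \<le> vol"
    and e: "gagliardo v \<le> ennreal e" "0 < e" and \<kappa>: "0 < \<kappa>" "\<kappa> < pstar"
  shows "(\<integral>\<^sup>+x. ennreal (v x powr \<kappa>) \<partial>lborel)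
     \<le> ennreal (sob_const \<kappa> * a powr (1 - \<kappa> / pstar) * e powr (\<kappa> / p))"
proof -
  define S where "S = sob_base e powr (1 / (1 - \<theta>))"
  define T where "T = (S / a) powr (1 / pstar)"
  define D where "D n = (2 * (2 ^ n * T)) powr \<kappa>" for n :: nat
  have sets[measurable]: "{x. l < v x} \<in> sets lborel" for l by measurable
  have sb: "0 < sob_base e" using e fk_const_pos by (simp add: sob_base_def)
  have S: "0 < S" using sb by (simp add: S_def)
  have T: "0 < T" using S a by (simp add: T_def)
  have ps: "0 < pstar" using pstar_gt p by simp
  have "T powr - pstar = (S / a) powr - 1" using ps by (simp add: T_def powr_powr)
  then have TS: "T powr - pstar * S = a" using S a by (simp add: powr_minus)
  have "ennreal (v x powr \<kappa>) \<le> ennreal (T powr \<kappa>) * indicator {x. 0 < v x} x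
     + (\<Sum>n. ennreal (D n) * indicator {x. 2 ^ n * T < v x} x)" for x
  proof (cases "v x \<le> T")
    case True
    have "v x powr \<kappa> \<le> T powr \<kappa>" using True v0[of x] \<kappa> by (intro powr_mono2) auto
    then have "ennreal (v x powr \<kappa>) \<le> ennreal (T powr \<kappa>) * indicator {x. 0 < v x} x"
      using v0[of x] by (cases "v x = 0") (auto simp: indicator_def intro: ennreal_leI)
    then show ?thesis by (rule order_trans) simp
  next
    case False
    have "v x > 0" using False T by simp
    obtain n where n: "T * 2 ^ n \<le> v x" "v x < T * 2 ^ Suc n"
      using exists_dyadic_up[of T "v x"] False T by auto
    \<comment> \<open>The level sets are defined by strict inequalities, whereas
      \<open>exists_dyadic_up\<close> gives \<open>T * 2 ^ n \<le> v x\<close>. In case of equality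
      one level lower is taken, which exists because \<open>T < v x\<close>.\<close>
    obtain m where m: "2 ^ m * T < v x" "v x \<le> 2 * (2 ^ m * T)"
    proof (cases "T * 2 ^ n < v x")
      case True
      then show ?thesis using that[of n] n by (simp add: mult_ac)
    next
      case F: False
      then have eq: "v x = T * 2 ^ n" using n by simp
      then have "n \<noteq> 0" using False by (intro notI) simp
      then obtain m where "n = Suc m" by (cases n) auto
      then show ?thesis using that[of m] eq T by (simp add: mult_ac)
    qed
    have "v x powr \<kappa> \<le> D m" unfolding D_def using m \<kappa> v0[of x] by (intro powr_mono2) auto
    then have "ennreal (v x powr \<kappa>) \<le> ennreal (D m) * indicator {x. 2 ^ m * T < v x} x"
      using m by (auto simp: indicator_def intro: ennreal_leI)
    also have "\<dots> \<le> (\<Sum>n. ennreal (D n) * indicator {x. 2 ^ n * T < v x} x)" by (rule ennreal_le_suminf)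
    finally show ?thesis by (rule order_trans) simp
  qed
  then have "(\<integral>\<^sup>+x. ennreal (v x powr \<kappa>) \<partial>lborel)
     \<le> (\<integral>\<^sup>+x. ennreal (T powr \<kappa>) * indicator {x. 0 < v x} x
     + (\<Sum>n. ennreal (D n) * indicator {x. 2 ^ n * T < v x} x) \<partial>lborel)"
    by (intro nn_integral_mono) auto
  also have "\<dots> = ennreal (T powr \<kappa>) * emeasure lborel {x. 0 < v x}
     + (\<Sum>n. ennreal (D n) * emeasure lborel {x. 2 ^ n * T < v x})"
    by (subst nn_integral_add) (measurable, simp add: nn_integral_suminf nn_integral_cmult_indicator)
  also have "\<dots> \<le> ennreal (T powr \<kappa>) * ennreal a
     + (\<Sum>n. ennreal (T powr \<kappa> * a * 2 powr \<kappa> * (2 powr (\<kappa> - pstar)) ^ n))"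
  proof (intro add_mono mult_left_mono a suminf_le)
    fix n
    have "ennreal (D n) * emeasure lborel {x. 2 ^ n * T < v x}
       \<le> ennreal (D n) * ennreal (S * (2 ^ n * T) powr - pstar)"
      unfolding S_def using T by (intro mult_left_mono weak_sobolev[OF assms(1,2) a e]) auto
    also have "\<dots> = ennreal (D n * (S * (2 ^ n * T) powr - pstar))"
      using S by (subst ennreal_mult) (auto simp: D_def)
    also have "D n * (S * (2 ^ n * T) powr - pstar)
        = T powr \<kappa> * (T powr - pstar * S) * 2 powr \<kappa> * ((2 ^ n) powr \<kappa> * (2 ^ n) powr - pstar)"
      using T by (simp add: D_def powr_mult mult_ac)
    also have "\<dots> = T powr \<kappa> * a * 2 powr \<kappa> * (2 powr (\<kappa> - pstar)) ^ n"
      unfolding TS by (simp add: two_power_powr power_mult_distrib[symmetric] powr_add[symmetric])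
    finally show "ennreal (D n) * emeasure lborel {x. 2 ^ n * T < v x}
       \<le> ennreal (T powr \<kappa> * a * 2 powr \<kappa> * (2 powr (\<kappa> - pstar)) ^ n)" .
  qed auto
  also have "\<dots> = ennreal (T powr \<kappa> * a * (1 + 2 powr \<kappa> * (\<Sum>n. (2 powr (\<kappa> - pstar)) ^ n)))"
  proof -
    have "(\<Sum>n. ennreal (T powr \<kappa> * a * 2 powr \<kappa> * (2 powr (\<kappa> - pstar)) ^ n))
       = ennreal (\<Sum>n. T powr \<kappa> * a * 2 powr \<kappa> * (2 powr (\<kappa> - pstar)) ^ n)"
      using a by (intro suminf_ennreal2 summable_mult sob_series \<kappa>) auto
    also have "(\<Sum>n. T powr \<kappa> * a * 2 powr \<kappa> * (2 powr (\<kappa> - pstar)) ^ n)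
       = T powr \<kappa> * a * 2 powr \<kappa> * (\<Sum>n. (2 powr (\<kappa> - pstar)) ^ n)"
      by (rule suminf_mult[OF sob_series[OF \<kappa>(2)]])
    finally have eq: "(\<Sum>n. ennreal (T powr \<kappa> * a * 2 powr \<kappa> * (2 powr (\<kappa> - pstar)) ^ n))
       = ennreal (T powr \<kappa> * a * 2 powr \<kappa> * (\<Sum>n. (2 powr (\<kappa> - pstar)) ^ n))" .
    have "0 \<le> (\<Sum>n. (2 powr (\<kappa> - pstar)) ^ n)"
      by (intro suminf_nonneg sob_series \<kappa>) auto
    then show ?thesis unfolding eq using a
      by (simp add: ennreal_mult[symmetric] ennreal_plus[symmetric] algebra_simps del: ennreal_plus)
  qed
  also have "T powr \<kappa> * a = (2 powr pstar * fk_const) powr (\<kappa> / p) * (a powr (1 - \<kappa> / pstar) * e powr (\<kappa> / p))"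
  proof -
    have "T powr \<kappa> = S powr (\<kappa> / pstar) * a powr - (\<kappa> / pstar)"
    proof -
      have "T powr \<kappa> = (S / a) powr (\<kappa> / pstar)" unfolding T_def powr_powr by simp
      then show ?thesis using S a by (simp add: powr_divide powr_minus_divide)
    qed
    moreover have "S powr (\<kappa> / pstar) = sob_base e powr (\<kappa> / p)"
    proof -
      have "1 / (1 - \<theta>) * (\<kappa> / pstar) = \<kappa> / (pstar * (1 - \<theta>))" by simp
      also have "\<dots> = \<kappa> / p" unfolding pstar_theta ..
      finally show ?thesis unfolding S_def powr_powr by (rule arg_cong)
    qed
    moreover have "sob_base e powr (\<kappa> / p) = (2 powr pstar * fk_const) powr (\<kappa> / p) * e powr (\<kappa> / p)"
      unfolding sob_base_def using fk_const_pos e by (simp add: powr_mult)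
    moreover have "a powr - (\<kappa> / pstar) * a = a powr (1 - \<kappa> / pstar)"
      using a by (simp add: powr_diff powr_minus divide_inverse)
    ultimately have "T powr \<kappa> * a = (2 powr pstar * fk_const) powr (\<kappa> / p) * e powr (\<kappa> / p)
        * (a powr - (\<kappa> / pstar) * a)" by (simp only: mult.assoc)
    then show ?thesis unfolding \<open>a powr - (\<kappa> / pstar) * a = a powr (1 - \<kappa> / pstar)\<close> by (simp only: mult_ac)
  qed
  finally show ?thesis by (simp add: sob_const_def mult_ac)
qed

end

subsection \<open>Rescaled kernels and solutions\<close>

text \<open>Integrates a pointwise inequality in which \<open>G\<close> has no sign and
  \<open>N\<close> may have an infinite integral: in that case the claim is trivial, otherwise
  \<open>G + N\<close> is integrable and nonnegative.\<close>

lemma nn_integral_le_integral_add: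
  fixes G N P :: "'b \<Rightarrow> real"
  assumes G: "integrable M G" and [measurable]: "N \<in> borel_measurable M"
    and P: "\<And>z. 0 \<le> P z" and N: "\<And>z. 0 \<le> N z" and le: "\<And>z. P z \<le> G z + N z"
  shows "(\<integral>\<^sup>+z. ennreal (P z) \<partial>M) \<le> ennreal \<bar>\<integral>z. G z \<partial>M\<bar> + (\<integral>\<^sup>+z. ennreal (N z) \<partial>M)"
proof (cases "(\<integral>\<^sup>+z. ennreal (N z) \<partial>M) = \<infinity>")
  case False
  then have iN: "integrable M N"
    using N by (intro integrableI_nonneg) (auto simp: top.not_eq_extremum)
  have pos: "0 \<le> G z + N z" for z using P[of z] le[of z] by linarith
  have "(\<integral>\<^sup>+z. ennreal (P z) \<partial>M) \<le> (\<integral>\<^sup>+z. ennreal (G z + N z) \<partial>M)"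
    using le by (intro nn_integral_mono ennreal_leI)
  also have "\<dots> = ennreal (\<integral>z. G z + N z \<partial>M)"
    using pos G iN by (intro nn_integral_eq_integral Bochner_Integration.integrable_add) auto
  also have "\<dots> = ennreal ((\<integral>z. G z \<partial>M) + (\<integral>z. N z \<partial>M))" using G iN by simp
  also have "\<dots> \<le> ennreal (\<bar>\<integral>z. G z \<partial>M\<bar> + (\<integral>z. N z \<partial>M))" by (intro ennreal_leI) simp
  also have "\<dots> = ennreal \<bar>\<integral>z. G z \<partial>M\<bar> + ennreal (\<integral>z. N z \<partial>M)"
    using N by (intro ennreal_plus) (auto intro: integral_nonneg_AE)
  also have "ennreal (\<integral>z. N z \<partial>M) = (\<integral>\<^sup>+z. ennreal (N z) \<partial>M)"
    using N iN by (intro nn_integral_eq_integral[symmetric]) auto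
  finally show ?thesis .
qed simp

text \<open>Holds for every \<open>g\<close>: if \<open>g\<close> is not integrable, its Bochner
  integral is 0.\<close>

lemma ennreal_abs_integral_le:
  fixes g :: "'b \<Rightarrow> real"
  shows "ennreal \<bar>\<integral>x. g x \<partial>M\<bar> \<le> (\<integral>\<^sup>+x. ennreal \<bar>g x\<bar> \<partial>M)"
proof (cases "integrable M g")
  case True
  then show ?thesis using integral_norm_bound_ennreal[of M g] by simp
qed (simp add: not_integrable_integral_eq)

lemma nn_integral_shift:
  fixes F :: "'a::euclidean_space \<Rightarrow> ennreal"
  assumes [measurable]: "F \<in> borel_measurable borel"
  shows "(\<integral>\<^sup>+y. F y \<partial>lborel) = (\<integral>\<^sup>+z. F (x + z) \<partial>lborel)"
proof -
  have "(\<integral>\<^sup>+y. F y \<partial>lborel) = (\<integral>\<^sup>+y. F y \<partial>distr lborel borel ((+) x))"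
    by (simp add: lborel_distr_plus)
  also have "\<dots> = (\<integral>\<^sup>+z. F (x + z) \<partial>lborel)" by (subst nn_integral_distr) auto
  finally show ?thesis .
qed

lemma nn_integral_dist:
  fixes h :: "real \<Rightarrow> real"
  assumes [measurable]: "h \<in> borel_measurable borel"
  shows "(\<integral>\<^sup>+y::'a::euclidean_space\<in>ball x r. ennreal (h (dist x y)) \<partial>lborel) = (\<integral>\<^sup>+z::'a\<in>ball 0 r. ennreal (h (norm z)) \<partial>lborel)"
proof -
  have "(\<integral>\<^sup>+y\<in>ball x r. ennreal (h (dist x y)) \<partial>lborel)
     = (\<integral>\<^sup>+z. ennreal (h (dist x (x + z))) * indicator (ball x r) (x + z) \<partial>lborel)"
    by (rule nn_integral_shift) measurable
  also have "\<dots> = (\<integral>\<^sup>+z::'a\<in>ball 0 r. ennreal (h (norm z)) \<partial>lborel)"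
    by (intro nn_integral_cong) (auto simp: indicator_def dist_norm)
  finally show ?thesis .
qed

text \<open>\<open>c\<close> and \<open>B\<close> stand for the normalization constant and its
  logarithmic derivative at the given exponents. The sign of \<open>B\<close> makes the kernel
  nonnegative up to distance 1.\<close>

locale log_kernel = frac_exponents ty s p for ty :: "'a::euclidean_space itself" and s :: real and p :: real +
  fixes c B q :: real
  assumes c: "0 < c" and B: "0 \<le> B" and q: "DIM('a) / (s * p) < q"
begin

definition "dsp = real DIM('a) + s * p"

text \<open>The kernel rescaled from \<open>B\<^sub>\<rho>\<close> to \<open>B\<^sub>1\<close> and divided by its logarithmic size at scale \<open>\<rho>\<close>;
  all estimates below are uniform in \<open>\<rho>\<close>.\<close>

definition lg :: "real \<Rightarrow> real" where "lg \<rho> = 1 + ln (1 / \<rho>)"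
definition "ker \<rho> r = c * (B - p * ln (\<rho> * r)) / lg \<rho> / r powr dsp"
text \<open>\<open>kmaj\<close> bounds the modulus of \<open>ker\<close> up to the factor
  \<open>kup\<close>, and the scale-free \<open>hmaj\<close> bounds \<open>kmaj\<close>. Near the
  diagonal \<open>hmaj\<close> is enough. In tails \<open>kmaj\<close> is kept, because it is
  exactly a rescaled \<open>hmaj\<close>, so that tail data of a fixed ball can be carried to all
  smaller scales.\<close>

definition "kmaj \<rho> r = (1 + \<bar>ln (\<rho> * r)\<bar>) / lg \<rho> / r powr dsp"
definition "kplus \<rho> r = max (- ln (\<rho> * r)) 0 / r powr dsp"
definition "hmaj r = (1 + \<bar>ln r\<bar>) / r powr dsp"
definition "kup = c * (B + p)"
text \<open>The value of \<open>c * (B - p * ln (\<rho> * r)) / lg \<rho>\<close> for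
  \<open>B = 0\<close> in the worst case \<open>\<rho> = 1 / 4\<close>, \<open>r = 3\<close>: with
  \<open>x = ln (1 / \<rho>)\<close> the quotient \<open>(x - ln 3) / (1 + x)\<close> increases in
  \<open>x\<close>.\<close>

definition "klow = c * p * ln (4 / 3) / (1 + ln 4)"

text \<open>The bound \<open>1 / 4\<close> keeps \<open>\<rho> * r \<le> 3 / 4\<close> for the
  distances \<open>r \<le> 3\<close> met inside \<open>ball 0 (3/2)\<close>, away from the zero of
  the logarithm; it is satisfied by \<open>\<rho> = R / 2\<close> with
  \<open>R \<le> 1 / 2\<close>.\<close>

definition scale :: "real \<Rightarrow> bool" where "scale \<rho> \<longleftrightarrow> 0 < \<rho> \<and> \<rho> \<le> 1 / 4"

section \<open>Kernel bounds uniform in the scale\<close>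

lemma ker_measurable [measurable]:
  assumes [measurable]: "g \<in> borel_measurable M"
  shows "(\<lambda>x. ker \<rho> (g x)) \<in> borel_measurable M" "(\<lambda>x. kmaj \<rho> (g x)) \<in> borel_measurable M"
    "(\<lambda>x. kplus \<rho> (g x)) \<in> borel_measurable M" "(\<lambda>x. hmaj (g x)) \<in> borel_measurable M"
  unfolding ker_def kmaj_def kplus_def hmaj_def by measurable

lemma dsp_pos: "0 < dsp" using dim_pos sp_pos by (simp add: dsp_def)
lemma kup_pos: "0 < kup" using c B p by (simp add: kup_def)
lemma klow_pos: "0 < klow" using c p by (simp add: klow_def add_pos_pos)

lemma lg_ge: assumes "scale \<rho>" shows "1 \<le> lg \<rho>" "1 + ln 4 \<le> lg \<rho>"
proof -
  have "ln 4 \<le> ln (1 / \<rho>)" using assms by (subst ln_le_cancel_iff) (auto simp: scale_def field_simps)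
  then show "1 + ln 4 \<le> lg \<rho>" by (simp add: lg_def)
  moreover have "0 < ln (4::real)" by simp
  ultimately show "1 \<le> lg \<rho>" by linarith
qed

lemma kmaj_nonneg: "scale \<rho> \<Longrightarrow> 0 \<le> kmaj \<rho> r"
  using lg_ge[of \<rho>] unfolding kmaj_def by (intro divide_nonneg_nonneg) auto
lemma hmaj_nonneg: "0 \<le> hmaj r" unfolding hmaj_def by (intro divide_nonneg_nonneg) auto
lemma kplus_nonneg: "0 \<le> kplus \<rho> r" unfolding kplus_def by (intro divide_nonneg_nonneg) auto

lemma ker_bound:
  assumes "scale \<rho>" shows "\<bar>ker \<rho> r\<bar> \<le> kup * kmaj \<rho> r"
proof -
  have "\<bar>p * ln (\<rho> * r)\<bar> = p * \<bar>ln (\<rho> * r)\<bar>" using p by (simp add: abs_mult)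
  then have "\<bar>B - p * ln (\<rho> * r)\<bar> \<le> B + p * \<bar>ln (\<rho> * r)\<bar>" using B by linarith
  also have "\<dots> \<le> (B + p) * (1 + \<bar>ln (\<rho> * r)\<bar>)" using B p by (simp add: algebra_simps)
  finally have "c * \<bar>B - p * ln (\<rho> * r)\<bar> \<le> kup * (1 + \<bar>ln (\<rho> * r)\<bar>)"
    using c by (simp add: kup_def mult.assoc)
  then have "c * \<bar>B - p * ln (\<rho> * r)\<bar> / lg \<rho> / r powr dsp \<le> kup * (1 + \<bar>ln (\<rho> * r)\<bar>) / lg \<rho> / r powr dsp"
    using lg_ge[OF assms] by (intro divide_right_mono) auto
  moreover have "\<bar>ker \<rho> r\<bar> = c * \<bar>B - p * ln (\<rho> * r)\<bar> / lg \<rho> / r powr dsp"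
    using c lg_ge[OF assms] by (simp add: ker_def abs_mult)
  ultimately show ?thesis by (simp add: kmaj_def)
qed

text \<open>Rescaling shifts the logarithm by \<open>ln (1 / \<rho>)\<close>, and \<open>lg \<rho> +
  \<bar>ln r\<bar> \<le> lg \<rho> * (1 + \<bar>ln r\<bar>)\<close> because
  \<open>1 \<le> lg \<rho>\<close>. The division by \<open>lg \<rho>\<close> thus removes the scale
  from the majorant.\<close>

lemma kmaj_le_hmaj:
  assumes "scale \<rho>" "0 \<le> r" shows "kmaj \<rho> r \<le> hmaj r"
proof (cases "r = 0")
  case False
  have "ln (\<rho> * r) = ln r - ln (1 / \<rho>)" using assms False by (simp add: scale_def ln_mult ln_div)
  then have "1 + \<bar>ln (\<rho> * r)\<bar> \<le> lg \<rho> + \<bar>ln r\<bar>" using lg_ge[OF assms(1)] by (simp add: lg_def)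
  also have "\<dots> \<le> lg \<rho> + lg \<rho> * \<bar>ln r\<bar>"
    using lg_ge[OF assms(1)] mult_right_mono[of 1 "lg \<rho>" "\<bar>ln r\<bar>"] by simp
  finally have "(1 + \<bar>ln (\<rho> * r)\<bar>) / lg \<rho> \<le> 1 + \<bar>ln r\<bar>"
    using lg_ge[OF assms(1)] by (simp add: field_simps)
  then show ?thesis unfolding kmaj_def hmaj_def by (intro divide_right_mono) auto
qed (simp add: kmaj_def hmaj_def)

lemma ker_nonneg:
  assumes "scale \<rho>" "0 \<le> r" "\<rho> * r \<le> 1" shows "0 \<le> ker \<rho> r"
proof (cases "r = 0")
  case False
  then have "ln (\<rho> * r) \<le> 0" using assms by (simp add: scale_def)
  then have "0 \<le> B - p * ln (\<rho> * r)" using B p mult_nonneg_nonpos[of p "ln (\<rho> * r)"] by linarith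
  then show ?thesis using c lg_ge[OF assms(1)] unfolding ker_def
    by (intro divide_nonneg_nonneg mult_nonneg_nonneg) auto
qed (simp add: ker_def)

lemma ker_lower:
  assumes "scale \<rho>" "0 < r" "r \<le> 3" shows "klow / r powr dsp \<le> ker \<rho> r"
proof -
  define x where "x = ln (1 / \<rho>)"
  have x: "ln 4 \<le> x" using lg_ge[OF assms(1)] by (simp add: lg_def x_def)
  have "ln r \<le> ln 3" using assms by simp
  have eq: "ln (\<rho> * r) = ln r - x" using assms by (simp add: x_def scale_def ln_mult ln_div)
  have l43: "ln (4 / 3) = ln 4 - ln (3::real)" by (simp add: ln_div)
  have "(ln 4 - ln 3) * (1 + x) \<le> (x - ln 3) * (1 + ln 4)"
  proof -
    have "0 \<le> (x - ln 4) * (1 + ln 3)" using x by (intro mult_nonneg_nonneg) auto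
    then show ?thesis by (simp add: algebra_simps)
  qed
  moreover have "0 < 1 + ln (4::real)" "0 < 1 + x" using x ln_gt_zero[of "4::real"] by linarith+
  ultimately have "(ln 4 - ln 3) / (1 + ln 4) \<le> (x - ln 3) / (1 + x)" by (simp add: divide_simps)
  also have "\<dots> \<le> (x - ln r) / (1 + x)" using \<open>ln r \<le> ln 3\<close> \<open>0 < 1 + x\<close> by (intro divide_right_mono) auto
  finally have "c * p * ((ln 4 - ln 3) / (1 + ln 4)) \<le> c * p * ((x - ln r) / (1 + x))"
    using c p by (intro mult_left_mono) auto
  also have "\<dots> = c * (p * (x - ln r)) / (1 + x)" by simp
  also have "\<dots> \<le> c * (B + p * (x - ln r)) / (1 + x)"
    using c B \<open>0 < 1 + x\<close> by (intro divide_right_mono mult_left_mono) auto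
  finally have "klow \<le> c * (B - p * ln (\<rho> * r)) / lg \<rho>"
    unfolding eq klow_def l43 by (simp add: lg_def x_def[symmetric] algebra_simps)
  then show ?thesis unfolding ker_def by (intro divide_right_mono) auto
qed

text \<open>Comparable distances have comparable majorants: \<open>m powr dsp\<close> comes from the
  power and one more factor \<open>m\<close> from the logarithm, through
  \<open>ln m \<le> m - 1\<close>.\<close>

lemma kmaj_compare:
  assumes \<rho>: "scale \<rho>" and m: "1 \<le> m" and r: "0 < r" "r / m \<le> r'" "r' \<le> m * r"
  shows "kmaj \<rho> r' \<le> m powr (dsp + 1) * kmaj \<rho> r"
proof -
  have r': "0 < r'" using r m by (smt (verit) divide_pos_pos)
  have "\<bar>ln r' - ln r\<bar> \<le> ln m"
  proof -
    have "ln r' \<le> ln (m * r)" using r r' by simp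
    moreover have "ln (r / m) \<le> ln r'" using r r' m by (subst ln_le_cancel_iff) auto
    ultimately show ?thesis using r m by (simp add: ln_mult ln_div abs_le_iff)
  qed
  moreover have "ln m \<le> m - 1" using m by (intro ln_le_minus_one) auto
  moreover have "ln (\<rho> * r') - ln (\<rho> * r) = ln r' - ln r" using \<rho> r r' by (simp add: scale_def ln_mult)
  ultimately have "1 + \<bar>ln (\<rho> * r')\<bar> \<le> m + \<bar>ln (\<rho> * r)\<bar>" by linarith
  also have "\<dots> \<le> m * (1 + \<bar>ln (\<rho> * r)\<bar>)"
    using m mult_right_mono[of 1 m "\<bar>ln (\<rho> * r)\<bar>"] by (simp add: algebra_simps)
  finally have 1: "(1 + \<bar>ln (\<rho> * r')\<bar>) / lg \<rho> \<le> m * (1 + \<bar>ln (\<rho> * r)\<bar>) / lg \<rho>"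
    using lg_ge[OF \<rho>] by (intro divide_right_mono) auto
  have "(r / m) powr dsp \<le> r' powr dsp" using r r' m dsp_pos by (intro powr_mono2) auto
  then have 2: "r powr dsp / m powr dsp \<le> r' powr dsp" using r m by (simp add: powr_divide)
  have 3: "0 \<le> m * (1 + \<bar>ln (\<rho> * r)\<bar>) / lg \<rho>" "0 < r powr dsp / m powr dsp"
    using r m lg_ge[OF \<rho>] by auto
  have "kmaj \<rho> r' \<le> (m * (1 + \<bar>ln (\<rho> * r)\<bar>) / lg \<rho>) / (r powr dsp / m powr dsp)"
    unfolding kmaj_def by (rule frac_le[OF 3(1) 1 3(2) 2])
  also have "\<dots> = (m * m powr dsp) * kmaj \<rho> r" using m r by (simp add: kmaj_def field_simps)
  also have "m * m powr dsp = m powr (dsp + 1)" using m by (simp add: powr_add)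
  finally show ?thesis .
qed

lemma kplus_le: "scale \<rho> \<Longrightarrow> kplus \<rho> r \<le> lg \<rho> * kmaj \<rho> r"
  using lg_ge[of \<rho>] by (auto simp: kplus_def kmaj_def intro!: divide_right_mono)

lemma kplus_le_ker:
  assumes "scale \<rho>" "0 \<le> r" "\<rho> * r \<le> 1" shows "kplus \<rho> r \<le> lg \<rho> / (c * p) * ker \<rho> r"
proof (cases "r = 0")
  case False
  then have "ln (\<rho> * r) \<le> 0" using assms by (simp add: scale_def)
  then have "max (- ln (\<rho> * r)) 0 \<le> (B - p * ln (\<rho> * r)) / p"
    using B p by (simp add: field_simps)
  also have "\<dots> = lg \<rho> / (c * p) * (c * (B - p * ln (\<rho> * r)) / lg \<rho>)"
    using c p lg_ge[OF assms(1)] by simp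
  finally have "kplus \<rho> r \<le> lg \<rho> / (c * p) * (c * (B - p * ln (\<rho> * r)) / lg \<rho>) / r powr dsp"
    unfolding kplus_def by (intro divide_right_mono) auto
  then show ?thesis by (simp add: ker_def)
qed (simp add: kplus_def ker_def)

text \<open>The factor \<open>norm z powr p\<close> will come from the Lipschitz bound of the
  cutoff. Since \<open>s < 1\<close>, it leaves the positive exponent \<open>p - s * p\<close>, half
  of which is given up for the logarithm.\<close>

lemma hmaj_inside_finite: "(\<integral>\<^sup>+z::'a\<in>ball 0 R. ennreal (hmaj (norm z) * norm z powr p) \<partial>lborel) < \<infinity>"
proof -
  define e where "e = (p - s * p) / 2"
  have sp1: "s * p < p" using s p by simp
  then have e: "0 < e" by (simp add: e_def)
  let ?b = "p - s * p"
  have le: "ennreal (hmaj (norm z) * norm z powr p) \<le> ennreal (1 + 1 / e)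
      * (ennreal (norm z powr (?b + e - DIM('a))) + ennreal (norm z powr (?b - e - DIM('a))))" for z :: 'a
  proof (cases "z = 0")
    case False
    have "hmaj (norm z) * norm z powr p \<le> (1 + 1 / e) * (norm z powr e + norm z powr - e) / norm z powr dsp * norm z powr p"
      unfolding hmaj_def using one_plus_abs_ln_le[OF e, of "norm z"] False
      by (intro mult_right_mono divide_right_mono) auto
    also have "\<dots> = (1 + 1 / e) * (norm z powr (?b + e - DIM('a)) + norm z powr (?b - e - DIM('a)))"
      using False by (simp add: dsp_def powr_add powr_diff powr_minus field_simps)
    finally show ?thesis using e by (simp add: ennreal_mult[symmetric] ennreal_plus[symmetric] ennreal_leI del: ennreal_plus)
  qed (simp add: hmaj_def)
  have "(\<integral>\<^sup>+z::'a\<in>ball 0 R. ennreal (hmaj (norm z) * norm z powr p) \<partial>lborel)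
    \<le> (\<integral>\<^sup>+z. ennreal (1 + 1 / e) * (ennreal (norm z powr (?b + e - DIM('a))) * indicator (ball (0::'a) R) z
        + ennreal (norm z powr (?b - e - DIM('a))) * indicator (ball 0 R) z) \<partial>lborel)"
    using le by (intro nn_integral_mono) (auto simp: indicator_def)
  also have "\<dots> = ennreal (1 + 1 / e) * ((\<integral>\<^sup>+z::'a\<in>ball 0 R. ennreal (norm z powr (?b + e - DIM('a))) \<partial>lborel)
     + (\<integral>\<^sup>+z::'a\<in>ball 0 R. ennreal (norm z powr (?b - e - DIM('a))) \<partial>lborel))"
    by (subst nn_integral_cmult, measurable, subst nn_integral_add) auto
  also have "\<dots> < \<infinity>"
    using nn_integral_radial_inside[of "?b + e" R] nn_integral_radial_inside[of "?b - e" R] e sp1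
    by (auto simp: e_def ennreal_mult_less_top field_simps)
  finally show ?thesis .
qed

text \<open>The weight \<open>norm z powr (s * p / 2)\<close> leaves room for functions growing like
  a small power, as they arise in the oscillation iteration. Of the remaining decay
  \<open>s * p / 2\<close> another half pays for the logarithm.\<close>

lemma hmaj_outside_finite: "(\<integral>\<^sup>+z::'a\<in>- ball 0 1. ennreal (hmaj (norm z) * norm z powr (s * p / 2)) \<partial>lborel) < \<infinity>"
proof -
  define e where "e = s * p / 4"
  have e: "0 < e" using sp_pos by (simp add: e_def)
  have le: "ennreal (hmaj (norm z) * norm z powr (s * p / 2)) \<le> ennreal (2 * (1 + 1 / e))
      * ennreal (norm z powr (- real DIM('a) - e))" if "1 \<le> norm z" for z :: 'a
  proof -
    have "norm z powr - e \<le> norm z powr e" using that e by (intro powr_mono) auto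
    then have "(1 + 1 / e) * (norm z powr e + norm z powr - e) \<le> (1 + 1 / e) * (2 * norm z powr e)"
      using e by (intro mult_left_mono) auto
    with one_plus_abs_ln_le[OF e, of "norm z"] that
    have "1 + \<bar>ln (norm z)\<bar> \<le> (1 + 1 / e) * (2 * norm z powr e)" by linarith
    then have "hmaj (norm z) * norm z powr (s * p / 2) \<le> (1 + 1 / e) * (2 * norm z powr e) / norm z powr dsp * norm z powr (s * p / 2)"
      unfolding hmaj_def by (intro mult_right_mono divide_right_mono) auto
    also have "\<dots> = 2 * (1 + 1 / e) * (norm z powr (e - dsp + s * p / 2))"
      using that by (simp add: powr_add powr_diff)
    also have "e - dsp + s * p / 2 = - DIM('a) - e" by (simp add: e_def dsp_def)
    finally show ?thesis using e by (subst ennreal_mult[symmetric]) (auto intro: ennreal_leI)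
  qed
  have "(\<integral>\<^sup>+z::'a\<in>- ball 0 1. ennreal (hmaj (norm z) * norm z powr (s * p / 2)) \<partial>lborel)
    \<le> (\<integral>\<^sup>+z. ennreal (2 * (1 + 1 / e)) * (ennreal (norm z powr (- real DIM('a) - e)) * indicator (- ball (0::'a) 1) z) \<partial>lborel)"
    using le by (intro nn_integral_mono) (auto simp: indicator_def)
  also have "\<dots> = ennreal (2 * (1 + 1 / e)) * (\<integral>\<^sup>+z::'a\<in>- ball 0 1. ennreal (norm z powr (- real DIM('a) - e)) \<partial>lborel)"
    by (rule nn_integral_cmult) measurable
  also have "\<dots> < \<infinity>"
    using nn_integral_radial_outside[of e 1] e by (auto simp: ennreal_mult_less_top)
  finally show ?thesis .
qed

text \<open>Radius 3 contains all differences of two points of \<open>ball 0 (3/2)\<close>. Both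
  integrals are finite, so \<open>enn2real\<close> loses nothing.\<close>

definition "c_in = enn2real (\<integral>\<^sup>+z::'a\<in>ball 0 3. ennreal (hmaj (norm z) * norm z powr p) \<partial>lborel)"
definition "c_out = enn2real (\<integral>\<^sup>+z::'a\<in>- ball 0 1. ennreal (hmaj (norm z) * norm z powr (s * p / 2)) \<partial>lborel)"

lemma c_nonneg: "0 \<le> c_in" "0 \<le> c_out" by (simp_all add: c_in_def c_out_def)

lemma c_in: "(\<integral>\<^sup>+z::'a\<in>ball 0 3. ennreal (hmaj (norm z) * norm z powr p) \<partial>lborel) = ennreal c_in"
  unfolding c_in_def using hmaj_inside_finite[of 3] by simp

lemma c_out: "(\<integral>\<^sup>+z::'a\<in>- ball 0 1. ennreal (hmaj (norm z) * norm z powr (s * p / 2)) \<partial>lborel) = ennreal c_out"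
  unfolding c_out_def using hmaj_outside_finite by simp

lemma kmaj_outside:
  assumes "scale \<rho>"
  shows "(\<integral>\<^sup>+z::'a\<in>- ball 0 1. ennreal (kmaj \<rho> (norm z)) \<partial>lborel) \<le> ennreal c_out"
  unfolding c_out[symmetric]
proof (intro nn_integral_mono)
  fix z :: 'a
  show "ennreal (kmaj \<rho> (norm z)) * indicator (- ball 0 1) z
     \<le> ennreal (hmaj (norm z) * norm z powr (s * p / 2)) * indicator (- ball 0 1) z"
  proof (cases "1 \<le> norm z")
    case True
    have "kmaj \<rho> (norm z) * 1 \<le> hmaj (norm z) * norm z powr (s * p / 2)"
      using True assms sp_pos hmaj_nonneg by (intro mult_mono kmaj_le_hmaj ge_one_powr_ge_zero) auto
    then show ?thesis by (auto simp: indicator_def intro: ennreal_leI)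
  qed auto
qed

text \<open>The equation on \<open>ball 0 (3/2)\<close>, for Borel functions and with products of
  Borel measures. The energy is written with \<open>ker\<close>, which is nonnegative at distances
  below 3. Test functions are selected with \<open>kplus\<close>, as in \<open>W_log\<close>, and
  vanish outside a ball of smaller radius, which stands for a compact subset.\<close>

definition sol :: "real \<Rightarrow> ('a \<Rightarrow> real) \<Rightarrow> ('a \<Rightarrow> real) \<Rightarrow> bool" where
  "sol \<rho> u f \<longleftrightarrow> u \<in> borel_measurable borel \<and> f \<in> borel_measurable borel \<and>
     (\<integral>\<^sup>+x\<in>ball 0 (3/2). ennreal (\<bar>u x\<bar> powr p) \<partial>lborel) < \<infinity> \<and>
     (\<integral>\<^sup>+x. (\<integral>\<^sup>+y. ennreal (indicator (ball 0 (3/2)) x * indicator (ball 0 (3/2)) y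
        * (ker \<rho> (dist x y) * \<bar>u x - u y\<bar> powr p)) \<partial>lborel) \<partial>lborel) < \<infinity> \<and>
     (\<integral>\<^sup>+y\<in>- ball 0 1. ennreal (kmaj \<rho> (norm y) * \<bar>u y\<bar> powr (p - 1)) \<partial>lborel) < \<infinity> \<and>
     (\<forall>v r. r < 3/2 \<and> v \<in> borel_measurable borel \<and> (\<forall>x. 0 \<le> v x) \<and> (\<forall>x. x \<notin> cball 0 r \<longrightarrow> v x = 0) \<and>
        (\<integral>\<^sup>+x. ennreal (v x powr p) \<partial>lborel) < \<infinity> \<and>
        (\<integral>\<^sup>+x. (\<integral>\<^sup>+y. ennreal (kplus \<rho> (dist x y) * \<bar>v x - v y\<bar> powr p) \<partial>lborel) \<partial>lborel) < \<infinity> \<longrightarrow>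
        (\<integral>z. ker \<rho> (dist (fst z) (snd z)) * signed_powr p (u (fst z) - u (snd z)) * (v (fst z) - v (snd z))
           \<partial>(lborel \<Otimes>\<^sub>M lborel)) = (\<integral>x. f x * v x \<partial>lborel))"

text \<open>The last condition makes \<open>\<bar>y\<bar>\<close> and \<open>\<bar>x - y\<bar>\<close> comparable for \<open>\<bar>x\<bar> \<le> r0\<close> and \<open>\<bar>y\<bar> \<ge> r1\<close>.\<close>

definition cutoff :: "('a \<Rightarrow> real) \<Rightarrow> real \<Rightarrow> real \<Rightarrow> real \<Rightarrow> bool" where
  "cutoff \<eta> m r0 r1 \<longleftrightarrow> \<eta> \<in> borel_measurable borel \<and> (\<forall>x. 0 \<le> \<eta> x \<and> \<eta> x \<le> 1)
     \<and> (\<forall>x y. \<bar>\<eta> x - \<eta> y\<bar> \<le> m * dist x y) \<and> (\<forall>x. x \<notin> cball 0 r0 \<longrightarrow> \<eta> x = 0)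
     \<and> 0 < r0 \<and> r0 < r1 \<and> 1 \<le> r1 \<and> r1 \<le> 3/2 \<and> 2 \<le> m \<and> r1 \<le> m * (r1 - r0)"

text \<open>One cutoff serves twice: with \<open>r1\<close> in the Caccioppoli estimate, and with
  \<open>3/2\<close> for the finiteness of the integrals, which \<open>sol\<close> provides on
  \<open>ball 0 (3/2)\<close>.\<close>

lemma cutoff_extend:
  assumes "cutoff \<eta> m r0 r1" shows "cutoff \<eta> m r0 (3/2)"
proof -
  have c: "r0 < r1" "r1 \<le> 3/2" "2 \<le> m" "r1 \<le> m * (r1 - r0)" using assms by (auto simp: cutoff_def)
  have "0 \<le> (m - 1) * (3/2 - r1)" using c by (intro mult_nonneg_nonneg) auto
  moreover have "m * (3/2 - r0) - 3/2 = (m - 1) * (3/2 - r1) + (m * (r1 - r0) - r1)"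
    by (simp add: algebra_simps)
  ultimately have "3/2 \<le> m * (3/2 - r0)" using c(4) by linarith
  then show ?thesis using assms by (auto simp: cutoff_def)
qed

lemma cutoff_far:
  assumes \<rho>: "scale \<rho>" and c: "cutoff \<eta> m r0 r1" and x: "norm x \<le> r0" and y: "r1 \<le> norm y"
  shows "kmaj \<rho> (dist x y) \<le> m powr (dsp + 1) * kmaj \<rho> (norm y)" "1 \<le> norm y"
proof -
  have c': "0 < r0" "r0 < r1" "1 \<le> r1" "2 \<le> m" "r1 \<le> m * (r1 - r0)" using c by (auto simp: cutoff_def)
  show "1 \<le> norm y" using c' y by simp
  have d: "norm y - norm x \<le> dist x y" "dist x y \<le> norm x + norm y"
    using norm_triangle_ineq2[of y x] norm_triangle_ineq4[of x y] by (auto simp: dist_norm norm_minus_commute)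
  have "norm y \<le> m * dist x y"
  proof -
    have "0 \<le> (m - 1) * (norm y - r1)" using c' y by (intro mult_nonneg_nonneg) auto
    then have "norm y \<le> m * (norm y - r0)" using c'(5) by (simp add: algebra_simps)
    also have "\<dots> \<le> m * dist x y" using d x c' by (intro mult_left_mono) auto
    finally show ?thesis .
  qed
  moreover have "dist x y \<le> m * norm y"
  proof -
    have "dist x y \<le> 2 * norm y" using d x y c' by linarith
    also have "\<dots> \<le> m * norm y" using c' by (intro mult_right_mono) auto
    finally show ?thesis .
  qed
  ultimately show "kmaj \<rho> (dist x y) \<le> m powr (dsp + 1) * kmaj \<rho> (norm y)"
    using c' y \<rho> by (intro kmaj_compare) (auto simp: field_simps)
qed

text \<open>Majorant of everything in the Caccioppoli inequality that is not the energy, arranged so that the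
  integral over \<open>y\<close> factors out.\<close>

definition err :: "real \<Rightarrow> real \<Rightarrow> ('a \<Rightarrow> real) \<Rightarrow> ('a \<Rightarrow> real) \<Rightarrow> 'a \<Rightarrow> 'a \<Rightarrow> real" where
  "err \<rho> r w t x y = indicator (ball 0 r) x *
     (w x powr p * (indicator (ball x 3) y * (hmaj (dist x y) * dist x y powr p)
                    + indicator (- ball 0 1) y * kmaj \<rho> (norm y))
      + w x * (indicator (- ball 0 1) y * (kmaj \<rho> (norm y) * t y powr (p - 1))))"

lemma err_nonneg: "scale \<rho> \<Longrightarrow> 0 \<le> w x \<Longrightarrow> 0 \<le> err \<rho> r w t x y"
  using hmaj_nonneg kmaj_nonneg unfolding err_def by (auto intro!: mult_nonneg_nonneg add_nonneg_nonneg)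

lemma indicator_ball_pair [measurable]:
  assumes [measurable]: "g \<in> borel_measurable M" "h \<in> borel_measurable M"
  shows "(\<lambda>z. indicator (ball (g z) r) (h z :: 'a) :: real) \<in> borel_measurable M"
    "(\<lambda>z. indicator (ball (g z) r) (h z :: 'a) :: ennreal) \<in> borel_measurable M"
proof -
  have "(\<lambda>z. indicator (ball (g z) r) (h z) :: real) = (\<lambda>z. if dist (g z) (h z) < r then 1 else 0)"
    "(\<lambda>z. indicator (ball (g z) r) (h z) :: ennreal) = (\<lambda>z. if dist (g z) (h z) < r then 1 else 0)"
    by (auto simp: indicator_def)
  then show "(\<lambda>z. indicator (ball (g z) r) (h z) :: real) \<in> borel_measurable M"
    "(\<lambda>z. indicator (ball (g z) r) (h z) :: ennreal) \<in> borel_measurable M" by simp_all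
qed

lemma err_measurable [measurable]:
  assumes [measurable]: "w \<in> borel_measurable borel" "t \<in> borel_measurable borel"
  shows "(\<lambda>z. err \<rho> r w t (fst z) (snd z)) \<in> borel_measurable (borel \<Otimes>\<^sub>M borel)"
    "(\<lambda>z. err \<rho> r w t (snd z) (fst z)) \<in> borel_measurable (borel \<Otimes>\<^sub>M borel)"
proof -
  show 1: "(\<lambda>z. err \<rho> r w t (fst z) (snd z)) \<in> borel_measurable (borel \<Otimes>\<^sub>M borel)"
    unfolding err_def by measurable
  have "(\<lambda>z. (\<lambda>z. err \<rho> r w t (fst z) (snd z)) (snd z, fst z)) \<in> borel_measurable (borel \<Otimes>\<^sub>M borel)"
    by (rule measurable_compose[OF _ 1]) measurable
  then show "(\<lambda>z. err \<rho> r w t (snd z) (fst z)) \<in> borel_measurable (borel \<Otimes>\<^sub>M borel)" by simp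
qed

lemma nn_integral_pair:
  fixes F :: "'a \<Rightarrow> 'a \<Rightarrow> real"
  assumes [measurable]: "(\<lambda>z. F (fst z) (snd z)) \<in> borel_measurable (borel \<Otimes>\<^sub>M borel)"
  shows "(\<integral>\<^sup>+z. ennreal (F (fst z) (snd z)) \<partial>(lborel \<Otimes>\<^sub>M lborel)) = (\<integral>\<^sup>+x. (\<integral>\<^sup>+y. ennreal (F x y) \<partial>lborel) \<partial>lborel)"
  by (subst lborel.nn_integral_fst[symmetric]) (auto simp: measurable_lborel1)

lemma nn_integral_pair_swap:
  fixes F :: "'a \<Rightarrow> 'a \<Rightarrow> real"
  assumes [measurable]: "(\<lambda>z. F (fst z) (snd z)) \<in> borel_measurable (borel \<Otimes>\<^sub>M borel)"
  shows "(\<integral>\<^sup>+z. ennreal (F (snd z) (fst z)) \<partial>(lborel \<Otimes>\<^sub>M lborel)) = (\<integral>\<^sup>+x. (\<integral>\<^sup>+y. ennreal (F x y) \<partial>lborel) \<partial>lborel)"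
proof -
  have m: "(\<lambda>z. ennreal (F (snd z) (fst z))) \<in> borel_measurable (lborel \<Otimes>\<^sub>M lborel)"
    using measurable_compose[OF measurable_Pair[OF measurable_snd measurable_fst] assms] by simp
  have "(\<integral>\<^sup>+z. ennreal (F (snd z) (fst z)) \<partial>(lborel \<Otimes>\<^sub>M lborel))
     = (\<integral>\<^sup>+y. (\<integral>\<^sup>+x. ennreal (F (snd (x, y)) (fst (x, y))) \<partial>lborel) \<partial>lborel)"
    using m by (subst lborel_pair.nn_integral_snd[symmetric]) auto
  then show ?thesis by simp
qed

lemma err_integral:
  assumes \<rho>: "scale \<rho>" and [measurable]: "w \<in> borel_measurable borel" "t \<in> borel_measurable borel"
    and w: "\<And>x. 0 \<le> w x"
  shows "(\<integral>\<^sup>+x. (\<integral>\<^sup>+y. ennreal (err \<rho> r w t x y) \<partial>lborel) \<partial>lborel)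
    \<le> ennreal (c_in + c_out) * (\<integral>\<^sup>+x\<in>ball 0 r. ennreal (w x powr p) \<partial>lborel)
      + (\<integral>\<^sup>+y\<in>- ball 0 1. ennreal (kmaj \<rho> (norm y) * t y powr (p - 1)) \<partial>lborel)
        * (\<integral>\<^sup>+x\<in>ball 0 r. ennreal (w x) \<partial>lborel)"
proof -
  define T where "T = (\<integral>\<^sup>+y\<in>- ball (0::'a) 1. ennreal (kmaj \<rho> (norm y) * t y powr (p - 1)) \<partial>lborel)"
  have inner: "(\<integral>\<^sup>+y. ennreal (err \<rho> r w t x y) \<partial>lborel)
     \<le> ennreal (c_in + c_out) * (ennreal (w x powr p) * indicator (ball 0 r) x)
        + T * (ennreal (w x) * indicator (ball 0 r) x)" for x
  proof (cases "x \<in> ball 0 r")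
    case False
    then show ?thesis by (simp add: err_def)
  next
    case True
    have eq: "ennreal (err \<rho> r w t x y) =
        ennreal (w x powr p) * (ennreal (hmaj (dist x y) * dist x y powr p) * indicator (ball x 3) y
           + ennreal (kmaj \<rho> (norm y)) * indicator (- ball 0 1) y)
        + ennreal (w x) * (ennreal (kmaj \<rho> (norm y) * t y powr (p - 1)) * indicator (- ball 0 1) y)" for y
      using True w[of x] hmaj_nonneg[of "dist x y"] kmaj_nonneg[OF \<rho>, of "norm y"]
      unfolding err_def
      by (cases "y \<in> ball x 3"; cases "y \<in> ball 0 1")
        (simp_all add: indicator_def ennreal_mult[symmetric] ennreal_plus[symmetric] del: ennreal_plus)
    have "(\<integral>\<^sup>+y. ennreal (err \<rho> r w t x y) \<partial>lborel)
       = ennreal (w x powr p) * ((\<integral>\<^sup>+y\<in>ball x 3. ennreal (hmaj (dist x y) * dist x y powr p) \<partial>lborel)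
           + (\<integral>\<^sup>+y\<in>- ball (0::'a) 1. ennreal (kmaj \<rho> (norm y)) \<partial>lborel)) + ennreal (w x) * T"
      unfolding eq T_def
      by (subst nn_integral_add, measurable, subst nn_integral_cmult, measurable, subst nn_integral_add, measurable,
          subst nn_integral_cmult) measurable
    also have "(\<integral>\<^sup>+y\<in>ball x 3. ennreal (hmaj (dist x y) * dist x y powr p) \<partial>lborel) = ennreal c_in"
      using nn_integral_dist[of "\<lambda>r. hmaj r * r powr p" x 3] c_in by simp
    also have "ennreal (w x powr p) * (ennreal c_in + (\<integral>\<^sup>+y\<in>- ball (0::'a) 1. ennreal (kmaj \<rho> (norm y)) \<partial>lborel)) + ennreal (w x) * T
       \<le> ennreal (w x powr p) * (ennreal c_in + ennreal c_out) + ennreal (w x) * T"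
      by (intro add_mono mult_left_mono kmaj_outside \<rho>) auto
    finally show ?thesis using True c_nonneg by (simp add: ennreal_plus mult.commute)
  qed
  have "(\<integral>\<^sup>+x. (\<integral>\<^sup>+y. ennreal (err \<rho> r w t x y) \<partial>lborel) \<partial>lborel)
    \<le> (\<integral>\<^sup>+x. ennreal (c_in + c_out) * (ennreal (w x powr p) * indicator (ball 0 r) x)
        + T * (ennreal (w x) * indicator (ball 0 r) x) \<partial>lborel)"
    by (intro nn_integral_mono inner)
  also have "\<dots> = ennreal (c_in + c_out) * (\<integral>\<^sup>+x\<in>ball 0 r. ennreal (w x powr p) \<partial>lborel)
      + T * (\<integral>\<^sup>+x\<in>ball 0 r. ennreal (w x) \<partial>lborel)"
    by (subst nn_integral_add, measurable, subst nn_integral_cmult, measurable, subst nn_integral_cmult) measurable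
  finally show ?thesis by (simp add: T_def)
qed

section \<open>Admissibility of the test function \<open>\<eta> powr p\<close> times the positive
  part of \<open>u\<close>\<close>

definition core :: "real \<Rightarrow> ('a \<Rightarrow> real) \<Rightarrow> 'a \<Rightarrow> 'a \<Rightarrow> real" where
  "core \<rho> u x y = indicator (ball 0 (3/2)) x * indicator (ball 0 (3/2)) y * (ker \<rho> (dist x y) * \<bar>u x - u y\<bar> powr p)"

lemma dist_lt_3: "x \<in> ball 0 (3/2) \<Longrightarrow> y \<in> ball 0 (3/2) \<Longrightarrow> dist x (y::'a) < 3"
  using dist_triangle3[of x y 0] by (simp add: dist_commute)

lemma ker_nonneg_near: "scale \<rho> \<Longrightarrow> dist x y \<le> 4 \<Longrightarrow> 0 \<le> ker \<rho> (dist x y)"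
  using mult_mono[of \<rho> "1/4" "dist x y" 4] by (intro ker_nonneg) (auto simp: scale_def)

lemma core_nonneg: "scale \<rho> \<Longrightarrow> 0 \<le> core \<rho> u x y"
  using dist_lt_3[of x y] ker_nonneg_near[of \<rho> x y]
  by (auto simp: core_def indicator_def)

lemma core_sym: "core \<rho> u x y = core \<rho> u y x"
  by (simp add: core_def dist_commute abs_minus_commute mult_ac)

lemma core_measurable [measurable]:
  assumes [measurable]: "u \<in> borel_measurable borel"
  shows "(\<lambda>z. core \<rho> u (fst z) (snd z)) \<in> borel_measurable (borel \<Otimes>\<^sub>M borel)"
  unfolding core_def by measurable

lemma err_near:
  assumes "x \<in> ball 0 r" "y \<in> ball x 3" "scale \<rho>" "0 \<le> w x"
  shows "w x powr p * (hmaj (dist x y) * dist x y powr p) \<le> err \<rho> r w t x y"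
  using assms hmaj_nonneg[of "dist x y"] kmaj_nonneg[of \<rho> "norm y"]
  by (auto simp: err_def indicator_def intro!: mult_nonneg_nonneg mult_left_mono add_increasing2)

lemma err_far:
  assumes "x \<in> ball 0 r" "1 \<le> norm y" "scale \<rho>" "0 \<le> w x"
  shows "kmaj \<rho> (norm y) * (w x powr p + w x * t y powr (p - 1)) \<le> err \<rho> r w t x y"
proof -
  have "0 \<le> w x powr p * (indicator (ball x 3) y * (hmaj (dist x y) * dist x y powr p))"
    using hmaj_nonneg by (auto intro!: mult_nonneg_nonneg)
  then show ?thesis using assms by (simp add: err_def algebra_simps)
qed

text \<open>Splitting off the increment of \<open>max a 0\<close> leaves the increment of the cutoff
  multiplied by the value at one point only. This matches the majorant \<open>err\<close>, which
  carries \<open>w x\<close> alone.\<close>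

lemma truncated_diff_bound:
  fixes a b e h :: real
  assumes "0 \<le> e" "e \<le> 1" "0 \<le> h" "h \<le> 1"
  shows "\<bar>e powr p * max a 0 - h powr p * max b 0\<bar> \<le> \<bar>a - b\<bar> + max a 0 * (p * \<bar>e - h\<bar>)"
proof -
  have lip: "\<bar>e powr p - h powr p\<bar> \<le> p * \<bar>e - h\<bar>"
  proof -
    have le: "x powr p - y powr p \<le> p * \<bar>x - y\<bar>" if "0 \<le> x" "x \<le> 1" "0 \<le> y" for x y :: real
    proof -
      have "x powr p - y powr p \<le> p * x powr (p - 1) * (x - y)" using that p by (intro powr_diff_le) auto
      also have "\<dots> \<le> p * x powr (p - 1) * \<bar>x - y\<bar>" using p by (intro mult_left_mono) auto
      also have "\<dots> \<le> p * 1 * \<bar>x - y\<bar>"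
        using that p powr_mono2[of "p - 1" x 1] by (intro mult_right_mono mult_left_mono) auto
      finally show ?thesis by simp
    qed
    show ?thesis using le[of e h] le[of h e] assms by (simp add: abs_le_iff abs_minus_commute)
  qed
  have "\<bar>e powr p * max a 0 - h powr p * max b 0\<bar>
     = \<bar>h powr p * (max a 0 - max b 0) + max a 0 * (e powr p - h powr p)\<bar>"
    by (simp add: algebra_simps)
  also have "\<dots> \<le> h powr p * \<bar>max a 0 - max b 0\<bar> + max a 0 * \<bar>e powr p - h powr p\<bar>"
    by (rule order_trans[OF abs_triangle_ineq]) (simp add: abs_mult)
  also have "\<dots> \<le> 1 * \<bar>a - b\<bar> + max a 0 * (p * \<bar>e - h\<bar>)"
    using assms lip p powr_mono2[of p h 1] by (intro add_mono mult_mono) auto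
  finally show ?thesis by simp
qed

definition "k_near m = 2 powr p * (1 + (p * m) powr p * kup)"

lemma test_near:
  assumes \<rho>: "scale \<rho>" and c: "cutoff \<eta> m r0 (3/2)"
    and w: "w = (\<lambda>x. max (u x) 0)" and V: "V = (\<lambda>x. \<eta> x powr p * w x)"
    and x: "x \<in> ball 0 (3/2)" and y: "y \<in> ball 0 (3/2)"
  shows "ker \<rho> (dist x y) * \<bar>V x - V y\<bar> powr p \<le> k_near m * (core \<rho> u x y + err \<rho> (3/2) w t x y)"
proof -
  have c': "0 \<le> \<eta> x" "\<eta> x \<le> 1" "0 \<le> \<eta> y" "\<eta> y \<le> 1" "\<bar>\<eta> x - \<eta> y\<bar> \<le> m * dist x y" "2 \<le> m"
    using c by (auto simp: cutoff_def)
  have d3: "dist x y < 3" using dist_lt_3 x y by auto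
  have k0: "0 \<le> ker \<rho> (dist x y)" using \<rho> d3 by (intro ker_nonneg_near) auto
  have w0: "0 \<le> w x" by (simp add: w)
  have "\<bar>V x - V y\<bar> \<le> \<bar>u x - u y\<bar> + w x * (p * \<bar>\<eta> x - \<eta> y\<bar>)"
    using truncated_diff_bound[OF c'(1-4), of "u x" "u y"] by (simp add: V w)
  also have "\<dots> \<le> \<bar>u x - u y\<bar> + w x * (p * (m * dist x y))"
    using c' w0 p by (intro add_left_mono mult_left_mono) auto
  finally have "\<bar>V x - V y\<bar> powr p \<le> (\<bar>u x - u y\<bar> + w x * (p * (m * dist x y))) powr p"
    using p by (intro powr_mono2) auto
  also have "\<dots> \<le> 2 powr p * (\<bar>u x - u y\<bar> powr p + (w x * (p * (m * dist x y))) powr p)"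
    using p w0 c' by (intro powr_add_le) auto
  also have "(w x * (p * (m * dist x y))) powr p = (p * m) powr p * (w x powr p * dist x y powr p)"
    using p w0 c' by (simp add: powr_mult mult_ac)
  finally have "ker \<rho> (dist x y) * \<bar>V x - V y\<bar> powr p
     \<le> ker \<rho> (dist x y) * (2 powr p * (\<bar>u x - u y\<bar> powr p + (p * m) powr p * (w x powr p * dist x y powr p)))"
    using k0 by (rule mult_left_mono)
  also have "\<dots> = 2 powr p * (core \<rho> u x y + (p * m) powr p * (ker \<rho> (dist x y) * (w x powr p * dist x y powr p)))"
    using x y by (simp add: core_def algebra_simps)
  also have "\<dots> \<le> 2 powr p * (core \<rho> u x y + (p * m) powr p * (kup * err \<rho> (3/2) w t x y))"
  proof -
    have "ker \<rho> (dist x y) \<le> kup * kmaj \<rho> (dist x y)"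
      using ker_bound[OF \<rho>] by (rule order_trans[OF abs_ge_self])
    also have "\<dots> \<le> kup * hmaj (dist x y)"
      using kmaj_le_hmaj[OF \<rho>] kup_pos by (intro mult_left_mono) auto
    finally have "ker \<rho> (dist x y) \<le> kup * hmaj (dist x y)" .
    then have "ker \<rho> (dist x y) * (w x powr p * dist x y powr p)
       \<le> kup * hmaj (dist x y) * (w x powr p * dist x y powr p)" by (intro mult_right_mono) auto
    also have "\<dots> = kup * (w x powr p * (hmaj (dist x y) * dist x y powr p))" by simp
    also have "\<dots> \<le> kup * err \<rho> (3/2) w t x y"
      using err_near[of x "3/2" y \<rho> w t] x d3 \<rho> w0 kup_pos by (intro mult_left_mono) auto
    finally show ?thesis by (intro mult_left_mono add_left_mono) auto
  qed
  also have "\<dots> \<le> k_near m * (core \<rho> u x y + err \<rho> (3/2) w t x y)"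
  proof -
    have "0 \<le> (p * m) powr p * kup * core \<rho> u x y" "0 \<le> err \<rho> (3/2) w t x y"
      using core_nonneg[OF \<rho>] kup_pos err_nonneg[OF \<rho>, of w x] w0 by auto
    then have "core \<rho> u x y + (p * m) powr p * (kup * err \<rho> (3/2) w t x y)
       \<le> (1 + (p * m) powr p * kup) * (core \<rho> u x y + err \<rho> (3/2) w t x y)"
      by (simp add: algebra_simps)
    then show ?thesis unfolding k_near_def mult.assoc by (rule mult_left_mono) simp
  qed
  finally show ?thesis .
qed

lemma signed_powr_far:
  assumes "0 \<le> a" shows "\<bar>signed_powr p (a - b)\<bar> \<le> 2 powr p * (a powr (p - 1) + \<bar>b\<bar> powr (p - 1))"
proof -
  have "\<bar>signed_powr p (a - b)\<bar> \<le> (a + \<bar>b\<bar>) powr (p - 1)"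
    unfolding abs_signed_powr using assms p by (intro powr_mono2) auto
  also have "\<dots> \<le> 2 powr (p - 1) * (a powr (p - 1) + \<bar>b\<bar> powr (p - 1))"
    using assms p by (intro powr_add_le) auto
  also have "\<dots> \<le> 2 powr p * (a powr (p - 1) + \<bar>b\<bar> powr (p - 1))"
    using powr_mono[of "p - 1" p 2] by (intro mult_right_mono) auto
  finally show ?thesis .
qed

lemma far_pair_bound:
  assumes \<rho>: "scale \<rho>" and c: "cutoff \<eta> m r0 r1"
    and w: "w = (\<lambda>x. max (u x) 0)" and V: "V = (\<lambda>x. \<eta> x powr p * w x)"
    and x: "norm x \<le> r0" and y: "r1 \<le> norm y"
  shows "kmaj \<rho> (dist x y) * ((w x powr (p - 1) + t y powr (p - 1)) * V x)
    \<le> m powr (dsp + 1) * err \<rho> r1 w t x y"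
    "kmaj \<rho> (dist x y) * w x powr p \<le> m powr (dsp + 1) * err \<rho> r1 w t x y"
proof -
  have c': "0 \<le> \<eta> x" "\<eta> x \<le> 1" "r0 < r1" using c by (auto simp: cutoff_def)
  have w0: "0 \<le> w x" by (simp add: w)
  note far = cutoff_far[OF \<rho> c x y]
  have xb: "x \<in> ball 0 r1" using x c' by auto
  have "V x \<le> w x"
    using c' w0 p powr_mono2[of p "\<eta> x" 1] mult_right_mono[of "\<eta> x powr p" 1 "w x"] by (auto simp: V)
  then have "(w x powr (p - 1) + t y powr (p - 1)) * V x \<le> (w x powr (p - 1) + t y powr (p - 1)) * w x"
    by (intro mult_left_mono) auto
  also have "\<dots> = w x powr p + w x * t y powr (p - 1)" using powr_split[OF w0 p] by (simp add: algebra_simps)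
  finally have 1: "(w x powr (p - 1) + t y powr (p - 1)) * V x \<le> w x powr p + w x * t y powr (p - 1)" .
  have nn: "0 \<le> w x powr p + w x * t y powr (p - 1)" using w0 by simp
  have "kmaj \<rho> (dist x y) * ((w x powr (p - 1) + t y powr (p - 1)) * V x)
     \<le> kmaj \<rho> (dist x y) * (w x powr p + w x * t y powr (p - 1))"
    using 1 kmaj_nonneg[OF \<rho>] by (intro mult_left_mono) auto
  also have A: "\<dots> \<le> (m powr (dsp + 1) * kmaj \<rho> (norm y)) * (w x powr p + w x * t y powr (p - 1))"
    using far(1) nn by (intro mult_right_mono) auto
  also have B: "\<dots> \<le> m powr (dsp + 1) * err \<rho> r1 w t x y"
    unfolding mult.assoc using err_far[where w = w and t = t and x = x, OF xb far(2) \<rho> w0] by (intro mult_left_mono) auto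
  finally show "kmaj \<rho> (dist x y) * ((w x powr (p - 1) + t y powr (p - 1)) * V x)
    \<le> m powr (dsp + 1) * err \<rho> r1 w t x y" .
  have "kmaj \<rho> (dist x y) * w x powr p \<le> kmaj \<rho> (dist x y) * (w x powr p + w x * t y powr (p - 1))"
    using w0 kmaj_nonneg[OF \<rho>] by (intro mult_left_mono) auto
  with A B show "kmaj \<rho> (dist x y) * w x powr p \<le> m powr (dsp + 1) * err \<rho> r1 w t x y" by linarith
qed

text \<open>This constant may depend on \<rho>: it serves only to show that integrals are finite and
  never enters an estimate.\<close>

definition "k_test \<rho> m = lg \<rho> / (c * p) * k_near m + lg \<rho> * m powr (dsp + 1)"
definition "k_form m = 1 + k_near m + kup * 2 powr p * m powr (dsp + 1)"

lemma k_near_nonneg: "0 \<le> k_near m" using kup_pos by (simp add: k_near_def)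
lemma k_test_nonneg: "scale \<rho> \<Longrightarrow> 0 \<le> k_test \<rho> m"
  using lg_ge[of \<rho>] c p k_near_nonneg[of m] by (simp add: k_test_def)
lemma k_form_nonneg: "0 \<le> k_form m" using k_near_nonneg kup_pos by (simp add: k_form_def)

text \<open>Membership of \<open>V\<close> in the test space and integrability of the form have the
  same majorant. If \<open>y\<close> also lies in the ball, energy and cutoff error suffice.
  Otherwise \<open>V y = 0\<close>, and the pair is either trivial or has comparable
  \<open>dist x y\<close> and \<open>norm y\<close>, which leads to the tail.\<close>

lemma test_half:
  assumes \<rho>: "scale \<rho>" and c: "cutoff \<eta> m r0 (3/2)"
    and w: "w = (\<lambda>x. max (u x) 0)" and V: "V = (\<lambda>x. \<eta> x powr p * w x)"
    and x: "x \<in> ball 0 (3/2)"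
  shows "kplus \<rho> (dist x y) * \<bar>V x - V y\<bar> powr p \<le> k_test \<rho> m * (core \<rho> u x y + err \<rho> (3/2) w (\<lambda>y. \<bar>u y\<bar>) x y)"
    "\<bar>ker \<rho> (dist x y) * signed_powr p (u x - u y) * (V x - V y)\<bar>
      \<le> k_form m * (core \<rho> u x y + err \<rho> (3/2) w (\<lambda>y. \<bar>u y\<bar>) x y)"
proof -
  let ?t = "\<lambda>y. \<bar>u y\<bar>"
  let ?S = "core \<rho> u x y + err \<rho> (3/2) w ?t x y"
  have c': "0 \<le> \<eta> x" "\<eta> x \<le> 1" "2 \<le> m" "\<And>x. x \<notin> cball 0 r0 \<Longrightarrow> \<eta> x = 0" "r0 < 3/2" using c by (auto simp: cutoff_def)
  have w0: "0 \<le> w x" by (simp add: w)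
  have cn: "0 \<le> core \<rho> u x y" by (rule core_nonneg[OF \<rho>])
  have en: "0 \<le> err \<rho> (3/2) w ?t x y" using err_nonneg[of \<rho> w x, OF \<rho> w0] .
  have lg: "1 \<le> lg \<rho>" using lg_ge[OF \<rho>] by simp
  have Vw: "0 \<le> V x" "V x \<le> w x"
    using c' w0 p powr_mono2[of p "\<eta> x" 1] mult_right_mono[of "\<eta> x powr p" 1 "w x"] by (auto simp: V)
  have "kplus \<rho> (dist x y) * \<bar>V x - V y\<bar> powr p \<le> k_test \<rho> m * ?S \<and>
    \<bar>ker \<rho> (dist x y) * signed_powr p (u x - u y) * (V x - V y)\<bar> \<le> k_form m * ?S"
  proof (cases "y \<in> ball 0 (3/2)")
    case True
    have d3: "dist x y < 3" using dist_lt_3 x True by auto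
    then have "\<rho> * dist x y \<le> 1 / 4 * 3" using \<rho> by (intro mult_mono) (auto simp: scale_def)
    then have r1: "\<rho> * dist x y \<le> 1" by simp
    have k0: "0 \<le> ker \<rho> (dist x y)" using \<rho> d3 by (intro ker_nonneg_near) auto
    note near = test_near[OF \<rho> c w V x True, of ?t]
    have "kplus \<rho> (dist x y) * \<bar>V x - V y\<bar> powr p \<le> lg \<rho> / (c * p) * ker \<rho> (dist x y) * \<bar>V x - V y\<bar> powr p"
      using \<rho> r1 by (intro mult_right_mono kplus_le_ker) auto
    also have "\<dots> \<le> lg \<rho> / (c * p) * (k_near m * ?S)"
      unfolding mult.assoc using near lg log_kernel.c[OF log_kernel_axioms] p by (intro mult_left_mono) auto
    also have "\<dots> \<le> k_test \<rho> m * ?S"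
    proof -
      have "0 \<le> lg \<rho> * m powr (dsp + 1) * ?S" using lg cn en by simp
      then show ?thesis by (simp add: k_test_def algebra_simps)
    qed
    finally have 1: "kplus \<rho> (dist x y) * \<bar>V x - V y\<bar> powr p \<le> k_test \<rho> m * ?S" .
    have "\<bar>ker \<rho> (dist x y) * signed_powr p (u x - u y) * (V x - V y)\<bar>
       = ker \<rho> (dist x y) * (\<bar>u x - u y\<bar> powr (p - 1) * \<bar>V x - V y\<bar>)"
      using k0 by (simp add: abs_mult abs_signed_powr)
    also have "\<dots> \<le> ker \<rho> (dist x y) * (\<bar>u x - u y\<bar> powr p + \<bar>V x - V y\<bar> powr p)"
      using k0 p by (intro mult_left_mono powr_mult_le_sum) auto
    also have "\<dots> = core \<rho> u x y + ker \<rho> (dist x y) * \<bar>V x - V y\<bar> powr p"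
      using x True by (simp add: core_def algebra_simps)
    also have "\<dots> \<le> ?S + k_near m * ?S" using near en by linarith
    also have "\<dots> \<le> k_form m * ?S"
    proof -
      have "0 \<le> kup * 2 powr p * m powr (dsp + 1) * ?S" using kup_pos cn en by simp
      then show ?thesis by (simp add: k_form_def algebra_simps)
    qed
    finally show ?thesis using 1 by blast
  next
    case False
    then have y: "3/2 \<le> norm y" by simp
    then have Vy: "V y = 0" using c' p by (auto simp: V)
    have S0: "0 \<le> ?S" using cn en by simp
    show ?thesis
    proof (cases "V x = 0")
      case True
      then show ?thesis using Vy S0 p mult_nonneg_nonneg[OF k_test_nonneg[OF \<rho>, of m] S0]
          mult_nonneg_nonneg[OF k_form_nonneg[of m] S0] by simp
    next
      case V0: False
      then have x0: "norm x \<le> r0" and ux: "u x = w x" "0 < w x" using c' p by (auto simp: V w max_def split: if_splits)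
      note far = far_pair_bound[OF \<rho> c w V x0 y, of ?t]
      have "kplus \<rho> (dist x y) * \<bar>V x - V y\<bar> powr p \<le> (lg \<rho> * kmaj \<rho> (dist x y)) * w x powr p"
        using Vy Vw p kplus_le[OF \<rho>] kmaj_nonneg[OF \<rho>] lg by (intro mult_mono powr_mono2) auto
      also have "\<dots> \<le> lg \<rho> * (m powr (dsp + 1) * err \<rho> (3/2) w ?t x y)"
        unfolding mult.assoc using far(2) lg by (intro mult_left_mono) auto
      also have "\<dots> \<le> k_test \<rho> m * ?S"
      proof -
        have "0 \<le> lg \<rho> / (c * p) * k_near m * ?S" "0 \<le> lg \<rho> * m powr (dsp + 1) * core \<rho> u x y"
          using lg log_kernel.c[OF log_kernel_axioms] p k_near_nonneg[of m] S0 cn by auto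
        then show ?thesis by (simp add: k_test_def algebra_simps)
      qed
      finally have 1: "kplus \<rho> (dist x y) * \<bar>V x - V y\<bar> powr p \<le> k_test \<rho> m * ?S" .
      have "\<bar>ker \<rho> (dist x y) * signed_powr p (u x - u y) * (V x - V y)\<bar>
         = \<bar>ker \<rho> (dist x y)\<bar> * (\<bar>signed_powr p (w x - u y)\<bar> * V x)"
        using Vy Vw ux by (simp add: abs_mult)
      also have "\<dots> \<le> (kup * kmaj \<rho> (dist x y)) * (2 powr p * (w x powr (p - 1) + \<bar>u y\<bar> powr (p - 1)) * V x)"
        using ker_bound[OF \<rho>] signed_powr_far[OF w0, of "u y"] Vw kup_pos kmaj_nonneg[OF \<rho>]
        by (intro mult_mono) auto
      also have "\<dots> = kup * 2 powr p * (kmaj \<rho> (dist x y) * ((w x powr (p - 1) + \<bar>u y\<bar> powr (p - 1)) * V x))"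
        by (simp add: mult_ac)
      also have "\<dots> \<le> kup * 2 powr p * (m powr (dsp + 1) * err \<rho> (3/2) w ?t x y)"
        using far(1) kup_pos by (intro mult_left_mono) auto
      also have "\<dots> \<le> k_form m * ?S"
      proof -
        have "0 \<le> (1 + k_near m) * ?S" "0 \<le> kup * 2 powr p * m powr (dsp + 1) * core \<rho> u x y"
          using k_near_nonneg[of m] S0 cn kup_pos by auto
        then show ?thesis by (simp add: k_form_def algebra_simps)
      qed
      finally show ?thesis using 1 by blast
    qed
  qed
  then show "kplus \<rho> (dist x y) * \<bar>V x - V y\<bar> powr p \<le> k_test \<rho> m * ?S"
    "\<bar>ker \<rho> (dist x y) * signed_powr p (u x - u y) * (V x - V y)\<bar> \<le> k_form m * ?S" by auto
qed

lemma test_full: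
  assumes \<rho>: "scale \<rho>" and c: "cutoff \<eta> m r0 (3/2)"
    and w: "w = (\<lambda>x. max (u x) 0)" and V: "V = (\<lambda>x. \<eta> x powr p * w x)"
  shows "kplus \<rho> (dist x y) * \<bar>V x - V y\<bar> powr p
      \<le> k_test \<rho> m * (core \<rho> u x y + err \<rho> (3/2) w (\<lambda>y. \<bar>u y\<bar>) x y + err \<rho> (3/2) w (\<lambda>y. \<bar>u y\<bar>) y x)" (is ?A)
    "\<bar>ker \<rho> (dist x y) * signed_powr p (u x - u y) * (V x - V y)\<bar>
      \<le> k_form m * (core \<rho> u x y + err \<rho> (3/2) w (\<lambda>y. \<bar>u y\<bar>) x y + err \<rho> (3/2) w (\<lambda>y. \<bar>u y\<bar>) y x)" (is ?B)
proof -
  let ?t = "\<lambda>y. \<bar>u y\<bar>"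
  have w0: "0 \<le> w x" "0 \<le> w y" by (simp_all add: w)
  have e: "0 \<le> err \<rho> (3/2) w ?t x y" "0 \<le> err \<rho> (3/2) w ?t y x" "0 \<le> core \<rho> u x y"
    using err_nonneg[OF \<rho>] w0 core_nonneg[OF \<rho>] by auto
  have kt: "0 \<le> k_test \<rho> m" "0 \<le> k_form m" using k_test_nonneg[OF \<rho>] k_form_nonneg by auto
  consider "x \<in> ball 0 (3/2)" | "y \<in> ball 0 (3/2)" | "x \<notin> ball 0 (3/2)" "y \<notin> ball 0 (3/2)" by blast
  then show ?A ?B
  proof (atomize (full), cases)
    case 1
    show "?A \<and> ?B" using test_half[OF \<rho> c w V 1, of y]
        mult_nonneg_nonneg[OF kt(1) e(2)] mult_nonneg_nonneg[OF kt(2) e(2)] by (simp add: distrib_left)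
  next
    case 2
    have "signed_powr p (u y - u x) * (V y - V x) = signed_powr p (u x - u y) * (V x - V y)"
      using signed_powr_minus[of p "u x - u y"] by (simp add: algebra_simps)
    then have "\<bar>ker \<rho> (dist y x) * signed_powr p (u y - u x) * (V y - V x)\<bar>
       = \<bar>ker \<rho> (dist x y) * signed_powr p (u x - u y) * (V x - V y)\<bar>"
      by (simp add: dist_commute mult.assoc)
    then show "?A \<and> ?B"
      using test_half[OF \<rho> c w V 2, of x, unfolded core_sym[of \<rho> u y x] dist_commute[of y x] abs_minus_commute[of "V y"]]
        mult_nonneg_nonneg[OF kt(1) e(1)] mult_nonneg_nonneg[OF kt(2) e(1)]
      by (simp add: distrib_left dist_commute)
  next
    case 3
    have "\<eta> x = 0" "\<eta> y = 0" using c 3 by (auto simp: cutoff_def)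
    then show "?A \<and> ?B" using p kt e by (simp add: V)
  qed
qed

lemma solD:
  assumes "sol \<rho> u f"
  shows "u \<in> borel_measurable borel" "f \<in> borel_measurable borel"
    "(\<integral>\<^sup>+x\<in>ball 0 (3/2). ennreal (\<bar>u x\<bar> powr p) \<partial>lborel) < \<infinity>"
    "(\<integral>\<^sup>+x. (\<integral>\<^sup>+y. ennreal (core \<rho> u x y) \<partial>lborel) \<partial>lborel) < \<infinity>"
    "(\<integral>\<^sup>+y\<in>- ball 0 1. ennreal (kmaj \<rho> (norm y) * \<bar>u y\<bar> powr (p - 1)) \<partial>lborel) < \<infinity>"
  using assms by (simp_all add: sol_def core_def)

lemma sol_equation:
  assumes "sol \<rho> u f" "r < 3/2" "v \<in> borel_measurable borel" "\<And>x. 0 \<le> v x"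
    "\<And>x. x \<notin> cball 0 r \<Longrightarrow> v x = 0" "(\<integral>\<^sup>+x. ennreal (v x powr p) \<partial>lborel) < \<infinity>"
    "(\<integral>\<^sup>+x. (\<integral>\<^sup>+y. ennreal (kplus \<rho> (dist x y) * \<bar>v x - v y\<bar> powr p) \<partial>lborel) \<partial>lborel) < \<infinity>"
  shows "(\<integral>z. ker \<rho> (dist (fst z) (snd z)) * signed_powr p (u (fst z) - u (snd z)) * (v (fst z) - v (snd z))
           \<partial>(lborel \<Otimes>\<^sub>M lborel)) = (\<integral>x. f x * v x \<partial>lborel)"
  using assms unfolding sol_def by blast

lemma pos_part_integrals_finite:
  assumes "sol \<rho> u f"
  shows "(\<integral>\<^sup>+x\<in>ball 0 (3/2). ennreal (max (u x) 0 powr p) \<partial>lborel) < \<infinity>"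
    "(\<integral>\<^sup>+x\<in>ball 0 (3/2). ennreal (max (u x) 0) \<partial>lborel) < \<infinity>"
proof -
  note [measurable] = solD(1,2)[OF assms]
  have "(\<integral>\<^sup>+x\<in>ball 0 (3/2). ennreal (max (u x) 0 powr p) \<partial>lborel) \<le> (\<integral>\<^sup>+x\<in>ball 0 (3/2). ennreal (\<bar>u x\<bar> powr p) \<partial>lborel)"
    using p by (intro nn_integral_mono mult_right_mono ennreal_leI powr_mono2) auto
  also have "\<dots> < \<infinity>" by (rule solD[OF assms])
  finally show "(\<integral>\<^sup>+x\<in>ball 0 (3/2). ennreal (max (u x) 0 powr p) \<partial>lborel) < \<infinity>" .
  have le: "max (u x) 0 \<le> 1 + \<bar>u x\<bar> powr p" for x
  proof (cases "u x \<le> 1")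
    case False
    then have "u x powr 1 \<le> u x powr p" using p by (intro powr_mono) auto
    then show ?thesis using False by simp
  next
    case True
    have "max (u x) 0 \<le> 1" using True by simp
    also have "\<dots> \<le> 1 + \<bar>u x\<bar> powr p" by simp
    finally show ?thesis .
  qed
  have "(\<integral>\<^sup>+x\<in>ball 0 (3/2). ennreal (max (u x) 0) \<partial>lborel)
     \<le> (\<integral>\<^sup>+x. indicator (ball 0 (3/2)) x + ennreal (\<bar>u x\<bar> powr p) * indicator (ball 0 (3/2)) x \<partial>lborel)"
  proof (intro nn_integral_mono)
    fix x :: 'a
    have "ennreal (max (u x) 0) \<le> 1 + ennreal (\<bar>u x\<bar> powr p)"
      using ennreal_leI[OF le[of x]] by simp
    then show "ennreal (max (u x) 0) * indicator (ball 0 (3/2)) x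
       \<le> indicator (ball 0 (3/2)) x + ennreal (\<bar>u x\<bar> powr p) * indicator (ball 0 (3/2)) x"
      by (auto simp: indicator_def)
  qed
  also have "\<dots> = emeasure lborel (ball (0::'a) (3/2)) + (\<integral>\<^sup>+x\<in>ball 0 (3/2). ennreal (\<bar>u x\<bar> powr p) \<partial>lborel)"
    by (subst nn_integral_add) auto
  also have "\<dots> < \<infinity>" using solD(3)[OF assms] emeasure_lborel_ball_finite[of 0 "3/2"] by simp
  finally show "(\<integral>\<^sup>+x\<in>ball 0 (3/2). ennreal (max (u x) 0) \<partial>lborel) < \<infinity>" .
qed

lemma dominated_finite:
  assumes \<rho>: "scale \<rho>" and sol: "sol \<rho> u f" and K: "0 \<le> K"
    and [measurable]: "(\<lambda>z. F (fst z) (snd z)) \<in> borel_measurable (borel \<Otimes>\<^sub>M borel)"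
    and w: "w = (\<lambda>x. max (u x) 0)"
    and le: "\<And>x y. F x y \<le> K * (core \<rho> u x y + err \<rho> (3/2) w (\<lambda>y. \<bar>u y\<bar>) x y + err \<rho> (3/2) w (\<lambda>y. \<bar>u y\<bar>) y x)"
  shows "(\<integral>\<^sup>+z. ennreal (F (fst z) (snd z)) \<partial>(lborel \<Otimes>\<^sub>M lborel)) < \<infinity>"
proof -
  note [measurable] = solD(1,2)[OF sol]
  have [measurable]: "w \<in> borel_measurable borel" unfolding w by measurable
  have w0: "0 \<le> w x" for x by (simp add: w)
  let ?e = "err \<rho> (3/2) w (\<lambda>y. \<bar>u y\<bar>)"
  have fin: "(\<integral>\<^sup>+x. (\<integral>\<^sup>+y. ennreal (?e x y) \<partial>lborel) \<partial>lborel) < \<infinity>"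
    by (rule le_less_trans[OF err_integral[OF \<rho>]])
      (use w0 pos_part_integrals_finite[OF sol] solD(5)[OF sol] in \<open>auto simp: w ennreal_mult_less_top\<close>)
  have "(\<integral>\<^sup>+z. ennreal (F (fst z) (snd z)) \<partial>(lborel \<Otimes>\<^sub>M lborel))
    \<le> (\<integral>\<^sup>+z. ennreal K * (ennreal (core \<rho> u (fst z) (snd z)) + ennreal (?e (fst z) (snd z)) + ennreal (?e (snd z) (fst z)))
       \<partial>(lborel \<Otimes>\<^sub>M lborel))"
    using K core_nonneg[OF \<rho>] err_nonneg[OF \<rho>] w0
    by (intro nn_integral_mono order_trans[OF ennreal_leI[OF le]])
      (simp add: ennreal_mult[symmetric] ennreal_plus[symmetric] del: ennreal_plus)
  also have "\<dots> = ennreal K * ((\<integral>\<^sup>+x. (\<integral>\<^sup>+y. ennreal (core \<rho> u x y) \<partial>lborel) \<partial>lborel)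
      + (\<integral>\<^sup>+x. (\<integral>\<^sup>+y. ennreal (?e x y) \<partial>lborel) \<partial>lborel) + (\<integral>\<^sup>+x. (\<integral>\<^sup>+y. ennreal (?e x y) \<partial>lborel) \<partial>lborel))"
    by (subst nn_integral_cmult, measurable, subst nn_integral_add, measurable, subst nn_integral_add, measurable,
        subst nn_integral_pair, measurable, subst nn_integral_pair, measurable, subst nn_integral_pair_swap, measurable)
  also have "\<dots> < \<infinity>" using fin solD(4)[OF sol] by (auto simp: ennreal_mult_less_top)
  finally show ?thesis .
qed

text \<open>The integrability of \<open>G\<close> matters as much as the equation: without it the
  Bochner integral on the left would be 0 by convention, and the pointwise Caccioppoli inequality
  could not be integrated.\<close>

lemma test_function_equation:
  assumes \<rho>: "scale \<rho>" and sol: "sol \<rho> u f" and c: "cutoff \<eta> m r0 r1"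
    and w: "w = (\<lambda>x. max (u x) 0)" and V: "V = (\<lambda>x. \<eta> x powr p * w x)"
    and G: "G = (\<lambda>z. ker \<rho> (dist (fst z) (snd z)) * signed_powr p (u (fst z) - u (snd z)) * (V (fst z) - V (snd z)))"
  shows "integrable (lborel \<Otimes>\<^sub>M lborel) G" "(\<integral>z. G z \<partial>(lborel \<Otimes>\<^sub>M lborel)) = (\<integral>x. f x * V x \<partial>lborel)"
    "(\<integral>\<^sup>+x. (\<integral>\<^sup>+y. ennreal (kplus \<rho> (dist x y) * \<bar>V x - V y\<bar> powr p) \<partial>lborel) \<partial>lborel) < \<infinity>"
proof -
  note [measurable] = solD(1,2)[OF sol]
  have [measurable]: "\<eta> \<in> borel_measurable borel" using c by (simp add: cutoff_def)
  have wm[measurable]: "w \<in> borel_measurable borel" unfolding w by measurable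
  have Vm[measurable]: "V \<in> borel_measurable borel" unfolding V by measurable
  note c2 = cutoff_extend[OF c]
  note full = test_full[OF \<rho> c2 w V]
  have "(\<integral>\<^sup>+z. ennreal \<bar>ker \<rho> (dist (fst z) (snd z)) * signed_powr p (u (fst z) - u (snd z)) * (V (fst z) - V (snd z))\<bar> \<partial>(lborel \<Otimes>\<^sub>M lborel)) < \<infinity>"
    by (rule dominated_finite[OF \<rho> sol k_form_nonneg _ w full(2)]) measurable
  then show "integrable (lborel \<Otimes>\<^sub>M lborel) G"
    unfolding G by (intro integrableI_bounded) (auto simp: measurable_lborel1)
  have c': "\<And>x. 0 \<le> \<eta> x" "\<And>x. \<eta> x \<le> 1" "\<And>x. x \<notin> cball 0 r0 \<Longrightarrow> \<eta> x = 0" "r0 < 3/2" "0 < r0"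
    using c2 by (auto simp: cutoff_def)
  have w0: "0 \<le> w x" for x by (simp add: w)
  have Vw: "V x \<le> w x" "0 \<le> V x" for x
    using c'(1,2)[of x] w0[of x] p powr_mono2[of p "\<eta> x" 1] mult_right_mono[of "\<eta> x powr p" 1 "w x"] by (auto simp: V)
  have "(\<integral>\<^sup>+z. ennreal (kplus \<rho> (dist (fst z) (snd z)) * \<bar>V (fst z) - V (snd z)\<bar> powr p) \<partial>(lborel \<Otimes>\<^sub>M lborel)) < \<infinity>"
    by (rule dominated_finite[OF \<rho> sol k_test_nonneg[OF \<rho>] _ w full(1)]) measurable
  then show 1: "(\<integral>\<^sup>+x. (\<integral>\<^sup>+y. ennreal (kplus \<rho> (dist x y) * \<bar>V x - V y\<bar> powr p) \<partial>lborel) \<partial>lborel) < \<infinity>"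
    by (subst (asm) nn_integral_pair) auto
  have "(\<integral>\<^sup>+x. ennreal (V x powr p) \<partial>lborel) \<le> (\<integral>\<^sup>+x\<in>ball 0 (3/2). ennreal (max (u x) 0 powr p) \<partial>lborel)"
  proof (intro nn_integral_mono)
    fix x :: 'a
    show "ennreal (V x powr p) \<le> ennreal (max (u x) 0 powr p) * indicator (ball 0 (3/2)) x"
    proof (cases "x \<in> ball 0 (3/2)")
      case True
      then show ?thesis using Vw[of x] p by (auto simp: w intro!: ennreal_leI powr_mono2)
    next
      case False
      then have "\<eta> x = 0" using c' by auto
      then show ?thesis using p by (simp add: V)
    qed
  qed
  then have 2: "(\<integral>\<^sup>+x. ennreal (V x powr p) \<partial>lborel) < \<infinity>"
    using pos_part_integrals_finite(1)[OF sol] by (rule le_less_trans)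
  show "(\<integral>z. G z \<partial>(lborel \<Otimes>\<^sub>M lborel)) = (\<integral>x. f x * V x \<partial>lborel)"
    unfolding G using c' p by (intro sol_equation[OF sol, of r0] Vw 1 2) (auto simp: V)
qed

text \<open>The kernel is nonnegative up to distance of order \<open>L\<close> once \<open>2 \<rho> L \<le> 1\<close>, so there the negative
  part of \<open>u\<close> has the favourable sign; farther away both signs count.\<close>

definition tail_fun :: "real \<Rightarrow> ('a \<Rightarrow> real) \<Rightarrow> 'a \<Rightarrow> real" where
  "tail_fun L u y = (if norm y < L then max (u y) 0 else \<bar>u y\<bar>)"

lemma tail_fun_measurable [measurable]:
  assumes [measurable]: "u \<in> borel_measurable borel"
  shows "tail_fun L u \<in> borel_measurable borel"
  unfolding tail_fun_def by measurable

lemma tail_fun_nonneg: "0 \<le> tail_fun L u y" by (simp add: tail_fun_def)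

section \<open>The Caccioppoli inequality\<close>

definition tail :: "real \<Rightarrow> real \<Rightarrow> ('a \<Rightarrow> real) \<Rightarrow> ennreal" where
  "tail \<rho> L u = (\<integral>\<^sup>+y\<in>- ball 0 1. ennreal (kmaj \<rho> (norm y) * tail_fun L u y powr (p - 1)) \<partial>lborel)"

text \<open>The dependence on \<open>m\<close> is a pure power: \<open>dsp + 1\<close> from
  comparing the kernel at \<open>dist x y\<close> and \<open>norm y\<close>, and \<open>p\<close>
  from the Lipschitz bound of the cutoff. Along the De Giorgi iteration, where \<open>m\<close>
  doubles at each stage, it therefore grows only geometrically.\<close>

definition "a_cac m = kup * (cac_low p + 2 powr p + cac_err p) * m powr (dsp + 1 + p)"

lemma a_cac_ge:
  assumes "2 \<le> m"
  shows "kup * (cac_low p + 2 powr p) * m powr (dsp + 1) \<le> a_cac m" "cac_err p * m powr p * kup \<le> a_cac m"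
proof -
  have 1: "m powr (dsp + 1) \<le> m powr (dsp + 1 + p)" "m powr p \<le> m powr (dsp + 1 + p)"
    using assms p dsp_pos by (auto intro!: powr_mono)
  have 2: "0 < cac_low p" "0 < cac_err p" using cac_low cac_err p by auto
  show "kup * (cac_low p + 2 powr p) * m powr (dsp + 1) \<le> a_cac m"
    unfolding a_cac_def using 1 2 kup_pos by (intro mult_mono) auto
  have "kup * cac_err p * m powr p \<le> kup * (cac_low p + 2 powr p + cac_err p) * m powr (dsp + 1 + p)"
    using 1 2 kup_pos by (intro mult_mono) auto
  then show "cac_err p * m powr p * kup \<le> a_cac m" by (simp add: a_cac_def mult_ac)
qed

lemma a_cac_nonneg: "0 \<le> a_cac m"
  unfolding a_cac_def using kup_pos cac_low[of p] cac_err[OF p] by (intro mult_nonneg_nonneg add_nonneg_nonneg) auto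

lemma caccioppoli_half:
  assumes \<rho>: "scale \<rho>" and c: "cutoff \<eta> m r0 r1" and L: "2 * \<rho> * L \<le> 1"
    and w: "w = (\<lambda>x. max (u x) 0)" and V: "V = (\<lambda>x. \<eta> x powr p * w x)"
    and v: "v = (\<lambda>x. \<eta> x * w x)" and t: "t = tail_fun L u"
    and x: "x \<in> ball 0 r1"
  shows "cac_low p * (indicator (ball x 2) y * (ker \<rho> (dist x y) * \<bar>v x - v y\<bar> powr p))
      + 1 / 2 * (indicator (ball 0 r1) x * indicator (ball 0 r1) y
          * (ker \<rho> (dist x y) * (max (- u y) 0 powr (p - 1) * (\<eta> x powr p * w x))))
    \<le> ker \<rho> (dist x y) * signed_powr p (u x - u y) * (V x - V y)
      + a_cac m * (err \<rho> r1 w t x y + err \<rho> r1 w t y x)"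
proof -
  have c': "\<And>x. 0 \<le> \<eta> x" "\<And>x. \<eta> x \<le> 1" "\<And>x. x \<notin> cball 0 r0 \<Longrightarrow> \<eta> x = 0" "r1 \<le> 3/2" "0 < r0" "r0 < r1" "1 \<le> r1"
    "2 \<le> m" "\<bar>\<eta> x - \<eta> y\<bar> \<le> m * dist x y"
    using c by (auto simp: cutoff_def)
  have w0: "0 \<le> w x" for x by (simp add: w)
  have e0: "0 \<le> err \<rho> r1 w t x y" "0 \<le> err \<rho> r1 w t y x"
    using err_nonneg[OF \<rho>] w0 by auto
  have cl: "0 < cac_low p" "0 < cac_err p" using cac_low cac_err p by auto
  show ?thesis
  proof (cases "y \<in> ball 0 r1")
    case True
    have d3: "dist x y < 3" using dist_lt_3[of x y] x True c' by auto
    have k0: "0 \<le> ker \<rho> (dist x y)" using \<rho> d3 by (intro ker_nonneg_near) auto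
    have "ker \<rho> (dist x y) * (cac_low p * \<bar>v x - v y\<bar> powr p + 1 / 2 * (max (- u y) 0 powr (p - 1) * (\<eta> x powr p * w x)))
        \<le> ker \<rho> (dist x y) * (signed_powr p (u x - u y) * (V x - V y)
           + cac_err p * ((w x powr p + w y powr p) * \<bar>\<eta> x - \<eta> y\<bar> powr p))"
      using caccioppoli_pointwise[OF p c'(1) c'(1), of x "u x" y "u y"] k0
      by (intro mult_left_mono) (simp_all add: v w V)
    moreover have "ker \<rho> (dist x y) * (cac_err p * ((w x powr p + w y powr p) * \<bar>\<eta> x - \<eta> y\<bar> powr p))
        \<le> a_cac m * (err \<rho> r1 w t x y + err \<rho> r1 w t y x)"
    proof -
      have "ker \<rho> (dist x y) \<le> kup * kmaj \<rho> (dist x y)"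
        using ker_bound[OF \<rho>] by (rule order_trans[OF abs_ge_self])
      also have "\<dots> \<le> kup * hmaj (dist x y)"
        using kmaj_le_hmaj[OF \<rho>] kup_pos by (intro mult_left_mono) auto
      finally have kh: "ker \<rho> (dist x y) \<le> kup * hmaj (dist x y)" .
      have "\<bar>\<eta> x - \<eta> y\<bar> powr p \<le> (m * dist x y) powr p" using c' p by (intro powr_mono2) auto
      then have "ker \<rho> (dist x y) * (cac_err p * ((w x powr p + w y powr p) * \<bar>\<eta> x - \<eta> y\<bar> powr p))
         \<le> (kup * hmaj (dist x y)) * (cac_err p * ((w x powr p + w y powr p) * (m powr p * dist x y powr p)))"
        using kh k0 cl c' kup_pos hmaj_nonneg by (intro mult_mono mult_nonneg_nonneg) (auto simp: powr_mult)
      also have "\<dots> = (cac_err p * m powr p * kup) *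
         (w x powr p * (hmaj (dist x y) * dist x y powr p) + w y powr p * (hmaj (dist y x) * dist y x powr p))"
        by (simp add: dist_commute algebra_simps)
      also have "\<dots> \<le> (cac_err p * m powr p * kup) * (err \<rho> r1 w t x y + err \<rho> r1 w t y x)"
        using x True d3 \<rho> w0 cl kup_pos
        by (intro mult_left_mono add_mono err_near) (auto simp: dist_commute)
      also have "\<dots> \<le> a_cac m * (err \<rho> r1 w t x y + err \<rho> r1 w t y x)"
        using a_cac_ge(2)[OF c'(8)] e0 by (intro mult_right_mono) auto
      finally show ?thesis .
    qed
    moreover have "cac_low p * (indicator (ball x 2) y * (ker \<rho> (dist x y) * \<bar>v x - v y\<bar> powr p))
        \<le> ker \<rho> (dist x y) * (cac_low p * \<bar>v x - v y\<bar> powr p)"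
      using k0 cl by (auto simp: indicator_def)
    ultimately show ?thesis using x True by (simp add: algebra_simps)
  next
    case False
    then have y: "r1 \<le> norm y" by simp
    then have \<eta>y: "\<eta> y = 0" using c' by auto
    show ?thesis
    proof (cases "\<eta> x = 0 \<or> w x = 0")
      case True
      then have "v x = 0" "V x = 0" "v y = 0" "V y = 0" using \<eta>y p by (auto simp: v V)
      then show ?thesis using False e0 p a_cac_nonneg[of m] by simp
    next
      case F: False
      then have x0: "norm x \<le> r0" and ux: "u x = w x" "0 < w x" using c' by (auto simp: w max_def split: if_splits)
      have V0: "0 \<le> V x" using ux by (simp add: V)
      have Vy: "V y = 0" "v y = 0" using \<eta>y p by (auto simp: V v)
      note far = far_pair_bound[OF \<rho> c w V x0 y, of t]
      have km: "0 \<le> kmaj \<rho> (dist x y)" by (rule kmaj_nonneg[OF \<rho>])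
      let ?Q = "2 powr p * (w x powr (p - 1) + t y powr (p - 1))"
      \<comment> \<open>A lower bound suffices because \<open>0 \<le> V x\<close>. For
        \<open>norm y < L\<close> the kernel is nonnegative and the product is negative only where
        \<open>u y\<close> exceeds \<open>w x\<close>, so the positive part of \<open>u y\<close>
        controls it. Farther out the modulus of both factors is taken.\<close>
      have low: "- (kup * kmaj \<rho> (dist x y) * ?Q) \<le> ker \<rho> (dist x y) * signed_powr p (u x - u y)"
      proof (cases "norm y < L")
        case True
        have "dist x y \<le> 2 * norm y"
          using norm_triangle_ineq4[of x y] x0 y c' by (simp add: dist_norm)
        also have "\<dots> \<le> 2 * L" using True by simp
        finally have "\<rho> * dist x y \<le> \<rho> * (2 * L)" using \<rho> by (intro mult_left_mono) (auto simp: scale_def)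
        also have "\<dots> \<le> 1" using L by (simp add: mult_ac)
        finally have "\<rho> * dist x y \<le> 1" .
        then have k0: "0 \<le> ker \<rho> (dist x y)" using \<rho> by (intro ker_nonneg) auto
        have tQ: "t y powr (p - 1) \<le> ?Q"
        proof -
          have "1 * t y powr (p - 1) \<le> 2 powr p * (w x powr (p - 1) + t y powr (p - 1))"
            using p by (intro mult_mono) (auto intro: ge_one_powr_ge_zero)
          then show ?thesis by simp
        qed
        have "- (t y powr (p - 1)) \<le> signed_powr p (w x - u y)"
        proof (cases "u y \<le> w x")
          case True
          then have "0 \<le> signed_powr p (w x - u y)" by (simp add: signed_powr_nonneg)
          moreover have "- (t y powr (p - 1)) \<le> 0" by simp
          ultimately show ?thesis by linarith
        next
          case F: False
          then have "signed_powr p (w x - u y) = - ((u y - w x) powr (p - 1))"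
            using signed_powr_minus[of p "u y - w x"] by (simp add: signed_powr_nonneg)
          moreover have "(u y - w x) powr (p - 1) \<le> t y powr (p - 1)"
            using F ux p True by (intro powr_mono2) (auto simp: t tail_fun_def)
          ultimately show ?thesis by simp
        qed
        then have "ker \<rho> (dist x y) * (- ?Q) \<le> ker \<rho> (dist x y) * signed_powr p (w x - u y)"
          using tQ k0 by (intro mult_left_mono) auto
        moreover have "ker \<rho> (dist x y) * ?Q \<le> kup * kmaj \<rho> (dist x y) * ?Q"
          using ker_bound[OF \<rho>, of "dist x y"] by (intro mult_right_mono) auto
        ultimately have "- (kup * kmaj \<rho> (dist x y) * ?Q) \<le> ker \<rho> (dist x y) * signed_powr p (w x - u y)"
          unfolding mult_minus_right by linarith
        then show ?thesis using ux by simp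
      next
        case False
        have "\<bar>ker \<rho> (dist x y) * signed_powr p (w x - u y)\<bar> \<le> kup * kmaj \<rho> (dist x y) * ?Q"
          unfolding abs_mult using ker_bound[OF \<rho>, of "dist x y"] signed_powr_far[OF w0, of x "u y"] km kup_pos False
          by (intro mult_mono) (auto simp: t tail_fun_def)
        then show ?thesis using ux by (simp add: abs_le_iff)
      qed
      have "cac_low p * (indicator (ball x 2) y * (ker \<rho> (dist x y) * \<bar>v x - v y\<bar> powr p))
         \<le> cac_low p * (kup * kmaj \<rho> (dist x y) * w x powr p)"
      proof -
        have "\<bar>v x\<bar> \<le> w x" using c'(1,2)[of x] w0[of x] by (simp add: v abs_mult mult_left_le_one_le)
        then have "\<bar>ker \<rho> (dist x y)\<bar> * \<bar>v x - v y\<bar> powr p \<le> kup * kmaj \<rho> (dist x y) * w x powr p"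
          using Vy p ker_bound[OF \<rho>, of "dist x y"] km kup_pos by (intro mult_mono powr_mono2) auto
        moreover have "indicator (ball x 2) y * (ker \<rho> (dist x y) * \<bar>v x - v y\<bar> powr p)
            \<le> \<bar>ker \<rho> (dist x y)\<bar> * \<bar>v x - v y\<bar> powr p"
          by (auto simp: indicator_def intro!: mult_right_mono)
        ultimately show ?thesis using cl by (intro mult_left_mono) linarith+
      qed
      moreover have "- (kup * kmaj \<rho> (dist x y) * ?Q) * V x \<le> ker \<rho> (dist x y) * signed_powr p (u x - u y) * (V x - V y)"
        using mult_right_mono[OF low V0] Vy by simp
      moreover have "cac_low p * (kup * kmaj \<rho> (dist x y) * w x powr p) + kup * kmaj \<rho> (dist x y) * ?Q * V x
         \<le> a_cac m * (err \<rho> r1 w t x y + err \<rho> r1 w t y x)"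
      proof -
        have "cac_low p * (kup * kmaj \<rho> (dist x y) * w x powr p) + kup * kmaj \<rho> (dist x y) * ?Q * V x
          = kup * cac_low p * (kmaj \<rho> (dist x y) * w x powr p)
            + kup * 2 powr p * (kmaj \<rho> (dist x y) * ((w x powr (p - 1) + t y powr (p - 1)) * V x))"
          by (simp add: mult_ac)
        also have "\<dots> \<le> kup * cac_low p * (m powr (dsp + 1) * err \<rho> r1 w t x y)
            + kup * 2 powr p * (m powr (dsp + 1) * err \<rho> r1 w t x y)"
          using far kup_pos cl by (intro add_mono mult_left_mono) auto
        also have "\<dots> = kup * (cac_low p + 2 powr p) * m powr (dsp + 1) * err \<rho> r1 w t x y"
          by (simp add: algebra_simps)
        also have "\<dots> \<le> a_cac m * (err \<rho> r1 w t x y + err \<rho> r1 w t y x)"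
          using a_cac_ge(1)[OF c'(8)] e0 a_cac_nonneg by (intro mult_mono) auto
        finally show ?thesis .
      qed
      ultimately show ?thesis using False by simp
    qed
  qed
qed

lemma caccioppoli_all:
  assumes \<rho>: "scale \<rho>" and c: "cutoff \<eta> m r0 r1" and L: "2 * \<rho> * L \<le> 1"
    and w: "w = (\<lambda>x. max (u x) 0)" and V: "V = (\<lambda>x. \<eta> x powr p * w x)"
    and v: "v = (\<lambda>x. \<eta> x * w x)" and t: "t = tail_fun L u"
  shows "cac_low p * (indicator (ball x 2) y * (ker \<rho> (dist x y) * \<bar>v x - v y\<bar> powr p))
      + 1 / 2 * (indicator (ball 0 r1) x * indicator (ball 0 r1) y
          * (ker \<rho> (dist x y) * (max (- u y) 0 powr (p - 1) * (\<eta> x powr p * w x))))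
    \<le> ker \<rho> (dist x y) * signed_powr p (u x - u y) * (V x - V y)
      + a_cac m * (err \<rho> r1 w t x y + err \<rho> r1 w t y x)"
proof -
  have e0: "0 \<le> err \<rho> r1 w t x y" "0 \<le> err \<rho> r1 w t y x"
    using err_nonneg[OF \<rho>] by (auto simp: w)
  consider "x \<in> ball 0 r1" | "x \<notin> ball 0 r1" "y \<in> ball 0 r1" | "x \<notin> ball 0 r1" "y \<notin> ball 0 r1" by blast
  then show ?thesis
  proof cases
    case 1
    then show ?thesis by (rule caccioppoli_half[OF assms])
  next
    case 2
    have eq: "ker \<rho> (dist y x) * signed_powr p (u y - u x) * (V y - V x)
      = ker \<rho> (dist x y) * signed_powr p (u x - u y) * (V x - V y)"
      using signed_powr_minus[of p "u x - u y"] by (simp add: algebra_simps dist_commute)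
    have ind: "indicator (ball y 2) x = (indicator (ball x 2) y :: real)" by (auto simp: indicator_def dist_commute)
    show ?thesis
      using caccioppoli_half[OF assms 2(2), of x] 2(1)
      unfolding eq ind by (simp add: dist_commute abs_minus_commute add.commute)
  next
    case 3
    have "\<eta> x = 0" "\<eta> y = 0" using c 3 by (auto simp: cutoff_def)
    then show ?thesis using 3 e0 a_cac_nonneg[of m] p by (simp add: v V)
  qed
qed

text \<open>Energy and cross term are both nonnegative, so the single integrated inequality bounds
  each of them by \<open>R\<close>. The factor 2 in \<open>R\<close> arises because
  \<open>err\<close> occurs with its arguments in both orders.\<close>

lemma caccioppoli:
  assumes \<rho>: "scale \<rho>" and sol: "sol \<rho> u f" and c: "cutoff \<eta> m r0 r1" and L: "2 * \<rho> * L \<le> 1"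
    and w: "w = (\<lambda>x. max (u x) 0)"
  defines "R \<equiv> (\<integral>\<^sup>+x. ennreal (\<bar>f x\<bar> * (\<eta> x powr p * w x)) \<partial>lborel)
       + ennreal (2 * a_cac m) * (ennreal (c_in + c_out) * (\<integral>\<^sup>+x\<in>ball 0 r1. ennreal (w x powr p) \<partial>lborel)
          + tail \<rho> L u * (\<integral>\<^sup>+x\<in>ball 0 r1. ennreal (w x) \<partial>lborel))"
  shows "ennreal (cac_low p * klow) * gagliardo (\<lambda>x. \<eta> x * w x) \<le> R"
    "(\<integral>\<^sup>+x. (\<integral>\<^sup>+y. ennreal (1 / 2 * (indicator (ball 0 r1) x * indicator (ball 0 r1) y
        * (ker \<rho> (dist x y) * (max (- u y) 0 powr (p - 1) * (\<eta> x powr p * w x))))) \<partial>lborel) \<partial>lborel) \<le> R"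
proof -
  note [measurable] = solD(1,2)[OF sol]
  define V where "V = (\<lambda>x. \<eta> x powr p * w x)"
  define v where "v = (\<lambda>x. \<eta> x * w x)"
  define t where "t = tail_fun L u"
  have [measurable]: "\<eta> \<in> borel_measurable borel" using c by (simp add: cutoff_def)
  have [measurable]: "w \<in> borel_measurable borel" unfolding w by measurable
  have [measurable]: "V \<in> borel_measurable borel" "v \<in> borel_measurable borel" "t \<in> borel_measurable borel"
    unfolding V_def v_def t_def by measurable
  have c': "\<And>x. 0 \<le> \<eta> x" "r1 \<le> 3/2" using c by (auto simp: cutoff_def)
  have w0: "0 \<le> w x" for x by (simp add: w)
  have cl: "0 < cac_low p" using cac_low by auto
  define P1 where "P1 x y = cac_low p * (indicator (ball x 2) y * (ker \<rho> (dist x y) * \<bar>v x - v y\<bar> powr p))" for x y :: 'a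
  define P2 where "P2 x y = 1 / 2 * (indicator (ball 0 r1) x * indicator (ball 0 r1) y
          * (ker \<rho> (dist x y) * (max (- u y) 0 powr (p - 1) * (\<eta> x powr p * w x))))" for x y :: 'a
  define G where "G = (\<lambda>z. ker \<rho> (dist (fst z) (snd z)) * signed_powr p (u (fst z) - u (snd z)) * (V (fst z) - V (snd z)))"
  define E where "E = err \<rho> r1 w t"
  define N where "N z = a_cac m * (E (fst z) (snd z) + E (snd z) (fst z))" for z
  have E0: "0 \<le> E x y" for x y unfolding E_def by (rule err_nonneg[OF \<rho> w0])
  have [measurable]: "(\<lambda>z. E (fst z) (snd z)) \<in> borel_measurable (borel \<Otimes>\<^sub>M borel)"
    "(\<lambda>z. E (snd z) (fst z)) \<in> borel_measurable (borel \<Otimes>\<^sub>M borel)" unfolding E_def by measurable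
  have P10: "0 \<le> P1 x y" for x y
    using cl ker_nonneg_near[OF \<rho>, of x y] by (auto simp: P1_def indicator_def)
  have P20: "0 \<le> P2 x y" for x y
  proof (cases "x \<in> ball 0 r1 \<and> y \<in> ball 0 r1")
    case True
    then have "dist x y \<le> 4" using dist_lt_3[of x y] c' by auto
    then show ?thesis using ker_nonneg_near[OF \<rho>, of x y] w0[of x] by (simp add: P2_def)
  qed (auto simp: P2_def)
  have [measurable]: "(\<lambda>z. P1 (fst z) (snd z)) \<in> borel_measurable (borel \<Otimes>\<^sub>M borel)"
    "(\<lambda>z. P2 (fst z) (snd z)) \<in> borel_measurable (borel \<Otimes>\<^sub>M borel)" unfolding P1_def P2_def by measurable
  note eqn = test_function_equation[OF \<rho> sol c w V_def G_def]
  have main: "(\<integral>\<^sup>+z. ennreal (P1 (fst z) (snd z) + P2 (fst z) (snd z)) \<partial>(lborel \<Otimes>\<^sub>M lborel)) \<le> R"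
  proof -
    have "(\<integral>\<^sup>+z. ennreal (P1 (fst z) (snd z) + P2 (fst z) (snd z)) \<partial>(lborel \<Otimes>\<^sub>M lborel))
      \<le> ennreal \<bar>\<integral>z. G z \<partial>(lborel \<Otimes>\<^sub>M lborel)\<bar> + (\<integral>\<^sup>+z. ennreal (N z) \<partial>(lborel \<Otimes>\<^sub>M lborel))"
    proof (rule nn_integral_le_integral_add[OF eqn(1)])
      show "N \<in> borel_measurable (lborel \<Otimes>\<^sub>M lborel)" unfolding N_def by (simp add: measurable_lborel1)
      show "P1 (fst z) (snd z) + P2 (fst z) (snd z) \<le> G z + N z" for z
        unfolding P1_def P2_def G_def N_def E_def by (rule caccioppoli_all[OF \<rho> c L w V_def v_def t_def])
      show "0 \<le> N z" for z unfolding N_def using a_cac_nonneg E0 by simp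
      show "0 \<le> P1 (fst z) (snd z) + P2 (fst z) (snd z)" for z using P10 P20 by (simp add: add_nonneg_nonneg)
    qed
    also have "\<dots> \<le> (\<integral>\<^sup>+x. ennreal (\<bar>f x\<bar> * V x) \<partial>lborel) + ennreal (2 * a_cac m) * (\<integral>\<^sup>+x. (\<integral>\<^sup>+y. ennreal (E x y) \<partial>lborel) \<partial>lborel)"
    proof (rule add_mono)
      have "V x = \<bar>V x\<bar>" for x using w0 by (simp add: V_def)
      then show "ennreal \<bar>\<integral>z. G z \<partial>(lborel \<Otimes>\<^sub>M lborel)\<bar> \<le> (\<integral>\<^sup>+x. ennreal (\<bar>f x\<bar> * V x) \<partial>lborel)"
        unfolding eqn(2) using ennreal_abs_integral_le[of lborel "\<lambda>x. f x * V x"] by (simp add: abs_mult)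
      have "(\<integral>\<^sup>+z. ennreal (N z) \<partial>(lborel \<Otimes>\<^sub>M lborel)) = (\<integral>\<^sup>+z. ennreal (a_cac m) *
          (ennreal (E (fst z) (snd z)) + ennreal (E (snd z) (fst z))) \<partial>(lborel \<Otimes>\<^sub>M lborel))"
        using a_cac_nonneg E0 by (simp add: N_def ennreal_mult)
      also have "\<dots> = ennreal (a_cac m) * ((\<integral>\<^sup>+x. (\<integral>\<^sup>+y. ennreal (E x y) \<partial>lborel) \<partial>lborel)
           + (\<integral>\<^sup>+x. (\<integral>\<^sup>+y. ennreal (E x y) \<partial>lborel) \<partial>lborel))"
        by (subst nn_integral_cmult, measurable, subst nn_integral_add, measurable,
            subst nn_integral_pair, measurable, subst nn_integral_pair_swap, measurable)
      also have "\<dots> = ennreal (2 * a_cac m) * (\<integral>\<^sup>+x. (\<integral>\<^sup>+y. ennreal (E x y) \<partial>lborel) \<partial>lborel)"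
        using a_cac_nonneg by (simp add: mult_2[symmetric] ennreal_mult mult_ac)
      finally show "(\<integral>\<^sup>+z. ennreal (N z) \<partial>(lborel \<Otimes>\<^sub>M lborel))
        \<le> ennreal (2 * a_cac m) * (\<integral>\<^sup>+x. (\<integral>\<^sup>+y. ennreal (E x y) \<partial>lborel) \<partial>lborel)" by simp
    qed
    also have "\<dots> \<le> R"
      unfolding R_def V_def E_def tail_def t_def
      by (intro add_mono order.refl mult_left_mono err_integral[OF \<rho>] w0) auto
    finally show ?thesis .
  qed
  have "ennreal (cac_low p * klow) * gagliardo v = (\<integral>\<^sup>+x. (\<integral>\<^sup>+y. ennreal (cac_low p * klow) * (ennreal (\<bar>v x - v y\<bar> powr p / dist x y powr (DIM('a) + s * p))
      * indicator (ball x 2) y) \<partial>lborel) \<partial>lborel)"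
  proof -
    have "ennreal (cac_low p * klow) * gagliardo v = (\<integral>\<^sup>+x. ennreal (cac_low p * klow) *
      (\<integral>\<^sup>+y. (ennreal (\<bar>v x - v y\<bar> powr p / dist x y powr (DIM('a) + s * p)) * indicator (ball x 2) y) \<partial>lborel) \<partial>lborel)"
      unfolding gagliardo_def by (rule nn_integral_cmult[symmetric]) measurable
    also have "\<dots> = (\<integral>\<^sup>+x. (\<integral>\<^sup>+y. ennreal (cac_low p * klow) * (ennreal (\<bar>v x - v y\<bar> powr p / dist x y powr (DIM('a) + s * p))
      * indicator (ball x 2) y) \<partial>lborel) \<partial>lborel)"
      by (intro nn_integral_cong nn_integral_cmult[symmetric]) measurable
    finally show ?thesis .
  qed
  also have "\<dots> \<le> (\<integral>\<^sup>+x. (\<integral>\<^sup>+y. ennreal (P1 x y) \<partial>lborel) \<partial>lborel)"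
  proof (intro nn_integral_mono)
    fix x y :: 'a
    show "ennreal (cac_low p * klow) * (ennreal (\<bar>v x - v y\<bar> powr p / dist x y powr (DIM('a) + s * p))
      * indicator (ball x 2) y) \<le> ennreal (P1 x y)"
    proof (cases "y \<in> ball x 2 \<and> x \<noteq> y")
      case True
      then have "klow / dist x y powr dsp \<le> ker \<rho> (dist x y)" by (intro ker_lower[OF \<rho>]) auto
      then have "cac_low p * (klow / dist x y powr dsp * \<bar>v x - v y\<bar> powr p) \<le> cac_low p * (ker \<rho> (dist x y) * \<bar>v x - v y\<bar> powr p)"
        using cl by (intro mult_left_mono mult_right_mono) auto
      then have "cac_low p * klow * (\<bar>v x - v y\<bar> powr p / dist x y powr dsp) \<le> P1 x y"
        using True by (simp add: P1_def mult.assoc)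
      then have "ennreal (cac_low p * klow * (\<bar>v x - v y\<bar> powr p / dist x y powr dsp)) \<le> ennreal (P1 x y)" by (rule ennreal_leI)
      moreover have "ennreal (cac_low p * klow) * ennreal (\<bar>v x - v y\<bar> powr p / dist x y powr dsp)
         = ennreal (cac_low p * klow * (\<bar>v x - v y\<bar> powr p / dist x y powr dsp))"
        using cl klow_pos by (intro ennreal_mult[symmetric]) auto
      ultimately show ?thesis using True by (simp add: dsp_def)
    next
      case False
      then show ?thesis using p by auto
    qed
  qed
  also have "\<dots> \<le> (\<integral>\<^sup>+z. ennreal (P1 (fst z) (snd z) + P2 (fst z) (snd z)) \<partial>(lborel \<Otimes>\<^sub>M lborel))"
    by (subst nn_integral_pair[symmetric]) (auto intro!: nn_integral_mono ennreal_leI simp: P20)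
  also note main
  finally show "ennreal (cac_low p * klow) * gagliardo (\<lambda>x. \<eta> x * w x) \<le> R" by (simp add: v_def)
  have "(\<integral>\<^sup>+x. (\<integral>\<^sup>+y. ennreal (P2 x y) \<partial>lborel) \<partial>lborel)
    \<le> (\<integral>\<^sup>+z. ennreal (P1 (fst z) (snd z) + P2 (fst z) (snd z)) \<partial>(lborel \<Otimes>\<^sub>M lborel))"
    by (subst nn_integral_pair[symmetric]) (auto intro!: nn_integral_mono ennreal_leI simp: P10)
  also note main
  finally show "(\<integral>\<^sup>+x. (\<integral>\<^sup>+y. ennreal (1 / 2 * (indicator (ball 0 r1) x * indicator (ball 0 r1) y
        * (ker \<rho> (dist x y) * (max (- u y) 0 powr (p - 1) * (\<eta> x powr p * w x))))) \<partial>lborel) \<partial>lborel) \<le> R"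
    by (simp add: P2_def)
qed

end

subsection \<open>Local boundedness at unit scale\<close>

text \<open>Hoelder's inequality for normalised \<open>f\<close>: Young's inequality is integrated
  for the product of \<open>f\<close> and \<open>v / U\<close>, where \<open>U\<close> is the bound
  for the norm of \<open>v\<close>, and the result is multiplied by \<open>U\<close>.\<close>

lemma nn_integral_holder_unit:
  fixes f v :: "'b \<Rightarrow> real"
  assumes [measurable]: "f \<in> borel_measurable M" "v \<in> borel_measurable M" and q: "1 < q"
    and v0: "\<And>x. 0 \<le> v x" and f1: "(\<integral>\<^sup>+x. ennreal (\<bar>f x\<bar> powr q) \<partial>M) \<le> 1"
    and W: "(\<integral>\<^sup>+x. ennreal (v x powr (q / (q - 1))) \<partial>M) \<le> ennreal W" "0 < W"
  shows "(\<integral>\<^sup>+x. ennreal (\<bar>f x\<bar> * v x) \<partial>M) \<le> ennreal (W powr (1 - 1 / q))"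
proof -
  define r where "r = q / (q - 1)"
  have r: "1 < r" "1 / q + 1 / r = 1" "1 / r = 1 - 1 / q" using q by (auto simp: r_def field_simps)
  define U where "U = W powr (1 / r)"
  have U: "0 < U" "U powr r = W"
  proof -
    show "0 < U" using W by (simp add: U_def)
    have "1 / r * r = 1" using r(1) by simp
    then show "U powr r = W" unfolding U_def powr_powr using W(2) by simp
  qed
  have le: "ennreal (\<bar>f x\<bar> * v x) \<le> ennreal (U / q) * ennreal (\<bar>f x\<bar> powr q)
      + ennreal (U / (r * W)) * ennreal (v x powr r)" for x
  proof -
    have "\<bar>f x\<bar> * (v x / U) \<le> \<bar>f x\<bar> powr q / q + (v x / U) powr r / r"
      using q r v0[of x] U by (intro Youngs_inequality) auto
    then have "U * (\<bar>f x\<bar> * (v x / U)) \<le> U * (\<bar>f x\<bar> powr q / q + (v x / U) powr r / r)"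
      using U by (intro mult_left_mono) auto
    also have "(v x / U) powr r = v x powr r / W" using U v0[of x] by (simp add: powr_divide)
    finally have "\<bar>f x\<bar> * v x \<le> U / q * \<bar>f x\<bar> powr q + U / (r * W) * v x powr r"
      using U by (simp add: algebra_simps)
    then have "ennreal (\<bar>f x\<bar> * v x) \<le> ennreal (U / q * \<bar>f x\<bar> powr q + U / (r * W) * v x powr r)"
      by (rule ennreal_leI)
    also have "\<dots> = ennreal (U / q * \<bar>f x\<bar> powr q) + ennreal (U / (r * W) * v x powr r)"
      using U q r(1) W by (intro ennreal_plus mult_nonneg_nonneg divide_nonneg_nonneg) auto
    also have "ennreal (U / q * \<bar>f x\<bar> powr q) = ennreal (U / q) * ennreal (\<bar>f x\<bar> powr q)"
      using U q by (intro ennreal_mult divide_nonneg_nonneg) auto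
    also have "ennreal (U / (r * W) * v x powr r) = ennreal (U / (r * W)) * ennreal (v x powr r)"
      using U r(1) W by (intro ennreal_mult divide_nonneg_nonneg) auto
    finally show ?thesis .
  qed
  have "(\<integral>\<^sup>+x. ennreal (\<bar>f x\<bar> * v x) \<partial>M) \<le> (\<integral>\<^sup>+x. ennreal (U / q) * ennreal (\<bar>f x\<bar> powr q)
      + ennreal (U / (r * W)) * ennreal (v x powr r) \<partial>M)"
    by (intro nn_integral_mono le)
  also have "\<dots> = ennreal (U / q) * (\<integral>\<^sup>+x. ennreal (\<bar>f x\<bar> powr q) \<partial>M)
      + ennreal (U / (r * W)) * (\<integral>\<^sup>+x. ennreal (v x powr r) \<partial>M)"
    by (subst nn_integral_add, measurable, subst nn_integral_cmult, measurable, subst nn_integral_cmult, measurable)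
  also have "\<dots> \<le> ennreal (U / q) * 1 + ennreal (U / (r * W)) * ennreal W"
    using f1 W by (intro add_mono mult_left_mono) (auto simp: r_def)
  also have "\<dots> = ennreal (U / q + U / (r * W) * W)"
    using U q r W by (simp add: ennreal_mult[symmetric])
  also have "U / q + U / (r * W) * W = U * (1 / q + 1 / r)" using W by (simp add: field_simps)
  also have "\<dots> = U" using r by simp
  finally show ?thesis using r by (simp add: U_def)
qed

section \<open>Energy estimate for functions of small support\<close>

context log_kernel
begin

lemma q_gt: "1 / q < \<theta>" "1 < q" "0 < 1 - 1 / q"
proof -
  have "1 / \<theta> < q" using q by (simp add: \<theta>_def)
  moreover have "1 < 1 / \<theta>" using theta by simp
  ultimately show "1 < q" by linarith
  then show "1 / q < \<theta>" using \<open>1 / \<theta> < q\<close> theta by (simp add: field_simps)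
  then show "0 < 1 - 1 / q" using theta by linarith
qed

lemma pstar_inv: "1 / pstar = (1 - \<theta>) / p"
proof -
  have "pstar \<noteq> 0" using pstar_gt p by auto
  then show ?thesis using pstar_theta p by (simp add: field_simps)
qed

definition "q' = q / (q - 1)"

lemma q': "1 / q' = 1 - 1 / q" "0 < q'" "q' < pstar"
proof -
  show 1: "1 / q' = 1 - 1 / q" "0 < q'" using q_gt by (auto simp: q'_def field_simps)
  have "1 / pstar \<le> 1 - \<theta>" unfolding pstar_inv using p theta divide_left_mono[of 1 p "1 - \<theta>"] by simp
  also have "\<dots> < 1 / q'" using q_gt 1 by simp
  finally have less: "1 / pstar < 1 / q'" .
  have "0 < pstar" using pstar_gt p by simp
  with less \<open>0 < q'\<close> show "q' < pstar" by (simp add: divide_less_eq less_divide_eq)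
qed

text \<open>The power of the measure \<open>a\<close> that the right-hand side contributes to the
  energy: Hoelder and Sobolev give \<open>a powr (1 / q' - 1 / pstar)\<close> times the energy to
  the power \<open>1 / p\<close>, and absorbing the latter raises this to the power
  \<open>p / (p - 1)\<close>. The bound \<open>1 - \<theta> < \<gamma>\<close> amounts to
  \<open>1 / q < \<theta>\<close>, that is to the hypothesis on \<open>q\<close>.\<close>

definition "\<gamma> = (1 / q' - 1 / pstar) * (p / (p - 1))"

lemma gamma: "1 - \<theta> < \<gamma>" "0 < \<gamma>"
proof -
  have "(1 - \<theta>) * (1 - 1 / p) < 1 / q' - 1 / pstar"
  proof -
    have "(1 - \<theta>) * (1 - 1 / p) = (1 - \<theta>) - (1 - \<theta>) / p" by (simp add: right_diff_distrib)
    then show ?thesis using q_gt(1) unfolding q'(1) pstar_inv by linarith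
  qed
  moreover have "(1 - \<theta>) * (1 - 1 / p) * (p / (p - 1)) = 1 - \<theta>" using p by (simp add: field_simps)
  moreover have "0 < p / (p - 1)" using p by simp
  ultimately show "1 - \<theta> < \<gamma>" unfolding \<gamma>_def using mult_strict_right_mono by fastforce
  then show "0 < \<gamma>" using theta by linarith
qed

definition "s_const = sob_const q' powr (1 - 1 / q)"
definition "e_const = 2 / (cac_low p * klow) + (2 * s_const / (cac_low p * klow)) powr (p / (p - 1))"

lemma e_const_pos: "0 < e_const"
  using cac_low(1)[of p] klow_pos unfolding e_const_def by (intro add_pos_nonneg) auto

text \<open>Absorbs the sublinear power of \<open>E\<close>: either it is at most half of the left
  side, or the inequality can be solved for \<open>E\<close> in terms of \<open>b\<close>
  alone.\<close>

lemma young_energy: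
  assumes k: "0 < k" and X: "0 < E" and S: "0 \<le> S" and D: "0 \<le> D" and b: "0 \<le> b"
    and le: "k * E \<le> D + S * b * E powr (1 / p)"
  shows "E \<le> (2 / k + (2 * S / k) powr (p / (p - 1))) * (D + b powr (p / (p - 1)))"
proof -
  define X where "X = E powr (1 / p)"
  have X0: "0 < X" "X powr p = E" using assms p by (auto simp: X_def powr_powr)
  have nn: "0 \<le> 2 / k * b powr (p / (p - 1))" "0 \<le> (2 * S / k) powr (p / (p - 1)) * D" "0 \<le> 2 / k * D"
    "0 \<le> (2 * S / k) powr (p / (p - 1)) * b powr (p / (p - 1))" using k D by auto
  have "E \<le> 2 / k * D + (2 * S / k) powr (p / (p - 1)) * b powr (p / (p - 1))"
  proof (cases "S * b * X \<le> k * E / 2")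
    case True
    then have "k * E \<le> 2 * D" using le by (simp add: X_def)
    then have "E \<le> 2 / k * D" using k by (simp add: field_simps)
    then show ?thesis using nn by linarith
  next
    case False
    have "E = X powr (p - 1) * X" using powr_split[of X p] X0 p by simp
    then have "k * X powr (p - 1) * X < 2 * S * b * X" using False by (simp add: mult_ac)
    then have "k * X powr (p - 1) < 2 * S * b" using X0 by simp
    then have "X powr (p - 1) \<le> 2 * S / k * b" using k by (simp add: field_simps)
    then have "(X powr (p - 1)) powr (p / (p - 1)) \<le> (2 * S / k * b) powr (p / (p - 1))"
      using p by (intro powr_mono2) auto
    also have "(X powr (p - 1)) powr (p / (p - 1)) = E" using X0 p by (simp add: powr_powr)
    also have "(2 * S / k * b) powr (p / (p - 1)) = (2 * S / k) powr (p / (p - 1)) * b powr (p / (p - 1))"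
      by (rule powr_mult)
    finally have "E \<le> (2 * S / k) powr (p / (p - 1)) * b powr (p / (p - 1))" .
    then show ?thesis using nn by linarith
  qed
  then show ?thesis using nn by (simp add: distrib_left distrib_right)
qed

lemma energy_step:
  assumes \<rho>: "scale \<rho>" and sol: "sol \<rho> u f" and c: "cutoff \<eta> m r0 r1" and L: "2 * \<rho> * L \<le> 1"
    and w: "w = (\<lambda>x. max (u x) 0)"
    and f1: "(\<integral>\<^sup>+x\<in>ball 0 (3/2). ennreal (\<bar>f x\<bar> powr q) \<partial>lborel) \<le> 1"
    and a: "emeasure lborel {x. 0 < \<eta> x * w x} \<le> ennreal a" "0 < a" "a \<le> vol"
    and D: "ennreal (2 * a_cac m) * (ennreal (c_in + c_out) * (\<integral>\<^sup>+x\<in>ball 0 r1. ennreal (w x powr p) \<partial>lborel)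
          + tail \<rho> L u * (\<integral>\<^sup>+x\<in>ball 0 r1. ennreal (w x) \<partial>lborel)) \<le> ennreal D" "0 \<le> D"
  shows "(\<integral>\<^sup>+x. ennreal ((\<eta> x * w x) powr p) \<partial>lborel)
    \<le> ennreal (fk_const * a powr \<theta> * (e_const * (D + a powr \<gamma>)))"
proof -
  note [measurable] = solD(1,2)[OF sol]
  have [measurable]: "\<eta> \<in> borel_measurable borel" using c by (simp add: cutoff_def)
  have [measurable]: "w \<in> borel_measurable borel" unfolding w by measurable
  define V where "V = (\<lambda>x. \<eta> x powr p * w x)"
  define v where "v = (\<lambda>x. \<eta> x * w x)"
  define fB where "fB x = f x * indicator (ball 0 (3/2)) x" for x
  have [measurable]: "V \<in> borel_measurable borel" "v \<in> borel_measurable borel" "fB \<in> borel_measurable borel"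
    unfolding V_def v_def fB_def by measurable
  have c': "\<And>x. 0 \<le> \<eta> x" "\<And>x. \<eta> x \<le> 1" "\<And>x. x \<notin> cball 0 r0 \<Longrightarrow> \<eta> x = 0" "r0 < 3/2"
    using c by (auto simp: cutoff_def)
  have w0: "0 \<le> w x" for x by (simp add: w)
  have v0: "0 \<le> v x" "0 \<le> V x" for x using c' w0 by (auto simp: v_def V_def)
  have Vv: "V x \<le> v x" for x
  proof -
    have "\<eta> x powr p \<le> \<eta> x powr 1" using c'(1,2)[of x] p by (intro powr_mono') auto
    then show ?thesis using c'(1)[of x] w0[of x] by (simp add: V_def v_def mult_right_mono)
  qed
  have pos_eq: "{x. 0 < V x} = {x. 0 < v x}"
  proof (intro Collect_cong)
    fix x
    show "(0 < V x) = (0 < v x)"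
      using c'(1)[of x] w0[of x] by (cases "\<eta> x = 0") (auto simp: V_def v_def zero_less_mult_iff)
  qed
  have fB1: "(\<integral>\<^sup>+x. ennreal (\<bar>fB x\<bar> powr q) \<partial>lborel) \<le> 1"
  proof -
    have "(\<integral>\<^sup>+x. ennreal (\<bar>fB x\<bar> powr q) \<partial>lborel) = (\<integral>\<^sup>+x\<in>ball 0 (3/2). ennreal (\<bar>f x\<bar> powr q) \<partial>lborel)"
      using q_gt by (intro nn_integral_cong) (auto simp: fB_def indicator_def)
    then show ?thesis using f1 by simp
  qed
  have fsupp: "\<bar>f x\<bar> * V x = \<bar>fB x\<bar> * V x" for x
  proof (cases "x \<in> ball 0 (3/2)")
    case False
    then have "\<eta> x = 0" using c' by auto
    then show ?thesis using p by (simp add: V_def)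
  qed (simp add: fB_def)
  have sob: "(\<integral>\<^sup>+x. ennreal (\<bar>fB x\<bar> * g x) \<partial>lborel) \<le> ennreal (s_const * a powr (1 / q' - 1 / pstar) * e powr (1 / p))"
    if [measurable]: "g \<in> borel_measurable borel" and g0: "\<And>x. 0 \<le> g x" and
      ga: "emeasure lborel {x. 0 < g x} \<le> ennreal a" and e: "gagliardo g \<le> ennreal e" "0 < e" for g e
  proof -
    define W where "W = sob_const q' * a powr (1 - q' / pstar) * e powr (q' / p)"
    have sc: "0 < sob_const q'" using sob_const_pos q' by auto
    have W: "0 < W" using sc a e by (simp add: W_def)
    have "(\<integral>\<^sup>+x. ennreal (g x powr q') \<partial>lborel) \<le> ennreal W"
      unfolding W_def using q' by (intro subcritical_sobolev g0 ga a e) auto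
    then have "(\<integral>\<^sup>+x. ennreal (\<bar>fB x\<bar> * g x) \<partial>lborel) \<le> ennreal (W powr (1 - 1 / q))"
      using q_gt W fB1 g0 by (intro nn_integral_holder_unit) (auto simp: q'_def)
    also have "W powr (1 - 1 / q) = s_const * a powr (1 / q' - 1 / pstar) * e powr (1 / p)"
    proof -
      have 1: "(1 - q' / pstar) * (1 - 1 / q) = 1 / q' - 1 / pstar" "q' / p * (1 - 1 / q) = 1 / p"
        unfolding q'(1)[symmetric] using q'(2) pstar_gt p by (auto simp: field_simps)
      have "W powr (1 - 1 / q) = s_const * (a powr (1 - q' / pstar)) powr (1 - 1 / q) * (e powr (q' / p)) powr (1 - 1 / q)"
        using sc a e by (simp add: W_def s_const_def powr_mult)
      then show ?thesis by (simp only: powr_powr 1)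
    qed
    finally show ?thesis .
  qed
  have kk: "0 < cac_low p * klow" using cac_low(1) klow_pos by simp
  have cac: "ennreal (cac_low p * klow) * gagliardo v \<le> (\<integral>\<^sup>+x. ennreal (\<bar>fB x\<bar> * V x) \<partial>lborel) + ennreal D"
  proof -
    have "ennreal (cac_low p * klow) * gagliardo v \<le> (\<integral>\<^sup>+x. ennreal (\<bar>f x\<bar> * V x) \<partial>lborel)
       + ennreal (2 * a_cac m) * (ennreal (c_in + c_out) * (\<integral>\<^sup>+x\<in>ball 0 r1. ennreal (w x powr p) \<partial>lborel)
          + tail \<rho> L u * (\<integral>\<^sup>+x\<in>ball 0 r1. ennreal (w x) \<partial>lborel))"
      using caccioppoli(1)[OF \<rho> sol c L w] by (simp add: v_def V_def)
    also have "\<dots> \<le> (\<integral>\<^sup>+x. ennreal (\<bar>f x\<bar> * V x) \<partial>lborel) + ennreal D" using D by (intro add_left_mono)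
    finally show ?thesis by (simp add: fsupp)
  qed
  \<comment> \<open>Absorption requires the energy of \<open>v\<close> to be finite beforehand. This
    is reached through \<open>V\<close>, an admissible test function: its finite energy bounds the
    integral of \<open>f * V\<close> by \<open>sob\<close>, and then \<open>cac\<close> bounds the
    energy of \<open>v\<close>. The factor \<open>1 / ln 2\<close> reflects
    \<open>\<rho> * dist x y \<le> 1 / 2\<close>.\<close>
  have gV: "gagliardo V < \<infinity>"
  proof -
    note fin = test_function_equation(3)[OF \<rho> sol c w V_def refl]
    have "gagliardo V \<le> (\<integral>\<^sup>+x. (\<integral>\<^sup>+y. ennreal (1 / ln 2) * ennreal (kplus \<rho> (dist x y) * \<bar>V x - V y\<bar> powr p) \<partial>lborel) \<partial>lborel)"
      unfolding gagliardo_def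
    proof (intro nn_integral_mono)
      fix x y :: 'a
      show "ennreal (\<bar>V x - V y\<bar> powr p / dist x y powr (DIM('a) + s * p)) * indicator (ball x 2) y
         \<le> ennreal (1 / ln 2) * ennreal (kplus \<rho> (dist x y) * \<bar>V x - V y\<bar> powr p)"
      proof (cases "y \<in> ball x 2 \<and> x \<noteq> y")
        case True
        then have "\<rho> * dist x y \<le> 1 / 4 * 2" using \<rho> by (intro mult_mono) (auto simp: scale_def)
        moreover have "0 < \<rho> * dist x y" using True \<rho> by (simp add: scale_def)
        ultimately have "ln (\<rho> * dist x y) \<le> ln (1 / 2)" by (subst ln_le_cancel_iff) auto
        then have "ln 2 \<le> max (- ln (\<rho> * dist x y)) 0" by (simp add: ln_div)
        then have "1 \<le> 1 / ln 2 * max (- ln (\<rho> * dist x y)) 0" by (simp add: field_simps)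
        then have "1 * (\<bar>V x - V y\<bar> powr p / dist x y powr dsp)
          \<le> 1 / ln 2 * max (- ln (\<rho> * dist x y)) 0 * (\<bar>V x - V y\<bar> powr p / dist x y powr dsp)"
          by (intro mult_right_mono) auto
        then have "\<bar>V x - V y\<bar> powr p / dist x y powr dsp \<le> 1 / ln 2 * (kplus \<rho> (dist x y) * \<bar>V x - V y\<bar> powr p)"
          by (simp add: kplus_def)
        then have "ennreal (\<bar>V x - V y\<bar> powr p / dist x y powr dsp) \<le> ennreal (1 / ln 2) * ennreal (kplus \<rho> (dist x y) * \<bar>V x - V y\<bar> powr p)"
          by (subst ennreal_mult[symmetric]) (auto simp: kplus_nonneg intro: ennreal_leI)
        then show ?thesis using True by (simp add: dsp_def)
      qed (use p in auto)
    qed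
    also have "\<dots> = ennreal (1 / ln 2) * (\<integral>\<^sup>+x. (\<integral>\<^sup>+y. ennreal (kplus \<rho> (dist x y) * \<bar>V x - V y\<bar> powr p) \<partial>lborel) \<partial>lborel)"
    proof -
      have "(\<integral>\<^sup>+x. (\<integral>\<^sup>+y. ennreal (1 / ln 2) * ennreal (kplus \<rho> (dist x y) * \<bar>V x - V y\<bar> powr p) \<partial>lborel) \<partial>lborel)
        = (\<integral>\<^sup>+x. ennreal (1 / ln 2) * (\<integral>\<^sup>+y. ennreal (kplus \<rho> (dist x y) * \<bar>V x - V y\<bar> powr p) \<partial>lborel) \<partial>lborel)"
        by (intro nn_integral_cong nn_integral_cmult) measurable
      also have "\<dots> = ennreal (1 / ln 2) * (\<integral>\<^sup>+x. (\<integral>\<^sup>+y. ennreal (kplus \<rho> (dist x y) * \<bar>V x - V y\<bar> powr p) \<partial>lborel) \<partial>lborel)"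
        by (rule nn_integral_cmult) measurable
      finally show ?thesis .
    qed
    also have "\<dots> < \<infinity>" using fin by (auto simp: ennreal_mult_less_top)
    finally show ?thesis .
  qed
  have gv: "gagliardo v < \<infinity>"
  proof -
    have "gagliardo V \<le> ennreal (enn2real (gagliardo V) + 1)"
      using gV by (cases "gagliardo V") auto
    then have "(\<integral>\<^sup>+x. ennreal (\<bar>fB x\<bar> * V x) \<partial>lborel) < \<infinity>"
      using a pos_eq v0
      by (intro le_less_trans[OF sob[of V "enn2real (gagliardo V) + 1"]]) (auto simp: v_def intro: add_nonneg_pos)
    then have "ennreal (cac_low p * klow) * gagliardo v < \<infinity>"
      by (intro le_less_trans[OF cac]) auto
    then show ?thesis using kk by (auto simp: ennreal_mult_less_top)
  qed
  define E where "E = enn2real (gagliardo v)"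
  have E: "gagliardo v = ennreal E" "0 \<le> E" using gv by (auto simp: E_def)
  have "E \<le> e_const * (D + a powr \<gamma>)"
  proof (cases "E = 0")
    case True
    then show ?thesis using e_const_pos D by simp
  next
    case False
    then have Ep: "0 < E" using E by simp
    have "(\<integral>\<^sup>+x. ennreal (\<bar>fB x\<bar> * V x) \<partial>lborel) \<le> (\<integral>\<^sup>+x. ennreal (\<bar>fB x\<bar> * v x) \<partial>lborel)"
      using Vv by (intro nn_integral_mono ennreal_leI mult_left_mono) auto
    also have "\<dots> \<le> ennreal (s_const * a powr (1 / q' - 1 / pstar) * E powr (1 / p))"
      using a v0 E Ep by (intro sob) (auto simp: v_def)
    finally have "ennreal (cac_low p * klow) * ennreal E
       \<le> ennreal (s_const * a powr (1 / q' - 1 / pstar) * E powr (1 / p)) + ennreal D"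
      using order_trans[OF cac add_right_mono] unfolding E(1) by blast
    then have "ennreal (cac_low p * klow * E) \<le> ennreal (s_const * a powr (1 / q' - 1 / pstar) * E powr (1 / p) + D)"
      using kk E D by (simp add: ennreal_mult s_const_def)
    then have "cac_low p * klow * E \<le> D + s_const * a powr (1 / q' - 1 / pstar) * E powr (1 / p)"
      using D by (subst (asm) ennreal_le_iff) (auto simp: s_const_def)
    then show ?thesis
      using young_energy[OF kk Ep, of s_const D "a powr (1 / q' - 1 / pstar)"] D
      by (simp add: e_const_def s_const_def powr_powr \<gamma>_def)
  qed
  then have "ennreal (fk_const * a powr \<theta>) * gagliardo v \<le> ennreal (fk_const * a powr \<theta>) * ennreal (e_const * (D + a powr \<gamma>))"
    unfolding E(1) by (intro mult_left_mono ennreal_leI) auto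
  also have "\<dots> = ennreal (fk_const * a powr \<theta> * (e_const * (D + a powr \<gamma>)))"
    using fk_const_pos e_const_pos D by (subst ennreal_mult) auto
  finally have "ennreal (fk_const * a powr \<theta>) * gagliardo v \<le> \<dots>" .
  moreover have "(\<integral>\<^sup>+x. ennreal (v x powr p) \<partial>lborel) \<le> ennreal (fk_const * a powr \<theta>) * gagliardo v"
    using a by (intro faber_krahn v0) (auto simp: v_def)
  ultimately show ?thesis unfolding v_def by (rule order_trans[rotated])
qed

end

section \<open>Affine changes of the solution\<close>

lemma affine_powr_le:
  fixes a b t r :: real
  assumes "0 \<le> r"
  shows "\<bar>a * t + b\<bar> powr r \<le> 2 powr r * (\<bar>a\<bar> powr r * \<bar>t\<bar> powr r + \<bar>b\<bar> powr r)"
proof -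
  have "\<bar>a * t + b\<bar> \<le> \<bar>a\<bar> * \<bar>t\<bar> + \<bar>b\<bar>" by (metis abs_mult abs_triangle_ineq)
  then have "\<bar>a * t + b\<bar> powr r \<le> (\<bar>a\<bar> * \<bar>t\<bar> + \<bar>b\<bar>) powr r" using assms by (intro powr_mono2) auto
  also have "\<dots> \<le> 2 powr r * ((\<bar>a\<bar> * \<bar>t\<bar>) powr r + \<bar>b\<bar> powr r)" using assms by (intro powr_add_le) auto
  finally show ?thesis by (simp add: powr_mult)
qed

lemma signed_powr_mult: "signed_powr p (a * t) = signed_powr p a * signed_powr p t"
  by (simp add: signed_powr_def abs_mult powr_mult)

context log_kernel
begin

text \<open>The operator is homogeneous of degree \<open>p - 1\<close> and annihilates constants.
  This covers the subtraction of levels, the change of sign and all normalisations below; the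
  integrability conditions survive because constants have a finite tail.\<close>

lemma sol_affine:
  assumes \<rho>: "scale \<rho>" and sol: "sol \<rho> u f" and a: "a \<noteq> 0"
  shows "sol \<rho> (\<lambda>x. a * u x + b) (\<lambda>x. signed_powr p a * f x)"
  unfolding sol_def
proof (intro conjI allI impI)
  note [measurable] = solD(1,2)[OF sol]
  show "(\<lambda>x. a * u x + b) \<in> borel_measurable borel" "(\<lambda>x. signed_powr p a * f x) \<in> borel_measurable borel"
    by measurable
  have gen: "(\<integral>\<^sup>+x\<in>A. ennreal (h x * \<bar>a * u x + b\<bar> powr r) \<partial>lborel) < \<infinity>"
    if [measurable]: "A \<in> sets borel" "h \<in> borel_measurable borel" and h: "\<And>x. 0 \<le> h x" and r: "0 \<le> r"
      and 1: "(\<integral>\<^sup>+x\<in>A. ennreal (h x * \<bar>u x\<bar> powr r) \<partial>lborel) < \<infinity>" and 2: "(\<integral>\<^sup>+x\<in>A. ennreal (h x) \<partial>lborel) < \<infinity>"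
    for A h r
  proof -
    have le: "ennreal (h x * \<bar>a * u x + b\<bar> powr r) * indicator A x \<le> ennreal (2 powr r * \<bar>a\<bar> powr r) * (ennreal (h x * \<bar>u x\<bar> powr r) * indicator A x)
        + ennreal (2 powr r * \<bar>b\<bar> powr r) * (ennreal (h x) * indicator A x)" for x
    proof (cases "x \<in> A")
      case True
      have "h x * \<bar>a * u x + b\<bar> powr r \<le> h x * (2 powr r * (\<bar>a\<bar> powr r * \<bar>u x\<bar> powr r + \<bar>b\<bar> powr r))"
        using h r by (intro mult_left_mono affine_powr_le) auto
      also have "\<dots> = 2 powr r * \<bar>a\<bar> powr r * (h x * \<bar>u x\<bar> powr r) + 2 powr r * \<bar>b\<bar> powr r * h x"
        by (simp add: algebra_simps)
      finally have "ennreal (h x * \<bar>a * u x + b\<bar> powr r) \<le> ennreal (2 powr r * \<bar>a\<bar> powr r * (h x * \<bar>u x\<bar> powr r) + 2 powr r * \<bar>b\<bar> powr r * h x)"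
        by (rule ennreal_leI)
      also have "\<dots> = ennreal (2 powr r * \<bar>a\<bar> powr r) * ennreal (h x * \<bar>u x\<bar> powr r) + ennreal (2 powr r * \<bar>b\<bar> powr r) * ennreal (h x)"
        using h[of x] by (simp add: ennreal_plus ennreal_mult)
      finally show ?thesis using True by simp
    qed simp
    have "(\<integral>\<^sup>+x\<in>A. ennreal (h x * \<bar>a * u x + b\<bar> powr r) \<partial>lborel) \<le> (\<integral>\<^sup>+x. ennreal (2 powr r * \<bar>a\<bar> powr r) * (ennreal (h x * \<bar>u x\<bar> powr r) * indicator A x)
        + ennreal (2 powr r * \<bar>b\<bar> powr r) * (ennreal (h x) * indicator A x) \<partial>lborel)"
      by (intro nn_integral_mono le)
    also have "\<dots> = ennreal (2 powr r * \<bar>a\<bar> powr r) * (\<integral>\<^sup>+x\<in>A. ennreal (h x * \<bar>u x\<bar> powr r) \<partial>lborel)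
        + ennreal (2 powr r * \<bar>b\<bar> powr r) * (\<integral>\<^sup>+x\<in>A. ennreal (h x) \<partial>lborel)"
      by (subst nn_integral_add, measurable, subst nn_integral_cmult, measurable, subst nn_integral_cmult, measurable)
    also have "\<dots> < \<infinity>" using 1 2 by (auto simp: ennreal_mult_less_top)
    finally show ?thesis .
  qed
  show "(\<integral>\<^sup>+x\<in>ball 0 (3/2). ennreal (\<bar>a * u x + b\<bar> powr p) \<partial>lborel) < \<infinity>"
    using gen[of "ball 0 (3/2)" "\<lambda>_. 1" p] solD(3)[OF sol] p emeasure_lborel_ball_finite[of 0 "3/2"] by simp
  show "(\<integral>\<^sup>+y\<in>- ball 0 1. ennreal (kmaj \<rho> (norm y) * \<bar>a * u y + b\<bar> powr (p - 1)) \<partial>lborel) < \<infinity>"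
    using p solD(5)[OF sol] kmaj_nonneg[OF \<rho>] kmaj_outside[OF \<rho>]
    by (intro gen) (auto intro: le_less_trans)
  have "(\<integral>\<^sup>+x. (\<integral>\<^sup>+y. ennreal (core \<rho> (\<lambda>x. a * u x + b) x y) \<partial>lborel) \<partial>lborel)
     = (\<integral>\<^sup>+x. (\<integral>\<^sup>+y. ennreal (\<bar>a\<bar> powr p) * ennreal (core \<rho> u x y) \<partial>lborel) \<partial>lborel)"
  proof (intro nn_integral_cong)
    fix x y :: 'a
    have "\<bar>a * u x + b - (a * u y + b)\<bar> = \<bar>a\<bar> * \<bar>u x - u y\<bar>" by (simp add: abs_mult[symmetric] algebra_simps)
    then have "core \<rho> (\<lambda>x. a * u x + b) x y = \<bar>a\<bar> powr p * core \<rho> u x y"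
      by (simp add: core_def powr_mult mult_ac)
    then show "ennreal (core \<rho> (\<lambda>x. a * u x + b) x y) = ennreal (\<bar>a\<bar> powr p) * ennreal (core \<rho> u x y)"
      using core_nonneg[OF \<rho>] by (simp add: ennreal_mult)
  qed
  also have "\<dots> = ennreal (\<bar>a\<bar> powr p) * (\<integral>\<^sup>+x. (\<integral>\<^sup>+y. ennreal (core \<rho> u x y) \<partial>lborel) \<partial>lborel)"
  proof -
    have "(\<integral>\<^sup>+x. (\<integral>\<^sup>+y. ennreal (\<bar>a\<bar> powr p) * ennreal (core \<rho> u x y) \<partial>lborel) \<partial>lborel)
      = (\<integral>\<^sup>+x. ennreal (\<bar>a\<bar> powr p) * (\<integral>\<^sup>+y. ennreal (core \<rho> u x y) \<partial>lborel) \<partial>lborel)"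
      unfolding core_def by (intro nn_integral_cong nn_integral_cmult) measurable
    also have "\<dots> = ennreal (\<bar>a\<bar> powr p) * (\<integral>\<^sup>+x. (\<integral>\<^sup>+y. ennreal (core \<rho> u x y) \<partial>lborel) \<partial>lborel)"
      unfolding core_def by (rule nn_integral_cmult) measurable
    finally show ?thesis .
  qed
  also have "\<dots> < \<infinity>" using solD(4)[OF sol] by (auto simp: ennreal_mult_less_top)
  finally show "(\<integral>\<^sup>+x. (\<integral>\<^sup>+y. ennreal (indicator (ball 0 (3/2)) x * indicator (ball 0 (3/2)) y
        * (ker \<rho> (dist x y) * \<bar>a * u x + b - (a * u y + b)\<bar> powr p)) \<partial>lborel) \<partial>lborel) < \<infinity>"
    by (simp add: core_def)
  fix v :: "'a \<Rightarrow> real" and r :: real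
  assume v: "r < 3/2 \<and> v \<in> borel_measurable borel \<and> (\<forall>x. 0 \<le> v x) \<and> (\<forall>x. x \<notin> cball 0 r \<longrightarrow> v x = 0) \<and>
        (\<integral>\<^sup>+x. ennreal (v x powr p) \<partial>lborel) < \<infinity> \<and>
        (\<integral>\<^sup>+x. (\<integral>\<^sup>+y. ennreal (kplus \<rho> (dist x y) * \<bar>v x - v y\<bar> powr p) \<partial>lborel) \<partial>lborel) < \<infinity>"
  have eqn: "(\<integral>z. ker \<rho> (dist (fst z) (snd z)) * signed_powr p (u (fst z) - u (snd z)) * (v (fst z) - v (snd z))
           \<partial>(lborel \<Otimes>\<^sub>M lborel)) = (\<integral>x. f x * v x \<partial>lborel)"
    using v by (intro sol_equation[OF sol, of r]) auto
  have "signed_powr p (a * u x + b - (a * u y + b)) = signed_powr p a * signed_powr p (u x - u y)" for x y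
    unfolding signed_powr_mult[symmetric] by (simp add: algebra_simps)
  then have "(\<integral>z. ker \<rho> (dist (fst z) (snd z)) * signed_powr p (a * u (fst z) + b - (a * u (snd z) + b)) * (v (fst z) - v (snd z)) \<partial>(lborel \<Otimes>\<^sub>M lborel))
    = (\<integral>z. signed_powr p a * (ker \<rho> (dist (fst z) (snd z)) * signed_powr p (u (fst z) - u (snd z)) * (v (fst z) - v (snd z))) \<partial>(lborel \<Otimes>\<^sub>M lborel))"
    by (simp add: mult_ac)
  also have "\<dots> = signed_powr p a * (\<integral>x. f x * v x \<partial>lborel)" by (simp only: integral_mult_right_zero eqn)
  also have "\<dots> = (\<integral>x. signed_powr p a * f x * v x \<partial>lborel)" by (simp only: integral_mult_right_zero mult.assoc)
  finally show "(\<integral>z. ker \<rho> (dist (fst z) (snd z)) * signed_powr p (a * u (fst z) + b - (a * u (snd z) + b)) * (v (fst z) - v (snd z)) \<partial>(lborel \<Otimes>\<^sub>M lborel))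
    = (\<integral>x. signed_powr p a * f x * v x \<partial>lborel)" .
qed

lemma signed_powr_one: "signed_powr p 1 = 1" "signed_powr p (- 1) = - 1"
  by (simp_all add: signed_powr_def)

lemma sol_shift: "scale \<rho> \<Longrightarrow> sol \<rho> u f \<Longrightarrow> sol \<rho> (\<lambda>x. u x - k) f"
  using sol_affine[of \<rho> u f 1 "- k"] by (simp add: signed_powr_one)

lemma tail_bound:
  assumes \<rho>: "scale \<rho>" and [measurable]: "u \<in> borel_measurable borel" and k: "0 \<le> k"
    and le: "\<And>y. tail_fun L v y \<le> tail_fun L u y + k"
  shows "tail \<rho> L v \<le> ennreal (2 powr p) * (tail \<rho> L u + ennreal (k powr (p - 1) * c_out))"
proof -
  have pt: "kmaj \<rho> (norm y) * tail_fun L v y powr (p - 1)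
     \<le> 2 powr p * (kmaj \<rho> (norm y) * tail_fun L u y powr (p - 1)) + 2 powr p * k powr (p - 1) * kmaj \<rho> (norm y)" for y :: 'a
  proof -
    have "tail_fun L v y powr (p - 1) \<le> (tail_fun L u y + k) powr (p - 1)"
      using le tail_fun_nonneg p by (intro powr_mono2) auto
    also have "\<dots> \<le> 2 powr (p - 1) * (tail_fun L u y powr (p - 1) + k powr (p - 1))"
      using tail_fun_nonneg k p by (intro powr_add_le) auto
    also have "\<dots> \<le> 2 powr p * (tail_fun L u y powr (p - 1) + k powr (p - 1))"
      by (intro mult_right_mono powr_mono) auto
    finally have "kmaj \<rho> (norm y) * tail_fun L v y powr (p - 1)
      \<le> kmaj \<rho> (norm y) * (2 powr p * (tail_fun L u y powr (p - 1) + k powr (p - 1)))"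
      using kmaj_nonneg[OF \<rho>] by (intro mult_left_mono) auto
    then show ?thesis by (simp add: algebra_simps)
  qed
  have "tail \<rho> L v \<le> (\<integral>\<^sup>+y. ennreal (2 powr p) * (ennreal (kmaj \<rho> (norm y) * tail_fun L u y powr (p - 1)) * indicator (- ball (0::'a) 1) y)
      + ennreal (2 powr p * k powr (p - 1)) * (ennreal (kmaj \<rho> (norm y)) * indicator (- ball 0 1) y) \<partial>lborel)"
    unfolding tail_def
  proof (intro nn_integral_mono)
    fix y :: 'a
    have "ennreal (kmaj \<rho> (norm y) * tail_fun L v y powr (p - 1))
      \<le> ennreal (2 powr p * (kmaj \<rho> (norm y) * tail_fun L u y powr (p - 1)) + 2 powr p * k powr (p - 1) * kmaj \<rho> (norm y))"
      by (rule ennreal_leI[OF pt])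
    also have "\<dots> = ennreal (2 powr p) * ennreal (kmaj \<rho> (norm y) * tail_fun L u y powr (p - 1)) + ennreal (2 powr p * k powr (p - 1)) * ennreal (kmaj \<rho> (norm y))"
      using kmaj_nonneg[OF \<rho>, of "norm y"] by (simp add: ennreal_plus ennreal_mult)
    finally show "ennreal (kmaj \<rho> (norm y) * tail_fun L v y powr (p - 1)) * indicator (- ball 0 1) y
      \<le> ennreal (2 powr p) * (ennreal (kmaj \<rho> (norm y) * tail_fun L u y powr (p - 1)) * indicator (- ball (0::'a) 1) y)
      + ennreal (2 powr p * k powr (p - 1)) * (ennreal (kmaj \<rho> (norm y)) * indicator (- ball 0 1) y)"
      by (cases "y \<in> ball 0 1") auto
  qed
  also have "\<dots> = ennreal (2 powr p) * tail \<rho> L u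
      + ennreal (2 powr p * k powr (p - 1)) * (\<integral>\<^sup>+y\<in>- ball (0::'a) 1. ennreal (kmaj \<rho> (norm y)) \<partial>lborel)"
    unfolding tail_def
    by (subst nn_integral_add, measurable, subst nn_integral_cmult, measurable, subst nn_integral_cmult, measurable)
  also have "\<dots> \<le> ennreal (2 powr p) * tail \<rho> L u + ennreal (2 powr p * k powr (p - 1)) * ennreal c_out"
    by (intro add_left_mono mult_left_mono kmaj_outside[OF \<rho>]) auto
  also have "\<dots> = ennreal (2 powr p) * (tail \<rho> L u + ennreal (k powr (p - 1) * c_out))"
    using c_nonneg by (simp add: distrib_left ennreal_mult mult.assoc)
  finally show ?thesis .
qed

lemma cutoff_exists:
  fixes r R r1 m :: real
  assumes "0 < r" "r < R" "R < r1" "1 \<le> r1" "r1 \<le> 3/2" "2 \<le> m" "1 / (R - r) \<le> m" "r1 \<le> m * (r1 - R)"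
  obtains \<eta> where "cutoff \<eta> m R r1" "\<And>x. x \<in> ball 0 r \<Longrightarrow> \<eta> x = 1"
proof
  define \<eta> where "\<eta> x = min 1 (max 0 ((R - norm x) / (R - r)))" for x :: 'a
  have "\<bar>\<eta> x - \<eta> y\<bar> \<le> m * dist x y" for x y
  proof -
    have "\<bar>\<eta> x - \<eta> y\<bar> \<le> \<bar>(R - norm x) / (R - r) - (R - norm y) / (R - r)\<bar>"
    proof -
      have "\<bar>min 1 (max 0 A) - min 1 (max 0 B)\<bar> \<le> \<bar>A - B\<bar>" for A B :: real
        by (auto simp: min_def max_def)
      then show ?thesis unfolding \<eta>_def .
    qed
    also have "\<dots> = \<bar>norm y - norm x\<bar> * (1 / (R - r))"
      using assms by (simp add: diff_divide_distrib[symmetric] abs_div)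
    also have "\<dots> \<le> dist x y * m"
      using assms norm_triangle_ineq3[of y x] by (intro mult_mono) (auto simp: dist_norm norm_minus_commute)
    finally show ?thesis by (simp add: mult.commute)
  qed
  moreover have "\<eta> x = 0" if "x \<notin> cball 0 R" for x
  proof -
    have "(R - norm x) / (R - r) \<le> 0" using that assms by (intro divide_nonpos_pos) auto
    then show ?thesis by (simp add: \<eta>_def)
  qed
  moreover have "\<eta> \<in> borel_measurable borel" unfolding \<eta>_def by measurable
  ultimately show "cutoff \<eta> m R r1" using assms by (auto simp: cutoff_def \<eta>_def)
  show "\<eta> x = 1" if "x \<in> ball 0 r" for x
    using that assms by (simp add: \<eta>_def min_def max_def field_simps)
qed

section \<open>De Giorgi iteration\<close>

definition level :: "nat \<Rightarrow> real" where "level j = 1 - (1 / 2) ^ j"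
definition radius :: "nat \<Rightarrow> real" where "radius j = 1 + (1 / 2) ^ j / 4"
definition "excess u j = (\<integral>\<^sup>+x\<in>ball (0::'a) (radius j). ennreal (max (u x - level j) 0 powr p) \<partial>lborel)"

lemma level_powr: "(1 / 2 :: real) ^ j = 2 powr - real j"
  by (simp add: powr_minus powr_realpow power_one_over inverse_eq_divide)

text \<open>The number \<open>D\<close> of \<open>energy_step\<close> at stage \<open>j\<close>. If
  \<open>z\<close> bounds the integral of p-th powers, the first power is bounded by
  \<open>2 powr ((j + 1) * (p - 1)) * z\<close>, because the previous truncation is at least
  \<open>2 powr - (j + 1)\<close> where the new one is positive.\<close>

definition "dg_data T j z = 2 * a_cac (2 powr (real j + 6)) * ((c_in + c_out) * z + T * (2 powr ((real j + 1) * (p - 1)) * z))"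

lemma de_giorgi_step:
  assumes \<rho>: "scale \<rho>" and L: "2 * \<rho> * L \<le> 1" and sol: "sol \<rho> u f"
    and T: "tail \<rho> L u \<le> ennreal T0" "0 \<le> T0"
    and f1: "(\<integral>\<^sup>+x\<in>ball 0 (3/2). ennreal (\<bar>f x\<bar> powr q) \<partial>lborel) \<le> 1"
    and z: "excess u j \<le> ennreal z" "0 < z" and a: "a = 2 powr ((real j + 1) * p) * z" "a \<le> vol"
    and T': "T' = 2 powr p * (T0 + c_out)"
  shows "excess u (Suc j) \<le> ennreal (fk_const * a powr \<theta> * (e_const * (dg_data T' j z + a powr \<gamma>)))"
proof -
  note [measurable] = solD(1,2)[OF sol]
  define k where "k = level (Suc j)"
  define w where "w = (\<lambda>x. max (u x - k) 0)"
  have [measurable]: "w \<in> borel_measurable borel" unfolding w_def by measurable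
  have h0: "0 < (1 / 2 :: real) ^ j" "(1 / 2 :: real) ^ j \<le> 1" by (auto intro: power_le_one)
  have k01: "0 \<le> k" "k \<le> 1" unfolding k_def level_def using h0 by auto
  have w0: "0 \<le> w x" for x by (simp add: w_def)
  define t :: real where "t = (1 / 2) ^ j"
  have t: "0 < t" "t \<le> 1" using h0 by (auto simp: t_def)
  have rad: "radius j = 1 + t / 4" "radius (Suc j) = 1 + t / 8" by (auto simp: radius_def t_def)
  \<comment> \<open>The intermediate radius \<open>1 + t * 3 / 16\<close> lies halfway between the
    two radii, at distance \<open>t / 16\<close> from each. With \<open>64 / t\<close> the product
    of slope and gap is 4, enough both for the slope and for the condition on
    \<open>radius j\<close>.\<close>
  have m: "2 powr (real j + 6) = 64 / t"
    by (simp add: powr_add powr_realpow power_one_over t_def)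
  have "1 / (1 + t * 3 / 16 - radius (Suc j)) \<le> 2 powr (real j + 6)"
    "radius j \<le> 2 powr (real j + 6) * (radius j - (1 + t * 3 / 16))"
    "0 < radius (Suc j)" "radius (Suc j) < 1 + t * 3 / 16" "1 + t * 3 / 16 < radius j" "1 \<le> radius j" "radius j \<le> 3/2"
    unfolding m rad using t by (auto simp: field_simps)
  moreover have "2 \<le> 2 powr (real j + 6)" using powr_mono[of 1 "real j + 6" 2] by simp
  ultimately obtain \<eta> :: "'a \<Rightarrow> real" where c: "cutoff \<eta> (2 powr (real j + 6)) (1 + t * 3 / 16) (radius j)"
    and \<eta>1: "\<And>x. x \<in> ball 0 (radius (Suc j)) \<Longrightarrow> \<eta> x = 1"
    using cutoff_exists[of "radius (Suc j)" "1 + t * 3 / 16" "radius j" "2 powr (real j + 6)"] by metis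
  have rj: "radius j \<le> 5/4" "radius (Suc j) \<le> radius j" using t by (auto simp: rad)
  have c': "\<And>x. 0 \<le> \<eta> x" "\<And>x. \<eta> x \<le> 1" "\<And>x. x \<notin> ball 0 (radius j) \<Longrightarrow> \<eta> x = 0"
    using c by (auto simp: cutoff_def)
  define g where "g x = max (u x - level j) 0" for x
  have [measurable]: "g \<in> borel_measurable borel" unfolding g_def by measurable
  have gap: "k - level j = 2 powr - (real j + 1)"
    by (simp add: k_def level_def level_powr powr_add powr_diff powr_minus)
  have kl: "level j \<le> k" using gap powr_ge_zero[of 2 "- (real j + 1)"] by linarith
  have wg: "w x \<le> g x" "0 < w x \<Longrightarrow> 2 powr - (real j + 1) \<le> g x" for x
    using kl unfolding gap[symmetric] by (auto simp: w_def g_def)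
  have exj: "excess u j = (\<integral>\<^sup>+x\<in>ball (0::'a) (radius j). ennreal (g x powr p) \<partial>lborel)"
    by (simp add: excess_def g_def)
  \<comment> \<open>Chebyshev's inequality in pointwise form, used with \<open>r = p\<close> for the
    measure of the support and with \<open>r = p - 1\<close> for the integral of
    \<open>w\<close>.\<close>
  have cheb: "1 \<le> 2 powr ((real j + 1) * r) * g x powr r" if "0 < w x" "0 < r" for x r
  proof -
    have "(2 powr - (real j + 1)) powr r \<le> g x powr r" using wg(2)[OF that(1)] that by (intro powr_mono2) auto
    then have "2 powr ((real j + 1) * r) * 2 powr - ((real j + 1) * r) \<le> 2 powr ((real j + 1) * r) * g x powr r"
      unfolding powr_powr minus_mult_left[symmetric] by (rule mult_left_mono) simp
    then show ?thesis by (simp add: powr_add[symmetric])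
  qed
  have cmult: "(\<integral>\<^sup>+x. ennreal C * (ennreal (g x powr p) * indicator (ball 0 (radius j)) x) \<partial>lborel) = ennreal C * excess u j" for C
    unfolding exj by (rule nn_integral_cmult) measurable
  have "ennreal (2 powr ((real j + 1) * p)) * excess u j \<le> ennreal a"
    unfolding a(1) using z by (subst ennreal_mult) (auto intro: mult_left_mono)
  have aset: "emeasure lborel {x. 0 < \<eta> x * w x} \<le> ennreal a"
  proof -
    have "emeasure lborel {x. 0 < \<eta> x * w x} = (\<integral>\<^sup>+x. indicator {x. 0 < \<eta> x * w x} x \<partial>lborel)"
      using c by (subst nn_integral_indicator) (auto simp: cutoff_def)
    also have "\<dots> \<le> (\<integral>\<^sup>+x. ennreal (2 powr ((real j + 1) * p)) * (ennreal (g x powr p) * indicator (ball 0 (radius j)) x) \<partial>lborel)"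
    proof (intro nn_integral_mono)
      fix x :: 'a
      show "indicator {x. 0 < \<eta> x * w x} x \<le> ennreal (2 powr ((real j + 1) * p)) * (ennreal (g x powr p) * indicator (ball 0 (radius j)) x)"
      proof (cases "0 < \<eta> x * w x")
        case True
        then have x: "x \<in> ball 0 (radius j)" "0 < w x" using c'(1)[of x] c'(3)[of x] w0[of x]
          by (auto simp: zero_less_mult_iff simp del: mem_ball)
        have "ennreal 1 \<le> ennreal (2 powr ((real j + 1) * p) * g x powr p)" using cheb[OF x(2)] p by (intro ennreal_leI) auto
        then show ?thesis using x True by (simp add: ennreal_mult)
      qed simp
    qed
    also have "\<dots> \<le> ennreal a" unfolding cmult by fact
    finally show ?thesis .
  qed
  have "0 < a" unfolding a(1) using z by simp
  have wp: "(\<integral>\<^sup>+x\<in>ball 0 (radius j). ennreal (w x powr p) \<partial>lborel) \<le> ennreal z"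
  proof -
    have "(\<integral>\<^sup>+x\<in>ball 0 (radius j). ennreal (w x powr p) \<partial>lborel) \<le> excess u j"
      unfolding exj using wg(1) w0 p by (intro nn_integral_mono mult_right_mono ennreal_leI powr_mono2) auto
    then show ?thesis using z by simp
  qed
  have w1: "(\<integral>\<^sup>+x\<in>ball 0 (radius j). ennreal (w x) \<partial>lborel) \<le> ennreal (2 powr ((real j + 1) * (p - 1)) * z)"
  proof -
    have "(\<integral>\<^sup>+x\<in>ball 0 (radius j). ennreal (w x) \<partial>lborel) \<le> (\<integral>\<^sup>+x. ennreal (2 powr ((real j + 1) * (p - 1))) * (ennreal (g x powr p) * indicator (ball 0 (radius j)) x) \<partial>lborel)"
    proof (intro nn_integral_mono)
      fix x :: 'a
      have "w x \<le> 2 powr ((real j + 1) * (p - 1)) * g x powr p"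
      proof (cases "0 < w x")
        case True
        have "1 * g x \<le> 2 powr ((real j + 1) * (p - 1)) * g x powr (p - 1) * g x"
          using cheb[OF True, of "p - 1"] p by (intro mult_right_mono) (auto simp: g_def)
        also have "\<dots> = 2 powr ((real j + 1) * (p - 1)) * g x powr p" using powr_split[of "g x" p] p by (simp add: g_def)
        finally show ?thesis using wg(1)[of x] by simp
      next
        case False
        then show ?thesis using w0[of x] by simp
      qed
      then have "ennreal (w x) \<le> ennreal (2 powr ((real j + 1) * (p - 1))) * ennreal (g x powr p)"
        by (subst ennreal_mult[symmetric]) (auto intro: ennreal_leI)
      then show "ennreal (w x) * indicator (ball 0 (radius j)) x \<le> ennreal (2 powr ((real j + 1) * (p - 1))) * (ennreal (g x powr p) * indicator (ball 0 (radius j)) x)"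
        by (auto simp: indicator_def)
    qed
    also have "\<dots> = ennreal (2 powr ((real j + 1) * (p - 1))) * excess u j" by (rule cmult)
    also have "\<dots> \<le> ennreal (2 powr ((real j + 1) * (p - 1)) * z)"
      using z by (subst ennreal_mult) (auto intro: mult_left_mono)
    finally show ?thesis .
  qed
  have T'0: "0 \<le> T'" using T' T c_nonneg by simp
  have tl: "tail \<rho> L (\<lambda>x. u x - k) \<le> ennreal T'"
  proof -
    have "tail \<rho> L (\<lambda>x. u x - k) \<le> ennreal (2 powr p) * (tail \<rho> L u + ennreal (k powr (p - 1) * c_out))"
      using k01 by (intro tail_bound[OF \<rho>]) (auto simp: tail_fun_def)
    also have "\<dots> \<le> ennreal (2 powr p) * (ennreal T0 + ennreal c_out)"
      using k01 c_nonneg p powr_mono2[of "p - 1" k 1] T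
      by (intro mult_left_mono add_mono ennreal_leI) (auto intro: mult_left_le_one_le)
    also have "\<dots> = ennreal T'" using T c_nonneg by (simp add: T' ennreal_mult)
    finally show ?thesis .
  qed
  have D: "ennreal (2 * a_cac (2 powr (real j + 6))) * (ennreal (c_in + c_out) * (\<integral>\<^sup>+x\<in>ball 0 (radius j). ennreal (w x powr p) \<partial>lborel)
          + tail \<rho> L (\<lambda>x. u x - k) * (\<integral>\<^sup>+x\<in>ball 0 (radius j). ennreal (w x) \<partial>lborel)) \<le> ennreal (dg_data T' j z)"
  proof -
    have "ennreal (2 * a_cac (2 powr (real j + 6))) * (ennreal (c_in + c_out) * (\<integral>\<^sup>+x\<in>ball 0 (radius j). ennreal (w x powr p) \<partial>lborel)
          + tail \<rho> L (\<lambda>x. u x - k) * (\<integral>\<^sup>+x\<in>ball 0 (radius j). ennreal (w x) \<partial>lborel))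
       \<le> ennreal (2 * a_cac (2 powr (real j + 6))) * (ennreal (c_in + c_out) * ennreal z
          + ennreal T' * ennreal (2 powr ((real j + 1) * (p - 1)) * z))"
      by (intro mult_left_mono add_mono mult_mono wp w1 tl) auto
    also have "\<dots> = ennreal (dg_data T' j z)"
      unfolding dg_data_def using z T'0 c_nonneg a_cac_nonneg
      by (subst ennreal_mult) (auto simp: ennreal_mult ennreal_plus)
    finally show ?thesis .
  qed
  have D0: "0 \<le> dg_data T' j z"
    unfolding dg_data_def using z T'0 c_nonneg a_cac_nonneg by (intro mult_nonneg_nonneg add_nonneg_nonneg) auto
  have "excess u (Suc j) \<le> (\<integral>\<^sup>+x. ennreal ((\<eta> x * w x) powr p) \<partial>lborel)"
    unfolding excess_def using \<eta>1 by (intro nn_integral_mono) (auto simp: w_def k_def indicator_def)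
  also have "\<dots> \<le> ennreal (fk_const * a powr \<theta> * (e_const * (dg_data T' j z + a powr \<gamma>)))"
    by (rule energy_step[OF \<rho> sol_shift[OF \<rho> sol] c L w_def f1 aset \<open>0 < a\<close> a(2) D D0])
  finally show ?thesis .
qed

text \<open>In one step the Caccioppoli error contributes the power \<open>1 + \<theta>\<close> of
  the excess and the right-hand side the power \<open>\<gamma> + \<theta>\<close>;
  \<open>1 + \<beta>\<close> is the smaller of the two.\<close>

definition "\<beta> = min \<theta> (\<gamma> + \<theta> - 1)"

lemma beta: "0 < \<beta>" "\<beta> \<le> \<theta>" "1 + \<beta> \<le> \<gamma> + \<theta>"
  using theta gamma by (auto simp: \<beta>_def)

text \<open>Collects all constants into one geometric factor; powers of the excess may be lowered
  because \<open>z \<le> 1\<close>. The bound \<open>p \<le> E\<close> is recorded because the decay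
  ratio derived from \<open>E\<close> must also compensate the factor
  \<open>2 powr ((j + 1) * p)\<close> in the bound for the support.\<close>

lemma dg_recursion:
  assumes T: "0 \<le> T"
  obtains K E where "0 < K" "p \<le> E"
    "\<And>(j::nat) z a. 0 < z \<Longrightarrow> z \<le> 1 \<Longrightarrow> a = 2 powr ((real j + 1) * p) * z \<Longrightarrow>
      fk_const * a powr \<theta> * (e_const * (dg_data T j z + a powr \<gamma>)) \<le> K * 2 powr (E * j) * z powr (1 + \<beta>)"
proof -
  define e1 where "e1 = dsp + 1 + p"
  define kc where "kc = kup * (cac_low p + 2 powr p + cac_err p)"
  define E' where "E' = e1 + p + p * \<gamma>"
  define KD where "KD = 2 * kc * 2 powr (6 * e1) * (c_in + c_out + T * 2 powr p)"
  define K where "K = fk_const * e_const * 2 powr p * (KD + 2 powr (p * \<gamma>))"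
  have kc: "0 < kc" using kup_pos cac_low[of p] cac_err[OF p] by (simp add: kc_def add_pos_pos)
  have KD: "0 \<le> KD" using kc c_nonneg T by (simp add: KD_def)
  have K: "0 < K" unfolding K_def using fk_const_pos e_const_pos KD by (intro mult_pos_pos add_nonneg_pos) auto
  have e1: "0 < e1" using dsp_pos p by (simp add: e1_def)
  have E': "0 < E'" using e1 p gamma by (simp add: E'_def add_pos_pos)
  have main: "fk_const * a powr \<theta> * (e_const * (dg_data T j z + a powr \<gamma>)) \<le> K * 2 powr ((p + E') * j) * z powr (1 + \<beta>)"
    if z: "0 < z" "z \<le> 1" and a: "a = 2 powr ((real j + 1) * p) * z" for j :: nat and z a
  proof -
    let ?P = "\<lambda>x. 2 powr (x * real j)"
    have P1: "1 \<le> ?P x" if "0 \<le> x" for x using that by (intro ge_one_powr_ge_zero) auto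
    have Pmono: "?P x \<le> ?P y" if "x \<le> y" for x y using that by (intro powr_mono mult_right_mono) auto
    have ac: "a_cac (2 powr (real j + 6)) = kc * 2 powr (6 * e1) * ?P e1"
    proof -
      have "(2 powr (real j + 6)) powr e1 = 2 powr (6 * e1) * ?P e1"
        by (simp add: powr_powr powr_add[symmetric] algebra_simps)
      then show ?thesis unfolding a_cac_def kc_def[symmetric] e1_def[symmetric] by simp
    qed
    have pw: "2 powr ((real j + 1) * (p - 1)) \<le> 2 powr p * ?P p"
    proof -
      have "(real j + 1) * (p - 1) \<le> p + p * real j" using p by (simp add: algebra_simps)
      then have "2 powr ((real j + 1) * (p - 1)) \<le> 2 powr (p + p * real j)" by (intro powr_mono) auto
      then show ?thesis by (simp add: powr_add)
    qed
    have "(c_in + c_out) * z + T * (2 powr ((real j + 1) * (p - 1)) * z)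
       \<le> (c_in + c_out) * (?P p * z) + T * ((2 powr p * ?P p) * z)"
      using c_nonneg T z pw P1[of p] p mult_right_mono[of 1 "?P p" z]
      by (intro add_mono mult_left_mono mult_right_mono) auto
    also have "\<dots> = (c_in + c_out + T * 2 powr p) * (?P p * z)" by (simp add: algebra_simps)
    finally have "dg_data T j z \<le> 2 * (kc * 2 powr (6 * e1) * ?P e1) * ((c_in + c_out + T * 2 powr p) * (?P p * z))"
      unfolding dg_data_def ac using kc by (intro mult_left_mono) auto
    also have "\<dots> = KD * (?P e1 * ?P p) * z" by (simp add: KD_def mult_ac)
    also have "\<dots> = KD * ?P (e1 + p) * z" by (simp only: powr_add[symmetric] distrib_right)
    also have "\<dots> \<le> KD * ?P E' * z"
      using KD z p gamma Pmono[of "e1 + p" E'] by (intro mult_right_mono mult_left_mono) (auto simp: E'_def)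
    finally have 1: "dg_data T j z \<le> KD * ?P E' * z" .
    have "a powr \<gamma> = 2 powr (p * \<gamma>) * ?P (p * \<gamma>) * z powr \<gamma>"
      unfolding a using z by (simp add: powr_mult powr_powr powr_add[symmetric] algebra_simps)
    also have "\<dots> \<le> 2 powr (p * \<gamma>) * ?P E' * z powr \<gamma>"
      using e1 p Pmono[of "p * \<gamma>" E'] by (intro mult_right_mono mult_left_mono) (auto simp: E'_def)
    finally have 2: "a powr \<gamma> \<le> 2 powr (p * \<gamma>) * ?P E' * z powr \<gamma>" .
    have "a powr \<theta> = 2 powr ((real j + 1) * p * \<theta>) * z powr \<theta>"
      unfolding a using z by (simp add: powr_mult powr_powr)
    also have "\<dots> \<le> 2 powr ((real j + 1) * p * 1) * z powr \<theta>"
      using theta p by (intro mult_right_mono powr_mono mult_left_mono) auto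
    also have "2 powr ((real j + 1) * p * 1) = 2 powr p * ?P p" by (simp add: powr_add[symmetric] algebra_simps)
    finally have 3: "a powr \<theta> \<le> 2 powr p * ?P p * z powr \<theta>" .
    have d0: "0 \<le> dg_data T j z"
      unfolding dg_data_def using z T c_nonneg a_cac_nonneg by (intro mult_nonneg_nonneg add_nonneg_nonneg) auto
    have "fk_const * a powr \<theta> * (e_const * (dg_data T j z + a powr \<gamma>))
       \<le> fk_const * (2 powr p * ?P p * z powr \<theta>) * (e_const * (KD * ?P E' * z + 2 powr (p * \<gamma>) * ?P E' * z powr \<gamma>))"
      using fk_const_pos e_const_pos 1 2 3 d0 by (intro mult_mono mult_left_mono add_mono mult_nonneg_nonneg add_nonneg_nonneg) auto
    also have "\<dots> = fk_const * e_const * 2 powr p * ?P (p + E') * (KD * (z powr \<theta> * z) + 2 powr (p * \<gamma>) * (z powr \<theta> * z powr \<gamma>))"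
      by (simp add: powr_add distrib_right distrib_left mult_ac)
    also have "\<dots> \<le> fk_const * e_const * 2 powr p * ?P (p + E') * (KD * z powr (1 + \<beta>) + 2 powr (p * \<gamma>) * z powr (1 + \<beta>))"
    proof -
      have "z powr \<theta> * z = z powr (1 + \<theta>)" "z powr \<theta> * z powr \<gamma> = z powr (\<gamma> + \<theta>)"
        using z by (simp_all add: powr_add mult.commute)
      moreover have "z powr (1 + \<theta>) \<le> z powr (1 + \<beta>)" "z powr (\<gamma> + \<theta>) \<le> z powr (1 + \<beta>)"
        using z beta by (auto intro!: powr_mono')
      ultimately show ?thesis
        using fk_const_pos e_const_pos KD by (intro mult_left_mono add_mono mult_nonneg_nonneg) auto
    qed
    also have "\<dots> = K * ?P (p + E') * z powr (1 + \<beta>)" by (simp add: K_def algebra_simps)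
    finally show ?thesis .
  qed
  show thesis using that[of K "p + E'"] K E' main by simp
qed

theorem de_giorgi:
  assumes T0: "0 \<le> T0"
  shows "\<exists>\<epsilon>>0. \<forall>\<rho> L u f. scale \<rho> \<longrightarrow> 2 * \<rho> * L \<le> 1 \<longrightarrow> sol \<rho> u f \<longrightarrow> tail \<rho> L u \<le> ennreal T0 \<longrightarrow>
    (\<integral>\<^sup>+x\<in>ball 0 (3/2). ennreal (\<bar>f x\<bar> powr q) \<partial>lborel) \<le> 1 \<longrightarrow>
    (\<integral>\<^sup>+x\<in>ball 0 (5/4). ennreal (max (u x) 0 powr p) \<partial>lborel) \<le> ennreal \<epsilon> \<longrightarrow>
    (AE x in lborel. x \<in> ball 0 1 \<longrightarrow> u x \<le> 1)"
proof -
  define T' where "T' = 2 powr p * (T0 + c_out)"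
  have "0 \<le> T'" using T0 c_nonneg by (simp add: T'_def)
  then obtain K E where K: "0 < K" and E: "p \<le> E" and
    rec: "\<And>(j::nat) z a. 0 < z \<Longrightarrow> z \<le> 1 \<Longrightarrow> a = 2 powr ((real j + 1) * p) * z \<Longrightarrow>
      fk_const * a powr \<theta> * (e_const * (dg_data T' j z + a powr \<gamma>)) \<le> K * 2 powr (E * j) * z powr (1 + \<beta>)"
    using dg_recursion by metis
  \<comment> \<open>Chosen so that \<open>lam powr (\<beta> * j)\<close> cancels the growth
    \<open>2 powr (E * j)\<close>. The bound \<open>\<epsilon> * lam powr j\<close> for the excess
    then reproduces itself once \<open>K * \<epsilon> powr \<beta> \<le> lam\<close>.\<close>
  define lam where "lam = 2 powr (- E / \<beta>)"
  \<comment> \<open>The entry \<open>vol / 2 powr p\<close> keeps \<open>a \<le> vol\<close> at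
    stage 0, and at later stages as well, since \<open>p \<le> E\<close> and
    \<open>\<beta> < 1\<close> give \<open>2 powr p * lam \<le> 1\<close>. The last entry is the
    closing condition of the induction.\<close>
  define \<epsilon> where "\<epsilon> = min 1 (min (vol / 2 powr p) ((lam / K) powr (1 / \<beta>)))"
  have lam: "0 < lam" by (simp add: lam_def)
  have eps: "0 < \<epsilon>" "\<epsilon> \<le> 1" "\<epsilon> \<le> vol / 2 powr p" "\<epsilon> \<le> (lam / K) powr (1 / \<beta>)"
    using vol_pos lam K by (auto simp: \<epsilon>_def)
  have epsb: "K * \<epsilon> powr \<beta> \<le> lam"
  proof -
    have "\<epsilon> powr \<beta> \<le> ((lam / K) powr (1 / \<beta>)) powr \<beta>" using eps beta by (intro powr_mono2) auto
    also have "\<dots> = lam / K" using lam K beta by (simp add: powr_powr)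
    finally show ?thesis using K by (simp add: field_simps)
  qed
  have lamp: "2 powr p * lam \<le> 1" "lam \<le> 1"
  proof -
    have "p * \<beta> \<le> E * 1" using E p beta theta by (intro mult_mono) auto
    then have "p \<le> E / \<beta>" using beta by (simp add: field_simps)
    then have "2 powr (p + - E / \<beta>) \<le> 2 powr 0" "2 powr (- E / \<beta>) \<le> 2 powr 0"
      using p by (intro powr_mono; simp)+
    then show "2 powr p * lam \<le> 1" "lam \<le> 1" unfolding lam_def powr_add by simp_all
  qed
  have lamb: "lam powr (\<beta> * real j) = 2 powr - (E * j)" for j :: nat
    using beta by (simp add: lam_def powr_powr)
  define z where "z j = \<epsilon> * lam powr real j" for j :: nat
  have z: "0 < z j" "z j \<le> 1" for j
    using eps lam lamp powr_mono2[of "real j" lam 1] mult_mono[of \<epsilon> 1 "lam powr real j" 1] by (auto simp: z_def)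
  have "AE x in lborel. x \<in> ball 0 1 \<longrightarrow> u x \<le> 1"
    if \<rho>: "scale \<rho>" and L: "2 * \<rho> * L \<le> 1" and sol: "sol \<rho> u f" and T: "tail \<rho> L u \<le> ennreal T0"
      and f1: "(\<integral>\<^sup>+x\<in>ball 0 (3/2). ennreal (\<bar>f x\<bar> powr q) \<partial>lborel) \<le> 1"
      and u0: "(\<integral>\<^sup>+x\<in>ball 0 (5/4). ennreal (max (u x) 0 powr p) \<partial>lborel) \<le> ennreal \<epsilon>" for \<rho> L u f
  proof -
    note [measurable] = solD(1,2)[OF sol]
    have ex: "excess u j \<le> ennreal (z j)" for j
    proof (induction j)
      case 0
      then show ?case using u0 lam by (simp add: excess_def z_def level_def radius_def)
    next
      case (Suc j)
      define a where "a = 2 powr ((real j + 1) * p) * z j"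
      have "a = 2 powr p * \<epsilon> * (2 powr p * lam) powr real j"
        using lam by (simp add: a_def z_def powr_mult powr_powr powr_add[symmetric] algebra_simps)
      also have "\<dots> \<le> 2 powr p * \<epsilon> * 1"
        using lamp lam eps powr_mono2[of "real j" "2 powr p * lam" 1] by (intro mult_left_mono) auto
      also have "\<dots> \<le> vol" using eps(3) by (simp add: field_simps)
      finally have a: "a \<le> vol" .
      have "excess u (Suc j) \<le> ennreal (fk_const * a powr \<theta> * (e_const * (dg_data T' j (z j) + a powr \<gamma>)))"
        by (rule de_giorgi_step[OF \<rho> L sol T T0 f1 Suc z(1) a_def a T'_def])
      also have "\<dots> \<le> ennreal (K * 2 powr (E * j) * z j powr (1 + \<beta>))"
        by (intro ennreal_leI rec z a_def)
      also have "K * 2 powr (E * j) * z j powr (1 + \<beta>) = z j * (K * \<epsilon> powr \<beta>)"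
      proof -
        have "z j powr (1 + \<beta>) = z j * (\<epsilon> powr \<beta> * lam powr (\<beta> * real j))"
          using z(1)[of j] eps lam by (simp add: powr_add z_def powr_mult powr_powr mult.commute)
        then show ?thesis unfolding lamb by (simp add: powr_minus field_simps)
      qed
      also have "\<dots> \<le> z j * lam" using z(1)[of j] epsb by (intro mult_left_mono) auto
      also have "\<dots> = z (Suc j)" using lam by (simp add: z_def powr_add)
      finally show ?case by (simp add: ennreal_leI)
    qed
    have "(\<integral>\<^sup>+x\<in>ball (0::'a) 1. ennreal (max (u x - 1) 0 powr p) \<partial>lborel) \<le> ennreal (z j)" for j
    proof -
      have "(\<integral>\<^sup>+x\<in>ball (0::'a) 1. ennreal (max (u x - 1) 0 powr p) \<partial>lborel) \<le> excess u j"
        unfolding excess_def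
      proof (intro nn_integral_mono mult_mono ennreal_leI powr_mono2)
        fix x :: 'a
        show "max (u x - 1) 0 \<le> max (u x - level j) 0" by (intro max.mono) (auto simp: level_def)
        have "0 < (1 / 2 :: real) ^ j" by simp
        then have "1 \<le> radius j" unfolding radius_def by linarith
        then show "indicator (ball 0 1) x \<le> (indicator (ball 0 (radius j)) x :: ennreal)"
          by (auto simp: indicator_def)
      qed (use p in auto)
      then show ?thesis using ex[of j] by simp
    qed
    moreover have "(\<lambda>j. ennreal (z j)) \<longlonglongrightarrow> ennreal 0"
    proof (intro tendsto_ennrealI)
      have "lam < 1" using lam E p beta by (auto simp: lam_def intro!: powr_less_one)
      then have "(\<lambda>j. \<epsilon> * lam ^ j) \<longlonglongrightarrow> \<epsilon> * 0" using lam by (intro tendsto_intros LIMSEQ_realpow_zero) auto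
      then show "z \<longlonglongrightarrow> 0" using lam by (simp add: z_def[abs_def] powr_realpow)
    qed
    ultimately have "(\<integral>\<^sup>+x\<in>ball (0::'a) 1. ennreal (max (u x - 1) 0 powr p) \<partial>lborel) \<le> ennreal 0"
      by (intro LIMSEQ_le_const) auto
    then have "AE x in lborel. ennreal (max (u x - 1) 0 powr p) * indicator (ball (0::'a) 1) x = 0"
      by (subst nn_integral_0_iff_AE[symmetric]) auto
    then show ?thesis
    proof eventually_elim
      case (elim x)
      then show ?case by (auto simp: max_def split: if_splits)
    qed
  qed
  then show ?thesis using eps(1) by (intro exI[of _ \<epsilon>]) auto
qed

text \<open>Inside \<open>ball 0 L\<close> a one-sided bound is enough, since
  \<open>tail_fun\<close> sees only the positive part there. Outside, the function is compared with
  the original \<open>u\<close>, whose weighted tail is the small quantity \<kappa>.\<close>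

lemma tail_le:
  assumes \<rho>: "scale \<rho>" and L: "1 \<le> L" and [measurable]: "u \<in> borel_measurable borel" and h: "0 \<le> h" and c0: "0 \<le> c0"
    and le: "AE y in lborel. y \<in> ball 0 L \<longrightarrow> v y \<le> h"
    and far: "\<And>y. L \<le> norm y \<Longrightarrow> \<bar>v y\<bar> \<le> c0 * (1 + \<bar>u y\<bar>)"
    and \<kappa>: "(\<integral>\<^sup>+y\<in>- ball 0 L. ennreal (kmaj \<rho> (norm y) * (1 + \<bar>u y\<bar>) powr (p - 1)) \<partial>lborel) \<le> ennreal \<kappa>" "0 \<le> \<kappa>"
  shows "tail \<rho> L v \<le> ennreal (h powr (p - 1) * c_out + c0 powr (p - 1) * \<kappa>)"
proof -
  have "tail \<rho> L v \<le> (\<integral>\<^sup>+y. ennreal (h powr (p - 1)) * (ennreal (kmaj \<rho> (norm y)) * indicator (- ball (0::'a) 1) y)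
      + ennreal (c0 powr (p - 1)) * (ennreal (kmaj \<rho> (norm y) * (1 + \<bar>u y\<bar>) powr (p - 1)) * indicator (- ball 0 L) y) \<partial>lborel)"
    unfolding tail_def
  proof (rule nn_integral_mono_AE)
    show "AE y in lborel. ennreal (kmaj \<rho> (norm y) * tail_fun L v y powr (p - 1)) * indicator (- ball 0 1) y
       \<le> ennreal (h powr (p - 1)) * (ennreal (kmaj \<rho> (norm y)) * indicator (- ball (0::'a) 1) y)
      + ennreal (c0 powr (p - 1)) * (ennreal (kmaj \<rho> (norm y) * (1 + \<bar>u y\<bar>) powr (p - 1)) * indicator (- ball 0 L) y)"
      using le
    proof eventually_elim
      case (elim y)
      have k0: "0 \<le> kmaj \<rho> (norm y)" by (rule kmaj_nonneg[OF \<rho>])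
      show ?case
      proof (cases "norm y < L")
        case True
        then have "tail_fun L v y \<le> h" using elim h by (simp add: tail_fun_def)
        then have "tail_fun L v y powr (p - 1) \<le> h powr (p - 1)" using p tail_fun_nonneg by (intro powr_mono2) auto
        then have "kmaj \<rho> (norm y) * tail_fun L v y powr (p - 1) \<le> h powr (p - 1) * kmaj \<rho> (norm y)"
          using k0 by (simp add: mult.commute[of _ "kmaj \<rho> (norm y)"] mult_left_mono)
        then have "ennreal (kmaj \<rho> (norm y) * tail_fun L v y powr (p - 1)) \<le> ennreal (h powr (p - 1)) * ennreal (kmaj \<rho> (norm y))"
          using k0 by (subst ennreal_mult[symmetric]) (auto intro: ennreal_leI)
        then show ?thesis using True by (auto simp: indicator_def)
      next
        case False
        then have "tail_fun L v y powr (p - 1) \<le> (c0 * (1 + \<bar>u y\<bar>)) powr (p - 1)"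
          using far[of y] p by (intro powr_mono2) (auto simp: tail_fun_def)
        then have "kmaj \<rho> (norm y) * tail_fun L v y powr (p - 1) \<le> kmaj \<rho> (norm y) * (c0 powr (p - 1) * (1 + \<bar>u y\<bar>) powr (p - 1))"
          using k0 by (intro mult_left_mono) (simp_all add: powr_mult)
        then have "kmaj \<rho> (norm y) * tail_fun L v y powr (p - 1) \<le> c0 powr (p - 1) * (kmaj \<rho> (norm y) * (1 + \<bar>u y\<bar>) powr (p - 1))"
          by (simp add: mult_ac)
        then have "ennreal (kmaj \<rho> (norm y) * tail_fun L v y powr (p - 1)) \<le> ennreal (c0 powr (p - 1)) * ennreal (kmaj \<rho> (norm y) * (1 + \<bar>u y\<bar>) powr (p - 1))"
          using k0 by (subst ennreal_mult[symmetric]) (auto intro: ennreal_leI)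
        then show ?thesis using False L by (simp add: add_increasing)
      qed
    qed
  qed
  also have "\<dots> = ennreal (h powr (p - 1)) * (\<integral>\<^sup>+y\<in>- ball (0::'a) 1. ennreal (kmaj \<rho> (norm y)) \<partial>lborel)
     + ennreal (c0 powr (p - 1)) * (\<integral>\<^sup>+y\<in>- ball (0::'a) L. ennreal (kmaj \<rho> (norm y) * (1 + \<bar>u y\<bar>) powr (p - 1)) \<partial>lborel)"
    by (subst nn_integral_add, measurable, subst nn_integral_cmult, measurable, subst nn_integral_cmult, measurable)
  also have "\<dots> \<le> ennreal (h powr (p - 1)) * ennreal c_out + ennreal (c0 powr (p - 1)) * ennreal \<kappa>"
    by (intro add_mono mult_left_mono kmaj_outside[OF \<rho>] \<kappa>) auto
  also have "\<dots> = ennreal (h powr (p - 1) * c_out + c0 powr (p - 1) * \<kappa>)"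
    using c_nonneg \<kappa> by (simp add: ennreal_mult ennreal_plus)
  finally show ?thesis .
qed

subsection \<open>Decrease of oscillation at unit scale\<close>

text \<open>The cross term of the Caccioppoli inequality for \<open>h - 1 - u\<close>: on at least half of \<open>B\<^sub>1\<close> its negative
  part is at least \<open>1 - h\<close>.\<close>

lemma level_set_estimate:
  assumes \<rho>: "scale \<rho>" and L: "2 \<le> L" "2 * \<rho> * L \<le> 1" and sol: "sol \<rho> u f"
    and bd: "AE x in lborel. x \<in> ball 0 L \<longrightarrow> \<bar>u x\<bar> \<le> 1"
    and h: "0 < h" "h \<le> 1/2"
    and T: "(\<integral>\<^sup>+y\<in>- ball 0 L. ennreal (kmaj \<rho> (norm y) * (1 + \<bar>u y\<bar>) powr (p - 1)) \<partial>lborel) \<le> ennreal (h powr (p - 1))"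
    and F: "(\<integral>\<^sup>+x\<in>ball 0 (3/2). ennreal \<bar>f x\<bar> \<partial>lborel) \<le> ennreal (h powr (p - 1))"
    and half: "ennreal (vol / 2) \<le> emeasure lborel {x \<in> ball 0 1. 0 \<le> u x}"
  shows "emeasure lborel {x \<in> ball 0 (5/4). u x < h / 2 - 1} \<le> ennreal
     ((1 + 2 * a_cac 32 * vol * 2 powr DIM('a) * (c_in + 2 * c_out + 1)) * 3 powr dsp * 2 powr (p + 2) / (klow * vol)
       * h powr (p - 1))"
proof -
  note [measurable] = solD(1,2)[OF sol]
  define U where "U = (\<lambda>x. h - 1 - u x)"
  define g where "g = (\<lambda>x. - f x)"
  define w where "w = (\<lambda>x. max (U x) 0)"
  have solU: "sol \<rho> U g"
    using sol_affine[OF \<rho> sol, of "- 1" "h - 1"] by (simp add: U_def g_def signed_powr_one algebra_simps)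
  have [measurable]: "w \<in> borel_measurable borel" "U \<in> borel_measurable borel" unfolding w_def U_def by measurable
  \<comment> \<open>Both gaps between the radii are \<open>1 / 8\<close>; 32 is a comfortable value
    above the required 12.\<close>
  obtain \<eta> :: "'a \<Rightarrow> real" where c: "cutoff \<eta> 32 (11/8) (3/2)" and \<eta>1: "\<And>x. x \<in> ball 0 (5/4) \<Longrightarrow> \<eta> x = 1"
    using cutoff_exists[of "5/4" "11/8" "3/2" 32] by auto
  have c': "\<And>x. 0 \<le> \<eta> x" "\<And>x. \<eta> x \<le> 1" "\<And>x. x \<notin> ball 0 (3/2) \<Longrightarrow> \<eta> x = 0"
    using c by (auto simp: cutoff_def)
  have w0: "0 \<le> w x" for x by (simp add: w_def)
  have wh: "AE x in lborel. x \<in> ball 0 (3/2) \<longrightarrow> w x \<le> h"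
    using bd by eventually_elim (use L h in \<open>auto simp: w_def U_def\<close>)
  have Uh: "AE x in lborel. x \<in> ball 0 L \<longrightarrow> U x \<le> h"
    using bd by eventually_elim (use L h in \<open>auto simp: U_def\<close>)
  have v32: "emeasure lborel (ball (0::'a) (3/2)) \<le> ennreal (vol * 2 powr DIM('a))"
    unfolding vol_def using powr_mono2[of "DIM('a)" "3/2" 2]
    by (simp add: emeasure_lborel_ball ennreal_leI)
  have wp: "(\<integral>\<^sup>+x\<in>ball 0 (3/2). ennreal (w x powr p) \<partial>lborel) \<le> ennreal (h powr p * (vol * 2 powr DIM('a)))"
  proof -
    have "(\<integral>\<^sup>+x\<in>ball 0 (3/2). ennreal (w x powr p) \<partial>lborel) \<le> (\<integral>\<^sup>+x. ennreal (h powr p) * indicator (ball (0::'a) (3/2)) x \<partial>lborel)"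
      by (rule nn_integral_mono_AE, use wh in eventually_elim)
        (use w0 p in \<open>auto simp: indicator_def intro!: ennreal_leI powr_mono2\<close>)
    also have "\<dots> = ennreal (h powr p) * emeasure lborel (ball (0::'a) (3/2))" by (subst nn_integral_cmult_indicator) auto
    also have "\<dots> \<le> ennreal (h powr p) * ennreal (vol * 2 powr DIM('a))" by (intro mult_left_mono v32) auto
    finally show ?thesis using vol_pos by (simp add: ennreal_mult)
  qed
  have w1: "(\<integral>\<^sup>+x\<in>ball 0 (3/2). ennreal (w x) \<partial>lborel) \<le> ennreal (h * (vol * 2 powr DIM('a)))"
  proof -
    have "(\<integral>\<^sup>+x\<in>ball 0 (3/2). ennreal (w x) \<partial>lborel) \<le> (\<integral>\<^sup>+x. ennreal h * indicator (ball (0::'a) (3/2)) x \<partial>lborel)"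
      by (rule nn_integral_mono_AE, use wh in eventually_elim)
        (auto simp: indicator_def intro!: ennreal_leI)
    also have "\<dots> = ennreal h * emeasure lborel (ball (0::'a) (3/2))" by (subst nn_integral_cmult_indicator) auto
    also have "\<dots> \<le> ennreal h * ennreal (vol * 2 powr DIM('a))" by (intro mult_left_mono v32) auto
    finally show ?thesis using vol_pos h by (simp add: ennreal_mult)
  qed
  have hp: "h powr (p - 1) * h = h powr p" using powr_split[of h p] h p by simp
  have tl: "tail \<rho> L U \<le> ennreal (h powr (p - 1) * (c_out + 1))"
  proof -
    have "tail \<rho> L U \<le> ennreal (h powr (p - 1) * c_out + 1 powr (p - 1) * h powr (p - 1))"
      using h L T Uh by (intro tail_le[OF \<rho>, where u = u]) (auto simp: U_def)
    then show ?thesis by (simp add: algebra_simps)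
  qed
  have fw: "(\<integral>\<^sup>+x. ennreal (\<bar>g x\<bar> * (\<eta> x powr p * w x)) \<partial>lborel) \<le> ennreal (h powr p)"
  proof -
    have "(\<integral>\<^sup>+x. ennreal (\<bar>g x\<bar> * (\<eta> x powr p * w x)) \<partial>lborel) \<le> (\<integral>\<^sup>+x. ennreal h * (ennreal \<bar>f x\<bar> * indicator (ball 0 (3/2)) x) \<partial>lborel)"
    proof (rule nn_integral_mono_AE, use wh in eventually_elim)
      case (elim x)
      show ?case
      proof (cases "x \<in> ball 0 (3/2)")
        case True
        have "\<eta> x powr p * w x \<le> 1 * h" using elim True c' p w0 powr_mono2[of p "\<eta> x" 1] by (intro mult_mono) auto
        then have "\<bar>g x\<bar> * (\<eta> x powr p * w x) \<le> h * \<bar>f x\<bar>"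
          using mult_left_mono[of "\<eta> x powr p * w x" h "\<bar>g x\<bar>"] by (simp add: g_def mult.commute)
        then have "ennreal (\<bar>g x\<bar> * (\<eta> x powr p * w x)) \<le> ennreal h * ennreal \<bar>f x\<bar>"
          using h by (subst ennreal_mult[symmetric]) (auto intro: ennreal_leI)
        then show ?thesis using True by simp
      next
        case False
        then show ?thesis using c'(3)[of x] p by simp
      qed
    qed
    also have "\<dots> = ennreal h * (\<integral>\<^sup>+x\<in>ball 0 (3/2). ennreal \<bar>f x\<bar> \<partial>lborel)" by (rule nn_integral_cmult) measurable
    also have "\<dots> \<le> ennreal h * ennreal (h powr (p - 1))" by (intro mult_left_mono F) auto
    also have "\<dots> = ennreal (h powr p)" using h hp by (simp add: ennreal_mult[symmetric] mult.commute)
    finally show ?thesis .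
  qed
  define A where "A = {x \<in> ball 0 (5/4). u x < h / 2 - 1}"
  define B where "B = {x \<in> ball 0 1. 0 \<le> u x}"
  have [measurable]: "A \<in> sets borel" "B \<in> sets borel" unfolding A_def B_def by measurable
  \<comment> \<open>A lower bound for the cross term on pairs from \<open>A\<close> and
    \<open>B\<close>: their distance is at most 3, \<open>- U y\<close> is at least
    \<open>1 - h \<ge> 1 / 2\<close> on \<open>B\<close>, and \<open>w x\<close> is at least
    \<open>h / 2\<close> on \<open>A\<close>. It is linear in \<open>h\<close>, while the right-hand
    side of the Caccioppoli inequality is of order \<open>h powr p\<close>; the quotient
    \<open>h powr (p - 1)\<close> is the gain.\<close>
  define \<delta> where "\<delta> = 1 / 2 * (klow / 3 powr dsp * ((1 / 2) powr (p - 1) * (h / 2)))"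
  have \<delta>: "0 < \<delta>" using klow_pos h by (simp add: \<delta>_def)
  define Q where "Q = 1 + 2 * a_cac 32 * vol * 2 powr DIM('a) * (c_in + 2 * c_out + 1)"
  have "ennreal \<delta> * (emeasure lborel A * emeasure lborel B)
      = (\<integral>\<^sup>+x. (\<integral>\<^sup>+y. ennreal \<delta> * (indicator A x * indicator B y) \<partial>lborel) \<partial>lborel)"
  proof -
    have "(\<integral>\<^sup>+x. (\<integral>\<^sup>+y. ennreal \<delta> * (indicator A x * indicator B y) \<partial>lborel) \<partial>lborel)
      = (\<integral>\<^sup>+x. (ennreal \<delta> * emeasure lborel B) * indicator A x \<partial>lborel)"
      by (intro nn_integral_cong) (simp add: nn_integral_cmult mult_ac)
    also have "\<dots> = ennreal \<delta> * emeasure lborel B * emeasure lborel A"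
      by (subst nn_integral_cmult_indicator) auto
    finally show ?thesis by (simp add: mult_ac)
  qed
  also have "\<dots> \<le> (\<integral>\<^sup>+x. (\<integral>\<^sup>+y. ennreal (1 / 2 * (indicator (ball 0 (3/2)) x * indicator (ball 0 (3/2)) y
        * (ker \<rho> (dist x y) * (max (- U y) 0 powr (p - 1) * (\<eta> x powr p * w x))))) \<partial>lborel) \<partial>lborel)"
  proof (intro nn_integral_mono)
    fix x y :: 'a
    show "ennreal \<delta> * (indicator A x * indicator B y) \<le> ennreal (1 / 2 * (indicator (ball 0 (3/2)) x * indicator (ball 0 (3/2)) y
        * (ker \<rho> (dist x y) * (max (- U y) 0 powr (p - 1) * (\<eta> x powr p * w x)))))"
    proof (cases "x \<in> A \<and> y \<in> B")
      case True
      then have x: "norm x < 5/4" "u x < h / 2 - 1" and y: "norm y < 1" "0 \<le> u y" by (auto simp: A_def B_def)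
      have "x \<noteq> y" using x y h by auto
      have d3: "dist x y \<le> 3" using norm_triangle_ineq4[of x y] x y by (simp add: dist_norm)
      have "klow / 3 powr dsp \<le> klow / dist x y powr dsp"
        using d3 \<open>x \<noteq> y\<close> klow_pos dsp_pos by (intro divide_left_mono powr_mono2 mult_pos_pos) auto
      also have "\<dots> \<le> ker \<rho> (dist x y)" using d3 \<open>x \<noteq> y\<close> by (intro ker_lower[OF \<rho>]) auto
      finally have 1: "klow / 3 powr dsp \<le> ker \<rho> (dist x y)" .
      have 2: "(1 / 2) powr (p - 1) \<le> max (- U y) 0 powr (p - 1)"
        using y h p by (intro powr_mono2) (auto simp: U_def)
      have 3: "h / 2 \<le> \<eta> x powr p * w x" using x h \<eta>1[of x] by (simp add: w_def U_def)
      have "\<delta> \<le> 1 / 2 * (ker \<rho> (dist x y) * (max (- U y) 0 powr (p - 1) * (\<eta> x powr p * w x)))"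
        unfolding \<delta>_def using 1 2 3 h klow_pos by (intro mult_left_mono mult_mono) (auto intro: order_trans[rotated])
      then show ?thesis using True x y by (simp add: ennreal_leI)
    qed (auto simp: indicator_def)
  qed
  also have "\<dots> \<le> (\<integral>\<^sup>+x. ennreal (\<bar>g x\<bar> * (\<eta> x powr p * w x)) \<partial>lborel)
       + ennreal (2 * a_cac 32) * (ennreal (c_in + c_out) * (\<integral>\<^sup>+x\<in>ball 0 (3/2). ennreal (w x powr p) \<partial>lborel)
          + tail \<rho> L U * (\<integral>\<^sup>+x\<in>ball 0 (3/2). ennreal (w x) \<partial>lborel))"
    by (rule caccioppoli(2)[OF \<rho> solU c L(2) w_def])
  also have "\<dots> \<le> ennreal (h powr p) + ennreal (2 * a_cac 32) * (ennreal (c_in + c_out) * ennreal (h powr p * (vol * 2 powr DIM('a)))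
      + ennreal (h powr (p - 1) * (c_out + 1)) * ennreal (h * (vol * 2 powr DIM('a))))"
    by (intro add_mono mult_left_mono mult_mono fw wp w1 tl) auto
  also have "\<dots> = ennreal (h powr p + 2 * a_cac 32 * ((c_in + c_out) * (h powr p * (vol * 2 powr DIM('a)))
      + (h powr (p - 1) * (c_out + 1)) * (h * (vol * 2 powr DIM('a)))))"
    using a_cac_nonneg[of 32] c_nonneg h vol_pos
    by (subst ennreal_plus, simp, simp, subst ennreal_mult, simp, simp, subst ennreal_plus, simp, simp, simp add: ennreal_mult)
  also have "h powr p + 2 * a_cac 32 * ((c_in + c_out) * (h powr p * (vol * 2 powr DIM('a)))
      + (h powr (p - 1) * (c_out + 1)) * (h * (vol * 2 powr DIM('a)))) = Q * h powr p"
    unfolding hp[symmetric] Q_def by (simp add: algebra_simps)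
  finally have main: "ennreal \<delta> * (emeasure lborel A * emeasure lborel B) \<le> ennreal (Q * h powr p)" .
  have Q0: "0 \<le> Q" unfolding Q_def using a_cac_nonneg vol_pos c_nonneg by (intro add_nonneg_nonneg mult_nonneg_nonneg) auto
  have "ennreal \<delta> * (emeasure lborel A * ennreal (vol / 2)) \<le> ennreal \<delta> * (emeasure lborel A * emeasure lborel B)"
    using half by (intro mult_left_mono) (auto simp: B_def)
  also note main
  finally have le: "ennreal \<delta> * (emeasure lborel A * ennreal (vol / 2)) \<le> ennreal (Q * h powr p)" .
  have "ennreal (\<delta> * (vol / 2)) = ennreal \<delta> * ennreal (vol / 2)" using \<delta> vol_pos by (intro ennreal_mult) auto
  with le have "ennreal (\<delta> * (vol / 2)) * emeasure lborel A \<le> ennreal (Q * h powr p)"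
    by (simp only: mult_ac)
  then have "ennreal (1 / (\<delta> * (vol / 2))) * (ennreal (\<delta> * (vol / 2)) * emeasure lborel A)
     \<le> ennreal (1 / (\<delta> * (vol / 2))) * ennreal (Q * h powr p)"
    by (rule mult_left_mono) simp
  also have "ennreal (1 / (\<delta> * (vol / 2))) * (ennreal (\<delta> * (vol / 2)) * emeasure lborel A) = emeasure lborel A"
    using \<delta> vol_pos by (simp add: mult.assoc[symmetric] ennreal_mult[symmetric])
  also have "ennreal (1 / (\<delta> * (vol / 2))) * ennreal (Q * h powr p) = ennreal (Q * h powr p / (\<delta> * (vol / 2)))"
    using \<delta> vol_pos Q0 by (simp add: ennreal_mult[symmetric])
  also have "Q * h powr p / (\<delta> * (vol / 2)) = Q * 3 powr dsp * 2 powr (p + 2) / (klow * vol) * h powr (p - 1)"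
  proof -
    have "(1 / 2 :: real) powr (p - 1) = 2 / 2 powr p" by (simp add: powr_divide powr_diff)
    moreover have "2 powr (p + 2) = 4 * 2 powr p" by (simp add: powr_add)
    ultimately show ?thesis using h klow_pos vol_pos unfolding \<delta>_def hp[symmetric] by (simp add: field_simps)
  qed
  finally show ?thesis by (simp add: A_def Q_def)
qed

definition "ls_const = (1 + 2 * a_cac 32 * vol * 2 powr DIM('a) * (c_in + 2 * c_out + 1)) * 3 powr dsp * 2 powr (p + 2) / (klow * vol)"

lemma ls_const_pos: "0 < ls_const"
proof -
  have "0 \<le> 2 * a_cac 32 * vol * 2 powr DIM('a) * (c_in + 2 * c_out + 1)"
    using a_cac_nonneg vol_pos c_nonneg by (intro mult_nonneg_nonneg) auto
  then have "0 < 1 + 2 * a_cac 32 * vol * 2 powr DIM('a) * (c_in + 2 * c_out + 1)" by linarith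
  then show ?thesis unfolding ls_const_def using klow_pos vol_pos by (intro divide_pos_pos mult_pos_pos) auto
qed

text \<open>Splitting \<open>f\<close> at the height \<mu> replaces Hoelder's inequality. The first
  term is made small by the choice of \<mu> and the second afterwards by \<kappa>.\<close>

lemma L1_le_Lq:
  fixes f :: "'a \<Rightarrow> real"
  assumes [measurable]: "f \<in> borel_measurable borel" and \<mu>: "0 < \<mu>" and \<kappa>: "0 \<le> \<kappa>"
    and F: "(\<integral>\<^sup>+x\<in>ball 0 (3/2). ennreal (\<bar>f x\<bar> powr q) \<partial>lborel) \<le> ennreal \<kappa>"
  shows "(\<integral>\<^sup>+x\<in>ball 0 (3/2). ennreal \<bar>f x\<bar> \<partial>lborel) \<le> ennreal (\<mu> * (vol * 2 powr DIM('a)) + \<mu> powr (1 - q) * \<kappa>)"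
proof -
  have le: "\<bar>f x\<bar> \<le> \<mu> + \<mu> powr (1 - q) * \<bar>f x\<bar> powr q" for x
  proof (cases "\<bar>f x\<bar> \<le> \<mu>")
    case True
    then show ?thesis by (simp add: add_increasing2)
  next
    case False
    have "\<bar>f x\<bar> = \<bar>f x\<bar> powr (1 - q) * \<bar>f x\<bar> powr q" using False \<mu> by (simp add: powr_add[symmetric])
    also have "\<dots> \<le> \<mu> powr (1 - q) * \<bar>f x\<bar> powr q"
      using False \<mu> q_gt by (intro mult_right_mono powr_mono2') auto
    finally show ?thesis using \<mu> by simp
  qed
  have "(\<integral>\<^sup>+x\<in>ball 0 (3/2). ennreal \<bar>f x\<bar> \<partial>lborel)
    \<le> (\<integral>\<^sup>+x. ennreal \<mu> * indicator (ball 0 (3/2)) x + ennreal (\<mu> powr (1 - q)) * (ennreal (\<bar>f x\<bar> powr q) * indicator (ball 0 (3/2)) x) \<partial>lborel)"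
  proof (intro nn_integral_mono)
    fix x
    have "ennreal \<bar>f x\<bar> \<le> ennreal (\<mu> + \<mu> powr (1 - q) * \<bar>f x\<bar> powr q)" by (rule ennreal_leI[OF le])
    also have "\<dots> = ennreal \<mu> + ennreal (\<mu> powr (1 - q)) * ennreal (\<bar>f x\<bar> powr q)"
      using \<mu> by (simp add: ennreal_plus ennreal_mult)
    finally show "ennreal \<bar>f x\<bar> * indicator (ball 0 (3/2)) x \<le> ennreal \<mu> * indicator (ball 0 (3/2)) x + ennreal (\<mu> powr (1 - q)) * (ennreal (\<bar>f x\<bar> powr q) * indicator (ball 0 (3/2)) x)"
      by (auto simp: indicator_def)
  qed
  also have "\<dots> = ennreal \<mu> * emeasure lborel (ball (0::'a) (3/2)) + ennreal (\<mu> powr (1 - q)) * (\<integral>\<^sup>+x\<in>ball 0 (3/2). ennreal (\<bar>f x\<bar> powr q) \<partial>lborel)"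
    by (subst nn_integral_add, measurable, subst nn_integral_cmult_indicator, simp, subst nn_integral_cmult, measurable)
  also have "\<dots> \<le> ennreal \<mu> * ennreal (vol * 2 powr DIM('a)) + ennreal (\<mu> powr (1 - q)) * ennreal \<kappa>"
  proof (intro add_mono mult_left_mono F)
    show "emeasure lborel (ball (0::'a) (3/2)) \<le> ennreal (vol * 2 powr DIM('a))"
      unfolding vol_def using powr_mono2[of "DIM('a)" "3/2" 2]
      by (simp add: emeasure_lborel_ball ennreal_leI)
  qed auto
  also have "\<dots> = ennreal (\<mu> * (vol * 2 powr DIM('a)) + \<mu> powr (1 - q) * \<kappa>)"
    using \<mu> vol_pos \<kappa> by (simp add: ennreal_plus ennreal_mult)
  finally show ?thesis .
qed

text \<open>The constants are fixed in the order \<open>T0\<close>, \<open>\<epsilon>\<close>,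
  \<open>h\<close>, \<open>\<mu>\<close>, \<open>\<kappa>\<close>. To avoid a circle, the tail of
  the rescaled function \<open>U\<close> has to be below \<open>T0\<close> before \<open>h\<close>
  is known: \<open>U \<le> 2\<close> on \<open>ball 0 L\<close> whatever \<open>h\<close> is, and
  the part outside, of size \<open>(4 / h) powr (p - 1)\<close>, is compensated by
  \<open>\<kappa>\<close>, which is chosen last.\<close>

theorem growth_lemma:
  "\<exists>h \<kappa>. 0 < h \<and> h \<le> 1/2 \<and> 0 < \<kappa> \<and> (\<forall>\<rho> L u f. scale \<rho> \<longrightarrow> 2 \<le> L \<longrightarrow> 2 * \<rho> * L \<le> 1 \<longrightarrow> sol \<rho> u f \<longrightarrow>
     (AE x in lborel. x \<in> ball 0 L \<longrightarrow> \<bar>u x\<bar> \<le> 1) \<longrightarrow>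
     (\<integral>\<^sup>+y\<in>- ball 0 L. ennreal (kmaj \<rho> (norm y) * (1 + \<bar>u y\<bar>) powr (p - 1)) \<partial>lborel) \<le> ennreal \<kappa> \<longrightarrow>
     (\<integral>\<^sup>+x\<in>ball 0 (3/2). ennreal (\<bar>f x\<bar> powr q) \<partial>lborel) \<le> ennreal \<kappa> \<longrightarrow>
     ennreal (vol / 2) \<le> emeasure lborel {x \<in> ball 0 1. 0 \<le> u x} \<longrightarrow>
     (AE x in lborel. x \<in> ball 0 1 \<longrightarrow> h / 4 - 1 \<le> u x))"
proof -
  define T0 where "T0 = 2 powr (p - 1) * c_out + 1"
  have T0: "0 \<le> T0" using c_nonneg by (simp add: T0_def)
  obtain \<epsilon> where \<epsilon>: "0 < \<epsilon>" and dg: "\<And>\<rho> L u f. scale \<rho> \<Longrightarrow> 2 * \<rho> * L \<le> 1 \<Longrightarrow> sol \<rho> u f \<Longrightarrow> tail \<rho> L u \<le> ennreal T0 \<Longrightarrow>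
    (\<integral>\<^sup>+x\<in>ball 0 (3/2). ennreal (\<bar>f x\<bar> powr q) \<partial>lborel) \<le> 1 \<Longrightarrow>
    (\<integral>\<^sup>+x\<in>ball 0 (5/4). ennreal (max (u x) 0 powr p) \<partial>lborel) \<le> ennreal \<epsilon> \<Longrightarrow>
    (AE x in lborel. x \<in> ball 0 1 \<longrightarrow> u x \<le> 1)"
    using de_giorgi[OF T0] by blast
  define h where "h = min (1/2) ((\<epsilon> / (2 powr p * ls_const)) powr (1 / (p - 1)))"
  have h: "0 < h" "h \<le> 1/2" using \<epsilon> ls_const_pos by (auto simp: h_def)
  have h\<epsilon>: "2 powr p * (ls_const * h powr (p - 1)) \<le> \<epsilon>"
  proof -
    have "h powr (p - 1) \<le> ((\<epsilon> / (2 powr p * ls_const)) powr (1 / (p - 1))) powr (p - 1)"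
      using h p by (intro powr_mono2) (auto simp: h_def)
    also have "\<dots> = \<epsilon> / (2 powr p * ls_const)" using p \<epsilon> ls_const_pos by (simp add: powr_powr)
    finally show ?thesis using ls_const_pos by (simp add: field_simps)
  qed
  define \<mu> where "\<mu> = h powr (p - 1) / (2 * (vol * 2 powr DIM('a)))"
  have \<mu>: "0 < \<mu>" using h vol_pos by (simp add: \<mu>_def)
  \<comment> \<open>The three entries control the tail of \<open>U\<close>, the right-hand side of
    its equation in the power \<open>q\<close>, and the integral of the modulus of \<open>f\<close>
    that \<open>level_set_estimate\<close> asks for.\<close>
  define \<kappa> where "\<kappa> = min ((h / 4) powr (p - 1)) (min ((h / 4) powr ((p - 1) * q)) (\<mu> powr (q - 1) * h powr (p - 1) / 2))"
  have \<kappa>: "0 < \<kappa>" "\<kappa> \<le> (h / 4) powr (p - 1)" "\<kappa> \<le> (h / 4) powr ((p - 1) * q)" "\<kappa> \<le> \<mu> powr (q - 1) * h powr (p - 1) / 2"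
    using h \<mu> by (auto simp: \<kappa>_def)
  have \<kappa>h: "\<kappa> \<le> h powr (p - 1)" using \<kappa>(2) powr_mono2[of "p - 1" "h / 4" h] h p by simp
  have "AE x in lborel. x \<in> ball 0 1 \<longrightarrow> h / 4 - 1 \<le> u x"
    if \<rho>: "scale \<rho>" and L: "2 \<le> L" "2 * \<rho> * L \<le> 1" and sol: "sol \<rho> u f"
     and bd: "AE x in lborel. x \<in> ball 0 L \<longrightarrow> \<bar>u x\<bar> \<le> 1"
     and T: "(\<integral>\<^sup>+y\<in>- ball 0 L. ennreal (kmaj \<rho> (norm y) * (1 + \<bar>u y\<bar>) powr (p - 1)) \<partial>lborel) \<le> ennreal \<kappa>"
     and F: "(\<integral>\<^sup>+x\<in>ball 0 (3/2). ennreal (\<bar>f x\<bar> powr q) \<partial>lborel) \<le> ennreal \<kappa>"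
     and half: "ennreal (vol / 2) \<le> emeasure lborel {x \<in> ball 0 1. 0 \<le> u x}" for \<rho> L u f
  proof -
    note [measurable] = solD(1,2)[OF sol]
    have "(\<integral>\<^sup>+x\<in>ball 0 (3/2). ennreal \<bar>f x\<bar> \<partial>lborel) \<le> ennreal (\<mu> * (vol * 2 powr DIM('a)) + \<mu> powr (1 - q) * \<kappa>)"
      using \<mu> \<kappa> F by (intro L1_le_Lq) auto
    also have "\<dots> \<le> ennreal (h powr (p - 1))"
    proof (rule ennreal_leI)
      have "\<mu> powr (1 - q) * \<kappa> \<le> \<mu> powr (1 - q) * (\<mu> powr (q - 1) * h powr (p - 1) / 2)"
        using \<kappa> by (intro mult_left_mono) auto
      also have "\<dots> = (\<mu> powr (1 - q) * \<mu> powr (q - 1)) * (h powr (p - 1) / 2)" by simp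
      also have "\<mu> powr (1 - q) * \<mu> powr (q - 1) = 1" using \<mu> by (simp add: powr_add[symmetric])
      finally have "\<mu> powr (1 - q) * \<kappa> \<le> h powr (p - 1) / 2" by simp
      moreover have "\<mu> * (vol * 2 powr DIM('a)) = h powr (p - 1) / 2" using vol_pos by (simp add: \<mu>_def field_simps)
      ultimately show "\<mu> * (vol * 2 powr DIM('a)) + \<mu> powr (1 - q) * \<kappa> \<le> h powr (p - 1)" by linarith
    qed
    finally have F1: "(\<integral>\<^sup>+x\<in>ball 0 (3/2). ennreal \<bar>f x\<bar> \<partial>lborel) \<le> ennreal (h powr (p - 1))" .
    have T1: "(\<integral>\<^sup>+y\<in>- ball 0 L. ennreal (kmaj \<rho> (norm y) * (1 + \<bar>u y\<bar>) powr (p - 1)) \<partial>lborel) \<le> ennreal (h powr (p - 1))"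
      using T ennreal_leI[OF \<kappa>h] by (rule order_trans)
    have ls: "emeasure lborel {x \<in> ball 0 (5/4). u x < h / 2 - 1} \<le> ennreal (ls_const * h powr (p - 1))"
      using level_set_estimate[OF \<rho> L sol bd h T1 F1 half] by (simp add: ls_const_def)
    \<comment> \<open>This is \<open>2 - 4 / h * (u + 1)\<close>: it is positive exactly where
      \<open>u < h / 2 - 1\<close>, at most 2 where \<open>- 1 \<le> u\<close>, and
      \<open>U \<le> 1\<close> is the claim \<open>h / 4 - 1 \<le> u\<close>.\<close>
    define U where "U = (\<lambda>x. - 4 / h * u x + (2 - 4 / h))"
    define g where "g = (\<lambda>x. signed_powr p (- 4 / h) * f x)"
    have solU: "sol \<rho> U g" unfolding U_def g_def using h by (intro sol_affine[OF \<rho> sol]) auto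
    have Ule: "U x = 2 - 4 / h * (u x + 1)" for x by (simp add: U_def algebra_simps add_divide_distrib)
    have U2: "AE x in lborel. x \<in> ball 0 L \<longrightarrow> U x \<le> 2"
      using bd
    proof eventually_elim
      case (elim x)
      then show ?case unfolding Ule using h by (auto intro!: mult_nonneg_nonneg)
    qed
    have tl: "tail \<rho> L U \<le> ennreal T0"
    proof -
      have "tail \<rho> L U \<le> ennreal (2 powr (p - 1) * c_out + (4 / h) powr (p - 1) * \<kappa>)"
      proof (rule tail_le[OF \<rho> _ _ _ _ U2 _ T])
        fix y :: 'a
        have "\<bar>U y\<bar> \<le> \<bar>- 4 / h * u y\<bar> + \<bar>2 - 4 / h\<bar>" unfolding U_def by (rule abs_triangle_ineq)
        also have "\<bar>2 - 4 / h\<bar> \<le> 4 / h" using h by (simp add: field_simps abs_le_iff)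
        also have "\<bar>- 4 / h * u y\<bar> = 4 / h * \<bar>u y\<bar>" using h by (simp add: abs_mult)
        finally show "\<bar>U y\<bar> \<le> 4 / h * (1 + \<bar>u y\<bar>)" by (simp add: algebra_simps add_divide_distrib)
      qed (use L h \<kappa> in auto)
      also have "\<dots> \<le> ennreal T0"
      proof (rule ennreal_leI)
        have "(4 / h) powr (p - 1) * \<kappa> \<le> (4 / h) powr (p - 1) * (h / 4) powr (p - 1)" using \<kappa> by (intro mult_left_mono) auto
        also have "\<dots> = 1" using h by (simp add: powr_mult[symmetric])
        finally show "2 powr (p - 1) * c_out + (4 / h) powr (p - 1) * \<kappa> \<le> T0" by (simp add: T0_def)
      qed
      finally show ?thesis .
    qed
    have g1: "(\<integral>\<^sup>+x\<in>ball 0 (3/2). ennreal (\<bar>g x\<bar> powr q) \<partial>lborel) \<le> 1"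
    proof -
      have eq: "\<bar>g x\<bar> powr q = (4 / h) powr ((p - 1) * q) * \<bar>f x\<bar> powr q" for x
        using h by (simp add: g_def abs_mult abs_signed_powr powr_mult powr_powr)
      have "(\<integral>\<^sup>+x\<in>ball 0 (3/2). ennreal (\<bar>g x\<bar> powr q) \<partial>lborel) = (\<integral>\<^sup>+x. ennreal ((4 / h) powr ((p - 1) * q)) * (ennreal (\<bar>f x\<bar> powr q) * indicator (ball 0 (3/2)) x) \<partial>lborel)"
        by (intro nn_integral_cong) (simp add: eq ennreal_mult mult.assoc)
      also have "\<dots> = ennreal ((4 / h) powr ((p - 1) * q)) * (\<integral>\<^sup>+x\<in>ball 0 (3/2). ennreal (\<bar>f x\<bar> powr q) \<partial>lborel)"
        by (rule nn_integral_cmult) measurable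
      also have "\<dots> \<le> ennreal ((4 / h) powr ((p - 1) * q)) * ennreal ((h / 4) powr ((p - 1) * q))"
        using F \<kappa>(3) by (intro mult_left_mono) (auto intro: order_trans ennreal_leI)
      also have "\<dots> = 1" using h by (simp add: ennreal_mult[symmetric] powr_mult[symmetric])
      finally show ?thesis .
    qed
    have "(\<integral>\<^sup>+x\<in>ball 0 (5/4). ennreal (max (U x) 0 powr p) \<partial>lborel)
      \<le> (\<integral>\<^sup>+x. ennreal (2 powr p) * indicator {x \<in> ball 0 (5/4). u x < h / 2 - 1} x \<partial>lborel)"
    proof (rule nn_integral_mono_AE, use U2 in eventually_elim)
      case (elim x)
      show ?case
      proof (cases "x \<in> ball 0 (5/4)")
        case True
        then have U2': "U x \<le> 2" using elim L by auto
        show ?thesis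
        proof (cases "u x < h / 2 - 1")
          case ux: True
          have "max (U x) 0 powr p \<le> 2 powr p" using U2' p by (intro powr_mono2) auto
          then show ?thesis using True ux by (simp add: ennreal_leI)
        next
          case False
          then have "2 \<le> 4 / h * (u x + 1)" using h by (simp add: field_simps)
          then have "max (U x) 0 = 0" unfolding Ule by simp
          then show ?thesis using p by simp
        qed
      qed simp
    qed
    also have "\<dots> = ennreal (2 powr p) * emeasure lborel {x \<in> ball 0 (5/4). u x < h / 2 - 1}"
      by (subst nn_integral_cmult_indicator) auto
    also have "\<dots> \<le> ennreal (2 powr p) * ennreal (ls_const * h powr (p - 1))" by (intro mult_left_mono ls) simp
    also have "\<dots> = ennreal (2 powr p * (ls_const * h powr (p - 1)))"
      using ls_const_pos by (intro ennreal_mult[symmetric]) auto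
    also have "\<dots> \<le> ennreal \<epsilon>" by (rule ennreal_leI[OF h\<epsilon>])
    finally have "AE x in lborel. x \<in> ball 0 1 \<longrightarrow> U x \<le> 1" by (rule dg[OF \<rho> L(2) solU tl g1])
    then show ?thesis
    proof eventually_elim
      case (elim x)
      show ?case
      proof
        assume "x \<in> ball 0 1"
        then have "1 \<le> 4 / h * (u x + 1)" using elim unfolding Ule by simp
        then show "h / 4 - 1 \<le> u x" using h by (simp add: field_simps)
      qed
    qed
  qed
  then show ?thesis using h \<kappa>(1) by blast
qed

text \<open>One of \<open>u\<close> and \<open>- u\<close> is nonnegative on at least half of the
  unit ball, so \<open>growth_lemma\<close> raises one of the two bounds by \<open>h / 4\<close>.
  The remaining interval has half-length \<open>1 - h / 8\<close> and its centre at
  \<open>h / 8\<close> or \<open>- h / 8\<close>.\<close>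

theorem oscillation_step:
  "\<exists>\<delta> \<kappa>. 0 < \<delta> \<and> \<delta> \<le> 1/8 \<and> 0 < \<kappa> \<and> (\<forall>\<rho> L u f. scale \<rho> \<longrightarrow> 2 \<le> L \<longrightarrow> 2 * \<rho> * L \<le> 1 \<longrightarrow> sol \<rho> u f \<longrightarrow>
     (AE x in lborel. x \<in> ball 0 L \<longrightarrow> \<bar>u x\<bar> \<le> 1) \<longrightarrow>
     (\<integral>\<^sup>+y\<in>- ball 0 L. ennreal (kmaj \<rho> (norm y) * (1 + \<bar>u y\<bar>) powr (p - 1)) \<partial>lborel) \<le> ennreal \<kappa> \<longrightarrow>
     (\<integral>\<^sup>+x\<in>ball 0 (3/2). ennreal (\<bar>f x\<bar> powr q) \<partial>lborel) \<le> ennreal \<kappa> \<longrightarrow>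
     (\<exists>m. AE x in lborel. x \<in> ball 0 1 \<longrightarrow> \<bar>u x - m\<bar> \<le> 1 - \<delta>))"
proof -
  obtain h \<kappa> where h: "0 < h" "h \<le> 1/2" "0 < \<kappa>" and gr: "\<And>\<rho> L u f. scale \<rho> \<Longrightarrow> 2 \<le> L \<Longrightarrow> 2 * \<rho> * L \<le> 1 \<Longrightarrow> sol \<rho> u f \<Longrightarrow>
     (AE x in lborel. x \<in> ball 0 L \<longrightarrow> \<bar>u x\<bar> \<le> 1) \<Longrightarrow>
     (\<integral>\<^sup>+y\<in>- ball 0 L. ennreal (kmaj \<rho> (norm y) * (1 + \<bar>u y\<bar>) powr (p - 1)) \<partial>lborel) \<le> ennreal \<kappa> \<Longrightarrow>
     (\<integral>\<^sup>+x\<in>ball 0 (3/2). ennreal (\<bar>f x\<bar> powr q) \<partial>lborel) \<le> ennreal \<kappa> \<Longrightarrow>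
     ennreal (vol / 2) \<le> emeasure lborel {x \<in> ball 0 1. 0 \<le> u x} \<Longrightarrow>
     (AE x in lborel. x \<in> ball 0 1 \<longrightarrow> h / 4 - 1 \<le> u x)"
    using growth_lemma by blast
  have "\<exists>m. AE x in lborel. x \<in> ball 0 1 \<longrightarrow> \<bar>u x - m\<bar> \<le> 1 - h / 8"
    if \<rho>: "scale \<rho>" and L: "2 \<le> L" "2 * \<rho> * L \<le> 1" and sol: "sol \<rho> u f"
     and bd: "AE x in lborel. x \<in> ball 0 L \<longrightarrow> \<bar>u x\<bar> \<le> 1"
     and T: "(\<integral>\<^sup>+y\<in>- ball 0 L. ennreal (kmaj \<rho> (norm y) * (1 + \<bar>u y\<bar>) powr (p - 1)) \<partial>lborel) \<le> ennreal \<kappa>"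
     and F: "(\<integral>\<^sup>+x\<in>ball 0 (3/2). ennreal (\<bar>f x\<bar> powr q) \<partial>lborel) \<le> ennreal \<kappa>" for \<rho> L u f
  proof -
    note [measurable] = solD(1,2)[OF sol]
    have bd1: "AE x in lborel. x \<in> ball 0 1 \<longrightarrow> \<bar>u x\<bar> \<le> 1"
      using bd by eventually_elim (use L in auto)
    have "ennreal vol = emeasure lborel (ball (0::'a) 1)" by (simp add: emeasure_lborel_ball vol_def)
    also have "\<dots> \<le> emeasure lborel ({x \<in> ball 0 1. 0 \<le> u x} \<union> {x \<in> ball 0 1. 0 \<le> - u x})"
      by (intro emeasure_mono) auto
    also have "\<dots> \<le> emeasure lborel {x \<in> ball 0 1. 0 \<le> u x} + emeasure lborel {x \<in> ball 0 1. 0 \<le> - u x}"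
      by (intro emeasure_subadditive) auto
    finally have sum: "ennreal vol \<le> emeasure lborel {x \<in> ball 0 1. 0 \<le> u x} + emeasure lborel {x \<in> ball 0 1. 0 \<le> - u x}" .
    have "ennreal (vol / 2) \<le> emeasure lborel {x \<in> ball 0 1. 0 \<le> u x} \<or> ennreal (vol / 2) \<le> emeasure lborel {x \<in> ball 0 1. 0 \<le> - u x}"
    proof (rule ccontr)
      assume "\<not> ?thesis"
      moreover have "X + Y < ennreal vol" if "X < ennreal (vol / 2)" "Y < ennreal (vol / 2)" for X Y
        using that vol_pos by (cases X; cases Y) (auto simp: ennreal_plus[symmetric] ennreal_less_iff simp del: ennreal_plus)
      ultimately show False using sum by (meson not_le)
    qed
    then show ?thesis
    proof
      assume half: "ennreal (vol / 2) \<le> emeasure lborel {x \<in> ball 0 1. 0 \<le> u x}"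
      show ?thesis
      proof (intro exI[of _ "h / 8"])
        show "AE x in lborel. x \<in> ball 0 1 \<longrightarrow> \<bar>u x - h / 8\<bar> \<le> 1 - h / 8"
          using gr[OF \<rho> L sol bd T F half] bd1 by eventually_elim (auto simp: abs_le_iff)
      qed
    next
      assume half: "ennreal (vol / 2) \<le> emeasure lborel {x \<in> ball 0 1. 0 \<le> - u x}"
      have sol': "sol \<rho> (\<lambda>x. - u x) (\<lambda>x. - f x)"
        using sol_affine[OF \<rho> sol, of "- 1" 0] by (simp add: signed_powr_one)
      show ?thesis
      proof (intro exI[of _ "- h / 8"])
        show "AE x in lborel. x \<in> ball 0 1 \<longrightarrow> \<bar>u x - - h / 8\<bar> \<le> 1 - h / 8"
          using gr[OF \<rho> L sol' _ _ _ half] bd T F bd1 by (auto simp: abs_le_iff elim!: eventually_elim2)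
      qed
    qed
  qed
  then show ?thesis using h by (intro exI[of _ "h / 8"] exI[of _ \<kappa>]) auto
qed

end

subsection \<open>Scaling\<close>

lemma nn_integral_affine:
  fixes F :: "'b::euclidean_space \<Rightarrow> ennreal" and \<rho> :: real
  assumes [measurable]: "F \<in> borel_measurable borel" and \<rho>: "0 < \<rho>"
  shows "(\<integral>\<^sup>+y. F y \<partial>lborel) = ennreal (\<rho> powr DIM('b)) * (\<integral>\<^sup>+x. F (t + \<rho> *\<^sub>R x) \<partial>lborel)"
proof -
  have "(\<integral>\<^sup>+y. F y \<partial>lborel) = (\<integral>\<^sup>+y. F y \<partial>density (distr lborel borel (\<lambda>x. t + \<rho> *\<^sub>R x)) (\<lambda>_. ennreal (\<bar>\<rho>\<bar> ^ DIM('b))))"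
    using lborel_affine[of \<rho> t] \<rho> by simp
  also have "\<dots> = ennreal (\<rho> powr DIM('b)) * (\<integral>\<^sup>+x. F (t + \<rho> *\<^sub>R x) \<partial>lborel)"
    using \<rho> by (simp add: nn_integral_density nn_integral_cmult nn_integral_distr powr_realpow)
  finally show ?thesis .
qed

lemma integral_affine:
  fixes F :: "'b::euclidean_space \<Rightarrow> real" and \<rho> :: real
  assumes [measurable]: "F \<in> borel_measurable borel" and \<rho>: "0 < \<rho>"
  shows "(\<integral>y. F y \<partial>lborel) = \<rho> powr DIM('b) * (\<integral>x. F (t + \<rho> *\<^sub>R x) \<partial>lborel)"
proof -
  have "(\<integral>y. F y \<partial>lborel) = (\<integral>y. F y \<partial>density (distr lborel borel (\<lambda>x. t + \<rho> *\<^sub>R x)) (\<lambda>_. ennreal (\<bar>\<rho>\<bar> ^ DIM('b))))"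
    using lborel_affine[of \<rho> t] \<rho> by simp
  also have "\<dots> = \<rho> powr DIM('b) * (\<integral>x. F (t + \<rho> *\<^sub>R x) \<partial>lborel)"
    using \<rho> by (subst integral_density) (auto simp: integral_distr powr_realpow)
  finally show ?thesis .
qed

lemma AE_affine:
  fixes P :: "'b::euclidean_space \<Rightarrow> bool" and \<rho> :: real
  assumes [measurable]: "Measurable.pred borel P" and \<rho>: "0 < \<rho>"
  shows "(AE y in lborel. P y) \<longleftrightarrow> (AE x in lborel. P (t + \<rho> *\<^sub>R x))"
proof -
  let ?g = "\<lambda>y. indicator {y. \<not> P y} y :: ennreal"
  have "(AE y in lborel. P y) \<longleftrightarrow> (AE y in lborel. ?g y = 0)" by (simp add: indicator_def)
  also have "\<dots> \<longleftrightarrow> (\<integral>\<^sup>+y. ?g y \<partial>lborel) = 0" by (intro nn_integral_0_iff_AE[symmetric]) measurable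
  also have "\<dots> \<longleftrightarrow> (\<integral>\<^sup>+x. ?g (t + \<rho> *\<^sub>R x) \<partial>lborel) = 0"
    using \<rho> by (subst nn_integral_affine[of ?g \<rho> t]) auto
  also have "\<dots> \<longleftrightarrow> (AE x in lborel. ?g (t + \<rho> *\<^sub>R x) = 0)" by (intro nn_integral_0_iff_AE) measurable
  also have "\<dots> \<longleftrightarrow> (AE x in lborel. P (t + \<rho> *\<^sub>R x))" by (simp add: indicator_def)
  finally show ?thesis .
qed

text \<open>A ball of positive radius is not a null set. This extracts inequalities between
  constants, such as the centres belonging to nested balls, from almost everywhere
  statements.\<close>

lemma AE_ball_const:
  assumes "AE x in lborel. x \<in> ball (x0::'b::euclidean_space) r \<longrightarrow> Q" "0 < r"
  shows Q
proof (rule ccontr)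
  assume "\<not> Q"
  then have "AE x in lborel. x \<notin> ball x0 r" using assms(1) by simp
  then have "emeasure lborel (ball x0 r) = 0" by (subst (asm) AE_iff_measurable[of "ball x0 r"]) auto
  moreover have "0 < unit_ball_vol (real DIM('b))" by simp
  ultimately show False using assms(2) by (simp add: emeasure_lborel_ball ennreal_eq_0_iff mult_le_0_iff)
qed

context log_kernel
begin

text \<open>\<open>ker 1\<close> and \<open>kplus 1\<close> are the kernel itself and its part \<open>(- ln r)\<^sub>+ / r powr dsp\<close>.\<close>

definition borel_sol :: "'a set \<Rightarrow> ('a \<Rightarrow> real) \<Rightarrow> ('a \<Rightarrow> real) \<Rightarrow> bool" where
  "borel_sol U u f \<longleftrightarrow> u \<in> borel_measurable borel \<and> f \<in> borel_measurable borel \<and>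
     (\<forall>K. compact K \<and> K \<subseteq> U \<longrightarrow> (\<integral>\<^sup>+x\<in>K. ennreal (\<bar>u x\<bar> powr p) \<partial>lborel) < \<infinity> \<and>
       (\<integral>\<^sup>+x. (\<integral>\<^sup>+y. ennreal (indicator K x * indicator K y
        * (kplus 1 (dist x y) * \<bar>u x - u y\<bar> powr p)) \<partial>lborel) \<partial>lborel) < \<infinity>) \<and>
     (\<integral>\<^sup>+y. ennreal ((1 + ln (1 + norm y)) / (1 + norm y) powr dsp * \<bar>u y\<bar> powr (p - 1)) \<partial>lborel) < \<infinity> \<and>
     (\<forall>K v. compact K \<and> K \<subseteq> U \<and> v \<in> borel_measurable borel \<and> (\<forall>x. 0 \<le> v x) \<and> (\<forall>x. x \<notin> K \<longrightarrow> v x = 0) \<and>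
        (\<integral>\<^sup>+x. ennreal (v x powr p) \<partial>lborel) < \<infinity> \<and>
        (\<integral>\<^sup>+x. (\<integral>\<^sup>+y. ennreal (kplus 1 (dist x y) * \<bar>v x - v y\<bar> powr p) \<partial>lborel) \<partial>lborel) < \<infinity> \<longrightarrow>
        (\<integral>z. ker 1 (dist (fst z) (snd z)) * signed_powr p (u (fst z) - u (snd z)) * (v (fst z) - v (snd z))
           \<partial>(lborel \<Otimes>\<^sub>M lborel)) = (\<integral>x. f x * v x \<partial>lborel))"

lemma lg_1: "lg 1 = 1" by (simp add: lg_def)

lemma ker_scaled: "0 < \<rho> \<Longrightarrow> 0 < lg \<rho> \<Longrightarrow> 0 \<le> r \<Longrightarrow> ker 1 (\<rho> * r) = lg \<rho> * \<rho> powr - dsp * ker \<rho> r"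
  by (simp add: ker_def lg_1 powr_mult powr_minus_divide)

lemma kplus_scaled: "0 < \<rho> \<Longrightarrow> 0 \<le> r \<Longrightarrow> kplus 1 (\<rho> * r) = \<rho> powr - dsp * kplus \<rho> r"
  by (simp add: kplus_def powr_mult powr_minus_divide)

lemma kmaj_scaled: "0 < \<rho> \<Longrightarrow> 0 \<le> r \<Longrightarrow> kmaj \<rho> r = \<rho> powr dsp / lg \<rho> * hmaj (\<rho> * r)"
  by (simp add: kmaj_def hmaj_def powr_mult)

text \<open>At these distances \<open>- ln (\<rho> * r)\<close> is at least
  \<open>ln (4 / 3)\<close>, so the constant \<open>B\<close> can be absorbed into the logarithm.
  This turns the energy in the definition of the space into the one in \<open>sol\<close>.\<close>

lemma ker_le_kplus:
  assumes "scale \<rho>" "0 \<le> r" "r \<le> 3"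
  shows "ker \<rho> r \<le> c * (B / ln (4/3) + p) * kplus \<rho> r"
proof (cases "r = 0")
  case False
  have "\<rho> * r \<le> 1/4 * 3" using assms by (intro mult_mono) (auto simp: scale_def)
  then have "ln (\<rho> * r) \<le> ln (3/4)" using assms False by (subst ln_le_cancel_iff) (auto simp: scale_def)
  then have l: "ln (4/3) \<le> - ln (\<rho> * r)" by (simp add: ln_div)
  have l0: "0 < ln (4/3 :: real)" by simp
  have "B \<le> B / ln (4/3) * (- ln (\<rho> * r))"
    using l l0 B mult_left_mono[OF l B] by (simp add: field_simps)
  then have "B - p * ln (\<rho> * r) \<le> (B / ln (4/3) + p) * (- ln (\<rho> * r))" by (simp add: distrib_right)
  also have "- ln (\<rho> * r) = max (- ln (\<rho> * r)) 0" using order_trans[OF less_imp_le[OF l0] l] by simp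
  finally have "c * (B - p * ln (\<rho> * r)) \<le> c * (B / ln (4/3) + p) * max (- ln (\<rho> * r)) 0"
    using c by (simp add: mult.assoc)
  then have "c * (B - p * ln (\<rho> * r)) / lg \<rho> \<le> c * (B / ln (4/3) + p) * max (- ln (\<rho> * r)) 0 / lg \<rho>"
    using lg_ge[OF assms(1)] by (intro divide_right_mono) auto
  also have "\<dots> \<le> c * (B / ln (4/3) + p) * max (- ln (\<rho> * r)) 0 / 1"
    using lg_ge[OF assms(1)] c B p l0 by (intro divide_left_mono mult_nonneg_nonneg add_nonneg_nonneg) auto
  finally have "c * (B - p * ln (\<rho> * r)) / lg \<rho> / r powr dsp \<le> c * (B / ln (4/3) + p) * max (- ln (\<rho> * r)) 0 / r powr dsp"
    by (intro divide_right_mono) auto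
  then show ?thesis by (simp add: ker_def kplus_def)
qed (simp add: ker_def kplus_def)

text \<open>Up to constants and the factor \<open>R powr (s * p)\<close> this is the power
  \<open>p - 1\<close> of \<open>Tail_mod\<close>: both weights behave like
  \<open>(1 + \<bar>ln r\<bar>) / r powr dsp\<close>.\<close>

definition "log_tail u x0 R = (\<integral>\<^sup>+y\<in>- ball (x0::'a) R. ennreal (hmaj (dist x0 y) * \<bar>u y\<bar> powr (p - 1)) \<partial>lborel)"

definition "log_norm u = (\<integral>\<^sup>+y. ennreal ((1 + ln (1 + norm (y::'a))) / (1 + norm y) powr dsp * \<bar>u y\<bar> powr (p - 1)) \<partial>lborel)"

text \<open>Moves the weight of \<open>L_log\<close> from the origin to \<open>x0\<close>. The
  constant depends on \<open>x0\<close> only through the bound \<open>b\<close> on its norm, which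
  gives uniformity on compact sets.\<close>

lemma log_tail_le:
  assumes [measurable]: "u \<in> borel_measurable borel" and R: "0 < R" "R \<le> 1" and b: "norm x0 \<le> b"
  shows "log_tail u x0 R \<le> ennreal ((1 + (1 + b) / R) powr dsp * (1 + ln (1 + b) + ln (1 / R))) * log_norm u"
proof -
  have b0: "0 \<le> b" using b norm_ge_zero[of x0] by linarith
  let ?A = "1 + (1 + b) / R" and ?N = "1 + ln (1 + b) + ln (1 / R)"
  have lR: "0 \<le> ln (1 / R)" using R by simp
  have lb: "0 \<le> ln (1 + b)" using b0 by simp
  have pt: "hmaj (dist x0 y) \<le> ?A powr dsp * ?N * ((1 + ln (1 + norm y)) / (1 + norm y) powr dsp)" if y: "R \<le> dist x0 y" for y
  proof -
    define z where "z = dist x0 y"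
    have z: "R \<le> z" "0 < z" using y R by (auto simp: z_def)
    have nz: "norm y \<le> b + z" "z \<le> b + norm y"
      using norm_triangle_ineq2[of y x0] norm_triangle_ineq4[of x0 y] b by (auto simp: z_def dist_norm norm_minus_commute)
    have "1 + norm y \<le> (1 + b) * 1 + z" using nz by simp
    also have "(1 + b) * 1 \<le> (1 + b) * (z / R)" using z R b0 by (intro mult_left_mono) auto
    finally have "1 + norm y \<le> ?A * z" by (simp add: algebra_simps)
    then have "(1 + norm y) powr dsp \<le> (?A * z) powr dsp" using dsp_pos by (intro powr_mono2) auto
    also have "\<dots> = ?A powr dsp * z powr dsp" by (rule powr_mult)
    finally have p1: "(1 + norm y) powr dsp \<le> ?A powr dsp * z powr dsp" .
    have "z \<le> (1 + b) * (1 + norm y)"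
    proof -
      have "(1 + b) * (1 + norm y) = 1 + b + norm y + b * norm y" by (simp add: algebra_simps)
      then show ?thesis using nz b0 mult_nonneg_nonneg[OF b0 norm_ge_zero[of y]] by linarith
    qed
    then have "ln z \<le> ln ((1 + b) * (1 + norm y))" using z by (subst ln_le_cancel_iff) (auto intro: mult_pos_pos add_pos_nonneg b0)
    also have "\<dots> = ln (1 + b) + ln (1 + norm y)" using b0 by (simp add: ln_mult add_pos_nonneg add_nonneg_eq_0_iff)
    finally have u1: "ln z \<le> ln (1 + b) + ln (1 + norm y)" .
    have "ln (1 / z) \<le> ln (1 / R)" using z R by (subst ln_le_cancel_iff) (auto simp: field_simps)
    then have u2: "- ln z \<le> ln (1 / R)" using z by (simp add: ln_div)
    have ly: "0 \<le> ln (1 + norm y)" by simp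
    have "1 + \<bar>ln z\<bar> \<le> ?N + ln (1 + norm y)" using u1 u2 lR lb ly by linarith
    also have "\<dots> \<le> ?N * (1 + ln (1 + norm y))" using ly lR lb by (simp add: algebra_simps)
    finally have n1: "1 + \<bar>ln z\<bar> \<le> ?N * (1 + ln (1 + norm y))" .
    have "hmaj z \<le> ?N * (1 + ln (1 + norm y)) / z powr dsp" unfolding hmaj_def using n1 by (rule divide_right_mono) simp
    also have "\<dots> \<le> ?N * (1 + ln (1 + norm y)) * (?A powr dsp / (1 + norm y) powr dsp)"
    proof -
      have "1 / z powr dsp \<le> ?A powr dsp / (1 + norm y) powr dsp"
      proof -
        have "0 < 1 + norm y" by (simp add: add_pos_nonneg)
        then have "0 < (1 + norm y) powr dsp" "0 < z powr dsp" using z by (auto simp: powr_gt_zero)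
        then show ?thesis using p1 by (simp add: field_simps)
      qed
      then have "?N * (1 + ln (1 + norm y)) * (1 / z powr dsp) \<le> ?N * (1 + ln (1 + norm y)) * (?A powr dsp / (1 + norm y) powr dsp)"
        using ly lR lb by (intro mult_left_mono) auto
      then show ?thesis by simp
    qed
    finally show ?thesis by (simp add: z_def mult_ac)
  qed
  have nn: "0 \<le> (1 + ln (1 + norm y)) / (1 + norm y) powr dsp" for y :: 'a by simp
  have C0: "0 \<le> ?A powr dsp * ?N" using lR lb by simp
  have "log_tail u x0 R \<le> (\<integral>\<^sup>+y. ennreal (?A powr dsp * ?N) * ennreal ((1 + ln (1 + norm y)) / (1 + norm y) powr dsp * \<bar>u y\<bar> powr (p - 1)) \<partial>lborel)"
    unfolding log_tail_def
  proof (intro nn_integral_mono)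
    fix y
    show "ennreal (hmaj (dist x0 y) * \<bar>u y\<bar> powr (p - 1)) * indicator (- ball x0 R) y
      \<le> ennreal (?A powr dsp * ?N) * ennreal ((1 + ln (1 + norm y)) / (1 + norm y) powr dsp * \<bar>u y\<bar> powr (p - 1))"
    proof (cases "R \<le> dist x0 y")
      case True
      have "hmaj (dist x0 y) * \<bar>u y\<bar> powr (p - 1) \<le> ?A powr dsp * ?N * ((1 + ln (1 + norm y)) / (1 + norm y) powr dsp) * \<bar>u y\<bar> powr (p - 1)"
        by (intro mult_right_mono pt True) simp
      also have "\<dots> = ?A powr dsp * ?N * ((1 + ln (1 + norm y)) / (1 + norm y) powr dsp * \<bar>u y\<bar> powr (p - 1))" by simp
      finally have "ennreal (hmaj (dist x0 y) * \<bar>u y\<bar> powr (p - 1)) \<le> ennreal (?A powr dsp * ?N) * ennreal ((1 + ln (1 + norm y)) / (1 + norm y) powr dsp * \<bar>u y\<bar> powr (p - 1))"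
        by (subst ennreal_mult[OF C0, symmetric]) (auto intro!: ennreal_leI mult_nonneg_nonneg nn)
      then show ?thesis using True by simp
    qed simp
  qed
  also have "\<dots> = ennreal (?A powr dsp * ?N) * log_norm u"
    unfolding log_norm_def by (rule nn_integral_cmult) measurable
  finally show ?thesis .
qed

lemma scaled_tail:
  assumes \<rho>: "scale \<rho>" and [measurable]: "u \<in> borel_measurable borel"
  shows "(\<integral>\<^sup>+y\<in>- ball 0 r. ennreal (kmaj \<rho> (norm y) * \<bar>u (x0 + \<rho> *\<^sub>R y)\<bar> powr (p - 1)) \<partial>lborel)
     = ennreal (\<rho> powr (s * p) / lg \<rho>) * log_tail u x0 (\<rho> * r)"
proof -
  have r0: "0 < \<rho>" using \<rho> by (simp add: scale_def)
  have lg0: "0 < lg \<rho>" using lg_ge[OF \<rho>] by simp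
  define F where "F y = ennreal (hmaj (dist x0 y) * \<bar>u y\<bar> powr (p - 1)) * indicator (- ball x0 (\<rho> * r)) y" for y
  have [measurable]: "F \<in> borel_measurable borel" unfolding F_def by measurable
  have "log_tail u x0 (\<rho> * r) = ennreal (\<rho> powr DIM('a)) * (\<integral>\<^sup>+y. F (x0 + \<rho> *\<^sub>R y) \<partial>lborel)"
    unfolding log_tail_def F_def[symmetric] using r0 by (intro nn_integral_affine) measurable
  then have "ennreal (\<rho> powr (s * p) / lg \<rho>) * log_tail u x0 (\<rho> * r)
      = ennreal (\<rho> powr dsp / lg \<rho>) * (\<integral>\<^sup>+y. F (x0 + \<rho> *\<^sub>R y) \<partial>lborel)"
  proof -
    have "ennreal (\<rho> powr (s * p) / lg \<rho>) * ennreal (\<rho> powr DIM('a)) = ennreal (\<rho> powr dsp / lg \<rho>)"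
      using lg0 by (subst ennreal_mult[symmetric]) (auto simp: dsp_def powr_add)
    then show ?thesis
      unfolding \<open>log_tail u x0 (\<rho> * r) = _\<close> by (simp only: mult.assoc[symmetric])
  qed
  also have "\<dots> = (\<integral>\<^sup>+y. ennreal (\<rho> powr dsp / lg \<rho>) * F (x0 + \<rho> *\<^sub>R y) \<partial>lborel)"
    by (rule nn_integral_cmult[symmetric]) measurable
  also have "\<dots> = (\<integral>\<^sup>+y\<in>- ball 0 r. ennreal (kmaj \<rho> (norm y) * \<bar>u (x0 + \<rho> *\<^sub>R y)\<bar> powr (p - 1)) \<partial>lborel)"
  proof (intro nn_integral_cong)
    fix y :: 'a
    have d: "dist x0 (x0 + \<rho> *\<^sub>R y) = \<rho> * norm y" using r0 by (simp add: dist_norm)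
    have i: "indicator (- ball x0 (\<rho> * r)) (x0 + \<rho> *\<^sub>R y) = (indicator (- ball 0 r) y :: ennreal)"
      using r0 by (simp add: indicator_def d)
    have "kmaj \<rho> (norm y) = \<rho> powr dsp / lg \<rho> * hmaj (\<rho> * norm y)" using r0 by (intro kmaj_scaled) auto
    then show "ennreal (\<rho> powr dsp / lg \<rho>) * F (x0 + \<rho> *\<^sub>R y)
       = ennreal (kmaj \<rho> (norm y) * \<bar>u (x0 + \<rho> *\<^sub>R y)\<bar> powr (p - 1)) * indicator (- ball 0 r) y"
      unfolding F_def i d using lg0 hmaj_nonneg[of "\<rho> * norm y"]
      by (subst mult.assoc[symmetric], subst ennreal_mult[symmetric]) (auto simp: mult.assoc)
  qed
  finally show ?thesis ..
qed

lemma scaled_ball: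
  fixes g :: "'a \<Rightarrow> real"
  assumes \<rho>: "0 < \<rho>" and [measurable]: "g \<in> borel_measurable borel"
  shows "(\<integral>\<^sup>+x\<in>ball 0 r. ennreal (g (x0 + \<rho> *\<^sub>R x)) \<partial>lborel)
     = ennreal (\<rho> powr - real DIM('a)) * (\<integral>\<^sup>+y\<in>ball x0 (\<rho> * r). ennreal (g y) \<partial>lborel)"
proof -
  have "(\<integral>\<^sup>+y\<in>ball x0 (\<rho> * r). ennreal (g y) \<partial>lborel)
    = ennreal (\<rho> powr DIM('a)) * (\<integral>\<^sup>+x. ennreal (g (x0 + \<rho> *\<^sub>R x)) * indicator (ball x0 (\<rho> * r)) (x0 + \<rho> *\<^sub>R x) \<partial>lborel)"
    using \<rho> by (intro nn_integral_affine) measurable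
  also have "(\<integral>\<^sup>+x. ennreal (g (x0 + \<rho> *\<^sub>R x)) * indicator (ball x0 (\<rho> * r)) (x0 + \<rho> *\<^sub>R x) \<partial>lborel)
     = (\<integral>\<^sup>+x\<in>ball 0 r. ennreal (g (x0 + \<rho> *\<^sub>R x)) \<partial>lborel)"
    using \<rho> by (intro nn_integral_cong) (simp add: indicator_def dist_norm)
  finally have eq: "(\<integral>\<^sup>+y\<in>ball x0 (\<rho> * r). ennreal (g y) \<partial>lborel)
     = ennreal (\<rho> powr DIM('a)) * (\<integral>\<^sup>+x\<in>ball 0 r. ennreal (g (x0 + \<rho> *\<^sub>R x)) \<partial>lborel)" .
  show ?thesis
  proof -
    have "ennreal (\<rho> powr - real DIM('a)) * ennreal (\<rho> powr DIM('a)) = 1"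
      using \<rho> by (subst ennreal_mult[symmetric]) (auto simp: powr_add[symmetric])
    then show ?thesis unfolding eq
      by (simp only: mult.assoc[symmetric] mult_1)
  qed
qed

text \<open>The product is treated as one Euclidean space of dimension \<open>2 * DIM('a)\<close>
  with centre \<open>(x0, x0)\<close>, so that a single change of variables suffices.\<close>

lemma nn_integral_pair_affine:
  fixes F :: "'a \<Rightarrow> 'a \<Rightarrow> real"
  assumes [measurable]: "(\<lambda>z. F (fst z) (snd z)) \<in> borel_measurable (borel \<Otimes>\<^sub>M borel)" and \<rho>: "0 < \<rho>"
  shows "(\<integral>\<^sup>+x. (\<integral>\<^sup>+y. ennreal (F x y) \<partial>lborel) \<partial>lborel) = ennreal (\<rho> powr (2 * DIM('a)))
     * (\<integral>\<^sup>+x. (\<integral>\<^sup>+y. ennreal (F (x0 + \<rho> *\<^sub>R x) (x0 + \<rho> *\<^sub>R y)) \<partial>lborel) \<partial>lborel)"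
proof -
  have m: "(\<lambda>z. F (fst z) (snd z)) \<in> borel_measurable borel" using assms(1) by (simp add: borel_prod)
  have "(\<integral>\<^sup>+x. (\<integral>\<^sup>+y. ennreal (F x y) \<partial>lborel) \<partial>lborel) = (\<integral>\<^sup>+z. ennreal (F (fst z) (snd z)) \<partial>lborel)"
    using nn_integral_pair[of F] by (simp add: lborel_prod)
  also have "\<dots> = ennreal (\<rho> powr DIM('a \<times> 'a)) * (\<integral>\<^sup>+z. ennreal (F (fst ((x0, x0) + \<rho> *\<^sub>R z)) (snd ((x0, x0) + \<rho> *\<^sub>R z))) \<partial>lborel)"
    using m \<rho> by (intro nn_integral_affine) auto
  also have "\<dots> = ennreal (\<rho> powr (2 * DIM('a))) * (\<integral>\<^sup>+z. ennreal (F (x0 + \<rho> *\<^sub>R fst z) (x0 + \<rho> *\<^sub>R snd z)) \<partial>(lborel \<Otimes>\<^sub>M lborel))"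
  proof -
    have d: "real DIM('a \<times> 'a) = 2 * DIM('a)" by simp
    show ?thesis unfolding d lborel_prod by simp
  qed
  also have "(\<integral>\<^sup>+z. ennreal (F (x0 + \<rho> *\<^sub>R fst z) (x0 + \<rho> *\<^sub>R snd z)) \<partial>(lborel \<Otimes>\<^sub>M lborel))
     = (\<integral>\<^sup>+x. (\<integral>\<^sup>+y. ennreal (F (x0 + \<rho> *\<^sub>R x) (x0 + \<rho> *\<^sub>R y)) \<partial>lborel) \<partial>lborel)"
  proof -
    have "(\<lambda>z. (\<lambda>z. F (fst z) (snd z)) (x0 + \<rho> *\<^sub>R fst z, x0 + \<rho> *\<^sub>R snd z)) \<in> borel_measurable (borel \<Otimes>\<^sub>M borel)"
      by (rule measurable_compose[OF _ assms(1)]) measurable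
    then show ?thesis using nn_integral_pair[of "\<lambda>x y. F (x0 + \<rho> *\<^sub>R x) (x0 + \<rho> *\<^sub>R y)"] by simp
  qed
  finally show ?thesis .
qed

lemma integral_pair_affine:
  fixes F :: "'a \<Rightarrow> 'a \<Rightarrow> real"
  assumes "(\<lambda>z. F (fst z) (snd z)) \<in> borel_measurable (borel \<Otimes>\<^sub>M borel)" and \<rho>: "0 < \<rho>"
  shows "(\<integral>z. F (fst z) (snd z) \<partial>(lborel \<Otimes>\<^sub>M lborel)) = \<rho> powr (2 * DIM('a))
     * (\<integral>z. F (x0 + \<rho> *\<^sub>R fst z) (x0 + \<rho> *\<^sub>R snd z) \<partial>(lborel \<Otimes>\<^sub>M lborel))"
proof -
  have m: "(\<lambda>z. F (fst z) (snd z)) \<in> borel_measurable borel" using assms(1) by (simp add: borel_prod)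
  have "(\<integral>z. F (fst z) (snd z) \<partial>lborel) = \<rho> powr DIM('a \<times> 'a) * (\<integral>z. F (fst ((x0, x0) + \<rho> *\<^sub>R z)) (snd ((x0, x0) + \<rho> *\<^sub>R z)) \<partial>lborel)"
    using m \<rho> by (intro integral_affine) auto
  moreover have "real DIM('a \<times> 'a) = 2 * DIM('a)" by simp
  ultimately show ?thesis unfolding lborel_prod by simp
qed

lemma borel_solD:
  assumes "borel_sol U u f"
  shows "u \<in> borel_measurable borel" "f \<in> borel_measurable borel"
    "\<And>K. compact K \<Longrightarrow> K \<subseteq> U \<Longrightarrow> (\<integral>\<^sup>+x\<in>K. ennreal (\<bar>u x\<bar> powr p) \<partial>lborel) < \<infinity>"
    "\<And>K. compact K \<Longrightarrow> K \<subseteq> U \<Longrightarrow> (\<integral>\<^sup>+x. (\<integral>\<^sup>+y. ennreal (indicator K x * indicator K y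
        * (kplus 1 (dist x y) * \<bar>u x - u y\<bar> powr p)) \<partial>lborel) \<partial>lborel) < \<infinity>"
    "log_norm u < \<infinity>"
  using assms by (simp_all add: borel_sol_def log_norm_def)

lemma borel_sol_equation:
  assumes "borel_sol U u f" "compact K" "K \<subseteq> U" "v \<in> borel_measurable borel" "\<And>x. 0 \<le> v x" "\<And>x. x \<notin> K \<Longrightarrow> v x = 0"
    "(\<integral>\<^sup>+x. ennreal (v x powr p) \<partial>lborel) < \<infinity>"
    "(\<integral>\<^sup>+x. (\<integral>\<^sup>+y. ennreal (kplus 1 (dist x y) * \<bar>v x - v y\<bar> powr p) \<partial>lborel) \<partial>lborel) < \<infinity>"
  shows "(\<integral>z. ker 1 (dist (fst z) (snd z)) * signed_powr p (u (fst z) - u (snd z)) * (v (fst z) - v (snd z))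
           \<partial>(lborel \<Otimes>\<^sub>M lborel)) = (\<integral>x. f x * v x \<partial>lborel)"
  using assms unfolding borel_sol_def by blast

text \<open>The factor of \<open>f\<close> is a quotient of Jacobians: the double integral produces
  \<open>\<rho> powr (2 * DIM('a) - dsp) * lg \<rho>\<close>, the right-hand side
  \<open>\<rho> powr DIM('a)\<close>.\<close>

lemma borel_sol_scaled:
  assumes bs: "borel_sol U u f" and \<rho>: "scale \<rho>" and sub: "cball x0 (\<rho> * (3/2)) \<subseteq> U"
  shows "sol \<rho> (\<lambda>x. u (x0 + \<rho> *\<^sub>R x)) (\<lambda>x. \<rho> powr (s * p) / lg \<rho> * f (x0 + \<rho> *\<^sub>R x))"
  unfolding sol_def
proof (intro conjI allI impI)
  note [measurable] = borel_solD(1,2)[OF bs]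
  have r0: "0 < \<rho>" "\<rho> \<le> 1" using \<rho> by (auto simp: scale_def)
  have lg0: "0 < lg \<rho>" using lg_ge[OF \<rho>] by simp
  show "(\<lambda>x. u (x0 + \<rho> *\<^sub>R x)) \<in> borel_measurable borel" "(\<lambda>x. \<rho> powr (s * p) / lg \<rho> * f (x0 + \<rho> *\<^sub>R x)) \<in> borel_measurable borel"
    by measurable
  let ?K = "cball x0 (\<rho> * (3/2))"
  have "(\<integral>\<^sup>+y\<in>ball x0 (\<rho> * (3/2)). ennreal (\<bar>u y\<bar> powr p) \<partial>lborel) \<le> (\<integral>\<^sup>+y\<in>?K. ennreal (\<bar>u y\<bar> powr p) \<partial>lborel)"
    by (intro nn_integral_mono mult_left_mono) (auto simp: indicator_def)
  also have "\<dots> < \<infinity>" using sub by (intro borel_solD(3)[OF bs]) auto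
  finally show "(\<integral>\<^sup>+x\<in>ball 0 (3/2). ennreal (\<bar>u (x0 + \<rho> *\<^sub>R x)\<bar> powr p) \<partial>lborel) < \<infinity>"
    using scaled_ball[OF r0(1), where g = "\<lambda>y. \<bar>u y\<bar> powr p" and r = "3/2" and ?x0.0 = x0] by (simp add: ennreal_mult_less_top)
  define F where "F x y = indicator ?K x * indicator ?K y * (kplus 1 (dist x y) * \<bar>u x - u y\<bar> powr p)" for x y
  have F0: "0 \<le> F x y" for x y using kplus_nonneg[of 1] by (simp add: F_def)
  have Fm[measurable]: "(\<lambda>z. F (fst z) (snd z)) \<in> borel_measurable (borel \<Otimes>\<^sub>M borel)" unfolding F_def by measurable
  have "(\<integral>\<^sup>+x. (\<integral>\<^sup>+y. ennreal (F x y) \<partial>lborel) \<partial>lborel) < \<infinity>"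
    unfolding F_def using sub by (intro borel_solD(4)[OF bs]) auto
  then have fin: "(\<integral>\<^sup>+x. (\<integral>\<^sup>+y. ennreal (F (x0 + \<rho> *\<^sub>R x) (x0 + \<rho> *\<^sub>R y)) \<partial>lborel) \<partial>lborel) < \<infinity>"
    using r0 unfolding nn_integral_pair_affine[OF Fm r0(1), of x0] by (auto simp: ennreal_mult_less_top)
  have Fm2: "(\<lambda>z. F (x0 + \<rho> *\<^sub>R fst z) (x0 + \<rho> *\<^sub>R snd z)) \<in> borel_measurable (borel \<Otimes>\<^sub>M borel)"
  proof -
    have "(\<lambda>z. (\<lambda>z. F (fst z) (snd z)) (x0 + \<rho> *\<^sub>R fst z, x0 + \<rho> *\<^sub>R snd z)) \<in> borel_measurable (borel \<Otimes>\<^sub>M borel)"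
      by (rule measurable_compose[OF _ Fm]) measurable
    then show ?thesis by simp
  qed
  define C where "C = c * (B / ln (4/3) + p) * \<rho> powr dsp"
  have C0: "0 \<le> C" unfolding C_def using log_kernel.c[OF log_kernel_axioms] B p by (intro mult_nonneg_nonneg add_nonneg_nonneg divide_nonneg_nonneg) auto
  have dd: "dist (\<rho> *\<^sub>R x) (\<rho> *\<^sub>R y) = \<rho> * dist x y" for x y :: 'a
    using r0 by (simp add: dist_norm scaleR_diff_right[symmetric])
  have le: "indicator (ball 0 (3/2)) x * indicator (ball 0 (3/2)) y * (ker \<rho> (dist x y) * \<bar>u (x0 + \<rho> *\<^sub>R x) - u (x0 + \<rho> *\<^sub>R y)\<bar> powr p)
     \<le> C * F (x0 + \<rho> *\<^sub>R x) (x0 + \<rho> *\<^sub>R y)" for x y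
  proof (cases "x \<in> ball 0 (3/2) \<and> y \<in> ball 0 (3/2)")
    case True
    then have d3: "dist x y \<le> 3" using dist_lt_3[of x y] by auto
    have K: "x0 + \<rho> *\<^sub>R x \<in> ?K" "x0 + \<rho> *\<^sub>R y \<in> ?K"
      using True r0 by (auto simp: dist_norm intro!: mult_left_mono)
    have "ker \<rho> (dist x y) \<le> c * (B / ln (4/3) + p) * kplus \<rho> (dist x y)" using d3 by (intro ker_le_kplus[OF \<rho>]) auto
    also have "kplus \<rho> (dist x y) = \<rho> powr dsp * kplus 1 (\<rho> * dist x y)"
      using r0 by (simp add: kplus_scaled powr_minus field_simps)
    finally have "ker \<rho> (dist x y) \<le> C * kplus 1 (\<rho> * dist x y)" by (simp add: C_def mult.assoc)
    then have "ker \<rho> (dist x y) * \<bar>u (x0 + \<rho> *\<^sub>R x) - u (x0 + \<rho> *\<^sub>R y)\<bar> powr p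
      \<le> C * kplus 1 (\<rho> * dist x y) * \<bar>u (x0 + \<rho> *\<^sub>R x) - u (x0 + \<rho> *\<^sub>R y)\<bar> powr p" by (rule mult_right_mono) simp
    then show ?thesis using True K by (simp add: F_def dd mult.assoc)
  next
    case False
    then show ?thesis using C0 F0[of "x0 + \<rho> *\<^sub>R x" "x0 + \<rho> *\<^sub>R y"] by auto
  qed
  have "(\<integral>\<^sup>+x. (\<integral>\<^sup>+y. ennreal (indicator (ball 0 (3/2)) x * indicator (ball 0 (3/2)) y * (ker \<rho> (dist x y) * \<bar>u (x0 + \<rho> *\<^sub>R x) - u (x0 + \<rho> *\<^sub>R y)\<bar> powr p)) \<partial>lborel) \<partial>lborel)
    \<le> (\<integral>\<^sup>+x. (\<integral>\<^sup>+y. ennreal (C * F (x0 + \<rho> *\<^sub>R x) (x0 + \<rho> *\<^sub>R y)) \<partial>lborel) \<partial>lborel)"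
    by (intro nn_integral_mono ennreal_leI le)
  also have "\<dots> = (\<integral>\<^sup>+z. ennreal C * ennreal (F (x0 + \<rho> *\<^sub>R fst z) (x0 + \<rho> *\<^sub>R snd z)) \<partial>(lborel \<Otimes>\<^sub>M lborel))"
    using Fm2 C0 F0 by (subst nn_integral_pair[symmetric]) (auto simp: ennreal_mult)
  also have "\<dots> = ennreal C * (\<integral>\<^sup>+x. (\<integral>\<^sup>+y. ennreal (F (x0 + \<rho> *\<^sub>R x) (x0 + \<rho> *\<^sub>R y)) \<partial>lborel) \<partial>lborel)"
    using Fm2 by (subst nn_integral_cmult) (auto simp: nn_integral_pair[of "\<lambda>x y. F (x0 + \<rho> *\<^sub>R x) (x0 + \<rho> *\<^sub>R y)"])
  also have "\<dots> < \<infinity>" using fin by (auto simp: ennreal_mult_less_top)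
  finally show "(\<integral>\<^sup>+x. (\<integral>\<^sup>+y. ennreal (indicator (ball 0 (3/2)) x * indicator (ball 0 (3/2)) y * (ker \<rho> (dist x y) * \<bar>u (x0 + \<rho> *\<^sub>R x) - u (x0 + \<rho> *\<^sub>R y)\<bar> powr p)) \<partial>lborel) \<partial>lborel) < \<infinity>" .
  show "(\<integral>\<^sup>+y\<in>- ball 0 1. ennreal (kmaj \<rho> (norm y) * \<bar>u (x0 + \<rho> *\<^sub>R y)\<bar> powr (p - 1)) \<partial>lborel) < \<infinity>"
  proof -
    have "log_tail u x0 \<rho> \<le> ennreal ((1 + (1 + norm x0) / \<rho>) powr dsp * (1 + ln (1 + norm x0) + ln (1 / \<rho>))) * log_norm u"
      using r0 by (intro log_tail_le) auto
    also have "\<dots> < \<infinity>" using borel_solD(5)[OF bs] by (auto simp: ennreal_mult_less_top)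
    finally show ?thesis using scaled_tail[OF \<rho>, where u = u and r = 1 and ?x0.0 = x0] by (auto simp: ennreal_mult_less_top)
  qed
  fix v :: "'a \<Rightarrow> real" and r :: real
  assume v: "r < 3/2 \<and> v \<in> borel_measurable borel \<and> (\<forall>x. 0 \<le> v x) \<and> (\<forall>x. x \<notin> cball 0 r \<longrightarrow> v x = 0) \<and>
        (\<integral>\<^sup>+x. ennreal (v x powr p) \<partial>lborel) < \<infinity> \<and>
        (\<integral>\<^sup>+x. (\<integral>\<^sup>+y. ennreal (kplus \<rho> (dist x y) * \<bar>v x - v y\<bar> powr p) \<partial>lborel) \<partial>lborel) < \<infinity>"
  then have [measurable]: "v \<in> borel_measurable borel" by blast
  define V where "V y = v ((1 / \<rho>) *\<^sub>R (y - x0))" for y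
  have [measurable]: "V \<in> borel_measurable borel" unfolding V_def by measurable
  have Vx: "V (x0 + \<rho> *\<^sub>R x) = v x" for x using r0 by (simp add: V_def)
  have V1: "(\<integral>\<^sup>+x. ennreal (V x powr p) \<partial>lborel) < \<infinity>"
    using v r0 by (subst nn_integral_affine[where \<rho> = \<rho> and t = x0]) (auto simp: Vx ennreal_mult_less_top)
  have kV: "kplus 1 (dist (x0 + \<rho> *\<^sub>R x) (x0 + \<rho> *\<^sub>R y)) * \<bar>V (x0 + \<rho> *\<^sub>R x) - V (x0 + \<rho> *\<^sub>R y)\<bar> powr p
     = \<rho> powr - dsp * (kplus \<rho> (dist x y) * \<bar>v x - v y\<bar> powr p)" for x y
    using r0 by (simp add: Vx dd kplus_scaled)
  have V2: "(\<integral>\<^sup>+x. (\<integral>\<^sup>+y. ennreal (kplus 1 (dist x y) * \<bar>V x - V y\<bar> powr p) \<partial>lborel) \<partial>lborel) < \<infinity>"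
  proof -
    have "(\<integral>\<^sup>+x. (\<integral>\<^sup>+y. ennreal (kplus 1 (dist x y) * \<bar>V x - V y\<bar> powr p) \<partial>lborel) \<partial>lborel)
      = ennreal (\<rho> powr (2 * DIM('a))) * (\<integral>\<^sup>+x. (\<integral>\<^sup>+y. ennreal (\<rho> powr - dsp * (kplus \<rho> (dist x y) * \<bar>v x - v y\<bar> powr p)) \<partial>lborel) \<partial>lborel)"
      unfolding kV[symmetric] by (rule nn_integral_pair_affine[OF _ r0(1)]) measurable
    also have "(\<integral>\<^sup>+x. (\<integral>\<^sup>+y. ennreal (\<rho> powr - dsp * (kplus \<rho> (dist x y) * \<bar>v x - v y\<bar> powr p)) \<partial>lborel) \<partial>lborel)
      = (\<integral>\<^sup>+z. ennreal (\<rho> powr - dsp) * ennreal (kplus \<rho> (dist (fst z) (snd z)) * \<bar>v (fst z) - v (snd z)\<bar> powr p) \<partial>(lborel \<Otimes>\<^sub>M lborel))"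
      by (subst nn_integral_pair[symmetric]) (auto simp: ennreal_mult kplus_nonneg)
    also have "\<dots> = ennreal (\<rho> powr - dsp) * (\<integral>\<^sup>+x. (\<integral>\<^sup>+y. ennreal (kplus \<rho> (dist x y) * \<bar>v x - v y\<bar> powr p) \<partial>lborel) \<partial>lborel)"
      by (subst nn_integral_cmult, measurable, subst nn_integral_pair[of "\<lambda>x y. kplus \<rho> (dist x y) * \<bar>v x - v y\<bar> powr p"]) auto
    finally show ?thesis using v by (auto simp: ennreal_mult_less_top)
  qed
  have V3: "V y = 0" if "y \<notin> cball x0 (\<rho> * (3/2))" for y
  proof -
    have "\<rho> * (3/2) < norm (y - x0)" using that by (simp add: dist_norm norm_minus_commute)
    then have "3/2 < (1 / \<rho>) * norm (y - x0)" using r0 by (simp add: field_simps)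
    also have "(1 / \<rho>) * norm (y - x0) = norm ((1 / \<rho>) *\<^sub>R (y - x0))" using r0 by (subst norm_scaleR) simp
    finally have "(1 / \<rho>) *\<^sub>R (y - x0) \<notin> cball 0 r" using v unfolding mem_cball_0 by linarith
    then show ?thesis unfolding V_def using v by blast
  qed
  have eqn: "(\<integral>z. ker 1 (dist (fst z) (snd z)) * signed_powr p (u (fst z) - u (snd z)) * (V (fst z) - V (snd z))
           \<partial>(lborel \<Otimes>\<^sub>M lborel)) = (\<integral>x. f x * V x \<partial>lborel)"
    using sub v V1 V2 V3 by (intro borel_sol_equation[OF bs, of ?K]) (auto simp: V_def)
  define I where "I = (\<integral>z. ker \<rho> (dist (fst z) (snd z)) * signed_powr p (u (x0 + \<rho> *\<^sub>R fst z) - u (x0 + \<rho> *\<^sub>R snd z)) * (v (fst z) - v (snd z)) \<partial>(lborel \<Otimes>\<^sub>M lborel))"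
  have "(\<integral>z. ker 1 (dist (fst z) (snd z)) * signed_powr p (u (fst z) - u (snd z)) * (V (fst z) - V (snd z)) \<partial>(lborel \<Otimes>\<^sub>M lborel))
     = \<rho> powr (2 * DIM('a)) * (\<integral>z. ker 1 (dist (x0 + \<rho> *\<^sub>R fst z) (x0 + \<rho> *\<^sub>R snd z)) * signed_powr p (u (x0 + \<rho> *\<^sub>R fst z) - u (x0 + \<rho> *\<^sub>R snd z)) * (V (x0 + \<rho> *\<^sub>R fst z) - V (x0 + \<rho> *\<^sub>R snd z)) \<partial>(lborel \<Otimes>\<^sub>M lborel))"
    by (rule integral_pair_affine[OF _ r0(1)]) measurable
  also have "(\<integral>z. ker 1 (dist (x0 + \<rho> *\<^sub>R fst z) (x0 + \<rho> *\<^sub>R snd z)) * signed_powr p (u (x0 + \<rho> *\<^sub>R fst z) - u (x0 + \<rho> *\<^sub>R snd z)) * (V (x0 + \<rho> *\<^sub>R fst z) - V (x0 + \<rho> *\<^sub>R snd z)) \<partial>(lborel \<Otimes>\<^sub>M lborel))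
     = (\<integral>z. (lg \<rho> * \<rho> powr - dsp) * (ker \<rho> (dist (fst z) (snd z)) * signed_powr p (u (x0 + \<rho> *\<^sub>R fst z) - u (x0 + \<rho> *\<^sub>R snd z)) * (v (fst z) - v (snd z))) \<partial>(lborel \<Otimes>\<^sub>M lborel))"
    using r0 lg0 by (intro Bochner_Integration.integral_cong) (auto simp: dd Vx ker_scaled)
  also have "\<dots> = lg \<rho> * \<rho> powr - dsp * I" unfolding I_def by (rule integral_mult_right_zero)
  finally have 1: "\<rho> powr (2 * DIM('a)) * (lg \<rho> * \<rho> powr - dsp * I) = (\<integral>x. f x * V x \<partial>lborel)" using eqn by simp
  have "(\<integral>x. f x * V x \<partial>lborel) = \<rho> powr DIM('a) * (\<integral>x. f (x0 + \<rho> *\<^sub>R x) * v x \<partial>lborel)"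
    using integral_affine[of "\<lambda>x. f x * V x" \<rho> x0] r0 by (simp add: Vx)
  with 1 have 2: "\<rho> powr (2 * DIM('a)) * (lg \<rho> * \<rho> powr - dsp * I) = \<rho> powr DIM('a) * (\<integral>x. f (x0 + \<rho> *\<^sub>R x) * v x \<partial>lborel)" by simp
  have "\<rho> powr (2 * DIM('a)) * \<rho> powr - dsp = \<rho> powr DIM('a) * \<rho> powr - (s * p)"
    by (simp add: powr_add[symmetric] dsp_def)
  with 2 have "\<rho> powr DIM('a) * (lg \<rho> * \<rho> powr - (s * p) * I) = \<rho> powr DIM('a) * (\<integral>x. f (x0 + \<rho> *\<^sub>R x) * v x \<partial>lborel)"
    by (metis (no_types, lifting) mult.assoc mult.left_commute)
  then have "lg \<rho> * \<rho> powr - (s * p) * I = (\<integral>x. f (x0 + \<rho> *\<^sub>R x) * v x \<partial>lborel)" using r0 by simp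
  then have "I = \<rho> powr (s * p) / lg \<rho> * (\<integral>x. f (x0 + \<rho> *\<^sub>R x) * v x \<partial>lborel)"
    using r0 lg0 by (simp add: powr_minus field_simps)
  also have "\<dots> = (\<integral>x. \<rho> powr (s * p) / lg \<rho> * f (x0 + \<rho> *\<^sub>R x) * v x \<partial>lborel)"
    by (simp only: integral_mult_right_zero mult.assoc)
  finally show "(\<integral>z. ker \<rho> (dist (fst z) (snd z)) * signed_powr p (u (x0 + \<rho> *\<^sub>R fst z) - u (x0 + \<rho> *\<^sub>R snd z)) * (v (fst z) - v (snd z)) \<partial>(lborel \<Otimes>\<^sub>M lborel))
     = (\<integral>x. \<rho> powr (s * p) / lg \<rho> * f (x0 + \<rho> *\<^sub>R x) * v x \<partial>lborel)" by (simp add: I_def)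
qed

end

subsection \<open>Oscillation decay\<close>

lemma exists_small_powr:
  fixes e k :: real
  assumes "0 < e" "0 < k"
  shows "\<exists>t0>0. \<forall>t. 0 < t \<and> t \<le> t0 \<longrightarrow> t powr e \<le> k"
proof (intro exI[of _ "k powr (1 / e)"] conjI allI impI)
  fix t :: real
  assume "0 < t \<and> t \<le> k powr (1 / e)"
  then have "t powr e \<le> (k powr (1 / e)) powr e" using assms by (intro powr_mono2) auto
  then show "t powr e \<le> k" using assms by (simp add: powr_powr)
qed (use assms in auto)

lemma discrete_crossing:
  fixes a :: "nat \<Rightarrow> real"
  assumes "z < a 0" "a j \<le> z"
  shows "\<exists>i<j. a (Suc i) \<le> z \<and> z < a i"
  using assms
proof (induction j)
  case (Suc j)
  then show ?case by (cases "a j \<le> z") (auto simp: less_Suc_eq)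
qed simp

context log_kernel
begin

text \<open>The scaling exponent of the right-hand side: rescaling by \<rho> multiplies the norm of
  \<open>f\<close> by \<open>\<rho> powr \<mu> / lg \<rho>\<close>.\<close>

definition "\<mu> = s * p - DIM('a) / q"

lemma mu_pos: "0 < \<mu>"
proof -
  have "DIM('a) < q * (s * p)" using q sp_pos by (simp add: field_simps)
  then show ?thesis using q_gt by (simp add: \<mu>_def field_simps)
qed

lemma lg_antimono: "0 < \<rho> \<Longrightarrow> \<rho> \<le> R \<Longrightarrow> lg R \<le> lg \<rho>"
  by (simp add: lg_def field_simps)

lemma lg_ge_1: "0 < R \<Longrightarrow> R \<le> 1 \<Longrightarrow> 1 \<le> lg R"
  by (simp add: lg_def)

text \<open>Since \<open>lg\<close> decreases in the radius,
  \<open>lg R / lg \<rho> \<le> 1\<close>. The logarithmic factor in the hypothesis at radius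
  \<open>R\<close> therefore takes care of all smaller scales, and a pure power of
  \<open>\<rho> / R\<close> remains.\<close>

lemma scaled_f_bound:
  fixes f :: "'a \<Rightarrow> real"
  assumes \<rho>: "scale \<rho>" and [measurable]: "f \<in> borel_measurable borel"
    and R: "0 < R" "R \<le> 1/2" "\<rho> * (3/2) \<le> R" and M: "0 < M" and a: "\<bar>a\<bar> = 1 / N" "0 < N"
    and F: "(\<integral>\<^sup>+x\<in>ball x0 R. ennreal (\<bar>f x\<bar> powr q) \<partial>lborel) \<le> ennreal ((M powr (p - 1) * lg R * R powr - \<mu>) powr q)"
  shows "(\<integral>\<^sup>+x\<in>ball 0 (3/2). ennreal (\<bar>signed_powr p a * (\<rho> powr (s * p) / lg \<rho> * f (x0 + \<rho> *\<^sub>R x))\<bar> powr q) \<partial>lborel)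
     \<le> ennreal (((\<rho> / R) powr \<mu> * (M / N) powr (p - 1)) powr q)"
proof -
  have r0: "0 < \<rho>" using \<rho> by (simp add: scale_def)
  have lR: "1 \<le> lg R" "lg R \<le> lg \<rho>" using R r0 by (auto intro: lg_ge_1 lg_antimono)
  define C where "C = (1 / N) powr (p - 1) * (\<rho> powr (s * p) / lg \<rho>)"
  have C0: "0 \<le> C" using lR by (simp add: C_def)
  define g where "g y = C powr q * \<bar>f y\<bar> powr q" for y :: 'a
  have [measurable]: "g \<in> borel_measurable borel" unfolding g_def by measurable
  have eq: "\<bar>signed_powr p a * (\<rho> powr (s * p) / lg \<rho> * z)\<bar> powr q = C powr q * \<bar>z\<bar> powr q" for z
  proof -
    have "\<bar>signed_powr p a * (\<rho> powr (s * p) / lg \<rho> * z)\<bar> = C * \<bar>z\<bar>"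
      using lR a by (simp add: abs_mult abs_signed_powr C_def)
    then show ?thesis by (simp add: powr_mult)
  qed
  have "(\<integral>\<^sup>+x\<in>ball 0 (3/2). ennreal (\<bar>signed_powr p a * (\<rho> powr (s * p) / lg \<rho> * f (x0 + \<rho> *\<^sub>R x))\<bar> powr q) \<partial>lborel)
    = ennreal (\<rho> powr - real DIM('a)) * (\<integral>\<^sup>+y\<in>ball x0 (\<rho> * (3/2)). ennreal (g y) \<partial>lborel)"
    unfolding eq g_def[symmetric] by (rule scaled_ball[OF r0, where g = g]) measurable
  also have "\<dots> \<le> ennreal (\<rho> powr - real DIM('a)) * (\<integral>\<^sup>+y. ennreal (C powr q) * (ennreal (\<bar>f y\<bar> powr q) * indicator (ball x0 R) y) \<partial>lborel)"
    using R by (intro mult_left_mono nn_integral_mono) (auto simp: g_def indicator_def ennreal_mult)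
  also have "(\<integral>\<^sup>+y. ennreal (C powr q) * (ennreal (\<bar>f y\<bar> powr q) * indicator (ball x0 R) y) \<partial>lborel)
     = ennreal (C powr q) * (\<integral>\<^sup>+y\<in>ball x0 R. ennreal (\<bar>f y\<bar> powr q) \<partial>lborel)" by (rule nn_integral_cmult) measurable
  also have "ennreal (\<rho> powr - real DIM('a)) * \<dots> \<le> ennreal (\<rho> powr - real DIM('a)) * (ennreal (C powr q) * ennreal ((M powr (p - 1) * lg R * R powr - \<mu>) powr q))"
    by (intro mult_left_mono F) auto
  also have "\<dots> = ennreal (\<rho> powr - real DIM('a) * (C powr q * (M powr (p - 1) * lg R * R powr - \<mu>) powr q))"
    by (simp add: ennreal_mult)
  also have "\<dots> \<le> ennreal (((\<rho> / R) powr \<mu> * (M / N) powr (p - 1)) powr q)"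
  proof (rule ennreal_leI)
    have "\<rho> powr - real DIM('a) = (\<rho> powr (- real DIM('a) / q)) powr q" using q_gt by (simp add: powr_powr)
    then have "\<rho> powr - real DIM('a) * (C powr q * (M powr (p - 1) * lg R * R powr - \<mu>) powr q)
       = (\<rho> powr (- real DIM('a) / q) * (C * (M powr (p - 1) * lg R * R powr - \<mu>))) powr q"
      by (simp only: powr_mult)
    also have "\<rho> powr (- real DIM('a) / q) * (C * (M powr (p - 1) * lg R * R powr - \<mu>))
       = (\<rho> powr (- real DIM('a) / q) * \<rho> powr (s * p) * R powr - \<mu>) * ((1 / N) powr (p - 1) * M powr (p - 1)) * (lg R / lg \<rho>)"
      by (simp add: C_def mult_ac)
    also have "\<rho> powr (- real DIM('a) / q) * \<rho> powr (s * p) * R powr - \<mu> = (\<rho> / R) powr \<mu>"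
    proof -
      have "\<rho> powr (- real DIM('a) / q) * \<rho> powr (s * p) = \<rho> powr \<mu>" by (simp add: powr_add[symmetric] \<mu>_def)
      then show ?thesis by (simp only: powr_divide powr_minus_divide) simp
    qed
    also have "(1 / N) powr (p - 1) * M powr (p - 1) = (M / N) powr (p - 1)" by (simp add: powr_mult[symmetric])
    also have "((\<rho> / R) powr \<mu> * (M / N) powr (p - 1) * (lg R / lg \<rho>)) powr q \<le> ((\<rho> / R) powr \<mu> * (M / N) powr (p - 1) * 1) powr q"
      using lR q_gt by (intro powr_mono2 mult_left_mono) auto
    finally show "\<rho> powr - real DIM('a) * (C powr q * (M powr (p - 1) * lg R * R powr - \<mu>) powr q) \<le> ((\<rho> / R) powr \<mu> * (M / N) powr (p - 1)) powr q"
      by simp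
  qed
  finally show ?thesis .
qed

lemma scaled_tail_bound:
  assumes \<rho>: "scale \<rho>" and [measurable]: "u \<in> borel_measurable borel"
    and R: "0 < R" "R \<le> 1/2" "\<rho> \<le> R" and M: "0 < M"
    and T: "log_tail u x0 (R / 2) \<le> ennreal (M powr (p - 1) * lg R * R powr - (s * p))"
  shows "(\<integral>\<^sup>+y\<in>- ball 0 (R / (2 * \<rho>)). ennreal (kmaj \<rho> (norm y) * \<bar>u (x0 + \<rho> *\<^sub>R y)\<bar> powr (p - 1)) \<partial>lborel)
     \<le> ennreal ((\<rho> / R) powr (s * p) * M powr (p - 1))"
proof -
  have r0: "0 < \<rho>" using \<rho> by (simp add: scale_def)
  have lR: "1 \<le> lg R" "lg R \<le> lg \<rho>" using R r0 by (auto intro: lg_ge_1 lg_antimono)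
  have "\<rho> * (R / (2 * \<rho>)) = R / 2" using r0 by simp
  then have "(\<integral>\<^sup>+y\<in>- ball 0 (R / (2 * \<rho>)). ennreal (kmaj \<rho> (norm y) * \<bar>u (x0 + \<rho> *\<^sub>R y)\<bar> powr (p - 1)) \<partial>lborel)
     = ennreal (\<rho> powr (s * p) / lg \<rho>) * log_tail u x0 (R / 2)"
    using scaled_tail[OF \<rho>, where u = u and r = "R / (2 * \<rho>)" and ?x0.0 = x0] by simp
  also have "\<dots> \<le> ennreal (\<rho> powr (s * p) / lg \<rho>) * ennreal (M powr (p - 1) * lg R * R powr - (s * p))"
    by (intro mult_left_mono T) simp
  also have "\<dots> = ennreal (\<rho> powr (s * p) / lg \<rho> * (M powr (p - 1) * lg R * R powr - (s * p)))"
    using lR by (intro ennreal_mult[symmetric]) auto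
  also have "\<dots> \<le> ennreal ((\<rho> / R) powr (s * p) * M powr (p - 1))"
  proof (rule ennreal_leI)
    have "\<rho> powr (s * p) / lg \<rho> * (M powr (p - 1) * lg R * R powr - (s * p)) = (\<rho> / R) powr (s * p) * M powr (p - 1) * (lg R / lg \<rho>)"
      by (simp add: powr_divide powr_minus_divide mult_ac)
    also have "\<dots> \<le> (\<rho> / R) powr (s * p) * M powr (p - 1) * 1" using lR by (intro mult_left_mono) auto
    finally show "\<rho> powr (s * p) / lg \<rho> * (M powr (p - 1) * lg R * R powr - (s * p)) \<le> (\<rho> / R) powr (s * p) * M powr (p - 1)" by simp
  qed
  finally show ?thesis .
qed

theorem local_boundedness:
  "\<exists>K\<ge>1. \<forall>U u f x0 R M. borel_sol U u f \<longrightarrow> 0 < R \<longrightarrow> R \<le> 1/2 \<longrightarrow> ball x0 R \<subseteq> U \<longrightarrow> 0 < M \<longrightarrow>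
     (\<integral>\<^sup>+x\<in>ball x0 R. ennreal (\<bar>u x\<bar> powr p) \<partial>lborel) \<le> ennreal (M powr p * R powr DIM('a)) \<longrightarrow>
     log_tail u x0 (R / 2) \<le> ennreal (M powr (p - 1) * lg R * R powr - (s * p)) \<longrightarrow>
     (\<integral>\<^sup>+x\<in>ball x0 R. ennreal (\<bar>f x\<bar> powr q) \<partial>lborel) \<le> ennreal ((M powr (p - 1) * lg R * R powr - \<mu>) powr q) \<longrightarrow>
     (AE x in lborel. x \<in> ball x0 (R / 2) \<longrightarrow> \<bar>u x\<bar> \<le> K * M)"
proof -
  obtain \<epsilon> where \<epsilon>: "0 < \<epsilon>" and dg: "\<And>\<rho> L u f. scale \<rho> \<Longrightarrow> 2 * \<rho> * L \<le> 1 \<Longrightarrow> sol \<rho> u f \<Longrightarrow> tail \<rho> L u \<le> ennreal 1 \<Longrightarrow>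
    (\<integral>\<^sup>+x\<in>ball 0 (3/2). ennreal (\<bar>f x\<bar> powr q) \<partial>lborel) \<le> 1 \<Longrightarrow>
    (\<integral>\<^sup>+x\<in>ball 0 (5/4). ennreal (max (u x) 0 powr p) \<partial>lborel) \<le> ennreal \<epsilon> \<Longrightarrow>
    (AE x in lborel. x \<in> ball 0 1 \<longrightarrow> u x \<le> 1)"
    using de_giorgi[of 1] by auto
  \<comment> \<open>Division by \<open>K * M\<close> brings the integral of the p-th power below
    \<epsilon>; \<open>2 powr DIM('a)\<close> is the volume ratio caused by rescaling with
    \<open>R / 2\<close> in place of \<open>R\<close>.\<close>
  define K where "K = max 1 ((2 powr DIM('a) / \<epsilon>) powr (1 / p))"
  have K: "1 \<le> K" by (simp add: K_def)
  have K\<epsilon>: "K powr - p * 2 powr DIM('a) \<le> \<epsilon>"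
  proof -
    have "((2 powr DIM('a) / \<epsilon>) powr (1 / p)) powr p \<le> K powr p" using p by (intro powr_mono2) (auto simp: K_def)
    then have "2 powr DIM('a) / \<epsilon> \<le> K powr p" using p \<epsilon> by (simp add: powr_powr)
    then show ?thesis using \<epsilon> K by (simp add: powr_minus field_simps)
  qed
  have "AE x in lborel. x \<in> ball x0 (R / 2) \<longrightarrow> \<bar>u x\<bar> \<le> K * M"
    if bs: "borel_sol U u f" and R: "0 < R" "R \<le> 1/2" and sub: "ball x0 R \<subseteq> U" and M: "0 < M" and
     A: "(\<integral>\<^sup>+x\<in>ball x0 R. ennreal (\<bar>u x\<bar> powr p) \<partial>lborel) \<le> ennreal (M powr p * R powr DIM('a))" and
     T: "log_tail u x0 (R / 2) \<le> ennreal (M powr (p - 1) * lg R * R powr - (s * p))" and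
     F: "(\<integral>\<^sup>+x\<in>ball x0 R. ennreal (\<bar>f x\<bar> powr q) \<partial>lborel) \<le> ennreal ((M powr (p - 1) * lg R * R powr - \<mu>) powr q)"
    for U u f x0 R M
  proof -
    note [measurable] = borel_solD(1,2)[OF bs]
    define \<rho> where "\<rho> = R / 2"
    define N where "N = K * M"
    have N: "0 < N" "M \<le> N" using K M by (auto simp: N_def)
    have r0: "0 < \<rho>" "\<rho> \<le> R" using R by (auto simp: \<rho>_def)
    have \<rho>: "scale \<rho>" using R by (simp add: scale_def \<rho>_def)
    have "cball x0 (\<rho> * (3/2)) \<subseteq> U" using sub R by (auto simp: \<rho>_def intro!: subsetD[OF sub])
    then have sol0: "sol \<rho> (\<lambda>x. u (x0 + \<rho> *\<^sub>R x)) (\<lambda>x. \<rho> powr (s * p) / lg \<rho> * f (x0 + \<rho> *\<^sub>R x))"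
      by (rule borel_sol_scaled[OF bs \<rho>])
    have MN: "(M / N) powr (p - 1) \<le> 1" using M N p powr_mono2[of "p - 1" "M / N" 1] by simp
    have one: "AE x in lborel. x \<in> ball 0 1 \<longrightarrow> a * u (x0 + \<rho> *\<^sub>R x) \<le> 1" if a: "\<bar>a\<bar> = 1 / N" for a
    proof -
      have a0: "a \<noteq> 0" using a N by auto
      have ap: "\<bar>a * z\<bar> powr r = (1 / N) powr r * \<bar>z\<bar> powr r" for z r by (simp only: abs_mult a powr_mult)
      define v where "v = (\<lambda>x. a * u (x0 + \<rho> *\<^sub>R x))"
      have [measurable]: "v \<in> borel_measurable borel" unfolding v_def by measurable
      have solv: "sol \<rho> v (\<lambda>x. signed_powr p a * (\<rho> powr (s * p) / lg \<rho> * f (x0 + \<rho> *\<^sub>R x)))"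
        using sol_affine[OF \<rho> sol0 a0, of 0] by (simp add: v_def)
      \<comment> \<open>With \<open>L = 0\<close> the function \<open>tail_fun\<close> is the
        modulus everywhere: for plain boundedness no sign information is needed in the tail.\<close>
      have "tail \<rho> 0 v = (\<integral>\<^sup>+y. ennreal ((1 / N) powr (p - 1)) * (ennreal (kmaj \<rho> (norm y) * \<bar>u (x0 + \<rho> *\<^sub>R y)\<bar> powr (p - 1)) * indicator (- ball 0 1) y) \<partial>lborel)"
        unfolding tail_def using a kmaj_nonneg[OF \<rho>]
        by (intro nn_integral_cong) (simp add: tail_fun_def v_def ap ennreal_mult mult_ac)
      also have "\<dots> = ennreal ((1 / N) powr (p - 1)) * (\<integral>\<^sup>+y\<in>- ball 0 1. ennreal (kmaj \<rho> (norm y) * \<bar>u (x0 + \<rho> *\<^sub>R y)\<bar> powr (p - 1)) \<partial>lborel)"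
        by (rule nn_integral_cmult) measurable
      also have "\<dots> \<le> ennreal ((1 / N) powr (p - 1)) * ennreal ((\<rho> / R) powr (s * p) * M powr (p - 1))"
        using scaled_tail_bound[OF \<rho> _ R r0(2) M T] R by (intro mult_left_mono) (auto simp: \<rho>_def)
      also have "\<dots> = ennreal ((\<rho> / R) powr (s * p) * (M / N) powr (p - 1))"
        by (simp add: ennreal_mult[symmetric] powr_mult[symmetric] mult_ac powr_divide)
      also have "\<dots> \<le> ennreal 1"
        using MN r0 R sp_pos powr_mono2[of "s * p" "\<rho> / R" 1] by (intro ennreal_leI mult_le_one) auto
      finally have tl: "tail \<rho> 0 v \<le> ennreal 1" .
      have "((\<rho> / R) powr \<mu> * (M / N) powr (p - 1)) powr q \<le> 1 powr q"
        using MN r0 R mu_pos q_gt powr_mono2[of \<mu> "\<rho> / R" 1] by (intro powr_mono2 mult_le_one) auto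
      then have "ennreal (((\<rho> / R) powr \<mu> * (M / N) powr (p - 1)) powr q) \<le> 1" by simp
      then have fb: "(\<integral>\<^sup>+x\<in>ball 0 (3/2). ennreal (\<bar>signed_powr p a * (\<rho> powr (s * p) / lg \<rho> * f (x0 + \<rho> *\<^sub>R x))\<bar> powr q) \<partial>lborel) \<le> 1"
        using scaled_f_bound[OF \<rho> _ R _ M a N(1) F] R by (auto simp: \<rho>_def intro: order_trans)
      define g where "g y = (1 / N) powr p * \<bar>u y\<bar> powr p" for y
      have [measurable]: "g \<in> borel_measurable borel" unfolding g_def by measurable
      have "(\<integral>\<^sup>+x\<in>ball 0 (5/4). ennreal (max (v x) 0 powr p) \<partial>lborel) \<le> (\<integral>\<^sup>+x\<in>ball 0 2. ennreal (g (x0 + \<rho> *\<^sub>R x)) \<partial>lborel)"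
      proof (intro nn_integral_mono mult_mono ennreal_leI)
        fix x
        have "max (v x) 0 powr p \<le> \<bar>v x\<bar> powr p" using p by (intro powr_mono2) auto
        also have "\<dots> = g (x0 + \<rho> *\<^sub>R x)" by (simp add: v_def g_def ap)
        finally show "max (v x) 0 powr p \<le> g (x0 + \<rho> *\<^sub>R x)" .
      qed (auto simp: indicator_def)
      also have "\<dots> = ennreal (\<rho> powr - real DIM('a)) * (\<integral>\<^sup>+y\<in>ball x0 R. ennreal (g y) \<partial>lborel)"
        using scaled_ball[OF r0(1), where g = g and r = 2 and ?x0.0 = x0] by (simp add: \<rho>_def)
      also have "(\<integral>\<^sup>+y\<in>ball x0 R. ennreal (g y) \<partial>lborel) = (\<integral>\<^sup>+y. ennreal ((1 / N) powr p) * (ennreal (\<bar>u y\<bar> powr p) * indicator (ball x0 R) y) \<partial>lborel)"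
        by (intro nn_integral_cong) (simp add: g_def ennreal_mult mult.assoc)
      also have "\<dots> = ennreal ((1 / N) powr p) * (\<integral>\<^sup>+y\<in>ball x0 R. ennreal (\<bar>u y\<bar> powr p) \<partial>lborel)"
        by (rule nn_integral_cmult) measurable
      also have "ennreal (\<rho> powr - real DIM('a)) * \<dots> \<le> ennreal (\<rho> powr - real DIM('a)) * (ennreal ((1 / N) powr p) * ennreal (M powr p * R powr DIM('a)))"
        by (intro mult_left_mono A) auto
      also have "\<dots> = ennreal (\<rho> powr - real DIM('a) * ((1 / N) powr p * (M powr p * R powr DIM('a))))"
        by (simp add: ennreal_mult)
      also have "\<rho> powr - real DIM('a) * ((1 / N) powr p * (M powr p * R powr DIM('a))) = K powr - p * 2 powr DIM('a)"
        using M K R unfolding N_def \<rho>_def by (simp add: powr_divide powr_mult powr_minus field_simps)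
      also have "ennreal (K powr - p * 2 powr DIM('a)) \<le> ennreal \<epsilon>" by (rule ennreal_leI[OF K\<epsilon>])
      finally have "AE x in lborel. x \<in> ball 0 1 \<longrightarrow> v x \<le> 1"
        by (intro dg[OF \<rho> _ solv tl fb]) auto
      then show ?thesis by (simp add: v_def)
    qed
    have "AE x in lborel. x0 + \<rho> *\<^sub>R x \<in> ball x0 (R / 2) \<longrightarrow> \<bar>u (x0 + \<rho> *\<^sub>R x)\<bar> \<le> N"
    proof -
      have "\<bar>1 / N\<bar> = 1 / N" "\<bar>- 1 / N\<bar> = 1 / N" using N by auto
      from one[OF this(1)] one[OF this(2)] show ?thesis
    proof eventually_elim
      case (elim x)
      show ?case
      proof
        assume "x0 + \<rho> *\<^sub>R x \<in> ball x0 (R / 2)"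
        then have "x \<in> ball 0 1" using r0 R by (simp add: dist_norm \<rho>_def)
        then show "\<bar>u (x0 + \<rho> *\<^sub>R x)\<bar> \<le> N" using elim N by (simp add: field_simps abs_le_iff)
      qed
    qed
    qed
    then show ?thesis
      by (subst AE_affine[where \<rho> = \<rho> and t = x0]) (auto simp: r0 N_def)
  qed
  then show ?thesis using K by (intro exI[of _ K]) blast
qed

text \<open>At stage \<open>j\<close> the scale contributes
  \<open>\<tau> powr ((j + 1) * e)\<close>, while normalising by the current oscillation bound costs
  \<open>\<tau> powr - (\<alpha> * (p - 1) * j)\<close>. Under
  \<open>\<alpha> * (p - 1) \<le> e\<close> a factor \<open>\<tau> powr e\<close> survives, which is
  small uniformly in \<open>j\<close> and \<alpha>.\<close>

lemma decay_factor:
  assumes \<tau>: "0 < \<tau>" "\<tau> \<le> 1" and \<alpha>: "0 < \<alpha>" "\<alpha> * (p - 1) \<le> e" and M: "0 < M" "M \<le> M'"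
  shows "(\<tau> ^ Suc j / 2) powr e * (M / ((\<tau> powr \<alpha>) ^ j * M')) powr (p - 1) \<le> \<tau> powr e"
proof -
  have e: "0 \<le> e" using \<alpha> p mult_pos_pos[of \<alpha> "p - 1"] by linarith
  have pw: "x ^ n = x powr real n" if "0 < x" for x :: real and n using that by (simp add: powr_realpow)
  have "(\<tau> ^ Suc j / 2) powr e \<le> (\<tau> ^ Suc j) powr e" using \<tau> e by (intro powr_mono2) auto
  also have "\<dots> = \<tau> powr ((real j + 1) * e)" using \<tau> by (simp add: pw powr_powr add.commute del: power_Suc)
  finally have 1: "(\<tau> ^ Suc j / 2) powr e \<le> \<tau> powr ((real j + 1) * e)" .
  have "M / ((\<tau> powr \<alpha>) ^ j * M') = (M / M') * \<tau> powr - (\<alpha> * j)"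
    using \<tau> M by (simp add: pw powr_powr powr_minus field_simps)
  also have "\<dots> \<le> 1 * \<tau> powr - (\<alpha> * j)" using M by (intro mult_right_mono) auto
  finally have "(M / ((\<tau> powr \<alpha>) ^ j * M')) powr (p - 1) \<le> (\<tau> powr - (\<alpha> * j)) powr (p - 1)"
    using p M \<tau> by (intro powr_mono2) auto
  also have "\<dots> = \<tau> powr - (\<alpha> * (p - 1) * j)" by (simp add: powr_powr mult_ac)
  also have "\<dots> \<le> \<tau> powr - (e * j)" using \<tau> \<alpha> by (intro powr_mono') (auto intro: mult_right_mono)
  finally have 2: "(M / ((\<tau> powr \<alpha>) ^ j * M')) powr (p - 1) \<le> \<tau> powr - (e * j)" .
  have "(\<tau> ^ Suc j / 2) powr e * (M / ((\<tau> powr \<alpha>) ^ j * M')) powr (p - 1) \<le> \<tau> powr ((real j + 1) * e) * \<tau> powr - (e * j)"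
    using 1 2 by (intro mult_mono) auto
  also have "\<dots> = \<tau> powr e" by (simp add: powr_add[symmetric] algebra_simps)
  finally show ?thesis .
qed

text \<open>The previous bounds at all larger scales control the tail at the scale \<open>\<tau> ^ Suc j * (R / 2)\<close>.\<close>

lemma osc_induction_step:
  fixes x0 :: 'a and ms :: "nat \<Rightarrow> real"
  assumes step: "\<And>\<rho> L u f. scale \<rho> \<Longrightarrow> 2 \<le> L \<Longrightarrow> 2 * \<rho> * L \<le> 1 \<Longrightarrow> sol \<rho> u f \<Longrightarrow>
     (AE x in lborel. x \<in> ball 0 L \<longrightarrow> \<bar>u x\<bar> \<le> 1) \<Longrightarrow>
     (\<integral>\<^sup>+y\<in>- ball 0 L. ennreal (kmaj \<rho> (norm y) * (1 + \<bar>u y\<bar>) powr (p - 1)) \<partial>lborel) \<le> ennreal \<kappa> \<Longrightarrow>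
     (\<integral>\<^sup>+x\<in>ball 0 (3/2). ennreal (\<bar>f x\<bar> powr q) \<partial>lborel) \<le> ennreal \<kappa> \<Longrightarrow>
     (\<exists>m. AE x in lborel. x \<in> ball 0 1 \<longrightarrow> \<bar>u x - m\<bar> \<le> 1 - \<delta>)"
    and \<tau>: "0 < \<tau>" "\<tau> \<le> 1/2" and \<alpha>: "0 < \<alpha>" "\<alpha> * (p - 1) \<le> s * p / 2" "\<alpha> * (p - 1) \<le> \<mu>"
    and t: "t = \<tau> powr \<alpha>" "1 - \<delta> \<le> t" "1/2 \<le> t"
    and sm: "2 powr p * 7 powr (p - 1) * c_out * \<tau> powr (s * p / 2) \<le> \<kappa> / 2" "2 powr p * \<tau> powr (s * p) \<le> \<kappa> / 2"
      "\<tau> powr (\<mu> * q) \<le> \<kappa>"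
    and bs: "borel_sol U u f" and R: "0 < R" "R \<le> 1/2" and sub: "ball x0 R \<subseteq> U" and M: "0 < M" "M \<le> M'"
    and T: "log_tail u x0 (R / 2) \<le> ennreal (M powr (p - 1) * lg R * R powr - (s * p))"
    and F: "(\<integral>\<^sup>+x\<in>ball x0 R. ennreal (\<bar>f x\<bar> powr q) \<partial>lborel) \<le> ennreal ((M powr (p - 1) * lg R * R powr - \<mu>) powr q)"
    and ms0: "ms 0 = 0" and ms: "\<And>i. i \<le> j \<Longrightarrow> AE x in lborel. x \<in> ball x0 (\<tau> ^ i * (R / 2)) \<longrightarrow> \<bar>u x - ms i\<bar> \<le> t ^ i * M'"
  shows "\<exists>m. AE x in lborel. x \<in> ball x0 (\<tau> ^ Suc j * (R / 2)) \<longrightarrow> \<bar>u x - m\<bar> \<le> t ^ Suc j * M'"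
proof -
  note [measurable] = borel_solD(1,2)[OF bs]
  have t1: "0 < t" "t \<le> 1" using \<tau> \<alpha> powr_mono2[of \<alpha> \<tau> 1] by (auto simp: t(1))
  have M': "0 < M'" using M by simp
  define rr where "rr i = \<tau> ^ i * (R / 2)" for i
  have rr: "0 < rr i" "rr i \<le> R / 2" for i
    using \<tau> R power_le_one[of \<tau> i] mult_right_mono[of "\<tau> ^ i" 1 "R / 2"] by (auto simp: rr_def)
  define \<rho> where "\<rho> = rr (Suc j)"
  \<comment> \<open>Seen from the scale \<open>rr (Suc j)\<close>, the ball of radius
    \<open>L\<close> is the previous ball of radius \<open>rr j\<close>, on which the induction
    hypothesis bounds the normalised function \<open>v\<close> by 1.\<close>
  define L where "L = 1 / \<tau>"
  define N where "N = t ^ j * M'"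
  have N: "0 < N" using t1 M' by (simp add: N_def)
  have L: "2 \<le> L" "1 \<le> L" using \<tau> by (auto simp: L_def field_simps)
  have \<rho>L: "\<rho> * L = rr j" using \<tau> by (auto simp: \<rho>_def L_def rr_def)
  have \<rho>R: "0 < \<rho>" "\<rho> \<le> R / 2" using rr by (auto simp: \<rho>_def)
  have \<rho>: "scale \<rho>" using \<rho>R R by (simp add: scale_def)
  have rho_R: "\<rho> / R = \<tau> ^ Suc j / 2" using R by (simp add: \<rho>_def rr_def)
  have "cball x0 (\<rho> * (3/2)) \<subseteq> ball x0 R" using \<rho>R R by auto
  then have sol0: "sol \<rho> (\<lambda>x. u (x0 + \<rho> *\<^sub>R x)) (\<lambda>x. \<rho> powr (s * p) / lg \<rho> * f (x0 + \<rho> *\<^sub>R x))"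
    using sub by (intro borel_sol_scaled[OF bs \<rho>]) auto
  define a where "a = 1 / N"
  define v where "v = (\<lambda>x. a * u (x0 + \<rho> *\<^sub>R x) + - ms j / N)"
  have v: "v y = (u (x0 + \<rho> *\<^sub>R y) - ms j) / N" for y by (simp add: v_def a_def diff_divide_distrib)
  have a: "\<bar>a\<bar> = 1 / N" "a \<noteq> 0" using N by (auto simp: a_def)
  have solv: "sol \<rho> v (\<lambda>x. signed_powr p a * (\<rho> powr (s * p) / lg \<rho> * f (x0 + \<rho> *\<^sub>R x)))"
    unfolding v_def by (rule sol_affine[OF \<rho> sol0 a(2)])
  have all: "AE x in lborel. \<forall>i\<le>j. x \<in> ball x0 (rr i) \<longrightarrow> \<bar>u x - ms i\<bar> \<le> t ^ i * M'"
    using ms unfolding rr_def by (simp add: AE_all_countable AE_conjI)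
  have mdiff: "\<bar>ms i - ms j\<bar> \<le> 2 * (t ^ i * M')" if "i \<le> j" for i
  proof (rule AE_ball_const[where ?x0.0 = x0 and r = "rr j"])
    show "AE x in lborel. x \<in> ball x0 (rr j) \<longrightarrow> \<bar>ms i - ms j\<bar> \<le> 2 * (t ^ i * M')"
      using all
    proof eventually_elim
      case (elim x)
      show ?case
      proof
        assume x: "x \<in> ball x0 (rr j)"
        have "rr j \<le> rr i" using that \<tau> R by (auto simp: rr_def intro!: mult_right_mono power_decreasing)
        then have xi: "x \<in> ball x0 (rr i)" using x by auto
        have tt: "t ^ j * M' \<le> t ^ i * M'" using that t1 M' by (intro mult_right_mono power_decreasing) auto
        show "\<bar>ms i - ms j\<bar> \<le> 2 * (t ^ i * M')"
          using elim[rule_format, OF that xi] elim[rule_format, OF order.refl x] tt by linarith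
      qed
    qed
  qed (rule rr)
  have allv: "AE y in lborel. \<forall>i\<le>j. x0 + \<rho> *\<^sub>R y \<in> ball x0 (rr i) \<longrightarrow> \<bar>u (x0 + \<rho> *\<^sub>R y) - ms i\<bar> \<le> t ^ i * M'"
    using all by (subst (asm) AE_affine[where \<rho> = \<rho> and t = x0]) (auto simp: \<rho>R)
  have inb: "dist x0 (x0 + \<rho> *\<^sub>R y) < r \<longleftrightarrow> \<rho> * norm y < r" for y r
    using \<rho>R by (simp add: dist_norm)
  have bd: "AE y in lborel. y \<in> ball 0 L \<longrightarrow> \<bar>v y\<bar> \<le> 1"
    using allv
  proof eventually_elim
    case (elim y)
    show ?case
    proof
      assume "y \<in> ball 0 L"
      then have "\<rho> * norm y < \<rho> * L" using \<rho>R by simp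
      then have "\<bar>u (x0 + \<rho> *\<^sub>R y) - ms j\<bar> \<le> N" using elim by (simp add: inb \<rho>L N_def)
      then show "\<bar>v y\<bar> \<le> 1" using N by (simp add: v)
    qed
  qed
  define Z where "Z y = (norm y / L) powr \<alpha>" for y :: 'a
  define E where "E y = (indicator (- ball 0 (R / (2 * \<rho>))) y * \<bar>u (x0 + \<rho> *\<^sub>R y)\<bar> / N :: real)" for y
  have E0: "0 \<le> E y" for y using N by (simp add: E_def)
  \<comment> \<open>If the point lies in the shell between \<open>rr (Suc i)\<close> and
    \<open>rr i\<close>, the distance to the centre \<open>ms j\<close> is at most
    \<open>3 * t ^ i * M'\<close>: once the bound at stage \<open>i\<close> and twice for the change
    of centre. Passing to \<open>t ^ Suc i\<close> costs 2 because \<open>1/2 \<le> t\<close>, and 7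
    is 6 plus the summand 1, as \<open>1 \<le> Z y\<close>. Outside \<open>ball x0 (R / 2)\<close>
    nothing is known about \<open>u\<close>, and \<open>E\<close> keeps it as it is.\<close>
  have vb: "AE y in lborel. L \<le> norm y \<longrightarrow> 1 + \<bar>v y\<bar> \<le> 7 * Z y + E y"
    using allv
  proof eventually_elim
    case (elim y)
    show ?case
    proof
      assume y: "L \<le> norm y"
      define z where "z = \<rho> * norm y"
      have yz: "norm y / L = z / rr j" using \<rho>R rr[of j] unfolding z_def \<rho>L[symmetric] by simp
      have "\<rho> * L \<le> z" using y \<rho>R by (simp add: z_def)
      then have zj: "rr j \<le> z" by (simp add: \<rho>L)
      have Z1: "1 \<le> Z y" using y L \<alpha> by (auto simp: Z_def intro!: ge_one_powr_ge_zero)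
      have ti: "t ^ i = (\<tau> ^ i) powr \<alpha>" for i
        using \<tau> by (simp add: t(1) powr_realpow[symmetric] powr_powr mult.commute)
      have Zge: "t ^ i \<le> t ^ j * Z y" if "rr i \<le> z" "i \<le> j" for i
      proof -
        have "\<tau> ^ i \<le> \<tau> ^ j * (z / rr j)"
          using that(1) \<tau> R by (simp add: rr_def field_simps)
        then have "(\<tau> ^ i) powr \<alpha> \<le> (\<tau> ^ j * (norm y / L)) powr \<alpha>"
          using \<tau> \<alpha> unfolding yz by (intro powr_mono2) auto
        then show ?thesis unfolding ti Z_def by (simp only: powr_mult)
      qed
      show "1 + \<bar>v y\<bar> \<le> 7 * Z y + E y"
      proof (cases "z < R / 2")
        case True
        then obtain i where i: "i < j" "rr (Suc i) \<le> z" "z < rr i"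
          using discrete_crossing[of z rr j] zj by (auto simp: rr_def)
        have "\<bar>u (x0 + \<rho> *\<^sub>R y) - ms i\<bar> \<le> t ^ i * M'" using elim i by (simp add: inb z_def)
        then have "\<bar>u (x0 + \<rho> *\<^sub>R y) - ms j\<bar> \<le> 3 * (t ^ i * M')" using mdiff[of i] i by linarith
        also have "t ^ i \<le> 2 * t ^ Suc i" using t t1 by simp
        also have "t ^ Suc i \<le> t ^ j * Z y" using i by (intro Zge) auto
        finally have "\<bar>u (x0 + \<rho> *\<^sub>R y) - ms j\<bar> \<le> 6 * Z y * N"
          using M' by (simp add: N_def mult_ac mult_left_mono mult_right_mono)
        then have "\<bar>v y\<bar> \<le> 6 * Z y" using N by (simp add: v field_simps)
        then show ?thesis using Z1 E0[of y] by linarith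
      next
        case False
        then have "R / 2 \<le> z" by simp
        then have Ey: "E y = \<bar>u (x0 + \<rho> *\<^sub>R y)\<bar> / N"
          using \<rho>R by (simp add: E_def z_def indicator_def field_simps)
        have "1 \<le> t ^ j * Z y" using Zge[of 0] \<open>R / 2 \<le> z\<close> by (simp add: rr_def)
        then have "2 * M' * 1 \<le> 2 * M' * (t ^ j * Z y)" using M' by (intro mult_left_mono) auto
        moreover have "\<bar>ms j\<bar> \<le> 2 * M'" using mdiff[of 0] ms0 by simp
        ultimately have "\<bar>ms j\<bar> \<le> 2 * Z y * N" by (simp add: N_def mult_ac)
        then have "\<bar>ms j\<bar> / N \<le> 2 * Z y" using N by (simp add: field_simps)
        moreover have "\<bar>v y\<bar> \<le> \<bar>u (x0 + \<rho> *\<^sub>R y)\<bar> / N + \<bar>ms j\<bar> / N"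
          using N abs_triangle_ineq4[of "u (x0 + \<rho> *\<^sub>R y)" "ms j"] by (simp add: v add_divide_distrib[symmetric] divide_right_mono)
        ultimately show ?thesis using Z1 Ey by linarith
      qed
    qed
  qed
  have tl: "(\<integral>\<^sup>+y\<in>- ball 0 L. ennreal (kmaj \<rho> (norm y) * (1 + \<bar>v y\<bar>) powr (p - 1)) \<partial>lborel) \<le> ennreal \<kappa>"
  proof -
    define C1 where "C1 = 2 powr p * 7 powr (p - 1) * \<tau> powr (s * p / 2)"
    define C2 where "C2 = 2 powr p * (1 / N) powr (p - 1)"
    have C: "0 \<le> C1" "0 \<le> C2" by (auto simp: C1_def C2_def)
    have "(\<integral>\<^sup>+y\<in>- ball 0 L. ennreal (kmaj \<rho> (norm y) * (1 + \<bar>v y\<bar>) powr (p - 1)) \<partial>lborel)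
      \<le> (\<integral>\<^sup>+y. ennreal C1 * (ennreal (hmaj (norm y) * norm y powr (s * p / 2)) * indicator (- ball 0 1) y)
         + ennreal C2 * (ennreal (kmaj \<rho> (norm y) * \<bar>u (x0 + \<rho> *\<^sub>R y)\<bar> powr (p - 1)) * indicator (- ball 0 (R / (2 * \<rho>))) y) \<partial>lborel)"
    proof (rule nn_integral_mono_AE, use vb in eventually_elim)
      case (elim y)
      show ?case
      proof (cases "L \<le> norm y")
        case True
        have k0: "0 \<le> kmaj \<rho> (norm y)" by (rule kmaj_nonneg[OF \<rho>])
        have Zp: "0 \<le> Z y" by (simp add: Z_def)
        have "(1 + \<bar>v y\<bar>) powr (p - 1) \<le> (7 * Z y + E y) powr (p - 1)" using elim True p by (intro powr_mono2) auto
        also have "\<dots> \<le> 2 powr (p - 1) * ((7 * Z y) powr (p - 1) + E y powr (p - 1))" using Zp E0 p by (intro powr_add_le) auto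
        also have "\<dots> \<le> 2 powr p * ((7 * Z y) powr (p - 1) + E y powr (p - 1))" by (intro mult_right_mono powr_mono) auto
        finally have "kmaj \<rho> (norm y) * (1 + \<bar>v y\<bar>) powr (p - 1) \<le> kmaj \<rho> (norm y) * (2 powr p * ((7 * Z y) powr (p - 1) + E y powr (p - 1)))"
          using k0 by (rule mult_left_mono)
        also have "\<dots> = 2 powr p * 7 powr (p - 1) * (kmaj \<rho> (norm y) * Z y powr (p - 1)) + 2 powr p * (kmaj \<rho> (norm y) * E y powr (p - 1))"
          by (simp add: powr_mult algebra_simps)
        also have "\<dots> \<le> C1 * (hmaj (norm y) * norm y powr (s * p / 2)) + C2 * (kmaj \<rho> (norm y) * \<bar>u (x0 + \<rho> *\<^sub>R y)\<bar> powr (p - 1)) * indicator (- ball 0 (R / (2 * \<rho>))) y"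
        proof (rule add_mono)
          \<comment> \<open>Here \<open>\<alpha> * (p - 1) \<le> s * p / 2\<close> is used: the
            growth of \<open>Z\<close> fits into the weight that defines \<open>c_out\<close>, and
            \<open>1 / L = \<tau>\<close> supplies the small factor.\<close>
          have "Z y powr (p - 1) \<le> (norm y / L) powr (s * p / 2)"
            unfolding Z_def powr_powr using True L \<alpha> by (intro powr_mono) auto
          also have "\<dots> = \<tau> powr (s * p / 2) * norm y powr (s * p / 2)"
            by (simp add: L_def powr_mult mult.commute)
          finally have "kmaj \<rho> (norm y) * Z y powr (p - 1) \<le> hmaj (norm y) * (\<tau> powr (s * p / 2) * norm y powr (s * p / 2))"
            using k0 hmaj_nonneg by (intro mult_mono kmaj_le_hmaj[OF \<rho>]) auto
          then have "2 powr p * 7 powr (p - 1) * (kmaj \<rho> (norm y) * Z y powr (p - 1)) \<le> 2 powr p * 7 powr (p - 1) * (hmaj (norm y) * (\<tau> powr (s * p / 2) * norm y powr (s * p / 2)))"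
            by (intro mult_left_mono) auto
          then show "2 powr p * 7 powr (p - 1) * (kmaj \<rho> (norm y) * Z y powr (p - 1)) \<le> C1 * (hmaj (norm y) * norm y powr (s * p / 2))"
            by (simp add: C1_def mult_ac)
          show "2 powr p * (kmaj \<rho> (norm y) * E y powr (p - 1)) \<le> C2 * (kmaj \<rho> (norm y) * \<bar>u (x0 + \<rho> *\<^sub>R y)\<bar> powr (p - 1)) * indicator (- ball 0 (R / (2 * \<rho>))) y"
            using p by (simp add: C2_def E_def indicator_def powr_divide)
        qed
        finally have "ennreal (kmaj \<rho> (norm y) * (1 + \<bar>v y\<bar>) powr (p - 1))
          \<le> ennreal (C1 * (hmaj (norm y) * norm y powr (s * p / 2)) + C2 * (kmaj \<rho> (norm y) * \<bar>u (x0 + \<rho> *\<^sub>R y)\<bar> powr (p - 1)) * indicator (- ball 0 (R / (2 * \<rho>))) y)"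
          by (rule ennreal_leI)
        also have "\<dots> = ennreal C1 * ennreal (hmaj (norm y) * norm y powr (s * p / 2)) + ennreal C2 * (ennreal (kmaj \<rho> (norm y) * \<bar>u (x0 + \<rho> *\<^sub>R y)\<bar> powr (p - 1)) * indicator (- ball 0 (R / (2 * \<rho>))) y)"
          using C hmaj_nonneg[of "norm y"] k0
          by (subst ennreal_plus) (auto simp: ennreal_mult indicator_def)
        finally show ?thesis using True L by (auto simp: indicator_def)
      qed simp
    qed
    also have "\<dots> = ennreal C1 * (\<integral>\<^sup>+y\<in>- ball (0::'a) 1. ennreal (hmaj (norm y) * norm y powr (s * p / 2)) \<partial>lborel)
       + ennreal C2 * (\<integral>\<^sup>+y\<in>- ball 0 (R / (2 * \<rho>)). ennreal (kmaj \<rho> (norm y) * \<bar>u (x0 + \<rho> *\<^sub>R y)\<bar> powr (p - 1)) \<partial>lborel)"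
      by (subst nn_integral_add, measurable, subst nn_integral_cmult, measurable, subst nn_integral_cmult, measurable)
    also have "\<dots> \<le> ennreal C1 * ennreal c_out + ennreal C2 * ennreal ((\<rho> / R) powr (s * p) * M powr (p - 1))"
      unfolding c_out using R \<rho>R by (intro add_left_mono mult_left_mono scaled_tail_bound[OF \<rho> _ _ _ _ M(1) T]) auto
    also have "\<dots> = ennreal (C1 * c_out + C2 * ((\<rho> / R) powr (s * p) * M powr (p - 1)))"
      using C c_nonneg by (simp add: ennreal_mult ennreal_plus)
    also have "\<dots> \<le> ennreal \<kappa>"
    proof (rule ennreal_leI)
      have "C2 * ((\<rho> / R) powr (s * p) * M powr (p - 1)) = 2 powr p * ((\<tau> ^ Suc j / 2) powr (s * p) * (M / N) powr (p - 1))"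
        unfolding C2_def rho_R using powr_mult[of M "1 / N" "p - 1"] by (simp add: mult_ac)
      also have "\<dots> \<le> 2 powr p * \<tau> powr (s * p)"
        unfolding N_def t(1) using \<tau> \<alpha> M sp_pos by (intro mult_left_mono decay_factor) auto
      finally show "C1 * c_out + C2 * ((\<rho> / R) powr (s * p) * M powr (p - 1)) \<le> \<kappa>"
        using sm(1,2) by (simp add: C1_def mult_ac)
    qed
    finally show ?thesis .
  qed
  have fb: "(\<integral>\<^sup>+x\<in>ball 0 (3/2). ennreal (\<bar>signed_powr p a * (\<rho> powr (s * p) / lg \<rho> * f (x0 + \<rho> *\<^sub>R x))\<bar> powr q) \<partial>lborel) \<le> ennreal \<kappa>"
  proof -
    have "(\<integral>\<^sup>+x\<in>ball 0 (3/2). ennreal (\<bar>signed_powr p a * (\<rho> powr (s * p) / lg \<rho> * f (x0 + \<rho> *\<^sub>R x))\<bar> powr q) \<partial>lborel)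
       \<le> ennreal (((\<rho> / R) powr \<mu> * (M / N) powr (p - 1)) powr q)"
      using R \<rho>R by (intro scaled_f_bound[OF \<rho> _ _ _ _ M(1) a(1) N F]) auto
    also have "\<dots> \<le> ennreal \<kappa>"
    proof (rule ennreal_leI)
      have "(\<rho> / R) powr \<mu> * (M / N) powr (p - 1) \<le> \<tau> powr \<mu>"
        unfolding rho_R N_def t(1) using \<tau> \<alpha> M by (intro decay_factor) auto
      then have "((\<rho> / R) powr \<mu> * (M / N) powr (p - 1)) powr q \<le> (\<tau> powr \<mu>) powr q"
        using q_gt by (intro powr_mono2) auto
      then show "((\<rho> / R) powr \<mu> * (M / N) powr (p - 1)) powr q \<le> \<kappa>" using sm(3) by (simp add: powr_powr)
    qed
    finally show ?thesis .
  qed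
  have "2 * \<rho> * L \<le> 1" using rr(2)[of j] R by (simp add: mult.assoc \<rho>L)
  then obtain m where m: "AE y in lborel. y \<in> ball 0 1 \<longrightarrow> \<bar>v y - m\<bar> \<le> 1 - \<delta>"
    using step[OF \<rho> L(1) _ solv bd tl fb] by blast
  have "AE x in lborel. x \<in> ball x0 \<rho> \<longrightarrow> \<bar>u x - (ms j + N * m)\<bar> \<le> t * N"
  proof (subst AE_affine[where \<rho> = \<rho> and t = x0])
    show "AE y in lborel. x0 + \<rho> *\<^sub>R y \<in> ball x0 \<rho> \<longrightarrow> \<bar>u (x0 + \<rho> *\<^sub>R y) - (ms j + N * m)\<bar> \<le> t * N"
      using m
    proof eventually_elim
      case (elim y)
      show ?case
      proof
        assume "x0 + \<rho> *\<^sub>R y \<in> ball x0 \<rho>"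
        then have "\<rho> * norm y < \<rho> * 1" by (simp add: inb)
        then have "\<bar>v y - m\<bar> \<le> t" using elim t \<rho>R by simp
        then have "N * \<bar>v y - m\<bar> \<le> N * t" using N by (intro mult_left_mono) auto
        moreover have "N * \<bar>v y - m\<bar> = \<bar>N * (v y - m)\<bar>" using N by (simp add: abs_mult)
        moreover have "N * (v y - m) = u (x0 + \<rho> *\<^sub>R y) - (ms j + N * m)"
        proof -
          have "N * v y = u (x0 + \<rho> *\<^sub>R y) - ms j" using N by (simp add: v)
          then show ?thesis by (simp add: right_diff_distrib)
        qed
        ultimately show "\<bar>u (x0 + \<rho> *\<^sub>R y) - (ms j + N * m)\<bar> \<le> t * N" by (simp add: mult.commute)
      qed
    qed
  qed (auto simp: \<rho>R)
  then show ?thesis by (intro exI[of _ "ms j + N * m"]) (simp add: \<rho>_def rr_def N_def mult_ac)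
qed

theorem holder_estimate:
  "\<exists>\<alpha> K. 0 < \<alpha> \<and> \<alpha> \<le> 1 \<and> \<alpha> < \<mu> / (p - 1) \<and> 0 < K \<and> (\<forall>U u f x0 R M. borel_sol U u f \<longrightarrow> 0 < R \<longrightarrow> R \<le> 1/2 \<longrightarrow> ball x0 R \<subseteq> U \<longrightarrow> 0 < M \<longrightarrow>
     (\<integral>\<^sup>+x\<in>ball x0 R. ennreal (\<bar>u x\<bar> powr p) \<partial>lborel) \<le> ennreal (M powr p * R powr DIM('a)) \<longrightarrow>
     log_tail u x0 (R / 2) \<le> ennreal (M powr (p - 1) * lg R * R powr - (s * p)) \<longrightarrow>
     (\<integral>\<^sup>+x\<in>ball x0 R. ennreal (\<bar>f x\<bar> powr q) \<partial>lborel) \<le> ennreal ((M powr (p - 1) * lg R * R powr - \<mu>) powr q) \<longrightarrow>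
     (\<forall>r. 0 < r \<and> r \<le> R / 2 \<longrightarrow> (\<exists>m. AE x in lborel. x \<in> ball x0 r \<longrightarrow> \<bar>u x - m\<bar> \<le> K * (r / R) powr \<alpha> * M)))"
proof -
  obtain \<delta> \<kappa> where \<delta>: "0 < \<delta>" "\<delta> \<le> 1/8" and \<kappa>: "0 < \<kappa>" and step: "\<And>\<rho> L u f. scale \<rho> \<Longrightarrow> 2 \<le> L \<Longrightarrow> 2 * \<rho> * L \<le> 1 \<Longrightarrow> sol \<rho> u f \<Longrightarrow>
     (AE x in lborel. x \<in> ball 0 L \<longrightarrow> \<bar>u x\<bar> \<le> 1) \<Longrightarrow>
     (\<integral>\<^sup>+y\<in>- ball 0 L. ennreal (kmaj \<rho> (norm y) * (1 + \<bar>u y\<bar>) powr (p - 1)) \<partial>lborel) \<le> ennreal \<kappa> \<Longrightarrow>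
     (\<integral>\<^sup>+x\<in>ball 0 (3/2). ennreal (\<bar>f x\<bar> powr q) \<partial>lborel) \<le> ennreal \<kappa> \<Longrightarrow>
     (\<exists>m. AE x in lborel. x \<in> ball 0 1 \<longrightarrow> \<bar>u x - m\<bar> \<le> 1 - \<delta>)"
    using oscillation_step by blast
  obtain K1 where K1: "1 \<le> K1" and bdd: "\<And>U u f x0 R M. borel_sol U u f \<Longrightarrow> 0 < R \<Longrightarrow> R \<le> 1/2 \<Longrightarrow> ball x0 R \<subseteq> U \<Longrightarrow> 0 < M \<Longrightarrow>
     (\<integral>\<^sup>+x\<in>ball x0 R. ennreal (\<bar>u x\<bar> powr p) \<partial>lborel) \<le> ennreal (M powr p * R powr DIM('a)) \<Longrightarrow>
     log_tail u x0 (R / 2) \<le> ennreal (M powr (p - 1) * lg R * R powr - (s * p)) \<Longrightarrow>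
     (\<integral>\<^sup>+x\<in>ball x0 R. ennreal (\<bar>f x\<bar> powr q) \<partial>lborel) \<le> ennreal ((M powr (p - 1) * lg R * R powr - \<mu>) powr q) \<Longrightarrow>
     (AE x in lborel. x \<in> ball x0 (R / 2) \<longrightarrow> \<bar>u x\<bar> \<le> K1 * M)"
    using local_boundedness by blast
  define k1 where "k1 = \<kappa> / (2 * (2 powr p * 7 powr (p - 1) * (c_out + 1)))"
  define k2 where "k2 = \<kappa> / (2 * 2 powr p)"
  have k12: "0 < k1" "0 < k2" using \<kappa> c_nonneg by (auto simp: k1_def k2_def add_nonneg_pos)
  obtain t1 where t1: "0 < t1" "\<And>t. 0 < t \<Longrightarrow> t \<le> t1 \<Longrightarrow> t powr (s * p / 2) \<le> k1"
    using exists_small_powr[of "s * p / 2" k1] sp_pos k12 by auto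
  obtain t2 where t2: "0 < t2" "\<And>t. 0 < t \<Longrightarrow> t \<le> t2 \<Longrightarrow> t powr (s * p) \<le> k2"
    using exists_small_powr[of "s * p" k2] sp_pos k12 by auto
  obtain t3 where t3: "0 < t3" "\<And>t. 0 < t \<Longrightarrow> t \<le> t3 \<Longrightarrow> t powr (\<mu> * q) \<le> \<kappa>"
    using exists_small_powr[of "\<mu> * q" \<kappa>] mu_pos q_gt \<kappa> by auto
  \<comment> \<open>The thresholds make the near tail, the far tail and the right-hand side small.
    None of them depends on the exponent \<alpha>, which can thus be chosen afterwards.\<close>
  define \<tau> where "\<tau> = min (1/2) (min t1 (min t2 t3))"
  have \<tau>: "0 < \<tau>" "\<tau> \<le> 1/2" "\<tau> \<le> t1" "\<tau> \<le> t2" "\<tau> \<le> t3" using t1(1) t2(1) t3(1) by (auto simp: \<tau>_def)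
  have lnt: "ln \<tau> < 0" using \<tau> by (simp add: ln_less_zero)
  have lnd: "ln (1 - \<delta>) < 0" using \<delta> by (simp add: ln_less_zero)
  \<comment> \<open>The quotient of logarithms yields
    \<open>1 - \<delta> \<le> \<tau> powr \<alpha>\<close>, and \<open>s * p / (2 * (p - 1))\<close>
    keeps the growth in the tail integrable. The factor 2 in the last entry makes
    \<open>\<alpha> < \<mu> / (p - 1)\<close> strict.\<close>
  define \<alpha> where "\<alpha> = min (min 1 (ln (1 - \<delta>) / ln \<tau>)) (min (s * p / (2 * (p - 1))) (\<mu> / (2 * (p - 1))))"
  have \<alpha>: "0 < \<alpha>" "\<alpha> \<le> 1" "\<alpha> \<le> ln (1 - \<delta>) / ln \<tau>" "\<alpha> \<le> s * p / (2 * (p - 1))" "\<alpha> \<le> \<mu> / (2 * (p - 1))"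
    using lnt lnd sp_pos mu_pos p by (auto simp: \<alpha>_def divide_neg_neg)
  have \<alpha>p: "\<alpha> * (p - 1) \<le> s * p / 2" "\<alpha> * (p - 1) \<le> \<mu> / 2"
    using \<alpha>(4,5) p by (simp_all add: field_simps)
  have \<alpha>\<mu>: "\<alpha> < \<mu> / (p - 1)" using \<alpha>p(2) mu_pos p by (simp add: field_simps)
  define t where "t = \<tau> powr \<alpha>"
  have t0: "1 - \<delta> \<le> t"
  proof -
    have "ln (1 - \<delta>) \<le> \<alpha> * ln \<tau>" using \<alpha>(3) lnt by (simp add: neg_le_divide_eq)
    then have "exp (ln (1 - \<delta>)) \<le> exp (\<alpha> * ln \<tau>)" by simp
    then show ?thesis using \<delta> \<tau> by (simp add: t_def powr_def)
  qed
  have thalf: "1/2 \<le> t" using t0 \<delta> by linarith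
  have tle: "0 < t" "t \<le> 1" using thalf \<tau> \<alpha> powr_mono2[of \<alpha> \<tau> 1] by (auto simp: t_def)
  have sm1: "2 powr p * 7 powr (p - 1) * c_out * \<tau> powr (s * p / 2) \<le> \<kappa> / 2"
  proof -
    have "2 powr p * 7 powr (p - 1) * c_out * \<tau> powr (s * p / 2) \<le> 2 powr p * 7 powr (p - 1) * (c_out + 1) * k1"
      using t1(2)[of \<tau>] \<tau> c_nonneg by (intro mult_mono) auto
    also have "\<dots> = \<kappa> / 2" using c_nonneg unfolding k1_def by (simp add: add_nonneg_eq_0_iff)
    finally show ?thesis .
  qed
  have sm2: "2 powr p * \<tau> powr (s * p) \<le> \<kappa> / 2"
  proof -
    have "2 powr p * \<tau> powr (s * p) \<le> 2 powr p * k2" using t2(2)[of \<tau>] \<tau> by (intro mult_left_mono) auto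
    then show ?thesis by (simp add: k2_def)
  qed
  have sm3: "\<tau> powr (\<mu> * q) \<le> \<kappa>" using t3(2) \<tau> by blast
  \<comment> \<open>A radius \<open>r\<close> is replaced by the next larger one of the form
    \<open>\<tau> ^ i * (R / 2)\<close>, for which
    \<open>\<tau> ^ i \<le> 2 / \<tau> * (r / R)\<close>.\<close>
  define K where "K = K1 * (2 / \<tau>) powr \<alpha>"
  have K: "0 < K" using K1 \<tau> by (simp add: K_def)
  have main: "\<exists>m. AE x in lborel. x \<in> ball x0 r \<longrightarrow> \<bar>u x - m\<bar> \<le> K * (r / R) powr \<alpha> * M"
    if bs: "borel_sol U u f" and R: "0 < R" "R \<le> 1/2" and sub: "ball x0 R \<subseteq> U" and M: "0 < M" and
     A: "(\<integral>\<^sup>+x\<in>ball x0 R. ennreal (\<bar>u x\<bar> powr p) \<partial>lborel) \<le> ennreal (M powr p * R powr DIM('a))" and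
     T: "log_tail u x0 (R / 2) \<le> ennreal (M powr (p - 1) * lg R * R powr - (s * p))" and
     F: "(\<integral>\<^sup>+x\<in>ball x0 R. ennreal (\<bar>f x\<bar> powr q) \<partial>lborel) \<le> ennreal ((M powr (p - 1) * lg R * R powr - \<mu>) powr q)"
     and r: "0 < r" "r \<le> R / 2"
    for U u f x0 R M r
  proof -
    have M': "M \<le> K1 * M" "0 < K1 * M" using K1 M by auto
    have ex: "\<exists>ms. ms 0 = 0 \<and> (\<forall>i\<le>j. AE x in lborel. x \<in> ball x0 (\<tau> ^ i * (R / 2)) \<longrightarrow> \<bar>u x - ms i\<bar> \<le> t ^ i * (K1 * M))" for j
    proof (induction j)
      case 0
      then show ?case using bdd[OF bs R sub M A T F] by (intro exI[of _ "\<lambda>_. 0"]) auto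
    next
      case (Suc j)
      then obtain ms where ms: "ms 0 = 0" "\<And>i. i \<le> j \<Longrightarrow> AE x in lborel. x \<in> ball x0 (\<tau> ^ i * (R / 2)) \<longrightarrow> \<bar>u x - ms i\<bar> \<le> t ^ i * (K1 * M)"
        by blast
      have "\<exists>m. AE x in lborel. x \<in> ball x0 (\<tau> ^ Suc j * (R / 2)) \<longrightarrow> \<bar>u x - m\<bar> \<le> t ^ Suc j * (K1 * M)"
        using \<alpha>p(2) mu_pos by (intro osc_induction_step[OF step \<tau>(1,2) \<alpha>(1) \<alpha>p(1) _ t_def t0 thalf sm1 sm2 sm3 bs R sub M M'(1) T F ms]) auto
      then obtain m where "AE x in lborel. x \<in> ball x0 (\<tau> ^ Suc j * (R / 2)) \<longrightarrow> \<bar>u x - m\<bar> \<le> t ^ Suc j * (K1 * M)" by blast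
      then show ?case using ms by (intro exI[of _ "ms(Suc j := m)"]) (auto simp: le_Suc_eq)
    qed
    have osc: "\<exists>m. AE x in lborel. x \<in> ball x0 (\<tau> ^ j * (R / 2)) \<longrightarrow> \<bar>u x - m\<bar> \<le> t ^ j * (K1 * M)" for j
    proof -
      obtain ms where "\<forall>i\<le>j. AE x in lborel. x \<in> ball x0 (\<tau> ^ i * (R / 2)) \<longrightarrow> \<bar>u x - ms i\<bar> \<le> t ^ i * (K1 * M)"
        using ex[of j] by blast
      then show ?thesis by (intro exI[of _ "ms j"]) simp
    qed
    obtain i where i: "\<tau> ^ Suc i * (R / 2) \<le> r" "r \<le> \<tau> ^ i * (R / 2)"
    proof (cases "r = R / 2")
      case True
      then show ?thesis using that[of 0] \<tau> R by simp
    next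
      case False
      obtain n where "\<tau> ^ n < r / (R / 2)" using real_arch_pow_inv[of "r / (R / 2)" \<tau>] r R \<tau> by auto
      then have "\<tau> ^ n * (R / 2) \<le> r" using R by (simp add: field_simps)
      moreover have "r < \<tau> ^ 0 * (R / 2)" using False r by simp
      ultimately obtain i where "\<tau> ^ Suc i * (R / 2) \<le> r" "r < \<tau> ^ i * (R / 2)"
        using discrete_crossing[of r "\<lambda>i. \<tau> ^ i * (R / 2)" n] by blast
      then show ?thesis by (intro that[of i]) auto
    qed
    obtain m where m: "AE x in lborel. x \<in> ball x0 (\<tau> ^ i * (R / 2)) \<longrightarrow> \<bar>u x - m\<bar> \<le> t ^ i * (K1 * M)" using osc by blast
    have "t ^ i \<le> (2 / \<tau>) powr \<alpha> * (r / R) powr \<alpha>"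
    proof -
      have "\<tau> ^ i \<le> 2 / \<tau> * (r / R)" using i(1) \<tau> R by (simp add: field_simps)
      then have "(\<tau> ^ i) powr \<alpha> \<le> (2 / \<tau> * (r / R)) powr \<alpha>" using \<tau> \<alpha> by (intro powr_mono2) auto
      moreover have "(\<tau> ^ i) powr \<alpha> = t ^ i"
        using \<tau> by (simp add: t_def powr_realpow[symmetric] powr_powr mult.commute)
      ultimately show ?thesis by (simp only: powr_mult)
    qed
    then have "t ^ i * (K1 * M) \<le> (2 / \<tau>) powr \<alpha> * (r / R) powr \<alpha> * (K1 * M)" using M' by (intro mult_right_mono) auto
    then have le: "t ^ i * (K1 * M) \<le> K * (r / R) powr \<alpha> * M" by (simp add: K_def mult_ac)
    show ?thesis
    proof (intro exI[of _ m])
      show "AE x in lborel. x \<in> ball x0 r \<longrightarrow> \<bar>u x - m\<bar> \<le> K * (r / R) powr \<alpha> * M"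
        using m by eventually_elim (use i(2) le in auto)
    qed
  qed
  show ?thesis
    by (rule exI[of _ \<alpha>], rule exI[of _ K], intro conjI \<alpha>(1,2) \<alpha>\<mu> K allI impI, elim conjE) (rule main; assumption)
qed

end

subsection \<open>From oscillation decay to a Hoelder representative\<close>

definition osc_center :: "('a::euclidean_space \<Rightarrow> real) \<Rightarrow> real \<Rightarrow> real \<Rightarrow> 'a \<Rightarrow> real \<Rightarrow> real \<Rightarrow> bool" where
  "osc_center u \<alpha> C x r m \<longleftrightarrow> (AE y in lborel. y \<in> ball x r \<longrightarrow> \<bar>u y - m\<bar> \<le> C * r powr \<alpha>)"

lemma osc_center_overlap:
  assumes "osc_center u \<alpha> C x r m" "osc_center u \<alpha> C' x' r' m'" "ball x' r' \<subseteq> ball x r" "0 < r'"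
  shows "\<bar>m - m'\<bar> \<le> C * r powr \<alpha> + C' * r' powr \<alpha>"
proof (rule AE_ball_const[OF _ assms(4), where ?x0.0 = x'])
  show "AE y in lborel. y \<in> ball x' r' \<longrightarrow> \<bar>m - m'\<bar> \<le> C * r powr \<alpha> + C' * r' powr \<alpha>"
    using assms(1,2) unfolding osc_center_def
  proof eventually_elim
    case (elim y)
    then show ?case using assms(3) by (smt (verit) subsetD)
  qed
qed

text \<open>Centres belonging to nested balls differ by at most the sum of their two bounds, so
  along dyadic radii they form a Cauchy sequence. Comparing an arbitrary ball with the small balls
  of the sequence shows that the limit serves all \<open>C\<close>, \<open>r\<close> and
  \<open>m\<close> at once. It will be the value of the continuous representative at
  \<open>x\<close>.\<close>

lemma osc_center_limit:
  assumes R: "0 < R0" and \<alpha>: "0 < \<alpha>" and ex: "\<And>r. 0 < r \<Longrightarrow> r \<le> R0 \<Longrightarrow> \<exists>m. osc_center u \<alpha> C0 x r m"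
  shows "\<exists>w. \<forall>C r m. osc_center u \<alpha> C x r m \<and> 0 < r \<longrightarrow> \<bar>m - w\<bar> \<le> C * r powr \<alpha>"
proof -
  define rr where "rr n = R0 / 2 ^ n" for n :: nat
  have rr: "0 < rr n" "rr n \<le> R0" for n using R by (auto simp: rr_def field_simps)
  have rmono: "rr k \<le> rr n" if "n \<le> k" for n k
    unfolding rr_def using R that by (intro divide_left_mono power_increasing) auto
  obtain ms where ms: "\<And>n. osc_center u \<alpha> C0 x (rr n) (ms n)" using ex[OF rr] by metis
  have C0: "0 \<le> C0"
  proof -
    have "\<bar>ms 0 - ms 0\<bar> \<le> C0 * rr 0 powr \<alpha> + C0 * rr 0 powr \<alpha>" by (rule osc_center_overlap[OF ms ms _ rr(1)]) simp
    moreover have "0 < rr 0 powr \<alpha>" using rr(1)[of 0] by simp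
    ultimately show ?thesis by (simp add: zero_le_mult_iff)
  qed
  have lim0: "(\<lambda>n. rr n powr \<alpha>) \<longlonglongrightarrow> 0"
  proof -
    have "(\<lambda>n. R0 * (1/2) ^ n) \<longlonglongrightarrow> R0 * 0" by (intro tendsto_intros LIMSEQ_realpow_zero) auto
    then have "rr \<longlonglongrightarrow> 0" by (simp add: rr_def[abs_def] power_one_over field_simps)
    then have "(\<lambda>n. rr n powr \<alpha>) \<longlonglongrightarrow> 0 powr \<alpha>"
      using \<alpha> rr by (intro tendsto_powr') (auto intro!: always_eventually less_imp_le)
    then show ?thesis by simp
  qed
  have "Cauchy ms"
  proof (rule CauchyI)
    fix e :: real assume "0 < e"
    have "(\<lambda>n. 2 * C0 * rr n powr \<alpha>) \<longlonglongrightarrow> 2 * C0 * 0" by (intro tendsto_intros lim0)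
    then have "eventually (\<lambda>n. 2 * C0 * rr n powr \<alpha> < e) sequentially" using \<open>0 < e\<close> by (intro order_tendstoD) auto
    then obtain N where N: "\<And>n. N \<le> n \<Longrightarrow> 2 * C0 * rr n powr \<alpha> < e" by (auto simp: eventually_sequentially)
    have aux: "\<bar>ms n - ms k\<bar> < e" if "N \<le> n" "n \<le> k" for n k
    proof -
      have "\<bar>ms n - ms k\<bar> \<le> C0 * rr n powr \<alpha> + C0 * rr k powr \<alpha>"
        using rmono[OF that(2)] by (intro osc_center_overlap[OF ms ms _ rr(1)]) auto
      also have "\<dots> \<le> C0 * rr n powr \<alpha> + C0 * rr n powr \<alpha>"
        using rmono[OF that(2)] rr(1)[of k] C0 \<alpha> by (intro add_left_mono mult_left_mono powr_mono2) auto
      also have "\<dots> < e" using N[OF that(1)] by simp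
      finally show ?thesis .
    qed
    show "\<exists>M. \<forall>m\<ge>M. \<forall>n\<ge>M. norm (ms m - ms n) < e"
    proof (intro exI[of _ N] allI impI)
      fix m n assume "N \<le> m" "N \<le> n"
      then show "norm (ms m - ms n) < e" using aux[of m n] aux[of n m] by (cases "m \<le> n") (auto simp: abs_minus_commute)
    qed
  qed
  then obtain w where w: "ms \<longlonglongrightarrow> w" using Cauchy_convergent_iff convergent_def by blast
  show ?thesis
  proof (intro exI[of _ w] allI impI)
    fix C r m
    assume asm: "osc_center u \<alpha> C x r m \<and> 0 < r"
    have "(\<lambda>n. R0 * (1/2) ^ n) \<longlonglongrightarrow> R0 * 0" by (intro tendsto_intros LIMSEQ_realpow_zero) auto
    then have "rr \<longlonglongrightarrow> 0" by (simp add: rr_def[abs_def] power_one_over field_simps)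
    then have ev: "eventually (\<lambda>n. rr n < r) sequentially" using asm by (intro order_tendstoD) auto
    have "(\<lambda>n. \<bar>m - ms n\<bar>) \<longlonglongrightarrow> \<bar>m - w\<bar>" by (intro tendsto_intros w)
    moreover have "(\<lambda>n. C * r powr \<alpha> + C0 * rr n powr \<alpha>) \<longlonglongrightarrow> C * r powr \<alpha> + C0 * 0" by (intro tendsto_intros lim0)
    moreover have "eventually (\<lambda>n. \<bar>m - ms n\<bar> \<le> C * r powr \<alpha> + C0 * rr n powr \<alpha>) sequentially"
      using ev
    proof eventually_elim
      case (elim n)
      then show ?case using asm by (intro osc_center_overlap[OF _ ms _ rr(1)]) auto
    qed
    ultimately have "\<bar>m - w\<bar> \<le> C * r powr \<alpha> + C0 * 0" by (intro tendsto_le[OF trivial_limit_sequentially])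
    then show "\<bar>m - w\<bar> \<le> C * r powr \<alpha>" by simp
  qed
qed

lemma locally_holder_from_oscillation:
  fixes u :: "'a::euclidean_space \<Rightarrow> real"
  assumes U: "open U" and \<alpha>: "0 < \<alpha>" "\<alpha> \<le> 1"
    and osc: "\<And>K. compact K \<Longrightarrow> K \<subseteq> U \<Longrightarrow>
      \<exists>C R0. 0 \<le> C \<and> 0 < R0 \<and> (\<forall>x\<in>K. \<forall>r. 0 < r \<and> r \<le> R0 \<longrightarrow> (\<exists>m. osc_center u \<alpha> C x r m))"
  shows "locally_holder U u"
proof -
  have "\<exists>w. \<forall>C r m. osc_center u \<alpha> C x r m \<and> 0 < r \<longrightarrow> \<bar>m - w\<bar> \<le> C * r powr \<alpha>" if "x \<in> U" for x
  proof -
    obtain C R0 where "0 < R0" "\<And>r. 0 < r \<Longrightarrow> r \<le> R0 \<Longrightarrow> \<exists>m. osc_center u \<alpha> C x r m"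
      using osc[of "{x}"] \<open>x \<in> U\<close> by auto
    then show ?thesis using \<alpha> by (intro osc_center_limit[of R0 \<alpha> u C])
  qed
  then obtain w where w: "\<And>x C r m. x \<in> U \<Longrightarrow> osc_center u \<alpha> C x r m \<Longrightarrow> 0 < r \<Longrightarrow> \<bar>m - w x\<bar> \<le> C * r powr \<alpha>"
    by metis
  \<comment> \<open>Finite covers of \<open>K\<close> at each dyadic scale replace a theorem on
    Lebesgue points: with finitely many centres per scale, one null set takes care of all scales. At
    other points \<open>y\<close> the value \<open>u y\<close> is compared with the centre of a
    covering ball, and that centre with \<open>w y\<close> through a small ball around
    \<open>y\<close>.\<close>
  have ae: "AE y in lborel. y \<in> K \<longrightarrow> u y = w y" if K: "compact K" "K \<subseteq> U" for K
  proof -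
    obtain C R0 where C: "0 \<le> C" "0 < R0" "\<And>x r. x \<in> K \<Longrightarrow> 0 < r \<Longrightarrow> r \<le> R0 \<Longrightarrow> \<exists>m. osc_center u \<alpha> C x r m"
      using osc[OF K] by blast
    define rr where "rr n = R0 / 2 ^ n" for n :: nat
    have rr: "0 < rr n" "rr n \<le> R0" for n using C by (auto simp: rr_def field_simps)
    have "\<exists>X. finite X \<and> X \<subseteq> K \<and> K \<subseteq> (\<Union>x\<in>X. ball x (rr n))" for n
      using compactE_image[OF K(1), of K "\<lambda>x. ball x (rr n)"] rr(1)[of n] by (metis UN_I centre_in_ball open_ball subsetI)
    then obtain X where X: "\<And>n. finite (X n)" "\<And>n. X n \<subseteq> K" "\<And>n. K \<subseteq> (\<Union>x\<in>X n. ball x (rr n))" by metis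
    obtain ms where ms: "\<And>x n. x \<in> K \<Longrightarrow> osc_center u \<alpha> C x (rr n) (ms x n)" using C(3)[OF _ rr] by metis
    have "AE y in lborel. \<forall>x\<in>X n. y \<in> ball x (rr n) \<longrightarrow> \<bar>u y - ms x n\<bar> \<le> C * rr n powr \<alpha>" for n
    proof (rule AE_finite_allI[OF X(1)])
      fix x assume "x \<in> X n"
      then have "osc_center u \<alpha> C x (rr n) (ms x n)" using ms X(2) by blast
      then show "AE y in lborel. y \<in> ball x (rr n) \<longrightarrow> \<bar>u y - ms x n\<bar> \<le> C * rr n powr \<alpha>"
        by (simp only: osc_center_def)
    qed
    then have "AE y in lborel. \<forall>n. \<forall>x\<in>X n. y \<in> ball x (rr n) \<longrightarrow> \<bar>u y - ms x n\<bar> \<le> C * rr n powr \<alpha>"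
      by (simp add: AE_all_countable)
    then show ?thesis
    proof eventually_elim
      case (elim y)
      show ?case
      proof
        assume y: "y \<in> K"
        have le: "\<bar>u y - w y\<bar> \<le> 4 * C * rr n powr \<alpha>" for n
        proof -
          obtain x where x: "x \<in> X n" "y \<in> ball x (rr n)" using X(3)[of n] y by blast
          obtain e where e: "0 < e" "ball y e \<subseteq> ball x (rr n)" using openE[OF open_ball x(2)] by blast
          define \<rho> where "\<rho> = min e (rr n)"
          have \<rho>: "0 < \<rho>" "\<rho> \<le> rr n" "ball y \<rho> \<subseteq> ball x (rr n)" using e rr(1)[of n] by (auto simp: \<rho>_def)
          obtain m where m: "osc_center u \<alpha> C y \<rho> m" using C(3)[OF y \<rho>(1)] \<rho>(2) rr(2)[of n] by auto
          have "\<bar>m - w y\<bar> \<le> C * \<rho> powr \<alpha>" using w[OF _ m \<rho>(1)] y K by auto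
          moreover have "\<bar>ms x n - m\<bar> \<le> C * rr n powr \<alpha> + C * \<rho> powr \<alpha>"
            using x X(2) by (intro osc_center_overlap[OF ms m \<rho>(3,1)]) auto
          moreover have "C * \<rho> powr \<alpha> \<le> C * rr n powr \<alpha>" using \<rho> C \<alpha> by (intro mult_left_mono powr_mono2) auto
          moreover have "\<bar>u y - ms x n\<bar> \<le> C * rr n powr \<alpha>" using elim x by blast
          ultimately show ?thesis by linarith
        qed
        have "(\<lambda>n. R0 * (1/2) ^ n) \<longlonglongrightarrow> R0 * 0" by (intro tendsto_intros LIMSEQ_realpow_zero) auto
        then have "rr \<longlonglongrightarrow> 0" by (simp add: rr_def[abs_def] power_one_over field_simps)
        then have "(\<lambda>n. rr n powr \<alpha>) \<longlonglongrightarrow> 0 powr \<alpha>"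
          using \<alpha> rr by (intro tendsto_powr') (auto intro!: always_eventually less_imp_le)
        then have "(\<lambda>n. 4 * C * rr n powr \<alpha>) \<longlonglongrightarrow> 4 * C * 0 powr \<alpha>" by (rule tendsto_mult_left)
        then have "\<bar>u y - w y\<bar> \<le> 4 * C * 0 powr \<alpha>" by (rule LIMSEQ_le_const) (use le in auto)
        then show "u y = w y" by simp
      qed
    qed
  qed
  obtain Cs where Cs: "\<And>n::nat. compact (Cs n)" "\<And>n. Cs n \<subseteq> U" "\<Union>(range Cs) = U"
    using open_Union_compact_subsets[OF U] by metis
  have "AE y in lborel. \<forall>n. y \<in> Cs n \<longrightarrow> u y = w y" using ae[OF Cs(1,2)] by (subst AE_all_countable) blast
  then have "AE y in lborel. y \<in> U \<longrightarrow> u y = w y"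
    by eventually_elim (use Cs(3) in blast)
  then have 1: "AE y in lebesgue. y \<in> U \<longrightarrow> u y = w y" by (rule AE_completion)
  have "\<exists>L. \<forall>x\<in>K. \<forall>y\<in>K. \<bar>w x - w y\<bar> \<le> L * dist x y powr \<alpha>" if K: "compact K" "K \<subseteq> U" for K
  proof -
    obtain C R0 where C: "0 \<le> C" "0 < R0" "\<And>x r. x \<in> K \<Longrightarrow> 0 < r \<Longrightarrow> r \<le> R0 \<Longrightarrow> \<exists>m. osc_center u \<alpha> C x r m"
      using osc[OF K] by blast
    \<comment> \<open>The path from \<open>w x\<close> through the two centres to \<open>w y\<close>
      costs the bound at radius \<open>2 * r\<close> twice and the bound at radius \<open>r\<close>
      twice; as \<open>\<alpha> \<le> 1\<close>, the former is at most twice the latter, whence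
      6.\<close>
    have near: "\<bar>w x - w y\<bar> \<le> 6 * C * dist x y powr \<alpha>" if xy: "x \<in> K" "y \<in> K" "dist x y \<le> R0 / 2" for x y
    proof (cases "x = y")
      case False
      define r where "r = dist x y"
      have r: "0 < r" "2 * r \<le> R0" using False xy by (auto simp: r_def)
      obtain m1 m2 where m: "osc_center u \<alpha> C x (2 * r) m1" "osc_center u \<alpha> C y r m2"
        using C(3)[OF xy(1), of "2 * r"] C(3)[OF xy(2), of r] r by auto
      have sub: "ball y r \<subseteq> ball x (2 * r)"
      proof
        fix z assume "z \<in> ball y r"
        then show "z \<in> ball x (2 * r)" using dist_triangle[of x z y] by (simp add: r_def)
      qed
      have "\<bar>m1 - w x\<bar> \<le> C * (2 * r) powr \<alpha>" "\<bar>m2 - w y\<bar> \<le> C * r powr \<alpha>"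
        using w[OF _ m(1)] w[OF _ m(2)] xy K r by auto
      moreover have "\<bar>m1 - m2\<bar> \<le> C * (2 * r) powr \<alpha> + C * r powr \<alpha>"
        by (rule osc_center_overlap[OF m sub r(1)])
      moreover have "C * (2 * r) powr \<alpha> \<le> 2 * (C * r powr \<alpha>)"
      proof -
        have "2 powr \<alpha> \<le> (2 powr 1 :: real)" using \<alpha> by (intro powr_mono) auto
        then have "2 powr \<alpha> * (C * r powr \<alpha>) \<le> 2 * (C * r powr \<alpha>)" using C by (intro mult_right_mono) auto
        then show ?thesis by (simp add: powr_mult mult_ac)
      qed
      ultimately show ?thesis unfolding r_def[symmetric] by linarith
    qed simp
    obtain X where X: "finite X" "X \<subseteq> K" "K \<subseteq> (\<Union>x\<in>X. ball x (R0 / 2))"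
      using compactE_image[OF K(1), of K "\<lambda>x. ball x (R0 / 2)"] C(2) by (metis UN_I centre_in_ball half_gt_zero open_ball subsetI)
    define D where "D = (\<Sum>x\<in>X. \<bar>w x\<bar>) + 6 * C * (R0 / 2) powr \<alpha>"
    have D: "\<bar>w y\<bar> \<le> D" if yK: "y \<in> K" for y
    proof -
      obtain x where x: "x \<in> X" "dist x y \<le> R0 / 2" using X(3) yK by force
      have "\<bar>w x\<bar> \<le> (\<Sum>x\<in>X. \<bar>w x\<bar>)" using X(1) x by (intro member_le_sum) auto
      moreover have "\<bar>w x - w y\<bar> \<le> 6 * C * dist x y powr \<alpha>" using near x X(2) yK by auto
      moreover have "6 * C * dist x y powr \<alpha> \<le> 6 * C * (R0 / 2) powr \<alpha>" using x C \<alpha> by (intro mult_left_mono powr_mono2) auto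
      ultimately show ?thesis unfolding D_def by linarith
    qed
    \<comment> \<open>The second term serves pairs farther apart than \<open>R0 / 2\<close>, for
      which the bound \<open>D\<close> on \<open>w\<close> is used.\<close>
    define L where "L = 6 * C + 2 * \<bar>D\<bar> / (R0 / 2) powr \<alpha>"
    have "\<bar>w x - w y\<bar> \<le> L * dist x y powr \<alpha>" if xy: "x \<in> K" "y \<in> K" for x y
    proof (cases "dist x y \<le> R0 / 2")
      case True
      have "6 * C * dist x y powr \<alpha> \<le> L * dist x y powr \<alpha>" unfolding L_def by (intro mult_right_mono) auto
      then show ?thesis using near[OF xy True] by linarith
    next
      case False
      have pos: "0 < (R0 / 2) powr \<alpha>" using C by simp
      have "(R0 / 2) powr \<alpha> \<le> dist x y powr \<alpha>" using False C \<alpha> by (intro powr_mono2) auto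
      then have "2 * \<bar>D\<bar> / (R0 / 2) powr \<alpha> * (R0 / 2) powr \<alpha> \<le> 2 * \<bar>D\<bar> / (R0 / 2) powr \<alpha> * dist x y powr \<alpha>"
        using pos by (intro mult_left_mono) auto
      moreover have "2 * \<bar>D\<bar> / (R0 / 2) powr \<alpha> * (R0 / 2) powr \<alpha> = 2 * \<bar>D\<bar>" using pos by simp
      moreover have "0 \<le> 6 * C * dist x y powr \<alpha>" using C by simp
      moreover have "\<bar>w x - w y\<bar> \<le> 2 * \<bar>D\<bar>" using D[OF xy(1)] D[OF xy(2)] by linarith
      ultimately show ?thesis unfolding L_def distrib_right by linarith
    qed
    then show ?thesis by blast
  qed
  then show ?thesis using 1 \<alpha> unfolding locally_holder_def by blast
qed

subsection \<open>From weak solutions to Borel representatives\<close>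

text \<open>The local spaces provide measurability on compact subsets. The open set is exhausted by
  them, and the cut-off functions converge pointwise because at each point they are eventually
  constant.\<close>

lemma lebesgue_measurable_exhaustion:
  fixes g :: "'a::euclidean_space \<Rightarrow> real"
  assumes U: "open U" and m: "\<And>K. compact K \<Longrightarrow> K \<subseteq> U \<Longrightarrow> set_borel_measurable lebesgue K g"
  shows "(\<lambda>x. indicator U x * g x) \<in> borel_measurable lebesgue"
proof -
  obtain C where C: "\<And>n. compact (C n)" "\<And>n. C n \<subseteq> U" "\<And>n. C n \<subseteq> interior (C (Suc n))" "\<Union> (range C) = U"
    using open_Union_compact_subsets[OF U] by metis
  have mono: "C n \<subseteq> C (n + k)" for n k
  proof (induction k)
    case (Suc k)
    then show ?case using C(3)[of "n + k"] interior_subset[of "C (Suc (n + k))"] by auto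
  qed simp
  show ?thesis
  proof (rule borel_measurable_LIMSEQ_real)
    show "(\<lambda>x. indicator (C n) x * g x) \<in> borel_measurable lebesgue" for n
      using m[OF C(1,2)[of n]] by (simp add: set_borel_measurable_def)
    show "(\<lambda>n. indicator (C n) x * g x) \<longlonglongrightarrow> indicator U x * g x" for x
    proof (cases "x \<in> U")
      case True
      then obtain n where n: "x \<in> C n" using C(4) by auto
      have "eventually (\<lambda>j. indicator (C j) x * g x = indicator U x * g x) sequentially"
        unfolding eventually_sequentially
      proof (intro exI[of _ n] allI impI)
        fix j assume "n \<le> j"
        then have "x \<in> C j" using mono[of n "j - n"] n by auto
        then show "indicator (C j) x * g x = indicator U x * g x" using True by simp
      qed
      then show ?thesis by (rule tendsto_eventually)
    next
      case False
      then have "x \<notin> C n" for n using C(2) by auto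
      then show ?thesis using False by simp
    qed
  qed
qed

lemma AE_lborel_pair:
  fixes P :: "'a::euclidean_space \<Rightarrow> bool"
  assumes "AE x in lborel. P x"
  shows "AE z in lborel \<Otimes>\<^sub>M (lborel :: 'a measure). P (fst z) \<and> P (snd z)"
proof -
  obtain N where N: "N \<in> null_sets lborel" "{x. \<not> P x} \<subseteq> N"
    using assms by (auto simp: eventually_ae_filter)
  have Nb: "N \<in> sets lborel" "emeasure lborel N = 0" using N(1) by auto
  have "N \<times> UNIV \<in> null_sets (lborel \<Otimes>\<^sub>M (lborel :: 'a measure))" "UNIV \<times> N \<in> null_sets (lborel \<Otimes>\<^sub>M (lborel :: 'a measure))"
    using Nb by (auto intro!: null_setsI simp: lborel.emeasure_pair_measure_Times)
  then have "AE z in lborel \<Otimes>\<^sub>M (lborel :: 'a measure). z \<notin> N \<times> UNIV" "AE z in lborel \<Otimes>\<^sub>M (lborel :: 'a measure). z \<notin> UNIV \<times> N"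
    by (auto intro: AE_not_in)
  then show ?thesis by eventually_elim (use N(2) in auto)
qed

lemma borel_measurable_completion_AE:
  fixes f g :: "'a \<Rightarrow> real"
  assumes g: "g \<in> borel_measurable M" and eq: "AE x in M. f x = g x"
  shows "f \<in> borel_measurable (completion M)"
proof (rule measurableI)
  fix A :: "real set" assume A: "A \<in> sets borel"
  have 1: "Measurable.pred (completion M) (\<lambda>x. f x \<noteq> g x \<and> f x \<in> A)"
    "Measurable.pred (completion M) (\<lambda>x. f x \<noteq> g x)"
    using eq by (auto intro!: sets_completion_AE elim: eventually_mono)
  have 2: "Measurable.pred (completion M) (\<lambda>x. g x \<in> A)"
    using measurable_completion[OF g] A by measurable
  have "Measurable.pred (completion M) (\<lambda>x. (f x \<noteq> g x \<and> f x \<in> A) \<or> (\<not> f x \<noteq> g x \<and> g x \<in> A))"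
    using 1 2 by measurable
  also have "(\<lambda>x. (f x \<noteq> g x \<and> f x \<in> A) \<or> (\<not> f x \<noteq> g x \<and> g x \<in> A)) = (\<lambda>x. f x \<in> A)" by auto
  finally show "f -` A \<inter> space (completion M) \<in> sets (completion M)"
    by (simp add: pred_def vimage_def Int_def conj_commute)
qed simp

context log_kernel
begin

text \<open>Lebesgue measure on a product is not the product of the completed measures, so Fubini is
  applied only to Borel representatives. The representative of \<open>f\<close> is 0 almost
  everywhere off \<open>U\<close>, which turns the integral over \<open>U\<close> into one over the
  whole space.\<close>

lemma borel_sol_if_weak_solution:
  fixes u f :: "'a \<Rightarrow> real"
  assumes Cn: "Cn DIM('a) s p = c" "log_const DIM('a) s p = B"
    and U: "open U" and f: "Lp_loc q U f" and u: "weak_solution Cn s p U f u"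
  obtains u' f' where "borel_sol U u' f'" "AE x in lborel. u x = u' x" "AE x in lborel. x \<in> U \<longrightarrow> f x = f' x"
proof -
  have ker: "kernel Cn DIM('a) s p r = ker 1 r" for r
    by (simp add: kernel_def ker_def lg_1 Cn dsp_def)
  have kp: "kernel_plus Cn DIM('a) s p r = c * kplus 1 r" for r
    by (simp add: kernel_plus_def kplus_def Cn dsp_def)
  have Wl: "u \<in> W_log_loc Cn s p U" and Ll: "u \<in> L_log s p"
    and weak: "\<And>K v. compact K \<Longrightarrow> K \<subseteq> U \<Longrightarrow> v \<in> W0_log Cn s p K \<Longrightarrow> (AE x in lebesgue. 0 \<le> v x) \<Longrightarrow>
      (\<integral>(x, y). kernel Cn DIM('a) s p (dist x y) * \<bar>u x - u y\<bar> powr (p - 2) * (u x - u y) * (v x - v y) \<partial>lebesgue)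
        = (LINT x:U|lebesgue. f x * v x)"
    using u unfolding weak_solution_def by auto
  have "(\<lambda>x. indicator UNIV x * u x) \<in> borel_measurable lebesgue"
    using Ll by (intro lebesgue_measurable_exhaustion) (auto simp: L_log_def Lp_loc_def Lp_on_def)
  then have um: "u \<in> borel_measurable lebesgue" by simp
  have fm: "(\<lambda>x. indicator U x * f x) \<in> borel_measurable lebesgue"
    using f U by (intro lebesgue_measurable_exhaustion) (auto simp: Lp_loc_def Lp_on_def)
  obtain u' where u'm: "u' \<in> borel_measurable lborel" and uu: "AE x in lborel. u x = u' x"
    using completion_ex_borel_measurable_real[OF um] by blast
  obtain f' where f'm: "f' \<in> borel_measurable lborel" and ff: "AE x in lborel. indicator U x * f x = f' x"
    using completion_ex_borel_measurable_real[OF fm] by blast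
  have [measurable]: "u' \<in> borel_measurable borel" "f' \<in> borel_measurable borel" using u'm f'm by auto
  have UU: "AE z in lborel \<Otimes>\<^sub>M (lborel :: 'a measure). u (fst z) = u' (fst z) \<and> u (snd z) = u' (snd z)"
    by (rule AE_lborel_pair[OF uu])
  have Kb: "K \<in> sets borel" if "compact K" for K :: "'a set" using that by (rule borel_compact)
  have bs: "borel_sol U u' f'"
    unfolding borel_sol_def
  proof (intro conjI allI impI; (elim conjE)?)
    show "u' \<in> borel_measurable borel" "f' \<in> borel_measurable borel" by measurable
    fix K assume K: "compact K" "K \<subseteq> U"
    have [measurable]: "K \<in> sets borel" by (rule Kb[OF K(1)])
    have L: "Lp_on p K u" "log_seminorm_finite_on Cn s p K u" using Wl K by (auto simp: W_log_loc_def)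
    have "(\<integral>\<^sup>+x\<in>K. ennreal (\<bar>u' x\<bar> powr p) \<partial>lborel) = (\<integral>\<^sup>+x\<in>K. ennreal (\<bar>u x\<bar> powr p) \<partial>lebesgue)"
      unfolding nn_integral_completion using uu by (intro nn_integral_cong_AE) (auto elim: eventually_mono)
    then show "(\<integral>\<^sup>+x\<in>K. ennreal (\<bar>u' x\<bar> powr p) \<partial>lborel) < \<infinity>" using L(1) by (simp add: Lp_on_def)
    define G where "G x y = indicator K x * indicator K y * (kplus 1 (dist x y) * \<bar>u' x - u' y\<bar> powr p)" for x y
    have G0: "0 \<le> G x y" for x y by (simp add: G_def kplus_nonneg)
    have Gm [measurable]: "(\<lambda>z. G (fst z) (snd z)) \<in> borel_measurable (borel \<Otimes>\<^sub>M borel)"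
      unfolding G_def by measurable
    have GU: "AE z in lborel \<Otimes>\<^sub>M lborel. ennreal c * ennreal (G (fst z) (snd z))
        = ennreal (case z of (x, y) \<Rightarrow> kernel_plus Cn DIM('a) s p (dist x y) * \<bar>u x - u y\<bar> powr p) * indicator (K \<times> K) z"
      using UU
    proof eventually_elim
      case (elim z)
      obtain x y where z: "z = (x, y)" by (cases z)
      have "ennreal c * ennreal (G x y) = ennreal (c * G x y)"
        using c G0 by (simp add: ennreal_mult)
      then show ?case using elim unfolding z
        by (cases "x \<in> K"; cases "y \<in> K") (simp_all add: kp mult.assoc G_def)
    qed
    have "ennreal c * (\<integral>\<^sup>+x. (\<integral>\<^sup>+y. ennreal (G x y) \<partial>lborel) \<partial>lborel)
        = ennreal c * (\<integral>\<^sup>+z. ennreal (G (fst z) (snd z)) \<partial>(lborel \<Otimes>\<^sub>M lborel))"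
      by (subst nn_integral_pair[OF Gm]) simp
    also have "\<dots> = (\<integral>\<^sup>+z. ennreal c * ennreal (G (fst z) (snd z)) \<partial>(lborel \<Otimes>\<^sub>M lborel))"
      by (rule nn_integral_cmult[symmetric]) measurable
    also have "\<dots> = (\<integral>\<^sup>+z\<in>K \<times> K. ennreal (case z of (x, y) \<Rightarrow> kernel_plus Cn DIM('a) s p (dist x y) * \<bar>u x - u y\<bar> powr p) \<partial>lebesgue)"
      unfolding nn_integral_completion lborel_prod[symmetric] by (rule nn_integral_cong_AE[OF GU])
    also have "\<dots> < \<infinity>" using L(2) by (simp add: log_seminorm_finite_on_def)
    finally show "(\<integral>\<^sup>+x. (\<integral>\<^sup>+y. ennreal (indicator K x * indicator K y * (kplus 1 (dist x y) * \<bar>u' x - u' y\<bar> powr p)) \<partial>lborel) \<partial>lborel) < \<infinity>"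
      using c by (auto simp: ennreal_mult_less_top G_def)
  next
    have "(\<integral>\<^sup>+y. ennreal ((1 + ln (1 + norm y)) / (1 + norm y) powr dsp * \<bar>u' y\<bar> powr (p - 1)) \<partial>lborel)
      = (\<integral>\<^sup>+y. ennreal ((1 + ln (1 + norm y)) / (1 + norm y) powr dsp * \<bar>u y\<bar> powr (p - 1)) \<partial>lebesgue)"
      unfolding nn_integral_completion using uu by (intro nn_integral_cong_AE) (auto elim: eventually_mono)
    then show "(\<integral>\<^sup>+y. ennreal ((1 + ln (1 + norm y)) / (1 + norm y) powr dsp * \<bar>u' y\<bar> powr (p - 1)) \<partial>lborel) < \<infinity>"
      using Ll by (simp add: L_log_def dsp_def)
  next
    fix K and v :: "'a \<Rightarrow> real"
    assume K: "compact K" "K \<subseteq> U" and [measurable]: "v \<in> borel_measurable borel"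
      and v: "\<forall>x. 0 \<le> v x" "\<forall>x. x \<notin> K \<longrightarrow> v x = 0" "(\<integral>\<^sup>+x. ennreal (v x powr p) \<partial>lborel) < \<infinity>"
        "(\<integral>\<^sup>+x. (\<integral>\<^sup>+y. ennreal (kplus 1 (dist x y) * \<bar>v x - v y\<bar> powr p) \<partial>lborel) \<partial>lborel) < \<infinity>"
    have vW: "v \<in> W0_log Cn s p K"
    proof -
      have "set_borel_measurable lebesgue UNIV v"
        unfolding set_borel_measurable_def by (simp add: measurable_completion)
      then have 1: "Lp_on p UNIV v"
        using v(1,3) by (simp add: Lp_on_def nn_integral_completion)
      define G where "G x y = kplus 1 (dist x y) * \<bar>v x - v y\<bar> powr p" for x y
      have G0: "0 \<le> G x y" for x y by (simp add: G_def kplus_nonneg)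
      have Gm [measurable]: "(\<lambda>z. G (fst z) (snd z)) \<in> borel_measurable (borel \<Otimes>\<^sub>M borel)"
        unfolding G_def by measurable
      have "(\<integral>\<^sup>+z\<in>UNIV \<times> UNIV. ennreal (case z of (x, y) \<Rightarrow> kernel_plus Cn DIM('a) s p (dist x y) * \<bar>v x - v y\<bar> powr p) \<partial>lebesgue)
        = (\<integral>\<^sup>+z. ennreal c * ennreal (G (fst z) (snd z)) \<partial>(lborel \<Otimes>\<^sub>M lborel))"
        unfolding nn_integral_completion lborel_prod[symmetric]
      proof (rule nn_integral_cong)
        fix z :: "'a \<times> 'a"
        have "ennreal c * ennreal (G (fst z) (snd z)) = ennreal (c * G (fst z) (snd z))"
          using c G0 by (simp add: ennreal_mult)
        then show "ennreal (case z of (x, y) \<Rightarrow> kernel_plus Cn DIM('a) s p (dist x y) * \<bar>v x - v y\<bar> powr p) * indicator (UNIV \<times> UNIV) z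
          = ennreal c * ennreal (G (fst z) (snd z))"
          by (simp add: kp mult.assoc case_prod_beta G_def)
      qed
      also have "\<dots> = ennreal c * (\<integral>\<^sup>+z. ennreal (G (fst z) (snd z)) \<partial>(lborel \<Otimes>\<^sub>M lborel))"
        by (rule nn_integral_cmult) measurable
      also have "\<dots> = ennreal c * (\<integral>\<^sup>+x. (\<integral>\<^sup>+y. ennreal (G x y) \<partial>lborel) \<partial>lborel)"
        by (subst nn_integral_pair[OF Gm]) simp
      also have "\<dots> < \<infinity>" using v(4) by (simp add: ennreal_mult_less_top G_def)
      finally have 2: "log_seminorm_finite_on Cn s p UNIV v" by (simp add: log_seminorm_finite_on_def)
      show ?thesis using 1 2 v(2) by (simp add: W0_log_def W_log_def)
    qed
    have eq: "(\<integral>(x, y). kernel Cn DIM('a) s p (dist x y) * \<bar>u x - u y\<bar> powr (p - 2) * (u x - u y) * (v x - v y) \<partial>lebesgue)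
        = (LINT x:U|lebesgue. f x * v x)"
      using weak[OF K vW] v(1) by simp
    define G where "G z = ker 1 (dist (fst z) (snd z)) * signed_powr p (u' (fst z) - u' (snd z)) * (v (fst z) - v (snd z))" for z
    have "G \<in> borel_measurable (borel \<Otimes>\<^sub>M borel)" unfolding G_def by measurable
    then have Gm: "G \<in> borel_measurable lborel" by (simp add: borel_prod)
    have GA: "AE z in lborel. (case z of (x, y) \<Rightarrow> kernel Cn DIM('a) s p (dist x y) * \<bar>u x - u y\<bar> powr (p - 2) * (u x - u y) * (v x - v y)) = G z"
      using UU unfolding lborel_prod
      by eventually_elim (auto simp: G_def ker signed_powr_def mult.assoc)
    have "(\<integral>z. G z \<partial>(lborel \<Otimes>\<^sub>M lborel)) = (\<integral>z. G z \<partial>lebesgue)"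
      unfolding lborel_prod using Gm by (rule integral_completion[symmetric])
    also have "\<dots> = (\<integral>(x, y). kernel Cn DIM('a) s p (dist x y) * \<bar>u x - u y\<bar> powr (p - 2) * (u x - u y) * (v x - v y) \<partial>lebesgue)"
    proof (rule integral_cong_AE)
      show "G \<in> borel_measurable lebesgue" using Gm by (rule measurable_completion)
      \<comment> \<open>As \<open>u\<close> is merely Lebesgue measurable, the integrand is
        recognised as measurable through its almost everywhere equality with the Borel function
        \<open>G\<close>.\<close>
      show "(\<lambda>(x, y). kernel Cn DIM('a) s p (dist x y) * \<bar>u x - u y\<bar> powr (p - 2) * (u x - u y) * (v x - v y)) \<in> borel_measurable lebesgue"
        by (rule borel_measurable_completion_AE[OF Gm GA])
      show "AE z in lebesgue. G z = (case z of (x, y) \<Rightarrow> kernel Cn DIM('a) s p (dist x y) * \<bar>u x - u y\<bar> powr (p - 2) * (u x - u y) * (v x - v y))"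
        using AE_completion[OF GA] by eventually_elim simp
    qed
    also have "\<dots> = (LINT x:U|lebesgue. f x * v x)" by (rule eq)
    also have "\<dots> = (\<integral>x. f' x * v x \<partial>lebesgue)"
      unfolding set_lebesgue_integral_def
    proof (rule integral_cong_AE)
      have vm: "v \<in> borel_measurable lebesgue" "f' \<in> borel_measurable lebesgue" by (auto intro: measurable_completion)
      show "(\<lambda>x. indicator U x *\<^sub>R (f x * v x)) \<in> borel_measurable lebesgue"
        using borel_measurable_times[OF fm vm(1)] by (simp add: mult.assoc)
      show "(\<lambda>x. f' x * v x) \<in> borel_measurable lebesgue" using vm by (intro borel_measurable_times)
      show "AE x in lebesgue. indicator U x *\<^sub>R (f x * v x) = f' x * v x"
        using AE_completion[OF ff] by eventually_elim (metis mult.assoc real_scaleR_def)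
    qed
    also have "\<dots> = (\<integral>x. f' x * v x \<partial>lborel)" by (rule integral_completion) simp
    finally show "(\<integral>z. ker 1 (dist (fst z) (snd z)) * signed_powr p (u' (fst z) - u' (snd z)) * (v (fst z) - v (snd z))
           \<partial>(lborel \<Otimes>\<^sub>M lborel)) = (\<integral>x. f' x * v x \<partial>lborel)" by (simp add: G_def)
  qed
  have "AE x in lborel. x \<in> U \<longrightarrow> f x = f' x" using ff by eventually_elim auto
  then show ?thesis using that bs uu by blast
qed

end

subsection \<open>The estimate in terms of mean, tail and right-hand side\<close>

text \<open>With \<open>N = d * p - d + s * p\<close> the denominator of \<sigma> is
  \<open>N * q - d * p\<close>, positive by \<open>1 < q\<close> and \<open>d < s * p * q\<close>.
  After cross-multiplication the second claim becomes \<open>N * d < N * (s * p * q)\<close>, again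
  the hypothesis on \<open>q\<close>.\<close>

lemma sigma_exp_bounds:
  fixes s p q :: real
  assumes d: "0 < d" and p: "1 < p" and s: "0 < s" and sp: "s * p < real d" and q: "real d / (s * p) < q"
  shows "1 < sigma_exp d s p q" "p * sigma_exp d s p q < real d * p / (real d - s * p)"
proof -
  define N where "N = real d * p - real d + s * p"
  have sp0: "0 < s * p" using s p by simp
  have dq: "real d < s * p * q" using q sp0 by (simp add: field_simps)
  have d0: "0 < real d" using d by simp
  have q1: "1 < q"
  proof -
    have "1 < real d / (s * p)" using sp sp0 by simp
    then show ?thesis using q by linarith
  qed
  have N0: "0 < N"
  proof -
    have "real d < real d * p" using d0 p by simp
    then show ?thesis using sp0 unfolding N_def by linarith
  qed
  have "N * q - real d * p = real d * (p - 1) * (q - 1) + (s * p * q - real d)" by (simp add: N_def algebra_simps)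
  moreover have "0 < real d * (p - 1) * (q - 1)" using d0 p q1 by (intro mult_pos_pos) auto
  ultimately have D: "0 < N * q - real d * p" using dq by linarith
  have \<sigma>: "sigma_exp d s p q = (N * q - real d) / (N * q - real d * p)" by (simp add: sigma_exp_def N_def)
  show "1 < sigma_exp d s p q" using D d0 p unfolding \<sigma> by (simp add: less_divide_eq)
  have "N * real d < N * (s * p * q)" using N0 dq by simp
  then have "(N * q - real d) * (real d - s * p) < real d * (N * q - real d * p)"
    by (simp add: N_def algebra_simps)
  then have "sigma_exp d s p q < real d / (real d - s * p)"
    using D sp unfolding \<sigma> by (simp add: divide_less_eq less_divide_eq mult_ac)
  then have "p * sigma_exp d s p q < p * (real d / (real d - s * p))"
    using p by (intro mult_strict_left_mono) auto
  also have "p * (real d / (real d - s * p)) = real d * p / (real d - s * p)" by simp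
  finally show "p * sigma_exp d s p q < real d * p / (real d - s * p)" .
qed

lemma ennreal_powr_leD:
  assumes "ennreal_powr X (1 / b) \<le> ennreal t" "0 < b" "0 \<le> t"
  shows "X \<le> ennreal (t powr b)"
proof (cases X)
  case (real x)
  then have "ennreal (x powr (1 / b)) \<le> ennreal t" using assms(1) by (simp add: ennreal_powr_def)
  then have "x powr (1 / b) \<le> t" using assms(3) by simp
  then have "(x powr (1 / b)) powr b \<le> t powr b" using assms(2) by (intro powr_mono2) auto
  then show ?thesis using real assms(2) by (simp add: powr_powr ennreal_leI)
next
  case top
  then show ?thesis using assms(1) by (simp add: ennreal_powr_def top_unique)
qed

lemma ennreal_mult_leD:
  assumes "ennreal k * X \<le> ennreal a" "0 < k" "0 \<le> a"
  shows "X \<le> ennreal (a / k)"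
proof (cases X)
  case (real x)
  then have "ennreal (k * x) \<le> ennreal a" using assms by (simp add: ennreal_mult)
  then have "k * x \<le> a" using assms(3) by simp
  then show ?thesis using real assms(2) by (auto intro!: ennreal_leI simp: field_simps)
next
  case top
  then show ?thesis using assms by (simp add: ennreal_mult_top top_unique)
qed

lemma ess_osc_le:
  fixes u :: "'a::euclidean_space \<Rightarrow> real"
  assumes u: "u \<in> borel_measurable lebesgue" and A: "A \<in> sets lebesgue"
    and bd: "AE x in lebesgue. x \<in> A \<longrightarrow> \<bar>u x - m\<bar> \<le> D"
  shows "ess_osc A u \<le> ereal (2 * D)"
proof -
  have AEA: "AE x in restrict_space lebesgue A. \<bar>u x - m\<bar> \<le> D"
    using A bd by (subst AE_restrict_space_iff) auto
  have um: "(\<lambda>x. ereal (u x)) \<in> borel_measurable (restrict_space lebesgue A)"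
    "(\<lambda>x. - ereal (u x)) \<in> borel_measurable (restrict_space lebesgue A)"
    using measurable_restrict_space1[OF u, of A] by auto
  have "esssup (restrict_space lebesgue A) (\<lambda>x. ereal (u x)) \<le> ereal (m + D)"
    using AEA by (intro esssup_I um) (auto elim: eventually_mono)
  moreover have "esssup (restrict_space lebesgue A) (\<lambda>x. - ereal (u x)) \<le> ereal (D - m)"
    using AEA by (intro esssup_I um) (auto elim: eventually_mono)
  ultimately have "esssup (restrict_space lebesgue A) (\<lambda>x. ereal (u x)) + esssup (restrict_space lebesgue A) (\<lambda>x. - ereal (u x))
     \<le> ereal (m + D) + ereal (D - m)" by (rule add_mono)
  then show ?thesis by (simp add: ess_osc_def minus_ereal_def)
qed

context log_kernel
begin

text \<open>The positive and the negative part of the logarithm add up to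
  \<open>\<bar>ln r\<bar>\<close>, so the weight in \<open>Tail_mod\<close> is
  \<open>(1 + p * c * \<bar>ln r\<bar>) / r powr dsp\<close>.\<close>

lemma kernel_mod_ge_hmaj:
  assumes Cn: "Cn DIM('a) s p = c" and r: "0 \<le> r"
  shows "min 1 (p * c) * hmaj r \<le> 1 / r powr dsp + kernel_mod Cn DIM('a) s p r"
proof -
  have "kernel_mod Cn DIM('a) s p r = p * c * \<bar>ln r\<bar> / r powr dsp"
    by (simp add: kernel_mod_def kernel_plus_def kernel_minus_def Cn dsp_def max_def)
  moreover have "min 1 (p * c) * (1 + \<bar>ln r\<bar>) \<le> 1 + p * c * \<bar>ln r\<bar>"
  proof -
    have "min 1 (p * c) * \<bar>ln r\<bar> \<le> p * c * \<bar>ln r\<bar>" by (intro mult_right_mono) auto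
    then show ?thesis unfolding distrib_left by simp
  qed
  then have "min 1 (p * c) * (1 + \<bar>ln r\<bar>) / r powr dsp \<le> (1 + p * c * \<bar>ln r\<bar>) / r powr dsp"
    by (intro divide_right_mono) auto
  ultimately show ?thesis by (simp only: hmaj_def times_divide_eq_right add_divide_distrib[symmetric])
qed

text \<open>One entry for each datum: 1 for the right-hand side, \<open>2 * vol\<close> for the
  mean, and the last for the tail, so that \<open>K0\<close> times the bracket of the estimate is an
  admissible \<open>M\<close> in \<open>holder_estimate\<close>.\<close>

definition K0 :: real where
  "K0 = max 1 (max ((2 * vol) powr (1 / p)) ((2 powr (s * p) / min 1 (p * c)) powr (1 / (p - 1))))"

lemma K0: "1 \<le> K0" "2 * vol \<le> K0 powr p" "2 powr (s * p) / min 1 (p * c) \<le> K0 powr (p - 1)"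
proof -
  show "1 \<le> K0" by (simp add: K0_def)
  have "((2 * vol) powr (1 / p)) powr p \<le> K0 powr p" using p by (intro powr_mono2) (auto simp: K0_def)
  then show "2 * vol \<le> K0 powr p" using p vol_pos by (simp add: powr_powr)
  have "((2 powr (s * p) / min 1 (p * c)) powr (1 / (p - 1))) powr (p - 1) \<le> K0 powr (p - 1)"
    using p by (intro powr_mono2) (auto simp: K0_def)
  moreover have "0 < p * c" using p c by simp
  ultimately show "2 powr (s * p) / min 1 (p * c) \<le> K0 powr (p - 1)" using p by (simp add: powr_powr)
qed

text \<open>No Hoelder inequality is needed: \<open>t\<^sup>p \<le> A\<^sup>p + A powr (p - p \<sigma>) * t powr (p \<sigma>)\<close>.\<close>

lemma Lp_data:
  fixes u :: "'a \<Rightarrow> real"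
  assumes [measurable]: "u \<in> borel_measurable borel" and R: "0 < R" and A: "0 < A" and \<sigma>: "1 < \<sigma>"
    and m: "Lp_mean_on (p * \<sigma>) (ball x0 R) u \<le> ennreal A"
  shows "(\<integral>\<^sup>+x\<in>ball x0 R. ennreal (\<bar>u x\<bar> powr p) \<partial>lborel) \<le> ennreal ((K0 * A) powr p * R powr DIM('a))"
proof -
  let ?X = "\<integral>\<^sup>+x\<in>ball x0 R. ennreal (\<bar>u x\<bar> powr (p * \<sigma>)) \<partial>lborel"
  let ?V = "vol * R powr DIM('a)"
  have V: "0 < ?V" using vol_pos R by simp
  have em: "emeasure lborel (ball x0 R) = ennreal ?V"
    using R by (simp add: emeasure_lborel_ball vol_def powr_realpow)
  have ps: "0 < p * \<sigma>" "p \<le> p * \<sigma>" using p \<sigma> by auto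
  have "?X / ennreal ?V \<le> ennreal (A powr (p * \<sigma>))"
    using m ps A em unfolding Lp_mean_on_def nn_integral_completion by (intro ennreal_powr_leD) auto
  then have "?X / ennreal ?V * ennreal ?V \<le> ennreal (A powr (p * \<sigma>)) * ennreal ?V" by (rule mult_right_mono) simp
  moreover have "?X / ennreal ?V * ennreal ?V = ?X"
  proof -
    have "ennreal ?V / ennreal ?V = 1" using V by (intro ennreal_divide_self) (auto simp: ennreal_eq_0_iff)
    then show ?thesis by (simp only: ennreal_divide_times ennreal_times_divide[symmetric] mult_1_right)
  qed
  ultimately have X: "?X \<le> ennreal (A powr (p * \<sigma>) * ?V)" using V by (simp add: ennreal_mult)
  have pt: "t powr p \<le> A powr p + A powr (p - p * \<sigma>) * t powr (p * \<sigma>)" if t: "0 \<le> t" for t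
  proof (cases "t \<le> A")
    case True
    then have "t powr p \<le> A powr p" using p t by (intro powr_mono2) auto
    then show ?thesis by (simp add: add_increasing2)
  next
    case False
    have "t powr p = t powr (p - p * \<sigma>) * t powr (p * \<sigma>)" using False A by (simp add: powr_add[symmetric])
    also have "\<dots> \<le> A powr (p - p * \<sigma>) * t powr (p * \<sigma>)"
      using False A ps by (intro mult_right_mono powr_mono2') auto
    finally show ?thesis by (simp add: add_increasing)
  qed
  have "(\<integral>\<^sup>+x\<in>ball x0 R. ennreal (\<bar>u x\<bar> powr p) \<partial>lborel)
     \<le> (\<integral>\<^sup>+x. ennreal (A powr p) * indicator (ball x0 R) x + ennreal (A powr (p - p * \<sigma>)) * (ennreal (\<bar>u x\<bar> powr (p * \<sigma>)) * indicator (ball x0 R) x) \<partial>lborel)"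
  proof (rule nn_integral_mono)
    fix x
    have "ennreal (\<bar>u x\<bar> powr p) \<le> ennreal (A powr p) + ennreal (A powr (p - p * \<sigma>)) * ennreal (\<bar>u x\<bar> powr (p * \<sigma>))"
      using pt[of "\<bar>u x\<bar>"] by (simp add: ennreal_mult[symmetric] ennreal_plus[symmetric] ennreal_leI del: ennreal_plus)
    then show "ennreal (\<bar>u x\<bar> powr p) * indicator (ball x0 R) x
      \<le> ennreal (A powr p) * indicator (ball x0 R) x + ennreal (A powr (p - p * \<sigma>)) * (ennreal (\<bar>u x\<bar> powr (p * \<sigma>)) * indicator (ball x0 R) x)"
      by (cases "x \<in> ball x0 R") simp_all
  qed
  also have "\<dots> = ennreal (A powr p) * ennreal ?V + ennreal (A powr (p - p * \<sigma>)) * ?X"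
    by (simp add: nn_integral_add nn_integral_cmult em)
  also have "\<dots> \<le> ennreal (A powr p) * ennreal ?V + ennreal (A powr (p - p * \<sigma>)) * ennreal (A powr (p * \<sigma>) * ?V)"
    by (intro add_left_mono mult_left_mono X) simp
  also have "\<dots> = ennreal (A powr p * ?V + A powr (p - p * \<sigma>) * (A powr (p * \<sigma>) * ?V))"
    using V by (simp add: ennreal_mult[symmetric] ennreal_plus[symmetric] del: ennreal_plus)
  also have "A powr p * ?V + A powr (p - p * \<sigma>) * (A powr (p * \<sigma>) * ?V) = 2 * vol * A powr p * R powr DIM('a)"
  proof -
    have "A powr (p - p * \<sigma>) * (A powr (p * \<sigma>) * ?V) = A powr p * ?V"
      using A by (simp add: powr_add[symmetric] mult.assoc[symmetric])
    then show ?thesis by simp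
  qed
  also have "ennreal (2 * vol * A powr p * R powr DIM('a)) \<le> ennreal (K0 powr p * A powr p * R powr DIM('a))"
    using K0(2) by (intro ennreal_leI mult_right_mono) auto
  finally show ?thesis by (simp add: powr_mult)
qed

text \<open>The prefactor \<open>lg R powr (- 1 / (p - 1))\<close> turns into one factor
  \<open>lg R\<close> when the power \<open>p - 1\<close> is taken; \<open>2 powr (s * p)\<close>
  compensates the radius \<open>R / 2\<close> in \<open>Tail_mod\<close>.\<close>

lemma tail_data:
  assumes [measurable]: "u \<in> borel_measurable borel" and Cn: "Cn DIM('a) s p = c"
    and R: "0 < R" "R \<le> 1" and A: "0 < A"
    and T: "ennreal ((1 + ln (1 / R)) powr (- 1 / (p - 1))) * Tail_mod Cn s p u x0 (R / 2) \<le> ennreal A"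
  shows "log_tail u x0 (R / 2) \<le> ennreal ((K0 * A) powr (p - 1) * lg R * R powr - (s * p))"
proof -
  let ?k = "min 1 (p * c)"
  have k: "0 < ?k" using p c by simp
  have lg: "1 \<le> lg R" by (rule lg_ge_1[OF R])
  let ?X = "\<integral>\<^sup>+y\<in>- ball x0 (R / 2). ennreal ((1 / dist x0 y powr dsp + kernel_mod Cn DIM('a) s p (dist x0 y)) * \<bar>u y\<bar> powr (p - 1)) \<partial>lborel"
  have "Tail_mod Cn s p u x0 (R / 2) \<le> ennreal (A / lg R powr (- 1 / (p - 1)))"
    using T A lg by (intro ennreal_mult_leD) (auto simp: lg_def)
  then have "ennreal ((R / 2) powr (s * p)) * ?X \<le> ennreal ((A / lg R powr (- 1 / (p - 1))) powr (p - 1))"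
    unfolding Tail_mod_def nn_integral_completion dsp_def[symmetric] using p A lg by (intro ennreal_powr_leD) auto
  also have "(A / lg R powr (- 1 / (p - 1))) powr (p - 1) = A powr (p - 1) * lg R"
    using p lg by (simp add: powr_divide powr_mult powr_powr powr_minus_divide)
  finally have X: "?X \<le> ennreal (A powr (p - 1) * lg R / (R / 2) powr (s * p))"
    using A lg R by (intro ennreal_mult_leD) auto
  have "ennreal ?k * log_tail u x0 (R / 2) = (\<integral>\<^sup>+y. ennreal ?k * (ennreal (hmaj (dist x0 y) * \<bar>u y\<bar> powr (p - 1)) * indicator (- ball x0 (R / 2)) y) \<partial>lborel)"
    unfolding log_tail_def by (rule nn_integral_cmult[symmetric]) measurable
  also have "\<dots> \<le> ?X"
  proof (rule nn_integral_mono)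
    fix y
    have "ennreal ?k * ennreal (hmaj (dist x0 y) * \<bar>u y\<bar> powr (p - 1)) = ennreal (?k * hmaj (dist x0 y) * \<bar>u y\<bar> powr (p - 1))"
      using k hmaj_nonneg[of "dist x0 y"] by (simp add: ennreal_mult[symmetric] mult.assoc)
    also have "\<dots> \<le> ennreal ((1 / dist x0 y powr dsp + kernel_mod Cn DIM('a) s p (dist x0 y)) * \<bar>u y\<bar> powr (p - 1))"
      using kernel_mod_ge_hmaj[of Cn "dist x0 y", OF Cn] by (intro ennreal_leI mult_right_mono) auto
    finally show "ennreal ?k * (ennreal (hmaj (dist x0 y) * \<bar>u y\<bar> powr (p - 1)) * indicator (- ball x0 (R / 2)) y)
      \<le> ennreal ((1 / dist x0 y powr dsp + kernel_mod Cn DIM('a) s p (dist x0 y)) * \<bar>u y\<bar> powr (p - 1)) * indicator (- ball x0 (R / 2)) y"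
      by (cases "y \<in> - ball x0 (R / 2)") simp_all
  qed
  also note X
  finally have "log_tail u x0 (R / 2) \<le> ennreal (A powr (p - 1) * lg R / (R / 2) powr (s * p) / ?k)"
    by (rule ennreal_mult_leD) (use k A lg in auto)
  also have "A powr (p - 1) * lg R / (R / 2) powr (s * p) / ?k = 2 powr (s * p) / ?k * (A powr (p - 1) * lg R * R powr - (s * p))"
    using R by (simp add: powr_divide powr_minus_divide mult_ac)
  also have "ennreal (2 powr (s * p) / ?k * (A powr (p - 1) * lg R * R powr - (s * p)))
     \<le> ennreal (K0 powr (p - 1) * (A powr (p - 1) * lg R * R powr - (s * p)))"
    using lg K0(3) by (intro ennreal_leI mult_right_mono) auto
  finally show ?thesis by (simp add: powr_mult mult_ac)
qed

lemma rhs_data: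
  fixes f :: "'a \<Rightarrow> real"
  assumes [measurable]: "f \<in> borel_measurable borel"
    and R: "0 < R" "R \<le> 1" and A: "0 < A" and \<sigma>: "1 < \<sigma>"
    and F: "ennreal ((1 + ln (1 / R)) powr (- \<sigma> / (p * \<sigma> - 1)) * R powr (\<mu> * (1 / (p - 1))))
       * ennreal_powr (Lp_norm_on q (ball x0 R) f) (1 / (p - 1)) \<le> ennreal A"
  shows "(\<integral>\<^sup>+x\<in>ball x0 R. ennreal (\<bar>f x\<bar> powr q) \<partial>lborel) \<le> ennreal (((K0 * A) powr (p - 1) * lg R * R powr - \<mu>) powr q)"
proof -
  have lg: "1 \<le> lg R" by (rule lg_ge_1[OF R])
  have q0: "0 < q" using q_gt by simp
  have ps: "0 < p * \<sigma> - 1" using p \<sigma> less_1_mult[of p \<sigma>] by simp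
  let ?b = "lg R powr (- \<sigma> / (p * \<sigma> - 1)) * R powr (\<mu> * (1 / (p - 1)))"
  have b: "0 < ?b" using lg R by simp
  have "ennreal_powr (Lp_norm_on q (ball x0 R) f) (1 / (p - 1)) \<le> ennreal (A / ?b)"
    using F A b by (intro ennreal_mult_leD) (auto simp: lg_def)
  then have "Lp_norm_on q (ball x0 R) f \<le> ennreal ((A / ?b) powr (p - 1))"
    using p A b by (intro ennreal_powr_leD) auto
  then have "(\<integral>\<^sup>+x\<in>ball x0 R. ennreal (\<bar>f x\<bar> powr q) \<partial>lborel) \<le> ennreal (((A / ?b) powr (p - 1)) powr q)"
    unfolding Lp_norm_on_def nn_integral_completion by (rule ennreal_powr_leD) (use q0 in auto)
  also have "((A / ?b) powr (p - 1)) powr q \<le> ((K0 * A) powr (p - 1) * lg R * R powr - \<mu>) powr q"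
  proof (intro powr_mono2)
    have "(A / ?b) powr (p - 1) = A powr (p - 1) * (lg R powr (\<sigma> / (p * \<sigma> - 1) * (p - 1)) * R powr - \<mu>)"
    proof -
      have "?b powr (p - 1) = lg R powr - (\<sigma> / (p * \<sigma> - 1) * (p - 1)) * R powr \<mu>"
        using p by (simp add: powr_mult powr_powr)
      then have "(A / ?b) powr (p - 1) = A powr (p - 1) / (lg R powr - (\<sigma> / (p * \<sigma> - 1) * (p - 1)) * R powr \<mu>)"
        by (simp only: powr_divide)
      then show ?thesis by (simp only: powr_minus_divide divide_divide_eq_left divide_divide_eq_right times_divide_eq_right times_divide_eq_left mult_1_right mult_1)
    qed
    also have "\<dots> \<le> A powr (p - 1) * (lg R * R powr - \<mu>)"
    proof -
      \<comment> \<open>Equivalent to \<open>1 \<le> \<sigma>\<close>. So the logarithmic factor in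
        front of \<open>f\<close> in the statement is at least
        \<open>lg R powr (- 1 / (p - 1))\<close>, which is what the iteration asks for.\<close>
      have "\<sigma> / (p * \<sigma> - 1) * (p - 1) \<le> 1" using ps \<sigma> by (simp add: divide_le_eq algebra_simps)
      then have "lg R powr (\<sigma> / (p * \<sigma> - 1) * (p - 1)) \<le> lg R powr 1" using lg by (intro powr_mono) auto
      then show ?thesis using lg by (intro mult_left_mono mult_right_mono) auto
    qed
    also have "\<dots> \<le> (K0 * A) powr (p - 1) * (lg R * R powr - \<mu>)"
    proof -
      have "A \<le> K0 * A" using K0(1) A by simp
      then show ?thesis using A p lg by (intro mult_right_mono powr_mono2) auto
    qed
    finally show "(A / ?b) powr (p - 1) \<le> (K0 * A) powr (p - 1) * lg R * R powr - \<mu>" by (simp add: mult.assoc)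
  qed (use q0 in auto)
  finally show ?thesis by (simp add: ennreal_leI)
qed

text \<open>Each of the three summands is at most the bracket, and this is how the bracket takes the
  role of \<open>M\<close>. The factor 2 passes from the deviation from a centre to the oscillation;
  an infinite bracket makes the claim trivial.\<close>

theorem ess_osc_bound:
  fixes u f u' f' :: "'a \<Rightarrow> real"
  assumes holder: "\<And>M. 0 < M \<Longrightarrow> (\<integral>\<^sup>+x\<in>ball x0 R. ennreal (\<bar>u' x\<bar> powr p) \<partial>lborel) \<le> ennreal (M powr p * R powr DIM('a)) \<Longrightarrow>
      log_tail u' x0 (R / 2) \<le> ennreal (M powr (p - 1) * lg R * R powr - (s * p)) \<Longrightarrow>
      (\<integral>\<^sup>+x\<in>ball x0 R. ennreal (\<bar>f' x\<bar> powr q) \<partial>lborel) \<le> ennreal ((M powr (p - 1) * lg R * R powr - \<mu>) powr q) \<Longrightarrow>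
      \<exists>m. AE x in lborel. x \<in> ball x0 r \<longrightarrow> \<bar>u' x - m\<bar> \<le> K * (r / R) powr \<alpha> * M"
    and meas [measurable]: "u' \<in> borel_measurable borel" "f' \<in> borel_measurable borel"
    and uu: "AE x in lborel. u x = u' x" and ff: "AE x in lborel. x \<in> ball x0 R \<longrightarrow> f x = f' x"
    and Cn: "Cn DIM('a) s p = c" and R: "0 < R" "R \<le> 1" and r: "0 < r" and K: "0 < K" and \<sigma>: "1 < \<sigma>"
  shows "ess_osc (ball x0 r) u \<le> enn2ereal (ennreal (2 * K * K0 * (r / R) powr \<alpha>) *
                (ennreal ((1 + ln (1 / R)) powr (- 1 / (p - 1))) * Tail_mod Cn s p u x0 (R / 2)
                 + Lp_mean_on (p * \<sigma>) (ball x0 R) u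
                 + ennreal ((1 + ln (1 / R)) powr (- \<sigma> / (p * \<sigma> - 1)) * R powr (\<mu> * (1 / (p - 1))))
                   * ennreal_powr (Lp_norm_on q (ball x0 R) f) (1 / (p - 1))))"
    (is "_ \<le> enn2ereal (ennreal ?k * (?T + ?A + ?F))")
proof -
  have k: "0 < ?k" using K K0(1) r R by simp
  have T: "Tail_mod Cn s p u x0 (R / 2) = Tail_mod Cn s p u' x0 (R / 2)"
    unfolding Tail_mod_def nn_integral_completion
    by (intro arg_cong2[where f = ennreal_powr] arg_cong2[where f = times] refl nn_integral_cong_AE)
      (use uu in \<open>auto elim: eventually_mono\<close>)
  have A: "Lp_mean_on (p * \<sigma>) (ball x0 R) u = Lp_mean_on (p * \<sigma>) (ball x0 R) u'"
    unfolding Lp_mean_on_def nn_integral_completion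
    by (intro arg_cong2[where f = ennreal_powr] arg_cong2[where f = divide] refl nn_integral_cong_AE)
      (use uu in \<open>auto elim: eventually_mono\<close>)
  have F: "Lp_norm_on q (ball x0 R) f = Lp_norm_on q (ball x0 R) f'"
    unfolding Lp_norm_on_def nn_integral_completion
    by (intro arg_cong2[where f = ennreal_powr] refl nn_integral_cong_AE, use ff in eventually_elim)
      (auto simp: indicator_def)
  have kk: "k * (Q + e / k) = k * Q + e" "ennreal k * \<infinity> = \<infinity>" if "0 < k" for k Q e :: real
    using that by (simp_all add: distrib_left ennreal_mult_eq_top_iff)
  have um: "u \<in> borel_measurable lebesgue"
    by (rule borel_measurable_completion_AE[OF _ uu]) simp
  have bd: "ess_osc (ball x0 r) u \<le> ereal (?k * M)" if M: "0 < M" "?T + ?A + ?F \<le> ennreal M" for M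
  proof -
    have le: "?T \<le> ennreal M" "?A \<le> ennreal M" "?F \<le> ennreal M"
      using M(2) by (auto intro: order_trans[rotated] simp: add_increasing add_increasing2 add.assoc)
    have KM: "0 < K0 * M" using M K0(1) by simp
    obtain m where m: "AE x in lborel. x \<in> ball x0 r \<longrightarrow> \<bar>u' x - m\<bar> \<le> K * (r / R) powr \<alpha> * (K0 * M)"
      using holder[OF KM Lp_data[OF _ R(1) M(1) \<sigma> le(2)[unfolded A]] tail_data[OF _ Cn R M(1) le(1)[unfolded T]]
        rhs_data[OF _ R M(1) \<sigma> le(3)[unfolded F]]] by auto
    have "AE x in lborel. x \<in> ball x0 r \<longrightarrow> \<bar>u x - m\<bar> \<le> K * (r / R) powr \<alpha> * (K0 * M)"
      using m uu by eventually_elim simp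
    then have "ess_osc (ball x0 r) u \<le> ereal (2 * (K * (r / R) powr \<alpha> * (K0 * M)))"
      by (intro ess_osc_le um AE_completion) auto
    then show ?thesis by (simp add: mult_ac)
  qed
  show ?thesis
  proof (cases "?T + ?A + ?F")
    case (real Q)
    \<comment> \<open>\<open>bd\<close> asks for a positive \<open>M\<close>, but the bracket may be
      0; it is therefore enlarged by \<open>e / ?k\<close> and \<open>e\<close> is sent to
      0.\<close>
    have "ess_osc (ball x0 r) u \<le> ereal (?k * Q)"
    proof (rule ereal_le_epsilon2)
      fix e :: real assume e: "0 < e"
      have "ess_osc (ball x0 r) u \<le> ereal (?k * (Q + e / ?k))"
        using real e k by (intro bd) (auto intro!: add_nonneg_pos ennreal_leI)
      also have "?k * (Q + e / ?k) = ?k * Q + e" by (rule kk(1)[OF k])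
      finally show "ess_osc (ball x0 r) u \<le> ereal (?k * Q) + ereal e" by simp
    qed
    also have "ereal (?k * Q) = enn2ereal (ennreal (?k * Q))" using k real by (simp add: enn2ereal_ennreal)
    also have "ennreal (?k * Q) = ennreal ?k * (?T + ?A + ?F)" using k real by (simp only: ennreal_mult less_imp_le)
    finally show ?thesis .
  next
    case top
    have "ennreal ?k * (?T + ?A + ?F) = \<infinity>" unfolding top using kk(2)[OF k] by simp
    then show ?thesis by (simp only:) simp
  qed
qed

end

section \<open>Local Hoelder continuity and the final estimate\<close>

lemma powr_dominates:
  fixes a b e :: real
  assumes "0 < e" "0 < b"
  shows "\<exists>M0. \<forall>M\<ge>M0. a \<le> M powr e * b"
proof (intro exI[of _ "(\<bar>a\<bar> / b) powr (1 / e)"] allI impI)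
  fix M assume "(\<bar>a\<bar> / b) powr (1 / e) \<le> M"
  then have "((\<bar>a\<bar> / b) powr (1 / e)) powr e \<le> M powr e" using assms by (intro powr_mono2) auto
  then have "\<bar>a\<bar> / b \<le> M powr e" using assms by (simp add: powr_powr)
  then show "a \<le> M powr e * b" using assms by (simp add: divide_le_eq)
qed

lemma nn_integral_set_mono:
  fixes h :: "'a::euclidean_space \<Rightarrow> ennreal"
  assumes "A \<subseteq> A'"
  shows "(\<integral>\<^sup>+x\<in>A. h x \<partial>M) \<le> (\<integral>\<^sup>+x\<in>A'. h x \<partial>M)"
  using assms by (intro nn_integral_mono mult_left_mono) (auto simp: indicator_def)

lemma locally_holder_cong_AE:
  assumes "locally_holder U u'" "AE x in lborel. u x = u' x"
  shows "locally_holder U u"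
proof -
  obtain w where w: "AE x in lebesgue. x \<in> U \<longrightarrow> u' x = w x" and
    h: "\<exists>\<gamma>. 0 < \<gamma> \<and> \<gamma> \<le> 1 \<and> (\<forall>K. compact K \<and> K \<subseteq> U \<longrightarrow> (\<exists>L. \<forall>x\<in>K. \<forall>y\<in>K. \<bar>w x - w y\<bar> \<le> L * dist x y powr \<gamma>))"
    using assms(1) unfolding locally_holder_def by blast
  have "AE x in lebesgue. x \<in> U \<longrightarrow> u x = w x"
    using w AE_completion[OF assms(2)] by eventually_elim auto
  then show ?thesis using h unfolding locally_holder_def by blast
qed

context log_kernel
begin

text \<open>For a compact \<open>K\<close> one radius \<open>R\<close> and one \<open>M\<close>
  serve all centres: the balls around points of \<open>K\<close> lie in the compact neighbourhood
  \<open>K'\<close> inside \<open>U\<close>, where the integrals of \<open>u\<close> and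
  \<open>f\<close> are finite, and the tails are bounded uniformly by \<open>log_norm u\<close>. Any
  finite data are dominated once \<open>M\<close> is large; \<alpha> is the same for all
  \<open>K\<close>.\<close>

lemma borel_sol_locally_holder:
  assumes est: "\<And>x0 R M r. 0 < R \<Longrightarrow> R \<le> 1/2 \<Longrightarrow> ball x0 R \<subseteq> U \<Longrightarrow> 0 < M \<Longrightarrow>
     (\<integral>\<^sup>+x\<in>ball x0 R. ennreal (\<bar>u x\<bar> powr p) \<partial>lborel) \<le> ennreal (M powr p * R powr DIM('a)) \<Longrightarrow>
     log_tail u x0 (R / 2) \<le> ennreal (M powr (p - 1) * lg R * R powr - (s * p)) \<Longrightarrow>
     (\<integral>\<^sup>+x\<in>ball x0 R. ennreal (\<bar>f x\<bar> powr q) \<partial>lborel) \<le> ennreal ((M powr (p - 1) * lg R * R powr - \<mu>) powr q) \<Longrightarrow>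
     0 < r \<Longrightarrow> r \<le> R / 2 \<Longrightarrow> \<exists>m. AE x in lborel. x \<in> ball x0 r \<longrightarrow> \<bar>u x - m\<bar> \<le> C * (r / R) powr \<alpha> * M"
    and \<alpha>: "0 < \<alpha>" "\<alpha> \<le> 1" and C: "0 < C" and U: "open U" and sol: "borel_sol U u f"
    and f: "\<And>K. compact K \<Longrightarrow> K \<subseteq> U \<Longrightarrow> (\<integral>\<^sup>+x\<in>K. ennreal (\<bar>f x\<bar> powr q) \<partial>lborel) < \<infinity>"
  shows "locally_holder U u"
proof (rule locally_holder_from_oscillation[OF U \<alpha>])
  fix K assume K: "compact K" "K \<subseteq> U"
  show "\<exists>C R0. 0 \<le> C \<and> 0 < R0 \<and> (\<forall>x\<in>K. \<forall>r. 0 < r \<and> r \<le> R0 \<longrightarrow> (\<exists>m. osc_center u \<alpha> C x r m))"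
  proof (cases "K = {}")
    case False
    obtain e where e: "0 < e" "(\<Union>x\<in>K. cball x e) \<subseteq> U"
      using compact_subset_open_imp_cball_epsilon_subset[OF K(1) U K(2)] by blast
    define K' where "K' = {x. infdist x K \<le> e}"
    have K'c: "compact K'" unfolding K'_def by (rule compact_infdist_le[OF False K(1) e(1)])
    have K'U: "K' \<subseteq> U"
    proof
      fix x assume "x \<in> K'"
      obtain y where "y \<in> K" "infdist x K = dist x y"
        using infdist_attains_inf[OF compact_imp_closed[OF K(1)] False] by metis
      then show "x \<in> U" using \<open>x \<in> K'\<close> e(2) by (force simp: K'_def dist_commute)
    qed
    define R where "R = min e (1/2)"
    have R: "0 < R" "R \<le> 1/2" "R \<le> 1" using e by (auto simp: R_def)
    have bK': "ball x R \<subseteq> K'" if "x \<in> K" for x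
    proof
      fix y assume "y \<in> ball x R"
      then show "y \<in> K'" using infdist_le[OF that, of y] by (simp add: K'_def R_def dist_commute)
    qed
    obtain b where b: "\<And>x. x \<in> K \<Longrightarrow> norm x \<le> b" using compact_imp_bounded[OF K(1)] by (auto simp: bounded_iff)
    have lg: "1 \<le> lg R" by (rule lg_ge_1[OF R(1,3)])
    have um: "u \<in> borel_measurable borel" by (rule borel_solD(1)[OF sol])
    define t where "t = (1 + (1 + b) / (R / 2)) powr dsp * (1 + ln (1 + b) + ln (1 / (R / 2)))"
    define I1 where "I1 = enn2real (\<integral>\<^sup>+x\<in>K'. ennreal (\<bar>u x\<bar> powr p) \<partial>lborel)"
    define I2 where "I2 = enn2real (log_norm u)"
    define I3 where "I3 = enn2real (\<integral>\<^sup>+x\<in>K'. ennreal (\<bar>f x\<bar> powr q) \<partial>lborel)"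
    have I: "(\<integral>\<^sup>+x\<in>K'. ennreal (\<bar>u x\<bar> powr p) \<partial>lborel) = ennreal I1" "log_norm u = ennreal I2"
      "(\<integral>\<^sup>+x\<in>K'. ennreal (\<bar>f x\<bar> powr q) \<partial>lborel) = ennreal I3"
      using borel_solD(3)[OF sol K'c K'U] borel_solD(5)[OF sol] f[OF K'c K'U] by (simp_all add: I1_def I2_def I3_def)
    obtain M1 where M1: "\<And>M. M1 \<le> M \<Longrightarrow> I1 \<le> M powr p * R powr DIM('a)"
      using powr_dominates[of p "R powr DIM('a)" I1] p R by auto
    obtain M2 where M2: "\<And>M. M2 \<le> M \<Longrightarrow> t * I2 \<le> M powr (p - 1) * (lg R * R powr - (s * p))"
      using powr_dominates[of "p - 1" "lg R * R powr - (s * p)" "t * I2"] p R lg by auto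
    obtain M3 where M3: "\<And>M. M3 \<le> M \<Longrightarrow> I3 \<le> M powr ((p - 1) * q) * (lg R * R powr - \<mu>) powr q"
      using powr_dominates[of "(p - 1) * q" "(lg R * R powr - \<mu>) powr q" I3] p R lg q_gt by auto
    define M where "M = max 1 (max M1 (max M2 M3))"
    have M: "0 < M" "M1 \<le> M" "M2 \<le> M" "M3 \<le> M" by (auto simp: M_def)
    have "\<exists>m. osc_center u \<alpha> (C * M / R powr \<alpha>) x r m" if x: "x \<in> K" and r: "0 < r" "r \<le> R / 2" for x r
    proof -
      have 1: "(\<integral>\<^sup>+x\<in>ball x R. ennreal (\<bar>u x\<bar> powr p) \<partial>lborel) \<le> ennreal (M powr p * R powr DIM('a))"
        using nn_integral_set_mono[OF bK'[OF x], of lborel "\<lambda>x. ennreal (\<bar>u x\<bar> powr p)"] ennreal_leI[OF M1[OF M(2)]]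
        unfolding I by (rule order_trans)
      have "0 \<le> b" using b[OF x] norm_ge_zero[of x] by linarith
      then have t0: "0 \<le> t"
        using R unfolding t_def by (intro mult_nonneg_nonneg add_nonneg_nonneg) auto
      have "log_tail u x (R / 2) \<le> ennreal t * log_norm u"
        unfolding t_def using R b[OF x] by (intro log_tail_le um) auto
      also have "\<dots> = ennreal (t * I2)" unfolding I using t0 by (simp add: ennreal_mult I2_def)
      also have "\<dots> \<le> ennreal (M powr (p - 1) * lg R * R powr - (s * p))"
        using M2[OF M(3)] by (intro ennreal_leI) (simp add: mult.assoc)
      finally have 2: "log_tail u x (R / 2) \<le> ennreal (M powr (p - 1) * lg R * R powr - (s * p))" .
      have "I3 \<le> (M powr (p - 1) * lg R * R powr - \<mu>) powr q"
        using M3[OF M(4)] by (simp add: powr_mult powr_powr mult.assoc)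
      then have 3: "(\<integral>\<^sup>+x\<in>ball x R. ennreal (\<bar>f x\<bar> powr q) \<partial>lborel) \<le> ennreal ((M powr (p - 1) * lg R * R powr - \<mu>) powr q)"
        using nn_integral_set_mono[OF bK'[OF x], of lborel "\<lambda>x. ennreal (\<bar>f x\<bar> powr q)"]
        unfolding I by (meson ennreal_leI order_trans)
      have "ball x R \<subseteq> U" using bK'[OF x] K'U by auto
      from est[OF R(1,2) this M(1) 1 2 3 r]
      obtain m where m: "AE y in lborel. y \<in> ball x r \<longrightarrow> \<bar>u y - m\<bar> \<le> C * (r / R) powr \<alpha> * M" by blast
      have "C * (r / R) powr \<alpha> * M = C * M / R powr \<alpha> * r powr \<alpha>" by (simp add: powr_divide)
      then show ?thesis using m unfolding osc_center_def by auto
    qed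
    then show ?thesis using C M R
      by (intro exI[of _ "C * M / R powr \<alpha>", OF exI[of _ "R / 2"]]) auto
  qed (auto intro!: exI[of _ 1])
qed

theorem regularity:
  assumes Cn: "Cn DIM('a) s p = c" "log_const DIM('a) s p = B" and \<sigma>: "1 < \<sigma>"
  shows "\<exists>\<alpha> C. 0 < \<alpha> \<and> \<alpha> < \<mu> / (p - 1) \<and> 0 < C \<and>
    (\<forall>(U :: 'a set) f u. open U \<and> Lp_loc q U f \<and> weak_solution Cn s p U f u \<longrightarrow> locally_holder U u \<and>
      (\<forall>x0 R r. 0 < R \<and> R \<le> 1/2 \<and> ball x0 R \<subseteq> U \<and> 0 < r \<and> r \<le> R / 2 \<longrightarrow>
        ess_osc (ball x0 r) u \<le> enn2ereal (ennreal (C * (r / R) powr \<alpha>) *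
                (ennreal ((1 + ln (1 / R)) powr (- 1 / (p - 1))) * Tail_mod Cn s p u x0 (R / 2)
                 + Lp_mean_on (p * \<sigma>) (ball x0 R) u
                 + ennreal ((1 + ln (1 / R)) powr (- \<sigma> / (p * \<sigma> - 1)) * R powr (\<mu> * (1 / (p - 1))))
                   * ennreal_powr (Lp_norm_on q (ball x0 R) f) (1 / (p - 1))))))"
proof -
  obtain \<alpha> K where \<alpha>: "0 < \<alpha>" "\<alpha> \<le> 1" "\<alpha> < \<mu> / (p - 1)" and K: "0 < K"
    and est: "\<forall>U u f x0 R M. borel_sol U u f \<longrightarrow> 0 < R \<longrightarrow> R \<le> 1/2 \<longrightarrow> ball x0 R \<subseteq> U \<longrightarrow> 0 < M \<longrightarrow>
     (\<integral>\<^sup>+x\<in>ball x0 R. ennreal (\<bar>u x\<bar> powr p) \<partial>lborel) \<le> ennreal (M powr p * R powr DIM('a)) \<longrightarrow>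
     log_tail u x0 (R / 2) \<le> ennreal (M powr (p - 1) * lg R * R powr - (s * p)) \<longrightarrow>
     (\<integral>\<^sup>+x\<in>ball x0 R. ennreal (\<bar>f x\<bar> powr q) \<partial>lborel) \<le> ennreal ((M powr (p - 1) * lg R * R powr - \<mu>) powr q) \<longrightarrow>
     (\<forall>r. 0 < r \<and> r \<le> R / 2 \<longrightarrow> (\<exists>m. AE x in lborel. x \<in> ball x0 r \<longrightarrow> \<bar>u x - m\<bar> \<le> K * (r / R) powr \<alpha> * M))"
    using holder_estimate by blast
  have main: "locally_holder U u \<and>
      (\<forall>x0 R r. 0 < R \<and> R \<le> 1/2 \<and> ball x0 R \<subseteq> U \<and> 0 < r \<and> r \<le> R / 2 \<longrightarrow>
        ess_osc (ball x0 r) u \<le> enn2ereal (ennreal (2 * K * K0 * (r / R) powr \<alpha>) *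
                (ennreal ((1 + ln (1 / R)) powr (- 1 / (p - 1))) * Tail_mod Cn s p u x0 (R / 2)
                 + Lp_mean_on (p * \<sigma>) (ball x0 R) u
                 + ennreal ((1 + ln (1 / R)) powr (- \<sigma> / (p * \<sigma> - 1)) * R powr (\<mu> * (1 / (p - 1))))
                   * ennreal_powr (Lp_norm_on q (ball x0 R) f) (1 / (p - 1)))))"
    if U: "open U" and f: "Lp_loc q U f" and u: "weak_solution Cn s p U f u" for U :: "'a set" and f u
  proof -
    obtain u' f' where bs: "borel_sol U u' f'" and uu: "AE x in lborel. u x = u' x" and ff: "AE x in lborel. x \<in> U \<longrightarrow> f x = f' x"
      using borel_sol_if_weak_solution[OF Cn U f u] .
    note est' = est[rule_format, OF bs]
    have f'q: "(\<integral>\<^sup>+x\<in>K. ennreal (\<bar>f' x\<bar> powr q) \<partial>lborel) < \<infinity>" if "compact K" "K \<subseteq> U" for K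
    proof -
      have "(\<integral>\<^sup>+x\<in>K. ennreal (\<bar>f' x\<bar> powr q) \<partial>lborel) = (\<integral>\<^sup>+x\<in>K. ennreal (\<bar>f x\<bar> powr q) \<partial>lebesgue)"
        unfolding nn_integral_completion
        by (rule nn_integral_cong_AE, use ff in eventually_elim) (use that in \<open>auto simp: indicator_def\<close>)
      then show ?thesis using f that by (simp add: Lp_loc_def Lp_on_def)
    qed
    have "locally_holder U u'"
      by (rule borel_sol_locally_holder[OF est' \<alpha>(1,2) K U bs f'q]) auto
    then have 1: "locally_holder U u" using uu by (rule locally_holder_cong_AE)
    have 2: "ess_osc (ball x0 r) u \<le> enn2ereal (ennreal (2 * K * K0 * (r / R) powr \<alpha>) *
                (ennreal ((1 + ln (1 / R)) powr (- 1 / (p - 1))) * Tail_mod Cn s p u x0 (R / 2)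
                 + Lp_mean_on (p * \<sigma>) (ball x0 R) u
                 + ennreal ((1 + ln (1 / R)) powr (- \<sigma> / (p * \<sigma> - 1)) * R powr (\<mu> * (1 / (p - 1))))
                   * ennreal_powr (Lp_norm_on q (ball x0 R) f) (1 / (p - 1))))"
      if x: "0 < R" "R \<le> 1/2" "ball x0 R \<subseteq> U" "0 < r" "r \<le> R / 2" for x0 R r
    proof -
      have ff': "AE y in lborel. y \<in> ball x0 R \<longrightarrow> f y = f' y" using ff by eventually_elim (use x(3) in auto)
      have R1: "R \<le> 1" using x by simp
      show ?thesis
        by (rule ess_osc_bound[where u' = u' and f' = f' and ?x0.0 = x0 and R = R and r = r and K = K and \<alpha> = \<alpha> and u = u and f = f and \<sigma> = \<sigma> and Cn = Cn, OF est'[OF x(1,2,3) _ _ _ _ conjI[OF x(4,5)]] borel_solD(1,2)[OF bs] uu ff' Cn(1) x(1) R1 x(4) K \<sigma>])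
    qed
    show ?thesis using 1 2 by simp
  qed
  show ?thesis
    by (rule exI[of _ \<alpha>], rule exI[of _ "2 * K * K0"], intro conjI \<alpha>(1,3) allI impI)
      (use K K0(1) main in auto)
qed

end

theorem theorem1p4:
  fixes Cn :: "nat \<Rightarrow> real \<Rightarrow> real \<Rightarrow> real" and s s0 p q \<sigma> :: real
  assumes "is_normalization_const Cn"
    and "1 < p"
    and "0 < s0" and "s0 < min (2 * (p - 1) / p) 1"
    and "\<forall>t. 0 < t \<and> t < s0 \<longrightarrow> 0 \<le> log_const DIM('a::euclidean_space) t p"
    and "0 < s" and "s < s0"
    and "s * p < real DIM('a)"
    and "real DIM('a) / (s * p) < q"
    and "\<sigma> = sigma_exp DIM('a) s p q"
  shows "p * \<sigma> < real DIM('a) * p / (real DIM('a) - s * p) \<and>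
    (\<exists>\<alpha> C. 0 < \<alpha> \<and> \<alpha> < (s * p - real DIM('a) / q) / (p - 1) \<and> 0 < C \<and>
      (\<forall>(\<Omega> :: 'a set) f u.
         open \<Omega> \<and> bounded \<Omega> \<and> Lp_loc q \<Omega> f \<and> weak_solution Cn s p \<Omega> f u \<longrightarrow>
           locally_holder \<Omega> u \<and>
           (\<forall>x0 R r. 0 < R \<and> ball x0 R \<subseteq> \<Omega> \<and> diameter (ball x0 R) \<le> 1 \<and> 0 < r \<and> r \<le> R / 2 \<longrightarrow>
              ess_osc (ball x0 r) u \<le> enn2ereal (ennreal (C * (r / R) powr \<alpha>) *
                (ennreal ((1 + ln (1 / R)) powr (- 1 / (p - 1))) * Tail_mod Cn s p u x0 (R / 2)
                 + Lp_mean_on (p * \<sigma>) (ball x0 R) u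
                 + ennreal ((1 + ln (1 / R)) powr (- \<sigma> / (p * \<sigma> - 1))
                       * R powr ((s * p - real DIM('a) / q) * (1 / (p - 1))))
                   * ennreal_powr (Lp_norm_on q (ball x0 R) f) (1 / (p - 1)))))))"
proof
  have s1: "s < 1" using assms(4,7) by simp
  have d: "1 \<le> DIM('a)" using DIM_positive[where 'a = 'a] by linarith
  show "p * \<sigma> < real DIM('a) * p / (real DIM('a) - s * p)"
    using sigma_exp_bounds(2)[of "DIM('a)" p s q] assms d by simp
  have \<sigma>: "1 < \<sigma>" using sigma_exp_bounds(1)[of "DIM('a)" p s q] assms d by simp
  have c: "0 < Cn DIM('a) s p" using assms(1,2,6) s1 d unfolding is_normalization_const_def by blast
  have B: "0 \<le> log_const DIM('a) s p" using assms(5,6,7) by blast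
  interpret log_kernel "TYPE('a)" s p "Cn DIM('a) s p" "log_const DIM('a) s p" q
    by unfold_locales (use assms s1 c B in auto)
  obtain \<alpha> C where "0 < \<alpha>" "\<alpha> < \<mu> / (p - 1)" "0 < C" and
    main: "\<And>(U :: 'a set) f u. open U \<and> Lp_loc q U f \<and> weak_solution Cn s p U f u \<Longrightarrow> locally_holder U u \<and>
      (\<forall>x0 R r. 0 < R \<and> R \<le> 1/2 \<and> ball x0 R \<subseteq> U \<and> 0 < r \<and> r \<le> R / 2 \<longrightarrow>
        ess_osc (ball x0 r) u \<le> enn2ereal (ennreal (C * (r / R) powr \<alpha>) *
                (ennreal ((1 + ln (1 / R)) powr (- 1 / (p - 1))) * Tail_mod Cn s p u x0 (R / 2)
                 + Lp_mean_on (p * \<sigma>) (ball x0 R) u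
                 + ennreal ((1 + ln (1 / R)) powr (- \<sigma> / (p * \<sigma> - 1)) * R powr (\<mu> * (1 / (p - 1))))
                   * ennreal_powr (Lp_norm_on q (ball x0 R) f) (1 / (p - 1)))))"
    using regularity[of Cn \<sigma>] \<sigma> by blast
  show "\<exists>\<alpha> C. 0 < \<alpha> \<and> \<alpha> < (s * p - real DIM('a) / q) / (p - 1) \<and> 0 < C \<and>
      (\<forall>(\<Omega> :: 'a set) f u.
         open \<Omega> \<and> bounded \<Omega> \<and> Lp_loc q \<Omega> f \<and> weak_solution Cn s p \<Omega> f u \<longrightarrow>
           locally_holder \<Omega> u \<and>
           (\<forall>x0 R r. 0 < R \<and> ball x0 R \<subseteq> \<Omega> \<and> diameter (ball x0 R) \<le> 1 \<and> 0 < r \<and> r \<le> R / 2 \<longrightarrow>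
              ess_osc (ball x0 r) u \<le> enn2ereal (ennreal (C * (r / R) powr \<alpha>) *
                (ennreal ((1 + ln (1 / R)) powr (- 1 / (p - 1))) * Tail_mod Cn s p u x0 (R / 2)
                 + Lp_mean_on (p * \<sigma>) (ball x0 R) u
                 + ennreal ((1 + ln (1 / R)) powr (- \<sigma> / (p * \<sigma> - 1))
                       * R powr ((s * p - real DIM('a) / q) * (1 / (p - 1))))
                   * ennreal_powr (Lp_norm_on q (ball x0 R) f) (1 / (p - 1))))))"
    unfolding \<mu>_def[symmetric]
  proof (rule exI[of _ \<alpha>], rule exI[of _ C], intro conjI allI impI; (elim conjE)?)
    fix U :: "'a set" and f u assume *: "open U" "Lp_loc q U f" "weak_solution Cn s p U f u"
    show "locally_holder U u" using main * by blast
    fix x0 R r assume "0 < R" "ball x0 R \<subseteq> U" "diameter (ball x0 R) \<le> 1" "0 < r" "r \<le> R / 2"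
    moreover have "R \<le> 1/2" using \<open>0 < R\<close> \<open>diameter (ball x0 R) \<le> 1\<close> by simp
    ultimately show "ess_osc (ball x0 r) u \<le> enn2ereal (ennreal (C * (r / R) powr \<alpha>) *
                (ennreal ((1 + ln (1 / R)) powr (- 1 / (p - 1))) * Tail_mod Cn s p u x0 (R / 2)
                 + Lp_mean_on (p * \<sigma>) (ball x0 R) u
                 + ennreal ((1 + ln (1 / R)) powr (- \<sigma> / (p * \<sigma> - 1)) * R powr (\<mu> * (1 / (p - 1))))
                   * ennreal_powr (Lp_norm_on q (ball x0 R) f) (1 / (p - 1))))"
      using main * by blast
  qed fact+
qed

end
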